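(* Let $\mathfrak{H}$ be a real separable Hilbert space and let $X=\{X(h),h\in\mathfrak{H}\}$ be an isonormal Gaussian process over $\mathfrak{H}$. Let $d\geq 1$ and let $q_1,\ldots,q_d\geq 1$ be fixed integers. Consider the $\mathbb{R}^d$-valued random vector \[F=(F_1,\ldots,F_d)=\big(I_{q_1}(f_1),\ldots,I_{q_d}(f_d)\big),\] where each $f_i\in\mathfrak{H}^{\odot q_i}$. Let $C=(C_{ij})_{1\leq i,j\leq d}$ be the covariance matrix of $F$, i.e. $C_{ij}=E[F_iF_j]$, and define \[\Delta_C(F):=\sqrt{\sum_{i,j=1}^d E\left[\left(C_{ij}-\frac{1}{q_j}\langle DF_i,DF_j\rangle_{\mathfrak{H}}\right)^2\right]}.\] Then \[\Delta_C(F)\leq \psi\Big(E[F_1^4]-3E[F_1^2]^2,\,E[F_1^2],\,\ldots,\,E[F_d^4]-3E[F_d^2]^2,\,E[F_d^2]\Big),\] where $\psi:(\mathbb{R}\times\mathbb{R}_+)^d\to\mathbb{R}$ is the function \begin{align*} \psi(x_1,y_1,\ldots,x_d,y_d)=&\sum_{i,j=1}^d \mathbf{1}_{\{q_i=q_j\}}\sqrt{2\sum_{r=1}^{q_i-1}\binom{2r}{r}}\,|x_i|^{1/2}\\ &+\sum_{i,j=1}^d\mathbf{1}_{\{q_i\neq q_j\}}\left\{\sqrt{2}\sqrt{y_j}\,|x_i|^{1/4}+\sum_{r=1}^{q_i\wedge q_j-1}\sqrt{2(q_i+q_j-2r)!}\binom{q_j}{r}|x_i|^{1/2}\right\}. 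\end{align*}
   Context: An isonormal Gaussian process over $\mathfrak{H}$ is a centered Gaussian family $\{X(h):h\in\mathfrak{H}\}$ on a probability space $(\Omega,\mathcal{F},P)$ with $E[X(h)X(g)]=\langle h,g\rangle_{\mathfrak{H}}$; it is assumed that $\mathcal{F}$ is generated by $X$. $\mathfrak{H}^{\odot q}$ denotes the $q$th symmetric tensor power of $\mathfrak{H}$, and $I_q:\mathfrak{H}^{\odot q}\to L^2(\Omega)$ is the multiple Wiener–Itô integral of order $q$, i.e. the linear isometry (with norm $\sqrt{q!}\|\cdot\|_{\mathfrak{H}^{\otimes q}}$ on $\mathfrak{H}^{\odot q}$) onto the $q$th Wiener chaos determined by $I_q(h^{\otimes q})=q!H_q(X(h))$ for $\|h\|_{\mathfrak{H}}=1$, where $H_q(x)=(-1)^qe^{x^2/2}\frac{d^q}{dx^q}e^{-x^2/2}$ is the $q$th Hermite polynomial (for $\mathfrak{H}=L^2([0,T])$ this is the usual multiple Wiener–Itô integral with respect to Brownian motion). $D$ denotes the Malliavin derivative with respect to $X$: for $F=g(X(\phi_1),\ldots,X(\phi_n))$ with $g$ smooth with polynomially growing derivatives, $DF=\sum_i\partial_ig(X(\phi_1),\ldots,X(\phi_n))\phi_i\in L^2(\Omega,\mathfrak{H})$, extended by closure; multiple integrals are in its domain. *)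

theory Defs
  imports "HOL-Probability.Probability"
begin

definition hermite :: "nat \<Rightarrow> real \<Rightarrow> real" where
  "hermite q x = (-1) ^ q * exp (x\<^sup>2 / 2) * (deriv ^^ q) (\<lambda>y. exp (- (y\<^sup>2) / 2)) x"

text \<open>Centered Gaussian family (all finite linear combinations are centered,
  possibly degenerate, Gaussians; expressed through characteristic functions).\<close>
definition gaussian_family :: "'a measure \<Rightarrow> ('h \<Rightarrow> 'a \<Rightarrow> real) \<Rightarrow> bool" where
  "gaussian_family M X \<longleftrightarrow>
     (\<forall>(hs::'h list) (cs::real list). length cs = length hs \<longrightarrow>
        (\<exists>v\<ge>0. \<forall>t. char (distr M borel (\<lambda>\<omega>. \<Sum>k<length hs. cs ! k * X (hs ! k) \<omega>)) t
                    = complex_of_real (exp (- (t\<^sup>2 * v) / 2))))"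

definition isonormal :: "'a measure \<Rightarrow> ('h::real_inner \<Rightarrow> 'a \<Rightarrow> real) \<Rightarrow> bool" where
  "isonormal M X \<longleftrightarrow> prob_space M
     \<and> (\<forall>h. X h \<in> borel_measurable M)
     \<and> gaussian_family M X
     \<and> (\<forall>h g. prob_space.expectation M (\<lambda>\<omega>. X h \<omega> * X g \<omega>) = inner h g)
     \<and> sets M = sigma_sets (space M) {X h -` B \<inter> space M | h B. B \<in> sets borel}"

text \<open>The q-th Wiener chaos: closure in L^2 of the linear span of
  {H_q(X(h)) : norm h = 1}; this is the range of the multiple integral I_q.\<close>
definition wiener_chaos :: "'a measure \<Rightarrow> ('h::real_normed_vector \<Rightarrow> 'a \<Rightarrow> real) \<Rightarrow> nat \<Rightarrow> ('a \<Rightarrow> real) set" where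
  "wiener_chaos M X q = {F. F \<in> borel_measurable M \<and>
     (\<forall>e::real>0. \<exists>(hs::'h list) (cs::real list).
        (\<forall>h\<in>set hs. norm h = 1) \<and> length cs = length hs \<and>
        (\<integral>\<^sup>+\<omega>. ennreal ((F \<omega> - (\<Sum>k<length hs. cs ! k * hermite q (X (hs ! k) \<omega>)))\<^sup>2) \<partial>M) < ennreal e)}"

definition pd :: "nat \<Rightarrow> ((nat \<Rightarrow> real) \<Rightarrow> real) \<Rightarrow> (nat \<Rightarrow> real) \<Rightarrow> real" where
  "pd i g x = deriv (\<lambda>t. g (x(i := t))) (x i)"

definition smooth_pg :: "nat \<Rightarrow> ((nat \<Rightarrow> real) \<Rightarrow> real) \<Rightarrow> bool" where
  "smooth_pg n g \<longleftrightarrow>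
     (\<forall>x y. (\<forall>i<n. x i = y i) \<longrightarrow> g x = g y)
     \<and> (\<forall>is i x. set is \<subseteq> {..<n} \<and> i < n \<longrightarrow>
           (\<lambda>t. foldr pd is g (x(i := t))) differentiable (at (x i)))
     \<and> (\<forall>is. set is \<subseteq> {..<n} \<longrightarrow>
           (\<exists>c (N::nat). \<forall>x. \<bar>foldr pd is g x\<bar> \<le> c * (1 + (\<Sum>i<n. \<bar>x i\<bar>)) ^ N))"

definition smooth_cyl :: "'a measure \<Rightarrow> ('h::real_vector \<Rightarrow> 'a \<Rightarrow> real) \<Rightarrow> ('a \<Rightarrow> real) \<Rightarrow> ('a \<Rightarrow> 'h) \<Rightarrow> bool" where
  "smooth_cyl M X F DF \<longleftrightarrow> (\<exists>n g (\<phi>::nat \<Rightarrow> 'h). smooth_pg n g \<and>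
     (\<forall>\<omega>\<in>space M. F \<omega> = g (\<lambda>i. X (\<phi> i) \<omega>)
        \<and> DF \<omega> = (\<Sum>i<n. pd i g (\<lambda>i. X (\<phi> i) \<omega>) *\<^sub>R \<phi> i)))"

definition malliavin_deriv :: "'a measure \<Rightarrow> ('h::{real_normed_vector,second_countable_topology} \<Rightarrow> 'a \<Rightarrow> real) \<Rightarrow> ('a \<Rightarrow> real) \<Rightarrow> ('a \<Rightarrow> 'h) \<Rightarrow> bool" where
  "malliavin_deriv M X F G \<longleftrightarrow> F \<in> borel_measurable M \<and> G \<in> borel_measurable M \<and>
     (\<exists>Fs DFs. (\<forall>k. smooth_cyl M X (Fs k) (DFs k))
        \<and> (\<lambda>k. \<integral>\<^sup>+\<omega>. ennreal ((F \<omega> - Fs k \<omega>)\<^sup>2) \<partial>M) \<longlonglongrightarrow> 0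
        \<and> (\<lambda>k. \<integral>\<^sup>+\<omega>. ennreal ((norm (DFs k \<omega> - G \<omega>))\<^sup>2) \<partial>M) \<longlonglongrightarrow> 0)"

definition psi :: "nat \<Rightarrow> (nat \<Rightarrow> nat) \<Rightarrow> (nat \<Rightarrow> real) \<Rightarrow> (nat \<Rightarrow> real) \<Rightarrow> real" where
  "psi d q x y =
     (\<Sum>i<d. \<Sum>j<d. (if q i = q j then
         sqrt (2 * (\<Sum>r=1..q i - 1. real ((2*r) choose r))) * \<bar>x i\<bar> powr (1/2)
       else
         sqrt 2 * sqrt (y j) * \<bar>x i\<bar> powr (1/4)
         + (\<Sum>r=1..min (q i) (q j) - 1.
              sqrt (2 * fact (q i + q j - 2*r)) * real (q j choose r) * \<bar>x i\<bar> powr (1/2))))"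

end

theory Submission
  imports Defs
begin

text \<open>
  Consider first finite combinations \<open>F = \<Sum> a\<^sub>h H\<^sub>p(X h)\<close> over unit vectors \<open>h\<close>. Then \<open>F = I\<^sub>p(f)\<close> with
  \<open>f = \<Sum> a\<^sub>h h\<^sup>\<otimes>\<^sup>p\<close>, and all contraction norms of such kernels are polynomials in Gram matrices, so that
  tensor products never have to be constructed. For \<open>G = I\<^sub>q(g)\<close> of the same kind, let \<open>S\<^sub>r\<close> be the second
  moment of the component of \<open>F G\<close> in the chaos of order \<open>p + q - 2 r\<close>. The diagram formula
  for four Hermite polynomials gives \<open>E[F\<^sup>2 G\<^sup>2] = \<Sum> S\<^sub>r\<close> and \<open>E[\<langle>DF, DG\<rangle>\<^sup>2] = \<Sum> r\<^sup>2 S\<^sub>r\<close>.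
  The symmetrisation of a tensor has smaller norm than the tensor, which bounds \<open>S\<^sub>r\<close> by a multiple of
  \<open>\<parallel>f \<otimes>\<^sub>r g\<parallel>\<^sup>2 \<le> \<parallel>f \<otimes>\<^sub>r f\<parallel> \<parallel>g \<otimes>\<^sub>r g\<parallel>\<close> (here the contractions of \<open>f\<close> with itself of
  orders \<open>r\<close> and \<open>p - r\<close> have the same norm), and for \<open>F = G\<close> the diagrams with no edge between
  the two factors show that the fourth cumulant dominates each of these norms.

  In a general chaos one approximates in \<open>L\<^sup>2\<close>. The same expansion of \<open>E[F\<^sup>4]\<close> yields
  hypercontractivity, hence convergence of fourth moments, while Fatou's lemma takes care of the left-hand side.
  Malliavin derivatives are unique because one may integrate by parts against \<open>cos (X u)\<close> and
  \<open>sin (X u)\<close>, and these are total by uniqueness of Fourier transforms.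
\<close>

section \<open>Divided powers and Hermite polynomials\<close>

text \<open>One family of numbers serves both moments for the following reason. In the product
  formula the component of \<open>F G\<close> in the chaos of order \<open>p + q - 2 r\<close> comes
  from the contraction of order \<open>r\<close>, and the same component of
  \<open>\<langle>DF, DG\<rangle>\<close> is \<open>r\<close> times as large, because the inner
  product of the derivatives marks one of the \<open>r\<close> edges. Hence \<open>r = 0\<close> is
  absent from the left-hand side, and for \<open>p = q\<close> the top value \<open>r = p\<close> is
  the constant that the covariance removes. What remains are proper contractions, except for
  \<open>p < q\<close> and \<open>r = p\<close>: there \<open>f\<close> is contracted completely and
  only the cumulant of \<open>G\<close> can be small. This is the origin of the exponent 1/4 and of
  the variance in front of it. The obstacle in the limit is that kernels are no longer at hand in a
  general chaos, only \<open>L\<^sup>2\<close> closeness; therefore the inequalities for finite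
  combinations are brought into a form that involves second moments and fourth cumulants alone, with
  constants depending only on the orders.\<close>

text \<open>Extending \<open>x\<^sup>n / n!\<close> and \<open>H\<^sub>n / n!\<close> by zero to negative \<open>n\<close> makes their recurrences hold for
  all integers, so that sums over diagrams can be shifted without boundary terms.\<close>

definition dpow :: "int \<Rightarrow> real \<Rightarrow> real" where
  "dpow n x = (if n < 0 then 0 else x ^ nat n / fact (nat n))"

lemma dpow_neg [simp]: "n < 0 \<Longrightarrow> dpow n x = 0"
  by (simp add: dpow_def)

lemma dpow_0 [simp]: "dpow 0 x = 1"
  by (simp add: dpow_def)

lemma dpow_of_nat: "dpow (int n) x = x ^ n / fact n"
  by (simp add: dpow_def)

text \<open>Divided powers absorb the factorial of the derivative rule. At \<open>n = 0\<close> both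
  sides vanish, the right one because \<open>dpow (- 1) x = 0\<close>.\<close>

lemma dpow_step: "of_int n * dpow n x = x * dpow (n - 1) x"
proof (cases "n \<le> 0")
  case True then show ?thesis by (cases "n = 0") (auto simp: dpow_def)
next
  case False
  then obtain k where k: "n = int (Suc k)" by (metis not_le zero_less_imp_eq_int gr0_conv_Suc)
  have "n - 1 = int k" using k by simp
  then have "dpow (n - 1) x = x ^ k / fact k" by (simp add: dpow_of_nat)
  moreover have "dpow n x = x ^ Suc k / fact (Suc k)" unfolding k by (rule dpow_of_nat)
  moreover have "of_int n = real (Suc k)" unfolding k by simp
  ultimately show ?thesis by (simp del: of_nat_Suc)
qed

section \<open>Hermite polynomials through their three-term recurrence\<close>

fun herm :: "nat \<Rightarrow> real \<Rightarrow> real" where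
  "herm 0 x = 1"
| "herm (Suc 0) x = x"
| "herm (Suc (Suc n)) x = x * herm (Suc n) x - real (Suc n) * herm n x"

lemma herm_Suc: "herm (Suc n) x = x * herm n x - real n * herm (n - 1) x"
  by (cases n) auto

lemma herm_has_derivative:
  "(herm n has_real_derivative real n * herm (n - 1) x) (at x)"
proof (induction n x rule: herm.induct)
  case (1 x) then show ?case by (simp add: fun_eq_iff[symmetric])
next
  case (2 x) then show ?case by simp
next
  case (3 n x)
  have "((\<lambda>x. x * herm (Suc n) x - real (Suc n) * herm n x) has_real_derivative
     (1 * herm (Suc n) x + real (Suc n) * herm n x * x) - real (Suc n) * (real n * herm (n - 1) x)) (at x)"
    by (rule derivative_eq_intros 3 refl)+ (use 3 in simp_all)
  moreover have "herm (Suc (Suc n)) = (\<lambda>x. x * herm (Suc n) x - real (Suc n) * herm n x)" by auto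
  ultimately show ?case by (simp add: herm_Suc[of n] algebra_simps)
qed

text \<open>Differentiating \<open>herm q y * exp (- y ^ 2 / 2)\<close> gives
  \<open>q * herm (q - 1) y - y * herm q y\<close> times the exponential, which by the recurrence is
  minus the same expression for \<open>q + 1\<close>. Induction on this yields the Rodrigues
  formula.\<close>

lemma hermite_eq_herm: "hermite q x = herm q x"
proof -
  have "(deriv ^^ q) (\<lambda>y. exp (- (y\<^sup>2) / 2)) = (\<lambda>y. (-1) ^ q * herm q y * exp (- (y\<^sup>2) / 2))"
  proof (induction q)
    case 0 then show ?case by simp
  next
    case (Suc q)
    show ?case
    proof
      fix y :: real
      have "((\<lambda>y. (-1) ^ q * herm q y * exp (- (y\<^sup>2) / 2)) has_real_derivative
         (-1) ^ q * (real q * herm (q - 1) y) * exp (- (y\<^sup>2) / 2)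
         + exp (- (y\<^sup>2) / 2) * (- y) * ((-1) ^ q * herm q y)) (at y)"
        by (rule derivative_eq_intros herm_has_derivative refl | simp)+
      then have "deriv (\<lambda>y. (-1) ^ q * herm q y * exp (- (y\<^sup>2) / 2)) y
         = (-1) ^ q * (real q * herm (q - 1) y) * exp (- (y\<^sup>2) / 2)
         + exp (- (y\<^sup>2) / 2) * (- y) * ((-1) ^ q * herm q y)"
        by (rule DERIV_imp_deriv)
      then show "(deriv ^^ Suc q) (\<lambda>y. exp (- (y\<^sup>2) / 2)) y = (-1) ^ Suc q * herm (Suc q) y * exp (- (y\<^sup>2) / 2)"
        using Suc by (simp add: herm_Suc algebra_simps)
    qed
  qed
  then show ?thesis
  proof -
    assume *: "(deriv ^^ q) (\<lambda>y. exp (- (y\<^sup>2) / 2)) = (\<lambda>y. (-1) ^ q * herm q y * exp (- (y\<^sup>2) / 2))"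
    have "hermite q x = ((-1) ^ q * (-1) ^ q) * (exp (x\<^sup>2 / 2) * exp (- (x\<^sup>2) / 2)) * herm q x"
      unfolding hermite_def * by (simp add: algebra_simps)
    also have "(-1 :: real) ^ q * (-1) ^ q = 1" by (simp add: power_mult_distrib[symmetric])
    also have "exp (x\<^sup>2 / 2) * exp (- (x\<^sup>2) / 2) = 1" by (simp add: mult_exp_exp)
    finally show ?thesis by simp
  qed
qed

definition nherm :: "int \<Rightarrow> real \<Rightarrow> real" where
  "nherm n x = (if n < 0 then 0 else herm (nat n) x / fact (nat n))"

lemma nherm_neg [simp]: "n < 0 \<Longrightarrow> nherm n x = 0"
  by (simp add: nherm_def)

lemma nherm_0 [simp]: "nherm 0 x = 1"
  by (simp add: nherm_def)

lemma nherm_of_nat: "nherm (int n) x = herm n x / fact n"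
  by (simp add: nherm_def)

lemma hermite_eq_nherm: "hermite q x = fact q * nherm (int q) x"
  by (simp add: nherm_of_nat hermite_eq_herm)

text \<open>This is the three-term recurrence divided by \<open>(n - 1)!\<close>; for
  \<open>n \<le> 1\<close> the zero values at negative orders stand in for the missing
  terms.\<close>

lemma nherm_step: "of_int n * nherm n x = x * nherm (n - 1) x - nherm (n - 2) x"
proof (cases "n \<le> 1")
  case True
  then consider "n < 0" | "n = 0" | "n = 1" by linarith
  then show ?thesis by cases (auto simp: nherm_def)
next
  case False
  then obtain k where k: "n = int (Suc (Suc k))"
    by (metis One_nat_def int_nat_eq le_add_diff_inverse nat_2 nat_le_iff not_le of_nat_1 plus_1_eq_Suc Suc_1 add_2_eq_Suc int_one_le_iff_zero_less less_imp_le nat_less_as_int nat_int zero_less_nat_eq of_nat_0_less_iff not_less_eq_eq zle_iff_zadd)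
  have *: "n - 1 = int (Suc k)" "n - 2 = int k" using k by simp_all
  have "nherm n x = (x * herm (Suc k) x - real (Suc k) * herm k x) / fact (Suc (Suc k))"
    unfolding k nherm_of_nat herm.simps ..
  moreover have "of_int n / (fact (Suc (Suc k)) :: real) = 1 / fact (Suc k)"
    unfolding k by (simp del: of_nat_Suc add: of_nat_Suc[symmetric])
  ultimately have "of_int n * nherm n x = (x * herm (Suc k) x - real (Suc k) * herm k x) / fact (Suc k)"
    by (metis (no_types, opaque_lifting) mult.commute mult_1 times_divide_eq_left times_divide_eq_right)
  also have "\<dots> = x * (herm (Suc k) x / fact (Suc k)) - herm k x / fact k"
    by (simp add: diff_divide_distrib del: of_nat_Suc)
  finally show ?thesis unfolding * nherm_of_nat .
qed

lemma nherm_has_derivative: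
  "(nherm n has_real_derivative nherm (n - 1) x) (at x)"
proof (cases "n < 0")
  case True
  then have "nherm n = (\<lambda>_. 0)" by auto
  then show ?thesis using True by simp
next
  case False
  then obtain k where k: "n = int k" by (metis not_less nonneg_int_cases)
  have "nherm n = (\<lambda>x. herm k x / fact k)" by (auto simp: k nherm_of_nat)
  moreover have "((\<lambda>x. herm k x / fact k) has_real_derivative (real k * herm (k - 1) x / fact k)) (at x)"
    by (rule derivative_eq_intros herm_has_derivative refl | simp)+
  moreover have "real k * herm (k - 1) x / fact k = nherm (n - 1) x"
  proof (cases k)
    case 0 then show ?thesis by (simp add: k)
  next
    case (Suc j)
    then have "n - 1 = int j" using k by simp
    then show ?thesis unfolding \<open>n - 1 = int j\<close> nherm_of_nat Suc
      by (simp add: field_simps del: of_nat_Suc)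
  qed
  ultimately show ?thesis by simp
qed

lemma herm_growth: "\<exists>C\<ge>0. \<forall>x. \<bar>herm n x\<bar> \<le> C * (1 + \<bar>x\<bar>) ^ n"
proof (induction n rule: less_induct)
  case (less n)
  consider "n = 0" | "n = 1" | k where "n = Suc (Suc k)"
    by (metis One_nat_def not0_implies_Suc)
  then show ?case
  proof cases
    case 1 then show ?thesis by (auto intro!: exI[of _ 1])
  next
    case 2 then show ?thesis by (auto intro!: exI[of _ 1])
  next
    case (3 k)
    obtain C D where C: "C \<ge> 0" "\<And>x. \<bar>herm (Suc k) x\<bar> \<le> C * (1 + \<bar>x\<bar>) ^ Suc k"
      and D: "D \<ge> 0" "\<And>x. \<bar>herm k x\<bar> \<le> D * (1 + \<bar>x\<bar>) ^ k"
      using less[of k] less[of "Suc k"] 3 by auto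
    have "\<bar>herm n x\<bar> \<le> (C + real (Suc k) * D) * (1 + \<bar>x\<bar>) ^ n" for x
    proof -
      have "\<bar>herm n x\<bar> \<le> \<bar>x\<bar> * \<bar>herm (Suc k) x\<bar> + real (Suc k) * \<bar>herm k x\<bar>"
        unfolding 3 herm.simps by (rule order.trans[OF abs_triangle_ineq4]) (simp add: abs_mult)
      also have "\<dots> \<le> (1 + \<bar>x\<bar>) * (C * (1 + \<bar>x\<bar>) ^ Suc k) + real (Suc k) * (D * (1 + \<bar>x\<bar>) ^ k)"
        by (intro add_mono mult_mono C D) auto
      also have "\<dots> \<le> (1 + \<bar>x\<bar>) * (C * (1 + \<bar>x\<bar>) ^ Suc k) + real (Suc k) * (D * (1 + \<bar>x\<bar>) ^ n)"
        unfolding 3 using D(1) by (intro add_left_mono mult_left_mono power_increasing) auto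
      finally show ?thesis unfolding 3 by (simp add: algebra_simps)
    qed
    then show ?thesis using C(1) D(1)
      by (intro exI[of _ "C + real (Suc k) * D"]) (auto simp del: of_nat_Suc)
  qed
qed

lemma nherm_growth: "\<exists>C\<ge>0. \<exists>N. \<forall>x. \<bar>nherm n x\<bar> \<le> C * (1 + \<bar>x\<bar>) ^ N"
proof -
  obtain C where C: "C \<ge> 0" "\<And>x. \<bar>herm (nat n) x\<bar> \<le> C * (1 + \<bar>x\<bar>) ^ nat n" using herm_growth by blast
  have "\<bar>nherm n x\<bar> \<le> (C / fact (nat n)) * (1 + \<bar>x\<bar>) ^ nat n" for x
  proof (cases "n < 0")
    case True then show ?thesis using C(1) by simp
  next
    case False
    then show ?thesis using C(2)[of x] by (simp add: nherm_def divide_right_mono)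
  qed
  then show ?thesis using C(1) by (intro exI[of _ "C / fact (nat n)"]) auto
qed

lemma continuous_nherm: "continuous_on UNIV (nherm n)"
  by (meson nherm_has_derivative DERIV_isCont continuous_at_imp_continuous_on)

section \<open>Contraction norms as Gram sums\<close>

definition basis_lists :: "'h set \<Rightarrow> nat \<Rightarrow> 'h list set" where
  "basis_lists B n = {is. set is \<subseteq> B \<and> length is = n}"

lemma finite_basis_lists [simp]: "finite B \<Longrightarrow> finite (basis_lists B n)"
  unfolding basis_lists_def by (rule finite_lists_length_eq)

lemma basis_lists_0 [simp]: "basis_lists B 0 = {[]}"
  by (auto simp: basis_lists_def)

lemma sum_basis_lists_Suc:
  assumes "finite B"
  shows "(\<Sum>is\<in>basis_lists B (Suc n). f is) = (\<Sum>i\<in>B. \<Sum>is\<in>basis_lists B n. f (i # is))"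
proof -
  have "(\<Sum>is\<in>basis_lists B (Suc n). f is) = (\<Sum>(i, is)\<in>B \<times> basis_lists B n. f (i # is))"
    by (intro sum.reindex_bij_witness[where i = "\<lambda>(i, is). i # is" and j = "\<lambda>is. (hd is, tl is)"])
       (auto simp: basis_lists_def length_Suc_conv)
  then show ?thesis by (simp add: sum.cartesian_product)
qed

text \<open>The coordinate of the tensor power of \<open>h\<close> at the elementary tensor formed
  by \<open>is\<close>.\<close>

definition coord_prod :: "'h::real_inner list \<Rightarrow> 'h \<Rightarrow> real" where
  "coord_prod is h = prod_list (map (inner h) is)"

lemma coord_prod_Nil [simp]: "coord_prod [] h = 1" and coord_prod_Cons [simp]: "coord_prod (i # is) h = inner h i * coord_prod is h"
  by (simp_all add: coord_prod_def)

text \<open>Coefficient of \<open>x\<^sup>P y\<^sup>Q\<close> in the coordinate \<open>is\<close> of \<open>(x h + y g)\<^sup>\<otimes>\<^sup>(\<^sup>P\<^sup>+\<^sup>Q\<^sup>)\<close>, that is, up to a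
  constant, of the symmetrisation of \<open>h\<^sup>\<otimes>\<^sup>P \<otimes> g\<^sup>\<otimes>\<^sup>Q\<close>.\<close>

fun sym_coord :: "'h::real_inner list \<Rightarrow> int \<Rightarrow> int \<Rightarrow> 'h \<Rightarrow> 'h \<Rightarrow> real" where
  "sym_coord [] P Q h g = (if P = 0 \<and> Q = 0 then 1 else 0)"
| "sym_coord (i # is) P Q h g = inner h i * sym_coord is (P - 1) Q h g + inner g i * sym_coord is P (Q - 1) h g"

text \<open>The coefficient of \<open>x^P y^Q x'^P' y'^Q'\<close> in the divided power of order
  \<open>P + Q = P' + Q'\<close> of \<open>x x' hh + x y' hg + y x' gh + y y' gg\<close>. The index
  \<open>s\<close> counts the factors \<open>hg\<close>; the other three exponents follow from
  it.\<close>

definition sym_kernel :: "nat \<Rightarrow> int \<Rightarrow> int \<Rightarrow> int \<Rightarrow> int \<Rightarrow> real \<Rightarrow> real \<Rightarrow> real \<Rightarrow> real \<Rightarrow> real" where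
  "sym_kernel K P Q P' Q' hh hg gh gg =
     (\<Sum>s=0..K. dpow (P - int s) hh * dpow (int s) hg * dpow (P' - P + int s) gh * dpow (Q' - int s) gg)"

text \<open>Euler's identity for a homogeneous polynomial: the four exponents add up to
  \<open>n\<close>, and \<open>dpow_step\<close> lowers each of them in turn. Lowering the exponent
  of \<open>hg\<close> moves the summation index and therefore requires a shift.\<close>

lemma sym_kernel_step:
  assumes "P' + Q' = n" "P \<le> int K"
  shows "of_int n * sym_kernel K P Q P' Q' hh hg gh gg =
     hh * sym_kernel K (P - 1) Q (P' - 1) Q' hh hg gh gg + hg * sym_kernel K (P - 1) Q P' (Q' - 1) hh hg gh gg
   + gh * sym_kernel K P (Q - 1) (P' - 1) Q' hh hg gh gg + gg * sym_kernel K P (Q - 1) P' (Q' - 1) hh hg gh gg"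
proof -
  define t where "t s = dpow (P - int s) hh * dpow (int s) hg * dpow (P' - P + int s) gh * dpow (Q' - int s) gg" for s
  define u where "u s = dpow (P - int s) hh * (hg * dpow (int s - 1) hg) * dpow (P' - P + int s) gh * dpow (Q' - int s) gg" for s
  have 1: "of_int n * t s = hh * (dpow (P - 1 - int s) hh * dpow (int s) hg * dpow (P' - 1 - (P - 1) + int s) gh * dpow (Q' - int s) gg)
    + u s
    + gh * (dpow (P - int s) hh * dpow (int s) hg * dpow (P' - 1 - P + int s) gh * dpow (Q' - int s) gg)
    + gg * (dpow (P - int s) hh * dpow (int s) hg * dpow (P' - P + int s) gh * dpow (Q' - 1 - int s) gg)" for s
  proof -
    have n: "(of_int n :: real) = of_int (P - int s) + of_int (int s) + of_int (P' - P + int s) + of_int (Q' - int s)"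
      using assms(1) by simp
    have "of_int n * t s =
        (of_int (P - int s) * dpow (P - int s) hh) * dpow (int s) hg * dpow (P' - P + int s) gh * dpow (Q' - int s) gg
      + dpow (P - int s) hh * (of_int (int s) * dpow (int s) hg) * dpow (P' - P + int s) gh * dpow (Q' - int s) gg
      + dpow (P - int s) hh * dpow (int s) hg * (of_int (P' - P + int s) * dpow (P' - P + int s) gh) * dpow (Q' - int s) gg
      + dpow (P - int s) hh * dpow (int s) hg * dpow (P' - P + int s) gh * (of_int (Q' - int s) * dpow (Q' - int s) gg)"
      unfolding n t_def by (simp only: algebra_simps)
    then show ?thesis unfolding dpow_step u_def by (simp add: algebra_simps)
  qed
  have u: "(\<Sum>s=0..K. u s) = hg * sym_kernel K (P - 1) Q P' (Q' - 1) hh hg gh gg"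
  proof -
    define v where "v s = hg * (dpow (P - 1 - int s) hh * dpow (int s) hg * dpow (P' - (P - 1) + int s) gh * dpow (Q' - 1 - int s) gg)" for s
    have uS: "u (Suc s) = v s" for s
      unfolding u_def v_def by (simp add: algebra_simps)
    have "(\<Sum>s=0..K. u s) = u 0 + (\<Sum>s=0..<K. u (Suc s))"
      by (simp add: sum.atLeast0_atMost_Suc_shift atLeast0AtMost lessThan_Suc_atMost[symmetric] sum.lessThan_Suc_shift atLeast0LessThan del: sum.lessThan_Suc)
    \<comment> \<open>\<open>v K\<close> contains \<open>dpow (P - 1 - int K) hh\<close>, whose
      order is negative by \<open>P \<le> int K\<close>, and \<open>u 0\<close> contains
      \<open>dpow (- 1) hg\<close>; so both ends of the shifted sum are zero.\<close>
    also have "\<dots> = (\<Sum>s=0..<K. v s) + v K"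
      using assms(2) by (simp add: uS) (simp add: u_def v_def)
    also have "\<dots> = (\<Sum>s=0..K. v s)" by (simp add: atLeast0AtMost atLeast0LessThan lessThan_Suc_atMost[symmetric])
    finally show ?thesis unfolding sym_kernel_def v_def by (simp add: sum_distrib_left)
  qed
  have "of_int n * sym_kernel K P Q P' Q' hh hg gh gg = (\<Sum>s=0..K. of_int n * t s)"
    unfolding sym_kernel_def t_def by (simp add: sum_distrib_left)
  also have "\<dots> = hh * sym_kernel K (P - 1) Q (P' - 1) Q' hh hg gh gg + (\<Sum>s=0..K. u s)
   + gh * sym_kernel K P (Q - 1) (P' - 1) Q' hh hg gh gg + gg * sym_kernel K P (Q - 1) P' (Q' - 1) hh hg gh gg"
    unfolding 1 sum.distrib sym_kernel_def by (simp only: sum_distrib_left)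
  finally show ?thesis unfolding u by simp
qed

text \<open>The exponents \<open>P - s\<close>, \<open>s\<close>, \<open>P' - P + s\<close> and
  \<open>- P' - s\<close> add up to zero, so a summand without negative exponent has all of them
  zero.\<close>

lemma sym_kernel_0: "sym_kernel K P (-P) P' (-P') hh hg gh gg = (if P = 0 \<and> P' = 0 then 1 else 0)"
proof -
  have "sym_kernel K P (-P) P' (-P') hh hg gh gg = (\<Sum>s\<in>{0..K}. if s = 0 then (if P = 0 \<and> P' = 0 then 1 else 0) else 0)"
    unfolding sym_kernel_def
  proof (intro sum.cong refl)
    fix s :: nat
    show "dpow (P - int s) hh * dpow (int s) hg * dpow (P' - P + int s) gh * dpow (- P' - int s) gg =
      (if s = 0 then (if P = 0 \<and> P' = 0 then 1 else 0) else 0)"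
    proof (cases "P - int s < 0 \<or> P' - P + int s < 0 \<or> - P' - int s < 0")
      case True then show ?thesis by auto
    next
      case False
      then have "s = 0" "P = 0" "P' = 0" by linarith+
      then show ?thesis by simp
    qed
  qed
  also have "\<dots> = (if P = 0 \<and> P' = 0 then 1 else 0)" by (simp only: sum.delta finite_atLeastAtMost) simp
  finally show ?thesis .
qed

text \<open>\<open>B\<close> plays the role of an orthonormal basis of a finite-dimensional space
  around \<open>S\<close>. Factoring Gram matrices through \<open>B\<close> turns powers of inner
  products into sums of products indexed by lists over \<open>B\<close>, which is what a tensor
  product would provide.\<close>

locale parseval =
  fixes B S :: "'h::real_inner set"
  assumes finB: "finite B" and finS: "finite S"
    and parseval: "\<And>h g. h \<in> S \<Longrightarrow> g \<in> S \<Longrightarrow> inner h g = (\<Sum>i\<in>B. inner h i * inner g i)"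
begin

lemma coord_prod_sum:
  assumes "h \<in> S" "g \<in> S"
  shows "(\<Sum>is\<in>basis_lists B n. coord_prod is h * coord_prod is g) = inner h g ^ n"
proof (induction n)
  case 0 then show ?case by simp
next
  case (Suc n)
  have "(\<Sum>is\<in>basis_lists B (Suc n). coord_prod is h * coord_prod is g)
     = (\<Sum>i\<in>B. inner h i * inner g i * (\<Sum>is\<in>basis_lists B n. coord_prod is h * coord_prod is g))"
    by (simp add: sum_basis_lists_Suc finB sum_distrib_left algebra_simps)
  also have "\<dots> = inner h g * inner h g ^ n"
    using assms by (simp add: Suc parseval sum_distrib_right[symmetric])
  finally show ?case by simp
qed

text \<open>Both sides are the same coefficient of the identity expressing the inner product of two
  \<open>n\<close>-th tensor powers, of \<open>x h + y g\<close> and of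
  \<open>x' h' + y' g'\<close>, as the \<open>n\<close>-th power of their inner product;
  \<open>fact n\<close> appears because \<open>sym_kernel\<close> uses divided powers. Removing one
  list entry reproduces \<open>sym_kernel_step\<close>.\<close>

lemma sym_coord_sum:
  assumes "h \<in> S" "g \<in> S" "h' \<in> S" "g' \<in> S" "P + Q = int n" "P' + Q' = int n" "P \<le> int K"
  shows "(\<Sum>is\<in>basis_lists B n. sym_coord is P Q h g * sym_coord is P' Q' h' g')
    = fact n * sym_kernel K P Q P' Q' (inner h h') (inner h g') (inner g h') (inner g g')"
  using assms(5-)
proof (induction n arbitrary: P Q P' Q')
  case 0
  then have Q: "Q = - P" "Q' = - P'" by auto
  show ?case unfolding Q sym_kernel_0 by simp
next
  case (Suc n)
  let ?k = "\<lambda>P Q P' Q'. sym_kernel K P Q P' Q' (inner h h') (inner h g') (inner g h') (inner g g')"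
  let ?s = "\<lambda>P Q P' Q'. \<Sum>is\<in>basis_lists B n. sym_coord is P Q h g * sym_coord is P' Q' h' g'"
  have IH: "?s (P - 1) Q (P' - 1) Q' = fact n * ?k (P - 1) Q (P' - 1) Q'"
    "?s (P - 1) Q P' (Q' - 1) = fact n * ?k (P - 1) Q P' (Q' - 1)"
    "?s P (Q - 1) (P' - 1) Q' = fact n * ?k P (Q - 1) (P' - 1) Q'"
    "?s P (Q - 1) P' (Q' - 1) = fact n * ?k P (Q - 1) P' (Q' - 1)"
    using Suc.prems by (intro Suc.IH; simp)+
  have "(\<Sum>is\<in>basis_lists B (Suc n). sym_coord is P Q h g * sym_coord is P' Q' h' g')
    = (\<Sum>i\<in>B. inner h i * inner h' i * ?s (P - 1) Q (P' - 1) Q' + inner h i * inner g' i * ?s (P - 1) Q P' (Q' - 1)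
      + inner g i * inner h' i * ?s P (Q - 1) (P' - 1) Q' + inner g i * inner g' i * ?s P (Q - 1) P' (Q' - 1))"
    unfolding sum_basis_lists_Suc[OF finB]
    by (intro sum.cong refl) (simp add: sum_distrib_left algebra_simps sum.distrib)
  also have "\<dots> = inner h h' * ?s (P - 1) Q (P' - 1) Q' + inner h g' * ?s (P - 1) Q P' (Q' - 1)
      + inner g h' * ?s P (Q - 1) (P' - 1) Q' + inner g g' * ?s P (Q - 1) P' (Q' - 1)"
    using assms(1-4) by (simp only: sum.distrib sum_distrib_right[symmetric] parseval)
  also have "\<dots> = fact n * (of_int (int (Suc n)) * ?k P Q P' Q')"
    unfolding IH using Suc.prems by (subst sym_kernel_step) (auto simp: algebra_simps)
  finally show ?case by (simp add: algebra_simps)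
qed

end

lemma sum_swap3:
  "(\<Sum>s\<in>C. \<Sum>x\<in>A. \<Sum>y\<in>B. f s x y) = (\<Sum>x\<in>A. \<Sum>y\<in>B. \<Sum>s\<in>C. f s x y)"
  by (subst sum.swap) (intro sum.cong refl sum.swap)

text \<open>A kernel of finite rank splits a quadratic form into a sum of products of linear forms.
  Positivity and Cauchy-Schwarz for all Gram sums below are read off from such a splitting.\<close>

lemma sum_features:
  fixes w v :: "'x \<Rightarrow> real"
  assumes "\<And>x y. x \<in> X \<Longrightarrow> y \<in> X \<Longrightarrow> k x y = (\<Sum>i\<in>I. \<phi> i x * \<psi> i y)"
  shows "(\<Sum>x\<in>X. \<Sum>y\<in>X. w x * v y * k x y) = (\<Sum>i\<in>I. (\<Sum>x\<in>X. w x * \<phi> i x) * (\<Sum>y\<in>X. v y * \<psi> i y))"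
proof -
  have "(\<Sum>i\<in>I. (\<Sum>x\<in>X. w x * \<phi> i x) * (\<Sum>y\<in>X. v y * \<psi> i y))
    = (\<Sum>i\<in>I. \<Sum>x\<in>X. \<Sum>y\<in>X. w x * v y * (\<phi> i x * \<psi> i y))"
    unfolding sum_product by (simp add: algebra_simps)
  also have "\<dots> = (\<Sum>x\<in>X. \<Sum>y\<in>X. \<Sum>i\<in>I. w x * v y * (\<phi> i x * \<psi> i y))"
    by (subst sum.swap) (intro sum.cong refl sum.swap)
  also have "\<dots> = (\<Sum>x\<in>X. \<Sum>y\<in>X. w x * v y * k x y)"
    using assms by (intro sum.cong refl) (simp add: sum_distrib_left)
  finally show ?thesis by simp
qed

text \<open>Let \<open>f = \<Sum> a\<^sub>h h\<^sup>\<otimes>\<^sup>p\<close>, \<open>g = \<Sum> b\<^sub>h h\<^sup>\<otimes>\<^sup>q\<close>, \<open>F = I\<^sub>p(f) / p!\<close> and \<open>G = I\<^sub>q(g) / q!\<close>. In \<open>E[F\<^sup>2 G\<^sup>2]\<close>,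
  \<open>Tsum\<close> collects the diagrams with \<open>r\<close> edges between \<open>F\<close> and \<open>G\<close> of the same copy and \<open>s\<close> edges between
  \<open>F\<close> and \<open>G\<close> of different copies, \<open>Ssum\<close> is the contribution of the chaos of order \<open>p + q - 2 r\<close>, and
  \<open>Csum\<close> is \<open>\<parallel>f \<otimes>\<^sub>r g\<parallel>\<^sup>2\<close>. The cut-off \<open>K\<close> only has to be at least \<open>p\<close>.\<close>

definition Tsum :: "'h::real_inner set \<Rightarrow> ('h \<Rightarrow> real) \<Rightarrow> ('h \<Rightarrow> real) \<Rightarrow> nat \<Rightarrow> nat \<Rightarrow> nat \<Rightarrow> nat \<Rightarrow> real" where
  "Tsum S a b p q r s = (\<Sum>x\<in>S \<times> S. \<Sum>y\<in>S \<times> S. a (fst x) * b (snd x) * (a (fst y) * b (snd y)) *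
     (dpow (int r) (inner (fst x) (snd x)) * dpow (int s) (inner (fst x) (snd y)) *
      dpow (int p - int r - int s) (inner (fst x) (fst y)) * dpow (int q - int r - int s) (inner (snd x) (snd y)) *
      dpow (int s) (inner (snd x) (fst y)) * dpow (int r) (inner (fst y) (snd y))))"

definition Csum :: "'h::real_inner set \<Rightarrow> ('h \<Rightarrow> real) \<Rightarrow> ('h \<Rightarrow> real) \<Rightarrow> nat \<Rightarrow> nat \<Rightarrow> nat \<Rightarrow> real" where
  "Csum S a b p q r = (\<Sum>x\<in>S \<times> S. \<Sum>y\<in>S \<times> S.
     (a (fst x) * b (snd x) * inner (fst x) (snd x) ^ r) * (a (fst y) * b (snd y) * inner (fst y) (snd y) ^ r) *
      (inner (fst x) (fst y) ^ (p - r) * inner (snd x) (snd y) ^ (q - r)))"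

definition Ssum :: "'h::real_inner set \<Rightarrow> ('h \<Rightarrow> real) \<Rightarrow> ('h \<Rightarrow> real) \<Rightarrow> nat \<Rightarrow> nat \<Rightarrow> nat \<Rightarrow> nat \<Rightarrow> real" where
  "Ssum S a b p q K r = (\<Sum>s=0..K. Tsum S a b p q r s)"

lemma Tsum_eq_0: "r + s > p \<or> r + s > q \<Longrightarrow> Tsum S a b p q r s = 0"
  unfolding Tsum_def by (intro sum.neutral ballI) auto

section \<open>Positivity and norm inequalities for Gram sums\<close>

context parseval begin

text \<open>Summing over the cross edges \<open>s\<close> assembles the kernel of the symmetrised
  tensors, so the expression is, up to \<open>fact n\<close>, the squared norm of the symmetrised
  contraction of order \<open>r\<close>.\<close>

lemma Ssum_nonneg:
  assumes "r \<le> p" "r \<le> q" "p \<le> K"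
  shows "Ssum S a b p q K r \<ge> 0"
proof -
  define P Q where "P = int p - int r" and "Q = int q - int r"
  define n where "n = nat (P + Q)"
  have n: "P + Q = int n" using assms by (simp add: n_def P_def Q_def)
  define w where "w x = a (fst x) * b (snd x) * dpow (int r) (inner (fst x) (snd x))" for x
  have "Ssum S a b p q K r = (\<Sum>x\<in>S \<times> S. \<Sum>y\<in>S \<times> S. w x * w y *
     sym_kernel K P Q P Q (inner (fst x) (fst y)) (inner (fst x) (snd y)) (inner (snd x) (fst y)) (inner (snd x) (snd y)))"
    unfolding Ssum_def Tsum_def sym_kernel_def sum_distrib_left
    by (subst sum_swap3) (intro sum.cong refl, simp add: w_def P_def Q_def algebra_simps)
  also have "\<dots> = (\<Sum>is\<in>basis_lists B n. (\<Sum>x\<in>S \<times> S. w x * (sym_coord is P Q (fst x) (snd x) / fact n))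
       * (\<Sum>y\<in>S \<times> S. w y * sym_coord is P Q (fst y) (snd y)))"
  proof (rule sum_features)
    fix x y assume "x \<in> S \<times> S" "y \<in> S \<times> S"
    then have "(\<Sum>is\<in>basis_lists B n. sym_coord is P Q (fst x) (snd x) * sym_coord is P Q (fst y) (snd y)) =
     fact n * sym_kernel K P Q P Q (inner (fst x) (fst y)) (inner (fst x) (snd y)) (inner (snd x) (fst y)) (inner (snd x) (snd y))"
      using assms n by (intro sym_coord_sum) (auto simp: P_def)
    then show "sym_kernel K P Q P Q (inner (fst x) (fst y)) (inner (fst x) (snd y)) (inner (snd x) (fst y)) (inner (snd x) (snd y))
      = (\<Sum>is\<in>basis_lists B n. sym_coord is P Q (fst x) (snd x) / fact n * sym_coord is P Q (fst y) (snd y))"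
      by (simp add: sum_divide_distrib[symmetric])
  qed
  also have "\<dots> = (\<Sum>is\<in>basis_lists B n. (\<Sum>x\<in>S \<times> S. w x * sym_coord is P Q (fst x) (snd x))\<^sup>2) / fact n"
    by (simp add: sum_divide_distrib[symmetric] power2_eq_square)
  also have "\<dots> \<ge> 0" by (simp add: sum_nonneg)
  finally show ?thesis .
qed

text \<open>Expanding the \<open>p - r\<close> and \<open>q - r\<close> free legs in coordinates
  exhibits a sum of squares, one for each coordinate of the contraction.\<close>

lemma Csum_nonneg: "Csum S a b p q r \<ge> 0"
proof -
  have "Csum S a b p q r = (\<Sum>i\<in>basis_lists B (p - r) \<times> basis_lists B (q - r).
     (\<Sum>x\<in>S \<times> S. (a (fst x) * b (snd x) * inner (fst x) (snd x) ^ r) * (coord_prod (fst i) (fst x) * coord_prod (snd i) (snd x))) *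
     (\<Sum>x\<in>S \<times> S. (a (fst x) * b (snd x) * inner (fst x) (snd x) ^ r) * (coord_prod (fst i) (fst x) * coord_prod (snd i) (snd x))))"
    unfolding Csum_def
  proof (rule sum_features)
    fix x y assume xy: "x \<in> S \<times> S" "y \<in> S \<times> S"
    have "inner (fst x) (fst y) ^ (p - r) * inner (snd x) (snd y) ^ (q - r) =
      (\<Sum>is\<in>basis_lists B (p - r). coord_prod is (fst x) * coord_prod is (fst y)) * (\<Sum>is\<in>basis_lists B (q - r). coord_prod is (snd x) * coord_prod is (snd y))"
      using xy by (subst (1 2) coord_prod_sum) auto
    also have "\<dots> = (\<Sum>i\<in>basis_lists B (p - r) \<times> basis_lists B (q - r). coord_prod (fst i) (fst x) * coord_prod (snd i) (snd x) * (coord_prod (fst i) (fst y) * coord_prod (snd i) (snd y)))"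
      unfolding sum_product sum.cartesian_product by (intro sum.cong refl) auto
    finally show "inner (fst x) (fst y) ^ (p - r) * inner (snd x) (snd y) ^ (q - r) =
      (\<Sum>i\<in>basis_lists B (p - r) \<times> basis_lists B (q - r). coord_prod (fst i) (fst x) * coord_prod (snd i) (snd x) * (coord_prod (fst i) (fst y) * coord_prod (snd i) (snd y)))" .
  qed
  also have "\<dots> \<ge> 0" by (intro sum_nonneg) simp
  finally show ?thesis .
qed

text \<open>Exchanging two blocks of tensor legs is an isometry.\<close>

lemma Tsum_le_Csum:
  assumes rs: "r + s \<le> p" "r + s \<le> q"
  shows "Tsum S a b p q r s \<le> Csum S a b p q r / ((fact r)\<^sup>2 * (fact s)\<^sup>2 * fact (p - r - s) * fact (q - r - s))"
proof -
  define w where "w x = a (fst x) * b (snd x) * inner (fst x) (snd x) ^ r" for x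
  define I where "I = basis_lists B (p - r - s) \<times> basis_lists B s \<times> basis_lists B s \<times> basis_lists B (q - r - s)"
  define \<phi> :: "'h list \<times> 'h list \<times> 'h list \<times> 'h list \<Rightarrow> 'h \<times> 'h \<Rightarrow> real"
    where "\<phi> = (\<lambda>(i, j, k, l) x. coord_prod i (fst x) * coord_prod j (fst x) * coord_prod k (snd x) * coord_prod l (snd x))"
  \<comment> \<open>The two middle blocks both have length \<open>s\<close>, so exchanging them is
    an involution of \<open>I\<close>. It carries the kernel of uncrossed edges into the one with
    \<open>s\<close> crossed edges on either side.\<close>
  define \<sigma> where "\<sigma> = (\<lambda>(i::'h list, j::'h list, k::'h list, l::'h list). (i, k, j, l))"
  define u where "u i = (\<Sum>x\<in>S \<times> S. w x * \<phi> i x)" for i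
  have finI: "finite I" by (simp add: I_def finB)
  have prod4: "(\<Sum>i\<in>A1. f1 i) * (\<Sum>i\<in>A2. f2 i) * (\<Sum>i\<in>A3. f3 i) * (\<Sum>i\<in>A4. f4 i)
    = (\<Sum>(i, j, k, l)\<in>A1 \<times> A2 \<times> A3 \<times> A4. f1 i * f2 j * f3 k * f4 l)" for A1 A2 A3 A4 and f1 f2 f3 f4 :: "'h list \<Rightarrow> real"
  proof -
    have "(\<Sum>(i, j, k, l)\<in>A1 \<times> A2 \<times> A3 \<times> A4. f1 i * f2 j * f3 k * f4 l)
      = (\<Sum>i\<in>A1. \<Sum>j\<in>A2. \<Sum>k\<in>A3. \<Sum>l\<in>A4. f1 i * (f2 j * (f3 k * f4 l)))"
      by (simp add: sum.cartesian_product' case_prod_unfold mult.assoc)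
    also have "\<dots> = (\<Sum>i\<in>A1. f1 i) * (\<Sum>i\<in>A2. f2 i) * (\<Sum>i\<in>A3. f3 i) * (\<Sum>i\<in>A4. f4 i)"
      by (simp only: sum_distrib_left[symmetric] sum_distrib_right[symmetric] mult.assoc)
    finally show ?thesis by simp
  qed
  have k1: "inner (fst x) (fst y) ^ (p - r) * inner (snd x) (snd y) ^ (q - r) = (\<Sum>i\<in>I. \<phi> i x * \<phi> i y)"
    if "x \<in> S \<times> S" "y \<in> S \<times> S" for x y
  proof -
    have "p - r = (p - r - s) + s" "q - r = s + (q - r - s)" using rs by auto
    then have "inner (fst x) (fst y) ^ (p - r) * inner (snd x) (snd y) ^ (q - r) =
      inner (fst x) (fst y) ^ (p - r - s) * inner (fst x) (fst y) ^ s * inner (snd x) (snd y) ^ s * inner (snd x) (snd y) ^ (q - r - s)"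
      by (metis power_add mult.assoc)
    also have "\<dots> = (\<Sum>is\<in>basis_lists B (p - r - s). coord_prod is (fst x) * coord_prod is (fst y)) * (\<Sum>is\<in>basis_lists B s. coord_prod is (fst x) * coord_prod is (fst y))
       * (\<Sum>is\<in>basis_lists B s. coord_prod is (snd x) * coord_prod is (snd y)) * (\<Sum>is\<in>basis_lists B (q - r - s). coord_prod is (snd x) * coord_prod is (snd y))"
      using that by (subst (1 2 3 4) coord_prod_sum) auto
    also have "\<dots> = (\<Sum>i\<in>I. \<phi> i x * \<phi> i y)"
      unfolding prod4 I_def \<phi>_def by (intro sum.cong refl) (auto simp: algebra_simps)
    finally show ?thesis .
  qed
  have k2: "inner (fst x) (fst y) ^ (p - r - s) * inner (fst x) (snd y) ^ s * inner (snd x) (fst y) ^ s * inner (snd x) (snd y) ^ (q - r - s)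
      = (\<Sum>i\<in>I. \<phi> i x * \<phi> (\<sigma> i) y)"
    if "x \<in> S \<times> S" "y \<in> S \<times> S" for x y
  proof -
    have "inner (fst x) (fst y) ^ (p - r - s) * inner (fst x) (snd y) ^ s * inner (snd x) (fst y) ^ s * inner (snd x) (snd y) ^ (q - r - s)
     = (\<Sum>is\<in>basis_lists B (p - r - s). coord_prod is (fst x) * coord_prod is (fst y)) * (\<Sum>is\<in>basis_lists B s. coord_prod is (fst x) * coord_prod is (snd y))
       * (\<Sum>is\<in>basis_lists B s. coord_prod is (snd x) * coord_prod is (fst y)) * (\<Sum>is\<in>basis_lists B (q - r - s). coord_prod is (snd x) * coord_prod is (snd y))"
      using that by (subst (1 2 3 4) coord_prod_sum) auto
    also have "\<dots> = (\<Sum>i\<in>I. \<phi> i x * \<phi> (\<sigma> i) y)"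
      unfolding prod4 I_def \<phi>_def \<sigma>_def by (intro sum.cong refl) (auto simp: algebra_simps)
    finally show ?thesis .
  qed
  define D :: real where "D = (fact r)\<^sup>2 * (fact s)\<^sup>2 * fact (p - r - s) * fact (q - r - s)"
  have D: "D > 0" by (simp add: D_def)
  have ints: "int p - int r - int s = int (p - r - s)" "int q - int r - int s = int (q - r - s)" using rs by auto
  have "Tsum S a b p q r s = (\<Sum>x\<in>S \<times> S. \<Sum>y\<in>S \<times> S. w x * w y *
     (inner (fst x) (fst y) ^ (p - r - s) * inner (fst x) (snd y) ^ s * inner (snd x) (fst y) ^ s * inner (snd x) (snd y) ^ (q - r - s))) / D"
    unfolding Tsum_def ints dpow_of_nat D_def w_def sum_divide_distrib
    by (intro sum.cong refl) (simp add: power2_eq_square mult_ac)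
  also have "\<dots> = (\<Sum>i\<in>I. u i * u (\<sigma> i)) / D"
    unfolding u_def by (subst sum_features[OF k2]) auto
  \<comment> \<open>The arithmetic mean suffices instead of Cauchy-Schwarz, because
    \<open>\<sigma>\<close> permutes \<open>I\<close> and the two sums of squares are equal.\<close>
  also have "\<dots> \<le> (\<Sum>i\<in>I. (u i * u i + u (\<sigma> i) * u (\<sigma> i)) / 2) / D"
  proof (intro divide_right_mono sum_mono)
    fix i
    show "u i * u (\<sigma> i) \<le> (u i * u i + u (\<sigma> i) * u (\<sigma> i)) / 2"
      using sum_squares_bound[of "u i" "u (\<sigma> i)"] by (simp add: power2_eq_square)
  qed (use D in simp)
  also have "(\<Sum>i\<in>I. (u i * u i + u (\<sigma> i) * u (\<sigma> i)) / 2) = (\<Sum>i\<in>I. u i * u i)"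
  proof -
    have "(\<Sum>i\<in>I. u (\<sigma> i) * u (\<sigma> i)) = (\<Sum>i\<in>I. u i * u i)"
      by (rule sum.reindex_bij_witness[where i = \<sigma> and j = \<sigma>]) (auto simp: \<sigma>_def I_def)
    then show ?thesis by (simp add: sum_divide_distrib[symmetric] sum.distrib)
  qed
  also have "(\<Sum>i\<in>I. u i * u i) = Csum S a b p q r"
    unfolding Csum_def w_def[symmetric] u_def by (subst sum_features[OF k1]) auto
  finally show ?thesis unfolding D_def .
qed

text \<open>For \<open>r \<le> p\<close>, a coordinate of the contraction of \<open>f\<close> with
  itself of order \<open>p - r\<close>, which leaves \<open>r\<close> legs on either side; hence the
  exponent \<open>p - r\<close>.\<close>

definition contr_coord :: "('h \<Rightarrow> real) \<Rightarrow> nat \<Rightarrow> nat \<Rightarrow> 'h list \<times> 'h list \<Rightarrow> real" where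
  "contr_coord a p r i = (\<Sum>z\<in>S \<times> S. a (fst z) * a (snd z) * inner (fst z) (snd z) ^ (p - r) * (coord_prod (fst i) (fst z) * coord_prod (snd i) (snd z)))"

text \<open>The four vertices are regrouped: instead of pairing each \<open>f\<close> with its
  \<open>g\<close>, the two copies of \<open>f\<close> are paired, and so are the two copies of
  \<open>g\<close>. The free legs become the contracted ones, and the squared norm of a mixed
  contraction becomes an inner product of two self-contractions.\<close>

lemma Csum_eq_contr_coord:
  "Csum S a b p q r = (\<Sum>i\<in>basis_lists B r \<times> basis_lists B r. contr_coord a p r i * contr_coord b q r i)"
proof -
  define w where "w z = a (fst z) * a (snd z) * inner (fst z) (snd z) ^ (p - r)" for z
  define v where "v z = b (fst z) * b (snd z) * inner (fst z) (snd z) ^ (q - r)" for z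
  have k: "inner (fst z) (fst z') ^ r * inner (snd z) (snd z') ^ r =
     (\<Sum>i\<in>basis_lists B r \<times> basis_lists B r. (coord_prod (fst i) (fst z) * coord_prod (snd i) (snd z)) * (coord_prod (fst i) (fst z') * coord_prod (snd i) (snd z')))"
    if "z \<in> S \<times> S" "z' \<in> S \<times> S" for z z'
  proof -
    have "inner (fst z) (fst z') ^ r * inner (snd z) (snd z') ^ r =
      (\<Sum>is\<in>basis_lists B r. coord_prod is (fst z) * coord_prod is (fst z')) * (\<Sum>is\<in>basis_lists B r. coord_prod is (snd z) * coord_prod is (snd z'))"
      using that by (subst (1 2) coord_prod_sum) auto
    also have "\<dots> = (\<Sum>i\<in>basis_lists B r \<times> basis_lists B r. (coord_prod (fst i) (fst z) * coord_prod (snd i) (snd z)) * (coord_prod (fst i) (fst z') * coord_prod (snd i) (snd z')))"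
      unfolding sum_product sum.cartesian_product by (intro sum.cong refl) auto
    finally show ?thesis .
  qed
  have "(\<Sum>i\<in>basis_lists B r \<times> basis_lists B r. contr_coord a p r i * contr_coord b q r i)
    = (\<Sum>z\<in>S \<times> S. \<Sum>z'\<in>S \<times> S. w z * v z' * (inner (fst z) (fst z') ^ r * inner (snd z) (snd z') ^ r))"
    unfolding contr_coord_def w_def[symmetric] v_def[symmetric] by (rule sum_features[symmetric, OF k])
  also have "\<dots> = (\<Sum>(z, z')\<in>(S \<times> S) \<times> (S \<times> S). w z * v z' * (inner (fst z) (fst z') ^ r * inner (snd z) (snd z') ^ r))"
    by (simp only: sum.cartesian_product)
  also have "\<dots> = (\<Sum>(x, y)\<in>(S \<times> S) \<times> (S \<times> S).
     (a (fst x) * b (snd x) * inner (fst x) (snd x) ^ r) * (a (fst y) * b (snd y) * inner (fst y) (snd y) ^ r) *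
      (inner (fst x) (fst y) ^ (p - r) * inner (snd x) (snd y) ^ (q - r)))"
    by (rule sum.reindex_bij_witness[where i = "\<lambda>((h, g), (h', g')). ((h, h'), (g, g'))" and j = "\<lambda>((h, h'), (g, g')). ((h, g), (h', g'))"])
       (auto simp: w_def v_def)
  also have "\<dots> = Csum S a b p q r" unfolding Csum_def by (simp only: sum.cartesian_product)
  finally show ?thesis by simp
qed

lemma Csum_Cauchy_Schwarz:
  "(Csum S a b p q r)\<^sup>2 \<le> Csum S a a p p r * Csum S b b q q r"
proof -
  have "Csum S a b p q r ^ 2 \<le> (\<Sum>i\<in>basis_lists B r \<times> basis_lists B r. (contr_coord a p r i)\<^sup>2) * (\<Sum>i\<in>basis_lists B r \<times> basis_lists B r. (contr_coord b q r i)\<^sup>2)"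
    unfolding Csum_eq_contr_coord by (rule Cauchy_Schwarz_ineq_sum)
  then show ?thesis by (simp add: Csum_eq_contr_coord power2_eq_square)
qed

text \<open>With \<open>r\<close> of its legs set apart, \<open>f\<close> is a matrix
  \<open>c\<close>, and its self-contraction is the product of \<open>c\<close> with its transpose.
  The Hilbert-Schmidt norm of that product is at most the squared Hilbert-Schmidt norm of
  \<open>c\<close>, by Cauchy-Schwarz for its columns \<open>j\<close>.\<close>

lemma Csum_diag_le:
  assumes "r \<le> p"
  shows "Csum S a a p p r \<le> (\<Sum>h\<in>S. \<Sum>g\<in>S. a h * a g * inner h g ^ p)\<^sup>2"
proof -
  define c where "c k j = (\<Sum>h\<in>S. a h * (coord_prod k h * coord_prod j h))" for k j
  define n where "n j = (\<Sum>k\<in>basis_lists B (p - r). (c k j)\<^sup>2)" for j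
  have 1: "contr_coord a p r (j, j') = (\<Sum>k\<in>basis_lists B (p - r). c k j * c k j')" for j j'
  proof -
    have "(\<Sum>k\<in>basis_lists B (p - r). c k j * c k j')
      = (\<Sum>k\<in>basis_lists B (p - r). (\<Sum>h\<in>S. (a h * coord_prod j h) * coord_prod k h) * (\<Sum>h\<in>S. (a h * coord_prod j' h) * coord_prod k h))"
      unfolding c_def by (simp add: algebra_simps)
    also have "\<dots> = (\<Sum>h\<in>S. \<Sum>g\<in>S. (a h * coord_prod j h) * (a g * coord_prod j' g) * inner h g ^ (p - r))"
      by (rule sum_features[symmetric]) (simp add: coord_prod_sum)
    also have "\<dots> = contr_coord a p r (j, j')"
      unfolding contr_coord_def sum.cartesian_product by (intro sum.cong refl) auto
    finally show ?thesis by simp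
  qed
  have n: "(\<Sum>j\<in>basis_lists B r. n j) = (\<Sum>h\<in>S. \<Sum>g\<in>S. a h * a g * inner h g ^ p)"
  proof -
    have "(\<Sum>j\<in>basis_lists B r. n j) = (\<Sum>i\<in>basis_lists B r \<times> basis_lists B (p - r).
       (\<Sum>h\<in>S. a h * (coord_prod (snd i) h * coord_prod (fst i) h)) * (\<Sum>h\<in>S. a h * (coord_prod (snd i) h * coord_prod (fst i) h)))"
      unfolding n_def c_def sum.cartesian_product by (intro sum.cong refl) (auto simp: power2_eq_square)
    also have "\<dots> = (\<Sum>h\<in>S. \<Sum>g\<in>S. a h * a g * inner h g ^ p)"
    proof (rule sum_features[symmetric])
      fix h g assume "h \<in> S" "g \<in> S"
      have "inner h g ^ p = inner h g ^ r * inner h g ^ (p - r)" using assms by (simp flip: power_add)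
      also have "\<dots> = (\<Sum>is\<in>basis_lists B r. coord_prod is h * coord_prod is g) * (\<Sum>is\<in>basis_lists B (p - r). coord_prod is h * coord_prod is g)"
        using \<open>h \<in> S\<close> \<open>g \<in> S\<close> by (subst (1 2) coord_prod_sum) auto
      also have "\<dots> = (\<Sum>i\<in>basis_lists B r \<times> basis_lists B (p - r). coord_prod (snd i) h * coord_prod (fst i) h * (coord_prod (snd i) g * coord_prod (fst i) g))"
        unfolding sum_product sum.cartesian_product by (intro sum.cong refl) auto
      finally show "inner h g ^ p = (\<Sum>i\<in>basis_lists B r \<times> basis_lists B (p - r). coord_prod (snd i) h * coord_prod (fst i) h * (coord_prod (snd i) g * coord_prod (fst i) g))" .
    qed
    finally show ?thesis .
  qed
  have "Csum S a a p p r = (\<Sum>(j, j')\<in>basis_lists B r \<times> basis_lists B r. (contr_coord a p r (j, j'))\<^sup>2)"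
    unfolding Csum_eq_contr_coord by (intro sum.cong refl) (auto simp: power2_eq_square)
  also have "\<dots> \<le> (\<Sum>(j, j')\<in>basis_lists B r \<times> basis_lists B r. n j * n j')"
    unfolding 1 n_def by (intro sum_mono) (auto intro!: Cauchy_Schwarz_ineq_sum)
  also have "\<dots> = (\<Sum>j\<in>basis_lists B r. n j) * (\<Sum>j\<in>basis_lists B r. n j)"
    by (simp only: sum.cartesian_product[symmetric] sum_product)
  finally show ?thesis unfolding n by (simp only: power2_eq_square)
qed

end

text \<open>In the same notation, \<open>E[F G]\<close> for \<open>p = q\<close>, \<open>E[F\<^sup>4]\<close> and the fourth cumulant of \<open>F\<close>.\<close>

definition Gsum :: "'h::real_inner set \<Rightarrow> ('h \<Rightarrow> real) \<Rightarrow> ('h \<Rightarrow> real) \<Rightarrow> nat \<Rightarrow> real" where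
  "Gsum S a b p = (\<Sum>h\<in>S. \<Sum>g\<in>S. a h * b g * dpow (int p) (inner h g))"

definition Qsum :: "'h::real_inner set \<Rightarrow> ('h \<Rightarrow> real) \<Rightarrow> nat \<Rightarrow> nat \<Rightarrow> real" where
  "Qsum S a p K = (\<Sum>r=0..K. Ssum S a a p p K r)"

definition kappa_sum :: "'h::real_inner set \<Rightarrow> ('h \<Rightarrow> real) \<Rightarrow> nat \<Rightarrow> nat \<Rightarrow> real" where
  "kappa_sum S a p K = Qsum S a p K - 3 * (Gsum S a a p)\<^sup>2"

text \<open>Exchanging the two copies of \<open>G\<close> turns edges within a copy into edges
  between copies.\<close>

lemma Tsum_swap: "Tsum S a b p q r s = Tsum S a b p q s r"
proof -
  define f where "f x y r s = a (fst x) * b (snd x) * (a (fst y) * b (snd y)) *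
     (dpow (int r) (inner (fst x) (snd x)) * dpow (int s) (inner (fst x) (snd y)) *
      dpow (int p - int r - int s) (inner (fst x) (fst y)) * dpow (int q - int r - int s) (inner (snd x) (snd y)) *
      dpow (int s) (inner (snd x) (fst y)) * dpow (int r) (inner (fst y) (snd y)))" for x y r s
  have T: "Tsum S a b p q r s = (\<Sum>(x, y)\<in>(S \<times> S) \<times> (S \<times> S). f x y r s)" for r s
    unfolding Tsum_def f_def by (simp only: sum.cartesian_product)
  show ?thesis unfolding T
    by (rule sum.reindex_bij_witness[where i = "\<lambda>((h, g), (h', g')). ((h, g'), (h', g))" and j = "\<lambda>((h, g), (h', g')). ((h, g'), (h', g))"])
       (auto simp: f_def inner_commute algebra_simps)
qed

text \<open>Without cross edges the free legs are joined like to like, which is the definition of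
  the squared contraction norm up to factorials. Together with \<open>Tsum_swap\<close> this lets
  contraction norms be read off from a fourth moment.\<close>

lemma Tsum_r_0:
  assumes "r \<le> p" "r \<le> q"
  shows "Tsum S a b p q r 0 = Csum S a b p q r / ((fact r)\<^sup>2 * fact (p - r) * fact (q - r))"
proof -
  have ints: "int p - int r - int 0 = int (p - r)" "int q - int r - int 0 = int (q - r)" using assms by auto
  show ?thesis unfolding Tsum_def Csum_def ints dpow_of_nat sum_divide_distrib
    by (intro sum.cong refl) (simp add: power2_eq_square mult_ac)
qed

lemma sum_prod_square:
  fixes f :: "'a \<Rightarrow> real"
  shows "(\<Sum>x\<in>A. \<Sum>y\<in>A. f x * f y) = (\<Sum>x\<in>A. f x)\<^sup>2"
  by (simp add: power2_eq_square sum_product)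

text \<open>All legs are used up inside the two copies, so the diagram falls apart into two equal
  factors, each equal to \<open>E[F G]\<close>.\<close>

lemma Tsum_p_0: "Tsum S a b p p p 0 = (Gsum S a b p)\<^sup>2"
proof -
  have "Tsum S a b p p p 0 = (\<Sum>x\<in>S \<times> S. \<Sum>y\<in>S \<times> S. (a (fst x) * b (snd x) * dpow (int p) (inner (fst x) (snd x))) *
     (a (fst y) * b (snd y) * dpow (int p) (inner (fst y) (snd y))))"
    unfolding Tsum_def by (intro sum.cong refl) simp
  also have "\<dots> = (Gsum S a b p)\<^sup>2"
    unfolding sum_prod_square Gsum_def sum.cartesian_product by (simp add: case_prod_unfold)
  finally show ?thesis .
qed

text \<open>Every edge joins \<open>F\<close> to \<open>F\<close> or \<open>G\<close> to
  \<open>G\<close>; regrouping the vertices accordingly separates the variables and leaves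
  \<open>E[F\<^sup>2] E[G\<^sup>2]\<close>.\<close>

lemma Tsum_0_0: "Tsum S a b p q 0 0 = Gsum S a a p * Gsum S b b q"
proof -
  have "Tsum S a b p q 0 0 = (\<Sum>(x, y)\<in>(S \<times> S) \<times> (S \<times> S). a (fst x) * b (snd x) * (a (fst y) * b (snd y)) *
     (dpow (int p) (inner (fst x) (fst y)) * dpow (int q) (inner (snd x) (snd y))))"
    unfolding Tsum_def by (simp add: sum.cartesian_product)
  also have "\<dots> = (\<Sum>(x, y)\<in>(S \<times> S) \<times> (S \<times> S). (a (fst x) * a (snd x) * dpow (int p) (inner (fst x) (snd x))) *
     (b (fst y) * b (snd y) * dpow (int q) (inner (fst y) (snd y))))"
    by (rule sum.reindex_bij_witness[where i = "\<lambda>((h, h'), (g, g')). ((h, g), (h', g'))" and j = "\<lambda>((h, g), (h', g')). ((h, h'), (g, g'))"])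
       auto
  also have "\<dots> = Gsum S a a p * Gsum S b b q"
    unfolding Gsum_def sum.cartesian_product sum_product by (simp add: case_prod_unfold)
  finally show ?thesis .
qed

lemma Ssum_eq_0: "r > p \<or> r > q \<Longrightarrow> Ssum S a b p q K r = 0"
  unfolding Ssum_def by (intro sum.neutral ballI Tsum_eq_0) auto

text \<open>For equal orders the component in the chaos of order zero is the mean of
  \<open>F G\<close>, and no leg is left for a cross edge.\<close>

lemma Ssum_p_p: "Ssum S a b p p K p = (Gsum S a b p)\<^sup>2"
proof -
  have "Ssum S a b p p K p = (\<Sum>s\<in>{0..K}. if s = 0 then Tsum S a b p p p 0 else 0)"
    unfolding Ssum_def by (intro sum.cong refl) (auto intro!: Tsum_eq_0)
  then show ?thesis by (simp add: Tsum_p_0)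
qed

lemma sum_split_ends:
  fixes f :: "nat \<Rightarrow> real"
  assumes "1 \<le> p" "p \<le> K" "\<And>r. r > p \<Longrightarrow> f r = 0"
  shows "(\<Sum>r=0..K. f r) = f 0 + (\<Sum>r=1..p-1. f r) + f p"
proof -
  have "(\<Sum>r=0..K. f r) = (\<Sum>r\<in>insert 0 (insert p {1..p-1}). f r)"
  proof (intro sum.mono_neutral_right)
    show "\<forall>i\<in>{0..K} - insert 0 (insert p {1..p - 1}). f i = 0"
    proof
      fix i assume "i \<in> {0..K} - insert 0 (insert p {1..p - 1})"
      then have "i > p" by (cases "i \<le> p") auto
      then show "f i = 0" by (rule assms)
    qed
  qed (use assms in auto)
  also have "\<dots> = f 0 + (\<Sum>r=1..p-1. f r) + f p" using assms(1) by (subst sum.insert) auto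
  finally show ?thesis .
qed

text \<open>Each summand equals \<open>(P choose s) * (Q choose (Q - s))\<close> divided by
  \<open>P! Q!\<close>, so Vandermonde's identity bounds the sum by \<open>(P + Q) choose Q\<close>
  over \<open>P! Q!\<close>.\<close>

lemma sum_inverse_facts:
  "(\<Sum>s=0..K. if s \<le> P \<and> s \<le> Q then 1 / ((fact s)\<^sup>2 * fact (P - s) * fact (Q - s)) else 0 :: real)
    \<le> fact (P + Q) / ((fact P)\<^sup>2 * (fact Q)\<^sup>2)"
proof -
  have e: "1 / ((fact s)\<^sup>2 * fact (P - s) * fact (Q - s)) = real (P choose s) * real (Q choose (Q - s)) / (fact P * fact Q)"
    if "s \<le> P" "s \<le> Q" for s
    using that by (simp add: binomial_fact power2_eq_square)
  have "(\<Sum>s=0..K. if s \<le> P \<and> s \<le> Q then 1 / ((fact s)\<^sup>2 * fact (P - s) * fact (Q - s)) else 0 :: real)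
    = (\<Sum>s\<in>{0..K} \<inter> {s. s \<le> P \<and> s \<le> Q}. real (P choose s) * real (Q choose (Q - s)) / (fact P * fact Q))"
    using e by (subst sum.inter_restrict) (auto intro!: sum.cong)
  also have "\<dots> \<le> (\<Sum>s\<le>Q. real (P choose s) * real (Q choose (Q - s)) / (fact P * fact Q))"
    by (intro sum_mono2) auto
  also have "\<dots> = real ((P + Q) choose Q) / (fact P * fact Q)"
    by (simp only: vandermonde[symmetric] of_nat_sum of_nat_mult sum_divide_distrib)
  also have "\<dots> = fact (P + Q) / ((fact P)\<^sup>2 * (fact Q)\<^sup>2)"
    by (simp add: binomial_fact power2_eq_square)
  finally show ?thesis .
qed

section \<open>Bounds by the fourth cumulant and by the variance\<close>

context parseval begin

text \<open>All numbers of cross edges are bounded by the same contraction norm, and Vandermonde's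
  identity adds up their weights. In effect symmetrisation does not increase the norm.\<close>

lemma Ssum_le_Csum:
  assumes "r \<le> p" "r \<le> q"
  shows "Ssum S a b p q K r \<le> Csum S a b p q r * fact (p + q - 2 * r) / ((fact r)\<^sup>2 * (fact (p - r))\<^sup>2 * (fact (q - r))\<^sup>2)"
proof -
  let ?P = "p - r" and ?Q = "q - r"
  have C: "Csum S a b p q r \<ge> 0" by (rule Csum_nonneg)
  have "Ssum S a b p q K r \<le> (\<Sum>s=0..K. Csum S a b p q r / (fact r)\<^sup>2 *
     (if s \<le> ?P \<and> s \<le> ?Q then 1 / ((fact s)\<^sup>2 * fact (?P - s) * fact (?Q - s)) else 0))"
    unfolding Ssum_def
  proof (intro sum_mono)
    fix s
    show "Tsum S a b p q r s \<le> Csum S a b p q r / (fact r)\<^sup>2 *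
     (if s \<le> ?P \<and> s \<le> ?Q then 1 / ((fact s)\<^sup>2 * fact (?P - s) * fact (?Q - s)) else 0)"
    proof (cases "s \<le> ?P \<and> s \<le> ?Q")
      case True
      then have "r + s \<le> p" "r + s \<le> q" using assms by auto
      then show ?thesis using True Tsum_le_Csum[of r s p q a b] by (simp add: mult.assoc)
    next
      case False
      then have "p < r + s \<or> q < r + s" by auto
      then show ?thesis using Tsum_eq_0[of p r s q S a b] False by auto
    qed
  qed
  also have "\<dots> \<le> Csum S a b p q r / (fact r)\<^sup>2 * (fact (?P + ?Q) / ((fact ?P)\<^sup>2 * (fact ?Q)\<^sup>2))"
    unfolding sum_distrib_left[symmetric] using C by (intro mult_left_mono sum_inverse_facts) auto
  also have "?P + ?Q = p + q - 2 * r" using assms by simp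
  finally show ?thesis by (simp add: mult.assoc)
qed

text \<open>Three diagrams give \<open>E[F\<^sup>2]\<^sup>2\<close>: within \<open>S\<^sub>0\<close>
  those with no cross edges and with \<open>p\<close> cross edges, and all of
  \<open>S\<^sub>p\<close>. They are exactly what the cumulant subtracts. The inner terms of
  \<open>S\<^sub>0\<close> are contraction norms after \<open>Tsum_swap\<close>, so only nonnegative
  terms remain.\<close>

lemma kappa_sum_eq:
  assumes "1 \<le> p" "p \<le> K"
  shows "kappa_sum S a p K = (\<Sum>r=1..p-1. Ssum S a a p p K r)
    + (\<Sum>r=1..p-1. Csum S a a p p r / ((fact r)\<^sup>2 * (fact (p - r))\<^sup>2))"
proof -
  have "Ssum S a a p p K 0 = Tsum S a a p p 0 0 + (\<Sum>s=1..p-1. Tsum S a a p p 0 s) + Tsum S a a p p 0 p"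
    unfolding Ssum_def using assms by (intro sum_split_ends Tsum_eq_0) auto
  also have "(\<Sum>s=1..p-1. Tsum S a a p p 0 s) = (\<Sum>r=1..p-1. Csum S a a p p r / ((fact r)\<^sup>2 * (fact (p - r))\<^sup>2))"
    by (intro sum.cong refl, subst Tsum_swap, subst Tsum_r_0) (auto simp: power2_eq_square mult_ac)
  also have "Tsum S a a p p 0 p = (Gsum S a a p)\<^sup>2" by (subst Tsum_swap) (rule Tsum_p_0)
  finally have S0: "Ssum S a a p p K 0 = 2 * (Gsum S a a p)\<^sup>2 + (\<Sum>r=1..p-1. Csum S a a p p r / ((fact r)\<^sup>2 * (fact (p - r))\<^sup>2))"
    by (simp add: Tsum_0_0 power2_eq_square)
  have "Qsum S a p K = Ssum S a a p p K 0 + (\<Sum>r=1..p-1. Ssum S a a p p K r) + Ssum S a a p p K p"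
    unfolding Qsum_def using assms by (intro sum_split_ends Ssum_eq_0) auto
  then show ?thesis unfolding kappa_sum_def S0 Ssum_p_p by simp
qed

lemma kappa_sum_nonneg: "1 \<le> p \<Longrightarrow> p \<le> K \<Longrightarrow> kappa_sum S a p K \<ge> 0"
  unfolding kappa_sum_eq by (intro add_nonneg_nonneg sum_nonneg Ssum_nonneg divide_nonneg_nonneg Csum_nonneg) auto

lemma Csum_le_kappa_sum:
  assumes "1 \<le> r" "r < p" "p \<le> K"
  shows "Csum S a a p p r \<le> (fact r)\<^sup>2 * (fact (p - r))\<^sup>2 * kappa_sum S a p K"
proof -
  have "Csum S a a p p r / ((fact r)\<^sup>2 * (fact (p - r))\<^sup>2) \<le> (\<Sum>r=1..p-1. Csum S a a p p r / ((fact r)\<^sup>2 * (fact (p - r))\<^sup>2))"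
    using assms by (intro member_le_sum[of r _ "\<lambda>r. Csum S a a p p r / ((fact r)\<^sup>2 * (fact (p - r))\<^sup>2)"] divide_nonneg_nonneg Csum_nonneg) auto
  also have "\<dots> \<le> kappa_sum S a p K"
    using assms by (subst kappa_sum_eq) (auto intro!: sum_nonneg Ssum_nonneg)
  finally show ?thesis by (simp add: field_simps)
qed

text \<open>Cauchy-Schwarz replaces the mixed contraction by the two self-contractions, each bounded
  by its cumulant with weight \<open>(r!)\<^sup>2 ((p - r)!)\<^sup>2\<close> and
  \<open>(r!)\<^sup>2 ((q - r)!)\<^sup>2\<close>. Square roots of these weights cancel against the
  symmetrisation constant and leave the binomial coefficient.\<close>

lemma Ssum_le_kappa_sum:
  assumes "1 \<le> r" "r < p" "r < q" "p \<le> K" "q \<le> K"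
  shows "Ssum S a b p q K r \<le> real ((p + q - 2 * r) choose (p - r)) * sqrt (kappa_sum S a p K * kappa_sum S b q K)"
proof -
  define F :: "nat \<Rightarrow> real" where "F n = fact n" for n
  have Fpos: "F n > 0" for n by (simp add: F_def)
  have k: "kappa_sum S a p K \<ge> 0" "kappa_sum S b q K \<ge> 0" using assms by (auto intro!: kappa_sum_nonneg)
  have "(Csum S a b p q r)\<^sup>2 \<le> ((F r)\<^sup>2 * (F (p - r))\<^sup>2 * kappa_sum S a p K) * ((F r)\<^sup>2 * (F (q - r))\<^sup>2 * kappa_sum S b q K)"
    unfolding F_def
    by (rule order.trans[OF Csum_Cauchy_Schwarz], intro mult_mono Csum_le_kappa_sum)
       (use assms k Csum_nonneg in auto)
  also have "\<dots> = ((F r)\<^sup>2 * F (p - r) * F (q - r) * sqrt (kappa_sum S a p K * kappa_sum S b q K))\<^sup>2"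
    using k by (simp add: power_mult_distrib real_sqrt_pow2 power2_eq_square algebra_simps)
  finally have C: "Csum S a b p q r \<le> (F r)\<^sup>2 * F (p - r) * F (q - r) * sqrt (kappa_sum S a p K * kappa_sum S b q K)"
    by (rule power2_le_imp_le) (use k Fpos in \<open>auto intro!: mult_nonneg_nonneg simp: less_imp_le\<close>)
  have b: "p + q - 2 * r - (p - r) = q - r" using assms by auto
  have "Ssum S a b p q K r \<le> Csum S a b p q r * (F (p + q - 2 * r) / ((F r)\<^sup>2 * (F (p - r))\<^sup>2 * (F (q - r))\<^sup>2))"
    using Ssum_le_Csum[of r p q a b K] assms unfolding F_def by simp
  also have "\<dots> \<le> (F r)\<^sup>2 * F (p - r) * F (q - r) * sqrt (kappa_sum S a p K * kappa_sum S b q K) * (F (p + q - 2 * r) / ((F r)\<^sup>2 * (F (p - r))\<^sup>2 * (F (q - r))\<^sup>2))"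
    using C Fpos by (intro mult_right_mono) (auto simp: less_imp_le)
  also have "\<dots> = F (p + q - 2 * r) / (F (p - r) * F (q - r)) * sqrt (kappa_sum S a p K * kappa_sum S b q K)"
    using Fpos[of r] Fpos[of "p - r"] Fpos[of "q - r"] by (simp add: power2_eq_square field_simps)
  also have "F (p + q - 2 * r) / (F (p - r) * F (q - r)) = real ((p + q - 2 * r) choose (p - r))"
    unfolding F_def using assms b by (subst binomial_fact) auto
  finally show ?thesis .
qed

lemma Gsum_power: "Gsum S a b p = (\<Sum>h\<in>S. \<Sum>g\<in>S. a h * b g * inner h g ^ p) / fact p"
  by (simp add: Gsum_def dpow_of_nat sum_divide_distrib)

lemma Csum_diag_le_Gsum: "r \<le> p \<Longrightarrow> Csum S a a p p r \<le> (fact p * Gsum S a a p)\<^sup>2"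
  using Csum_diag_le[of r p a] by (simp add: Gsum_power)

lemma Gsum_nonneg: "Gsum S a a p \<ge> 0"
proof -
  have "(\<Sum>h\<in>S. \<Sum>g\<in>S. a h * a g * inner h g ^ p) = (\<Sum>i\<in>basis_lists B p. (\<Sum>h\<in>S. a h * coord_prod i h) * (\<Sum>h\<in>S. a h * coord_prod i h))"
    by (rule sum_features) (simp add: coord_prod_sum)
  also have "\<dots> \<ge> 0" by (intro sum_nonneg) auto
  finally show ?thesis by (simp add: Gsum_power)
qed

text \<open>At \<open>r = p\<close> the self-contraction of \<open>f\<close> is complete and is
  controlled only by the variance, whereas \<open>p < q\<close> still makes the contraction of
  \<open>g\<close> a proper one. Hence one cumulant under a single square root, with constant 1
  because the factorials cancel.\<close>

lemma Ssum_top_le_kappa_sum: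
  assumes "1 \<le> p" "p < q" "q \<le> K"
  shows "Ssum S a b p q K p \<le> Gsum S a a p * sqrt (kappa_sum S b q K)"
proof -
  define F :: "nat \<Rightarrow> real" where "F n = fact n" for n
  have Fpos: "F n > 0" for n by (simp add: F_def)
  have k: "kappa_sum S b q K \<ge> 0" "Gsum S a a p \<ge> 0" using assms by (auto intro!: kappa_sum_nonneg Gsum_nonneg)
  have "(Csum S a b p q p)\<^sup>2 \<le> (F p * Gsum S a a p)\<^sup>2 * ((F p)\<^sup>2 * (F (q - p))\<^sup>2 * kappa_sum S b q K)"
    unfolding F_def
    by (rule order.trans[OF Csum_Cauchy_Schwarz], intro mult_mono Csum_le_kappa_sum Csum_diag_le_Gsum)
       (use assms k Csum_nonneg in auto)
  also have "\<dots> = ((F p)\<^sup>2 * F (q - p) * Gsum S a a p * sqrt (kappa_sum S b q K))\<^sup>2"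
    using k by (simp add: power_mult_distrib real_sqrt_pow2 power2_eq_square algebra_simps)
  finally have C: "Csum S a b p q p \<le> (F p)\<^sup>2 * F (q - p) * Gsum S a a p * sqrt (kappa_sum S b q K)"
    by (rule power2_le_imp_le) (use k Fpos in \<open>auto intro!: mult_nonneg_nonneg simp: less_imp_le\<close>)
  have b: "p + q - 2 * p = q - p" using assms by auto
  have "Ssum S a b p q K p \<le> Csum S a b p q p * (F (q - p) / ((F p)\<^sup>2 * (F (q - p))\<^sup>2))"
    using Ssum_le_Csum[of p p q a b K] assms unfolding F_def b by simp
  also have "\<dots> \<le> (F p)\<^sup>2 * F (q - p) * Gsum S a a p * sqrt (kappa_sum S b q K) * (F (q - p) / ((F p)\<^sup>2 * (F (q - p))\<^sup>2))"
    using C Fpos by (intro mult_right_mono) (auto simp: less_imp_le)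
  also have "\<dots> = Gsum S a a p * sqrt (kappa_sum S b q K)"
    using Fpos[of p] Fpos[of "q - p"] by (simp add: power2_eq_square field_simps)
  finally show ?thesis .
qed

end

definition hyper_const :: "nat \<Rightarrow> real" where
  "hyper_const p = (\<Sum>r=0..p. (fact p)\<^sup>2 * fact (p + p - 2 * r) / ((fact r)\<^sup>2 * (fact (p - r))\<^sup>2 * (fact (p - r))\<^sup>2))"

text \<open>Every self-contraction is at most the squared norm of the kernel, which is
  \<open>p!\<close> times \<open>Gsum\<close>; inserting this into each chaos component produces
  \<open>hyper_const\<close>. The constant depends on \<open>p\<close> alone, as the passage to the
  limit demands.\<close>

lemma (in parseval) Qsum_le:
  assumes "p \<le> K"
  shows "Qsum S a p K \<le> hyper_const p * (Gsum S a a p)\<^sup>2"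
proof -
  have "Qsum S a p K = (\<Sum>r=0..p. Ssum S a a p p K r)"
    unfolding Qsum_def using assms by (intro sum.mono_neutral_right) (auto intro: Ssum_eq_0)
  also have "\<dots> \<le> (\<Sum>r=0..p. (fact p * Gsum S a a p)\<^sup>2 * (fact (p + p - 2 * r) / ((fact r)\<^sup>2 * (fact (p - r))\<^sup>2 * (fact (p - r))\<^sup>2)))"
  proof (intro sum_mono)
    fix r assume "r \<in> {0..p}"
    then have "Ssum S a a p p K r \<le> Csum S a a p p r * (fact (p + p - 2 * r) / ((fact r)\<^sup>2 * (fact (p - r))\<^sup>2 * (fact (p - r))\<^sup>2))"
      using Ssum_le_Csum[of r p p a a K] by simp
    also have "\<dots> \<le> (fact p * Gsum S a a p)\<^sup>2 * (fact (p + p - 2 * r) / ((fact r)\<^sup>2 * (fact (p - r))\<^sup>2 * (fact (p - r))\<^sup>2))"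
      using \<open>r \<in> {0..p}\<close> by (intro mult_right_mono Csum_diag_le_Gsum) auto
    finally show "Ssum S a a p p K r \<le> (fact p * Gsum S a a p)\<^sup>2 * (fact (p + p - 2 * r) / ((fact r)\<^sup>2 * (fact (p - r))\<^sup>2 * (fact (p - r))\<^sup>2))" .
  qed
  also have "\<dots> = hyper_const p * (Gsum S a a p)\<^sup>2"
    unfolding hyper_const_def sum_distrib_right by (intro sum.cong refl) (simp add: power_mult_distrib)
  finally show ?thesis .
qed

section \<open>Fourier uniqueness and isonormal processes\<close>

text \<open>Levy's uniqueness theorem speaks of probability measures; a nonnegative weight of total
  mass \<open>c\<close> is brought into its scope by normalising and taking the image under
  \<open>Y\<close>.\<close>

lemma weighted_distr:
  fixes W :: "'a \<Rightarrow> real"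
  assumes W: "integrable M W" "\<And>\<omega>. W \<omega> \<ge> 0" "(\<integral>\<omega>. W \<omega> \<partial>M) = c" "c > 0"
    and Y[measurable]: "Y \<in> borel_measurable M"
  defines "\<mu> \<equiv> distr (density M (\<lambda>\<omega>. ennreal (W \<omega> / c))) borel Y"
  shows "real_distribution \<mu>"
    and "char \<mu> s = (\<integral>\<omega>. iexp (s * Y \<omega>) * complex_of_real (W \<omega>) \<partial>M) / c"
    and "B \<in> sets borel \<Longrightarrow> measure \<mu> B = (\<integral>\<omega>. W \<omega> * indicator B (Y \<omega>) \<partial>M) / c"
proof -
  have [measurable]: "W \<in> borel_measurable M" using W(1) by auto
  have "(\<integral>\<^sup>+\<omega>. ennreal (W \<omega> / c) \<partial>M) = ennreal (\<integral>\<omega>. W \<omega> / c \<partial>M)"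
    using W by (intro nn_integral_eq_integral) auto
  also have "\<dots> = 1" using W by simp
  finally have 1: "(\<integral>\<^sup>+\<omega>. ennreal (W \<omega> / c) \<partial>M) = 1" .
  have "prob_space (density M (\<lambda>\<omega>. ennreal (W \<omega> / c)))"
    by (intro prob_spaceI) (simp add: emeasure_density 1)
  then have ps: "prob_space \<mu>" unfolding \<mu>_def by (rule prob_space.prob_space_distr) simp
  show "real_distribution \<mu>"
    using ps by (simp add: real_distribution_def real_distribution_axioms_def \<mu>_def)
  have "char \<mu> s = (\<integral>\<omega>. (W \<omega> / c) *\<^sub>R iexp (s * Y \<omega>) \<partial>M)"
    unfolding char_def \<mu>_def using W by (subst integral_distr) (auto simp: integral_density)
  also have "\<dots> = (\<integral>\<omega>. (iexp (s * Y \<omega>) * complex_of_real (W \<omega>)) / c \<partial>M)"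
    by (simp add: scaleR_conv_of_real algebra_simps)
  finally show "char \<mu> s = (\<integral>\<omega>. iexp (s * Y \<omega>) * complex_of_real (W \<omega>) \<partial>M) / c"
    by simp
  show "measure \<mu> B = (\<integral>\<omega>. W \<omega> * indicator B (Y \<omega>) \<partial>M) / c" if [measurable]: "B \<in> sets borel"
  proof -
    interpret \<mu>: prob_space \<mu> by fact
    have "measure \<mu> B = (\<integral>x. indicator B x \<partial>\<mu>)"
      using that by (simp add: \<mu>_def)
    also have "\<dots> = (\<integral>\<omega>. (W \<omega> / c) * indicator B (Y \<omega>) \<partial>M)"
      unfolding \<mu>_def using W by (subst integral_distr) (auto simp: integral_density)
    also have "\<dots> = (\<integral>\<omega>. W \<omega> * indicator B (Y \<omega>) / c \<partial>M)" by (simp add: algebra_simps)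
    finally show ?thesis by simp
  qed
qed

text \<open>The positive and negative parts of \<open>Z\<close> have equal Fourier transforms
  against \<open>Y\<close>. At \<open>s = 0\<close> this says that they have the same mass
  \<open>c\<close>, so a common normalisation makes both into probability laws with the same
  characteristic function; for \<open>c = 0\<close> both parts vanish almost everywhere.\<close>

lemma fourier_unique_real:
  fixes Z :: "'a \<Rightarrow> real"
  assumes Z: "integrable M Z" and Y[measurable]: "Y \<in> borel_measurable M"
    and 0: "\<And>s. (\<integral>\<omega>. iexp (s * Y \<omega>) * complex_of_real (Z \<omega>) \<partial>M) = 0"
    and B[measurable]: "B \<in> sets borel"
  shows "(\<integral>\<omega>. Z \<omega> * indicator B (Y \<omega>) \<partial>M) = 0"
proof -
  define Zp Zm where "Zp \<omega> = max 0 (Z \<omega>)" and "Zm \<omega> = max 0 (- Z \<omega>)" for \<omega>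
  have Zpm: "Z \<omega> = Zp \<omega> - Zm \<omega>" for \<omega> by (simp add: Zp_def Zm_def)
  have int: "integrable M Zp" "integrable M Zm"
    unfolding Zp_def[abs_def] Zm_def[abs_def] using Z by (intro integrable_max; simp)+
  have nn: "Zp \<omega> \<ge> 0" "Zm \<omega> \<ge> 0" for \<omega> by (auto simp: Zp_def Zm_def)
  have mult_int: "integrable M (\<lambda>\<omega>. iexp (s * Y \<omega>) * complex_of_real (W \<omega>))" if "integrable M W" for W s
    using that by (intro Bochner_Integration.integrable_bound[OF that]) (auto simp: norm_mult)
  have ind_int: "integrable M (\<lambda>\<omega>. W \<omega> * indicator B (Y \<omega>))" if "integrable M W" for W :: "'a \<Rightarrow> real"
    using that by (intro Bochner_Integration.integrable_bound[OF that]) (auto simp: indicator_def)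
  have eq: "(\<integral>\<omega>. iexp (s * Y \<omega>) * complex_of_real (Zp \<omega>) \<partial>M) = (\<integral>\<omega>. iexp (s * Y \<omega>) * complex_of_real (Zm \<omega>) \<partial>M)" for s
  proof -
    have "(\<integral>\<omega>. iexp (s * Y \<omega>) * complex_of_real (Zp \<omega>) \<partial>M) - (\<integral>\<omega>. iexp (s * Y \<omega>) * complex_of_real (Zm \<omega>) \<partial>M)
      = (\<integral>\<omega>. iexp (s * Y \<omega>) * complex_of_real (Zp \<omega>) - iexp (s * Y \<omega>) * complex_of_real (Zm \<omega>) \<partial>M)"
      by (intro Bochner_Integration.integral_diff[symmetric] mult_int int)
    also have "\<dots> = 0" using 0[of s] unfolding Zpm of_real_diff right_diff_distrib .
    finally show ?thesis by simp
  qed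
  define c where "c = (\<integral>\<omega>. Zp \<omega> \<partial>M)"
  have c: "(\<integral>\<omega>. Zm \<omega> \<partial>M) = c" using eq[of 0] by (simp add: c_def)
  have "c \<ge> 0" unfolding c_def by (intro integral_nonneg_AE) (auto simp: nn)
  have "(\<integral>\<omega>. Zp \<omega> * indicator B (Y \<omega>) \<partial>M) = (\<integral>\<omega>. Zm \<omega> * indicator B (Y \<omega>) \<partial>M)"
  proof (cases "c = 0")
    case True
    have "AE \<omega> in M. Zp \<omega> = 0" using integral_nonneg_eq_0_iff_AE[OF int(1)] nn True c_def by auto
    then have "(\<integral>\<omega>. Zp \<omega> * indicator B (Y \<omega>) \<partial>M) = 0" by (intro integral_eq_zero_AE) auto
    moreover have "AE \<omega> in M. Zm \<omega> = 0" using integral_nonneg_eq_0_iff_AE[OF int(2)] nn True c by auto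
    then have "(\<integral>\<omega>. Zm \<omega> * indicator B (Y \<omega>) \<partial>M) = 0" by (intro integral_eq_zero_AE) auto
    ultimately show ?thesis by simp
  next
    case False
    with \<open>c \<ge> 0\<close> have "c > 0" by simp
    note p = weighted_distr[OF int(1) nn(1) c_def[symmetric] \<open>c > 0\<close> Y]
    note m = weighted_distr[OF int(2) nn(2) c \<open>c > 0\<close> Y]
    have "distr (density M (\<lambda>\<omega>. ennreal (Zp \<omega> / c))) borel Y = distr (density M (\<lambda>\<omega>. ennreal (Zm \<omega> / c))) borel Y"
      by (intro Levy_uniqueness p m ext) (simp only: p m eq)
    then show ?thesis using p(3)[OF B] m(3)[OF B] \<open>c > 0\<close> by simp
  qed
  then show ?thesis unfolding Zpm using int by (simp add: left_diff_distrib ind_int)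
qed

text \<open>Conjugating the hypothesis at \<open>- s\<close> shows that the conjugate of
  \<open>Z\<close> satisfies it too, hence so do the real and imaginary parts.\<close>

lemma fourier_unique:
  fixes Z :: "'a \<Rightarrow> complex"
  assumes Z: "integrable M Z" and Y[measurable]: "Y \<in> borel_measurable M"
    and 0: "\<And>s. (\<integral>\<omega>. iexp (s * Y \<omega>) * Z \<omega> \<partial>M) = 0"
    and B[measurable]: "B \<in> sets borel"
  shows "(\<integral>\<omega>. Z \<omega> * indicator B (Y \<omega>) \<partial>M) = 0"
proof -
  have [measurable]: "Z \<in> borel_measurable M" using Z by auto
  have int: "integrable M (\<lambda>\<omega>. iexp (s * Y \<omega>) * W \<omega>)" if "integrable M W" for W :: "'a \<Rightarrow> complex" and s
    using that by (intro Bochner_Integration.integrable_bound[OF that]) (auto simp: norm_mult)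
  have intc: "integrable M (\<lambda>\<omega>. cnj (Z \<omega>))" using Z by simp
  have c0: "(\<integral>\<omega>. iexp (s * Y \<omega>) * cnj (Z \<omega>) \<partial>M) = 0" for s
  proof -
    have "(\<integral>\<omega>. iexp (s * Y \<omega>) * cnj (Z \<omega>) \<partial>M) = (\<integral>\<omega>. cnj (iexp ((-s) * Y \<omega>) * Z \<omega>) \<partial>M)"
      by (intro Bochner_Integration.integral_cong refl) (simp add: exp_cnj)
    also have "\<dots> = cnj (\<integral>\<omega>. iexp ((-s) * Y \<omega>) * Z \<omega> \<partial>M)" by (rule Bochner_Integration.integral_cnj)
    also have "\<dots> = 0" by (simp only: 0 complex_cnj_zero)
    finally show ?thesis .
  qed
  have re: "(\<integral>\<omega>. Re (Z \<omega>) * indicator B (Y \<omega>) \<partial>M) = 0"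
  proof (rule fourier_unique_real[OF _ Y _ B])
    show "integrable M (\<lambda>\<omega>. Re (Z \<omega>))" using Z by simp
    fix s
    have "iexp (s * Y \<omega>) * complex_of_real (Re (Z \<omega>)) = (iexp (s * Y \<omega>) * Z \<omega> + iexp (s * Y \<omega>) * cnj (Z \<omega>)) / 2" for \<omega>
      by (simp add: complex_add_cnj flip: distrib_left)
    then have "(\<integral>\<omega>. iexp (s * Y \<omega>) * complex_of_real (Re (Z \<omega>)) \<partial>M)
      = (\<integral>\<omega>. (iexp (s * Y \<omega>) * Z \<omega> + iexp (s * Y \<omega>) * cnj (Z \<omega>)) / 2 \<partial>M)" by (simp only:)
    also have "\<dots> = 0"
      by (simp only: integral_divide_zero Bochner_Integration.integral_add[OF int[OF Z] int[OF intc]] 0 c0) simp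
    finally show "(\<integral>\<omega>. iexp (s * Y \<omega>) * complex_of_real (Re (Z \<omega>)) \<partial>M) = 0" .
  qed
  have im: "(\<integral>\<omega>. Im (Z \<omega>) * indicator B (Y \<omega>) \<partial>M) = 0"
  proof (rule fourier_unique_real[OF _ Y _ B])
    show "integrable M (\<lambda>\<omega>. Im (Z \<omega>))" using Z by simp
    fix s
    have "iexp (s * Y \<omega>) * complex_of_real (Im (Z \<omega>)) = (iexp (s * Y \<omega>) * Z \<omega> - iexp (s * Y \<omega>) * cnj (Z \<omega>)) / (2 * \<i>)" for \<omega>
    proof -
      have "complex_of_real (Im z) = (z - cnj z) / (2 * \<i>)" for z
        by (subst nonzero_eq_divide_eq) (simp_all add: complex_eq_iff)
      then have "iexp (s * Y \<omega>) * complex_of_real (Im (Z \<omega>)) = iexp (s * Y \<omega>) * ((Z \<omega> - cnj (Z \<omega>)) / (2 * \<i>))" by (simp only:)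
      then show ?thesis by (simp only: times_divide_eq_right right_diff_distrib)
    qed
    then have "(\<integral>\<omega>. iexp (s * Y \<omega>) * complex_of_real (Im (Z \<omega>)) \<partial>M)
      = (\<integral>\<omega>. (iexp (s * Y \<omega>) * Z \<omega> - iexp (s * Y \<omega>) * cnj (Z \<omega>)) / (2 * \<i>) \<partial>M)" by (simp only:)
    also have "\<dots> = 0"
      by (simp only: integral_divide_zero Bochner_Integration.integral_diff[OF int[OF Z] int[OF intc]] 0 c0) simp
    finally show "(\<integral>\<omega>. iexp (s * Y \<omega>) * complex_of_real (Im (Z \<omega>)) \<partial>M) = 0" .
  qed
  have intZ: "integrable M (\<lambda>\<omega>. Z \<omega> * indicator B (Y \<omega>))"
    by (intro Bochner_Integration.integrable_bound[OF Z]) (auto simp: indicator_def)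
  show ?thesis
  proof (rule complex_eqI)
    have "Re (\<integral>\<omega>. Z \<omega> * indicator B (Y \<omega>) \<partial>M) = (\<integral>\<omega>. Re (Z \<omega> * indicator B (Y \<omega>)) \<partial>M)" by (rule integral_Re[OF intZ, symmetric])
    also have "\<dots> = (\<integral>\<omega>. Re (Z \<omega>) * indicator B (Y \<omega>) \<partial>M)"
      by (intro Bochner_Integration.integral_cong refl) (simp add: indicator_def)
    finally show "Re (\<integral>\<omega>. Z \<omega> * indicator B (Y \<omega>) \<partial>M) = Re 0" by (simp add: re)
    have "Im (\<integral>\<omega>. Z \<omega> * indicator B (Y \<omega>) \<partial>M) = (\<integral>\<omega>. Im (Z \<omega> * indicator B (Y \<omega>)) \<partial>M)" by (rule integral_Im[OF intZ, symmetric])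
    also have "\<dots> = (\<integral>\<omega>. Im (Z \<omega>) * indicator B (Y \<omega>) \<partial>M)"
      by (intro Bochner_Integration.integral_cong refl) (simp add: indicator_def)
    finally show "Im (\<integral>\<omega>. Z \<omega> * indicator B (Y \<omega>) \<partial>M) = Im 0" by (simp add: im)
  qed
qed

section \<open>One-dimensional laws and linearity of an isonormal process\<close>

locale isonormal_process = prob_space M for M :: "'a measure" +
  fixes X :: "'h::{real_inner, complete_space, second_countable_topology} \<Rightarrow> 'a \<Rightarrow> real"
  assumes iso: "isonormal M X"
begin

lemma X_measurable [measurable]: "X h \<in> borel_measurable M"
  using iso by (simp add: isonormal_def)

abbreviation path :: "'a \<Rightarrow> 'h \<Rightarrow> real" where
  "path \<omega> \<equiv> (\<lambda>h. X h \<omega>)"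

lemma X_cov: "expectation (\<lambda>\<omega>. X h \<omega> * X g \<omega>) = inner h g"
  using iso by (simp add: isonormal_def)

lemma X_law_aux:
  obtains v where "v \<ge> 0" "distr M borel (X h) = distr std_normal_distribution borel (\<lambda>x. sqrt v * x)"
proof -
  have "length [1::real] = length [h]" by simp
  then obtain v where v: "v \<ge> 0" "\<And>t. char (distr M borel (\<lambda>\<omega>. \<Sum>k<length [h]. [1] ! k * X ([h] ! k) \<omega>)) t
                    = complex_of_real (exp (- (t\<^sup>2 * v) / 2))"
    using iso unfolding isonormal_def gaussian_family_def by blast
  have "(\<lambda>\<omega>. \<Sum>k<length [h]. [1] ! k * X ([h] ! k) \<omega>) = X h" by auto
  with v have c: "char (distr M borel (X h)) t = complex_of_real (exp (- (t\<^sup>2 * v) / 2))" for t by simp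
  interpret N: real_distribution std_normal_distribution by (rule real_dist_normal_dist)
  have "distr M borel (X h) = distr std_normal_distribution borel (\<lambda>x. sqrt v * x)"
  proof (rule Levy_uniqueness)
    show "real_distribution (distr M borel (X h))" by simp
    show "real_distribution (distr std_normal_distribution borel (\<lambda>x. sqrt v * x))"
      by (intro N.real_distribution_distr) auto
    have "char (distr std_normal_distribution borel (\<lambda>x. sqrt v * x)) t = char std_normal_distribution (t * sqrt v)" for t
      unfolding char_def by (subst integral_distr) (auto simp: algebra_simps)
    then have "char (distr std_normal_distribution borel (\<lambda>x. sqrt v * x)) t = complex_of_real (exp (- (t\<^sup>2 * v) / 2))" for t
      using v(1) by (simp add: char_std_normal_distribution power_mult_distrib)
    then show "char (distr M borel (X h)) = char (distr std_normal_distribution borel (\<lambda>x. sqrt v * x))"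
      using c by auto
  qed
  with v(1) show ?thesis by (rule that)
qed

lemma integrable_X_power: "integrable M (\<lambda>\<omega>. X h \<omega> ^ n)"
proof -
  obtain v where v: "v \<ge> 0" "distr M borel (X h) = distr std_normal_distribution borel (\<lambda>x. sqrt v * x)"
    by (rule X_law_aux)
  have "integrable std_normal_distribution (\<lambda>x. (sqrt v * x) ^ n)"
    unfolding power_mult_distrib by (intro integrable_mult_right integrable_std_normal_distribution_moment)
  then have "integrable (distr std_normal_distribution borel (\<lambda>x. sqrt v * x)) (\<lambda>x. x ^ n)"
    by (subst integrable_distr_eq) auto
  then have "integrable (distr M borel (X h)) (\<lambda>x. x ^ n)" unfolding v .
  then show ?thesis by (subst (asm) integrable_distr_eq) auto
qed

lemma X_law: "distr M borel (X h) = distr std_normal_distribution borel (\<lambda>x. norm h * x)"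
proof -
  obtain v where v: "v \<ge> 0" "distr M borel (X h) = distr std_normal_distribution borel (\<lambda>x. sqrt v * x)"
    by (rule X_law_aux)
  have "(norm h)\<^sup>2 = expectation (\<lambda>\<omega>. (X h \<omega>)\<^sup>2)"
    using X_cov[of h h] by (simp add: power2_eq_square power2_norm_eq_inner[symmetric])
  also have "\<dots> = (\<integral>x. x\<^sup>2 \<partial>distr M borel (X h))" by (subst integral_distr) auto
  also have "\<dots> = (\<integral>x. (sqrt v * x)\<^sup>2 \<partial>std_normal_distribution)" unfolding v by (subst integral_distr) auto
  also have "\<dots> = v" using v(1) std_normal_distribution_even_moments(1)[of 1]
    by (simp add: power_mult_distrib fact_numeral)
  finally have "sqrt v = norm h" by (metis norm_ge_zero real_sqrt_abs abs_of_nonneg)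
  then show ?thesis using v by simp
qed

lemma X_char: "(\<integral>\<omega>. iexp (t * X h \<omega>) \<partial>M) = complex_of_real (exp (- ((t * norm h)\<^sup>2) / 2))"
proof -
  have "(\<integral>\<omega>. iexp (t * X h \<omega>) \<partial>M) = (\<integral>x. iexp (t * x) \<partial>distr M borel (X h))"
    by (subst integral_distr) auto
  also have "\<dots> = (\<integral>x. iexp ((t * norm h) * x) \<partial>std_normal_distribution)"
    unfolding X_law by (subst integral_distr) (auto simp: mult.assoc)
  also have "\<dots> = char std_normal_distribution (t * norm h)" by (simp add: char_def)
  finally show ?thesis by (simp add: char_std_normal_distribution)
qed

lemma integrable_X_mult: "integrable M (\<lambda>\<omega>. X h \<omega> * X g \<omega>)"
proof (rule Bochner_Integration.integrable_bound)
  show "integrable M (\<lambda>\<omega>. X h \<omega> ^ 2 + X g \<omega> ^ 2)" by (intro Bochner_Integration.integrable_add integrable_X_power)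
  have "\<bar>x * y\<bar> \<le> x\<^sup>2 + y\<^sup>2" for x y :: real
    using sum_squares_bound[of x y] sum_squares_bound[of x "-y"] by (simp add: abs_le_iff)
  then show "AE \<omega> in M. norm (X h \<omega> * X g \<omega>) \<le> norm (X h \<omega> ^ 2 + X g \<omega> ^ 2)" by auto
qed simp

text \<open>Expanding the square by means of the covariances gives mean zero for the squared defect.
  Linearity is thus available only almost surely, with a null set that depends on the
  combination.\<close>

lemma X_linear:
  assumes "finite I"
  shows "AE \<omega> in M. X (\<Sum>i\<in>I. c i *\<^sub>R h i) \<omega> = (\<Sum>i\<in>I. c i * X (h i) \<omega>)"
proof -
  define u where "u = (\<Sum>i\<in>I. c i *\<^sub>R h i)"
  define D where "D \<omega> = X u \<omega> - (\<Sum>i\<in>I. c i * X (h i) \<omega>)" for \<omega>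
  have D2: "(D \<omega>)\<^sup>2 = X u \<omega> * X u \<omega> - 2 * (\<Sum>i\<in>I. c i * (X u \<omega> * X (h i) \<omega>))
      + (\<Sum>i\<in>I. \<Sum>j\<in>I. c i * c j * (X (h i) \<omega> * X (h j) \<omega>))" for \<omega>
  proof -
    have "(\<Sum>i\<in>I. c i * X (h i) \<omega>) * (\<Sum>i\<in>I. c i * X (h i) \<omega>) = (\<Sum>i\<in>I. \<Sum>j\<in>I. c i * c j * (X (h i) \<omega> * X (h j) \<omega>))"
      unfolding sum_product by (intro sum.cong refl) (simp add: algebra_simps)
    moreover have "X u \<omega> * (\<Sum>i\<in>I. c i * X (h i) \<omega>) = (\<Sum>i\<in>I. c i * (X u \<omega> * X (h i) \<omega>))"
      unfolding sum_distrib_left by (intro sum.cong refl) (simp add: algebra_simps)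
    ultimately show ?thesis unfolding D_def power2_eq_square by (simp add: algebra_simps)
  qed
  have int: "integrable M (\<lambda>\<omega>. (D \<omega>)\<^sup>2)"
    unfolding D2 by (intro Bochner_Integration.integrable_add Bochner_Integration.integrable_diff integrable_mult_right Bochner_Integration.integrable_sum integrable_X_mult)
  have "(\<integral>\<omega>. (D \<omega>)\<^sup>2 \<partial>M) = inner u u - 2 * (\<Sum>i\<in>I. c i * inner u (h i)) + (\<Sum>i\<in>I. \<Sum>j\<in>I. c i * c j * inner (h i) (h j))"
    unfolding D2
    by (subst Bochner_Integration.integral_add Bochner_Integration.integral_diff Bochner_Integration.integral_sum
      | intro Bochner_Integration.integrable_add Bochner_Integration.integrable_diff integrable_mult_right Bochner_Integration.integrable_sum integrable_X_mult
      | simp add: integrable_X_mult X_cov Bochner_Integration.integral_sum)+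
  also have "(\<Sum>i\<in>I. c i * inner u (h i)) = inner u u"
    by (subst (3) u_def) (simp add: inner_sum_right)
  also have "(\<Sum>i\<in>I. \<Sum>j\<in>I. c i * c j * inner (h i) (h j)) = inner u u"
    unfolding u_def inner_sum_left inner_sum_right inner_scaleR_left inner_scaleR_right
    by (intro sum.cong refl) (simp add: sum_distrib_left mult.assoc inner_commute[of "h _" "h _"])
  finally have "(\<integral>\<omega>. (D \<omega>)\<^sup>2 \<partial>M) = 0" by simp
  then have "AE \<omega> in M. (D \<omega>)\<^sup>2 = 0" using integral_nonneg_eq_0_iff_AE[OF int] by auto
  then show ?thesis unfolding D_def u_def by auto
qed

end

definition orthonormal :: "nat \<Rightarrow> (nat \<Rightarrow> 'h::real_inner) \<Rightarrow> bool" where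
  "orthonormal n e \<longleftrightarrow> (\<forall>i<n. \<forall>j<n. inner (e i) (e j) = (if i = j then 1 else 0))"

lemma orthonormalD: "orthonormal n e \<Longrightarrow> i < n \<Longrightarrow> j < n \<Longrightarrow> inner (e i) (e j) = (if i = j then 1 else 0)"
  by (simp add: orthonormal_def)

lemma orthonormal_inj_on:
  assumes on: "orthonormal n e"
  shows "inj_on e {..<n}"
proof (rule inj_onI)
  fix i j assume "i \<in> {..<n}" "j \<in> {..<n}" "e i = e j"
  then show "i = j" using orthonormalD[OF on, of i j] orthonormalD[OF on, of i i] by (auto split: if_splits)
qed

context isonormal_process begin

lemma X_zero: "AE \<omega> in M. X 0 \<omega> = 0"
  using X_linear[of "{}" "\<lambda>_. 0" "\<lambda>_. 0"] by simp

lemma X_add_scaled: "AE \<omega> in M. X (u + s *\<^sub>R h) \<omega> = X u \<omega> + s * X h \<omega>"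
  using X_linear[of "{False, True}" "\<lambda>b. if b then s else 1" "\<lambda>b. if b then h else u"] by simp

section \<open>Totality of the exponentials\<close>

definition cyl_ind :: "('h \<times> real set) list \<Rightarrow> 'a \<Rightarrow> real" where
  "cyl_ind hs \<omega> = prod_list (map (\<lambda>(h, B). indicator B (X h \<omega>)) hs)"

lemma cyl_ind_measurable:
  assumes "\<forall>x\<in>set hs. snd x \<in> sets borel"
  shows "cyl_ind hs \<in> borel_measurable M"
  using assms
proof (induction hs)
  case Nil then show ?case by (simp add: cyl_ind_def[abs_def])
next
  case (Cons hB hs)
  then have [measurable]: "cyl_ind hs \<in> borel_measurable M" "snd hB \<in> sets borel" by auto
  have "cyl_ind (hB # hs) = (\<lambda>\<omega>. indicator (snd hB) (X (fst hB) \<omega>) * cyl_ind hs \<omega>)"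
    by (auto simp: cyl_ind_def case_prod_unfold)
  then show ?case by simp
qed

lemma cyl_ind_bound: "\<bar>cyl_ind hs \<omega>\<bar> \<le> 1"
  by (induction hs) (auto simp: cyl_ind_def indicator_def)

lemma cyl_ind_eq_indicator:
  "cyl_ind hs \<omega> = indicator {\<omega>. \<forall>x\<in>set hs. X (fst x) \<omega> \<in> snd x} \<omega>"
  by (induction hs) (auto simp: cyl_ind_def indicator_def)

text \<open>A further exponential in \<open>X h\<close> merges with \<open>iexp (X u)\<close> into
  one with index \<open>u + s h\<close>, so Fourier uniqueness turns it into an indicator of
  \<open>X h\<close>. The induction must therefore keep \<open>u\<close> arbitrary.\<close>

lemma cyl_vanish:
  assumes Z: "integrable M Z" and 0: "\<And>h. (\<integral>\<omega>. iexp (X h \<omega>) * complex_of_real (Z \<omega>) \<partial>M) = 0"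
    and hs: "\<forall>x\<in>set hs. snd x \<in> sets borel"
  shows "(\<integral>\<omega>. iexp (X u \<omega>) * complex_of_real (Z \<omega> * cyl_ind hs \<omega>) \<partial>M) = 0"
  using hs
proof (induction hs arbitrary: u)
  case Nil
  then show ?case using 0 by (simp add: cyl_ind_def)
next
  case (Cons hB hs)
  obtain h B where hB: "hB = (h, B)" by (cases hB)
  have B: "B \<in> sets borel" and hs: "\<forall>x\<in>set hs. snd x \<in> sets borel" using Cons.prems hB by auto
  note [measurable] = cyl_ind_measurable[OF hs]
  have [measurable]: "Z \<in> borel_measurable M" using Z by auto
  have int: "integrable M (\<lambda>\<omega>. iexp (X u \<omega>) * complex_of_real (Z \<omega> * cyl_ind hs \<omega>))"
    by (intro Bochner_Integration.integrable_bound[OF Z])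
       (auto simp: norm_mult abs_mult intro!: mult_right_le_one_le cyl_ind_bound)
  have "(\<integral>\<omega>. (iexp (X u \<omega>) * complex_of_real (Z \<omega> * cyl_ind hs \<omega>)) * indicator B (X h \<omega>) \<partial>M) = 0"
  proof (rule fourier_unique[OF int X_measurable _ B])
    fix s
    have "(\<integral>\<omega>. iexp (s * X h \<omega>) * (iexp (X u \<omega>) * complex_of_real (Z \<omega> * cyl_ind hs \<omega>)) \<partial>M)
      = (\<integral>\<omega>. iexp (X (u + s *\<^sub>R h) \<omega>) * complex_of_real (Z \<omega> * cyl_ind hs \<omega>) \<partial>M)"
      using X_add_scaled[of u s h]
      by (intro integral_cong_AE) (auto simp: algebra_simps exp_add)
    then show "(\<integral>\<omega>. iexp (s * X h \<omega>) * (iexp (X u \<omega>) * complex_of_real (Z \<omega> * cyl_ind hs \<omega>)) \<partial>M) = 0"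
      using Cons.IH[OF hs] by simp
  qed
  moreover have "(iexp (X u \<omega>) * complex_of_real (Z \<omega> * cyl_ind hs \<omega>)) * indicator B (X h \<omega>)
    = iexp (X u \<omega>) * complex_of_real (Z \<omega> * cyl_ind (hB # hs) \<omega>)" for \<omega>
    by (auto simp: cyl_ind_def hB indicator_def)
  ultimately show ?case by (simp only:)
qed

text \<open>The generators in \<open>isonormal\<close> constrain one coordinate each and need not be
  stable under intersection; finite lists of constraints form a pi-system with the same
  sigma-algebra.\<close>

definition cyl_sets :: "'a set set" where
  "cyl_sets = {{\<omega>\<in>space M. \<forall>x\<in>set hs. X (fst x) \<omega> \<in> snd x} | hs. \<forall>x\<in>set hs. snd x \<in> sets borel}"

lemma sets_eq_cyl: "sets M = sigma_sets (space M) cyl_sets"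
proof -
  let ?G = "{X h -` B \<inter> space M | h B. B \<in> sets borel}"
  have sM: "sets M = sigma_sets (space M) ?G" using iso unfolding isonormal_def by blast
  have "?G \<subseteq> cyl_sets"
  proof safe
    fix h and B :: "real set" assume "B \<in> sets borel"
    then show "X h -` B \<inter> space M \<in> cyl_sets"
      unfolding cyl_sets_def by (intro CollectI exI[of _ "[(h, B)]"]) auto
  qed
  moreover have "cyl_sets \<subseteq> sets M"
    unfolding cyl_sets_def
  proof safe
    fix hs :: "('h \<times> real set) list" assume hs: "\<forall>x\<in>set hs. snd x \<in> sets borel"
    have "{\<omega>\<in>space M. \<forall>x\<in>set hs. X (fst x) \<omega> \<in> snd x} = {\<omega>\<in>space M. cyl_ind hs \<omega> = 1}"
      by (auto simp: cyl_ind_eq_indicator indicator_def)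
    also have "\<dots> \<in> sets M" using cyl_ind_measurable[OF hs] by measurable
    finally show "{\<omega>\<in>space M. \<forall>x\<in>set hs. X (fst x) \<omega> \<in> snd x} \<in> sets M" .
  qed
  ultimately show ?thesis using sM
    by (metis (no_types, lifting) sets.sigma_sets_subset sigma_sets_mono' subset_antisym)
qed

lemma Int_stable_cyl: "Int_stable cyl_sets"
  unfolding Int_stable_def
proof safe
  fix A C assume "A \<in> cyl_sets" "C \<in> cyl_sets"
  then obtain hs gs where "A = {\<omega>\<in>space M. \<forall>x\<in>set hs. X (fst x) \<omega> \<in> snd x}" "\<forall>x\<in>set hs. snd x \<in> sets borel"
    "C = {\<omega>\<in>space M. \<forall>x\<in>set gs. X (fst x) \<omega> \<in> snd x}" "\<forall>x\<in>set gs. snd x \<in> sets borel"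
    unfolding cyl_sets_def by blast
  then show "A \<inter> C \<in> cyl_sets"
    unfolding cyl_sets_def by (intro CollectI exI[of _ "hs @ gs"]) auto
qed

lemma integrable_times_indicator:
  fixes Z :: "'a \<Rightarrow> real"
  assumes "integrable M Z" "A \<in> sets M"
  shows "integrable M (\<lambda>\<omega>. Z \<omega> * indicator A \<omega>)"
  using integrable_real_mult_indicator[OF assms(2,1)] by (simp add: mult.commute)

text \<open>At \<open>u = 0\<close> the previous vanishing says that \<open>Z\<close> integrates to
  zero over the pi-system of cylinder sets. Dynkin's lemma extends this to all of
  \<open>sets M\<close>, and the sets where \<open>Z\<close> is positive or negative then give the
  claim. It is here that the generation of the sigma-algebra by \<open>X\<close> enters.\<close>

theorem exponentials_total:
  assumes Z: "integrable M Z" and 0: "\<And>h. (\<integral>\<omega>. iexp (X h \<omega>) * complex_of_real (Z \<omega>) \<partial>M) = 0"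
  shows "AE \<omega> in M. Z \<omega> = 0"
proof -
  have [measurable]: "Z \<in> borel_measurable M" using Z by auto
  have gen: "(\<integral>\<omega>. Z \<omega> * indicator A \<omega> \<partial>M) = 0" if "A \<in> cyl_sets" for A
  proof -
    obtain hs where A: "A = {\<omega>\<in>space M. \<forall>x\<in>set hs. X (fst x) \<omega> \<in> snd x}" and hs: "\<forall>x\<in>set hs. snd x \<in> sets borel"
      using \<open>A \<in> cyl_sets\<close> unfolding cyl_sets_def by blast
    note [measurable] = cyl_ind_measurable[OF hs]
    have "0 = (\<integral>\<omega>. iexp (X 0 \<omega>) * complex_of_real (Z \<omega> * cyl_ind hs \<omega>) \<partial>M)"
      using cyl_vanish[OF Z 0 hs] by simp
    also have "\<dots> = (\<integral>\<omega>. complex_of_real (Z \<omega> * cyl_ind hs \<omega>) \<partial>M)"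
      using X_zero by (intro integral_cong_AE) auto
    also have "\<dots> = complex_of_real (\<integral>\<omega>. Z \<omega> * cyl_ind hs \<omega> \<partial>M)" by (rule integral_complex_of_real)
    finally have "(\<integral>\<omega>. Z \<omega> * cyl_ind hs \<omega> \<partial>M) = 0" by simp
    moreover have "(\<integral>\<omega>. Z \<omega> * cyl_ind hs \<omega> \<partial>M) = (\<integral>\<omega>. Z \<omega> * indicator A \<omega> \<partial>M)"
      by (intro Bochner_Integration.integral_cong refl) (auto simp: cyl_ind_eq_indicator A indicator_def)
    ultimately show ?thesis by simp
  qed
  have all: "(\<integral>\<omega>. Z \<omega> * indicator A \<omega> \<partial>M) = 0" if "A \<in> sets M" for A
  proof -
    have cs: "cyl_sets \<subseteq> Pow (space M)" unfolding cyl_sets_def by auto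
    have "A \<in> sigma_sets (space M) cyl_sets" using that sets_eq_cyl by simp
    then show ?thesis
    proof (induction rule: sigma_sets_induct_disjoint[OF Int_stable_cyl cs, consumes 1, case_names basic empty compl union])
      case (basic A) then show ?case by (rule gen)
    next
      case empty then show ?case by simp
    next
      case (compl A)
      then have A: "A \<in> sets M" using sets_eq_cyl by simp
      have "space M \<in> cyl_sets" unfolding cyl_sets_def by (intro CollectI exI[of _ "[]"]) auto
      then have "(\<integral>\<omega>. Z \<omega> * indicator (space M) \<omega> \<partial>M) = 0" by (rule gen)
      moreover have "(\<integral>\<omega>. Z \<omega> * indicator (space M - A) \<omega> \<partial>M) =
        (\<integral>\<omega>. Z \<omega> * indicator (space M) \<omega> - Z \<omega> * indicator A \<omega> \<partial>M)"
        using sets.sets_into_space[OF A] by (intro Bochner_Integration.integral_cong refl) (auto simp: indicator_def)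
      ultimately show ?case using compl Z A by (simp add: Bochner_Integration.integral_diff integrable_times_indicator)
    next
      case (union A)
      then have A: "\<And>i. A i \<in> sets M" using sets_eq_cyl by auto
      have "set_lebesgue_integral M (\<Union>i. A i) Z = (\<Sum>i. set_lebesgue_integral M (A i) Z)"
      proof (rule lebesgue_integral_countable_add)
        show "A i \<inter> A j = {}" if "i \<noteq> j" for i j using union(1) that by (auto simp: disjoint_family_on_def)
        show "set_integrable M (\<Union>i. A i) Z"
          unfolding set_integrable_def using Z A by (intro integrable_mult_indicator) auto
      qed (use A in auto)
      then show ?case using union(3) by (simp add: set_lebesgue_integral_def mult.commute)
    qed
  qed
  have "AE \<omega> in M. Z \<omega> * indicator {\<omega>\<in>space M. Z \<omega> > 0} \<omega> = 0"
  proof (subst integral_nonneg_eq_0_iff_AE[symmetric])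
    show "integrable M (\<lambda>\<omega>. Z \<omega> * indicator {\<omega>\<in>space M. Z \<omega> > 0} \<omega>)"
      using Z by (intro integrable_times_indicator) auto
  qed (use all[of "{\<omega>\<in>space M. Z \<omega> > 0}"] in \<open>auto simp: indicator_def\<close>)
  moreover have "AE \<omega> in M. - (Z \<omega> * indicator {\<omega>\<in>space M. Z \<omega> < 0} \<omega>) = 0"
  proof (subst integral_nonneg_eq_0_iff_AE[symmetric])
    show "integrable M (\<lambda>\<omega>. - (Z \<omega> * indicator {\<omega>\<in>space M. Z \<omega> < 0} \<omega>))"
      using Z by (intro Bochner_Integration.integrable_minus integrable_times_indicator) auto
  qed (use all[of "{\<omega>\<in>space M. Z \<omega> < 0}"] in \<open>auto simp: indicator_def\<close>)
  ultimately show ?thesis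
    using AE_space
  proof eventually_elim
    case (elim \<omega>) then show ?case by (cases "Z \<omega> > 0"; cases "Z \<omega> < 0") (auto simp: indicator_def)
  qed
qed

section \<open>Independence along an orthonormal system\<close>

lemma prob_X_unit:
  assumes "norm h = 1" and [measurable]: "B \<in> sets borel"
  shows "expectation (\<lambda>\<omega>. indicator B (X h \<omega>)) = measure std_normal_distribution B"
proof -
  have "expectation (\<lambda>\<omega>. indicator B (X h \<omega>)) = (\<integral>x. (indicator B x :: real) \<partial>distr M borel (X h))"
    by (subst integral_distr) auto
  also have "\<dots> = (\<integral>x. (indicator B x :: real) \<partial>std_normal_distribution)"
    unfolding X_law using assms by (subst integral_distr) auto
  finally show ?thesis by simp
qed

text \<open>The indicators are introduced one at a time: one-dimensional Fourier uniqueness turns the exponential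
  in \<open>X (e j)\<close> into an indicator, which avoids a multivariate uniqueness theorem.\<close>

lemma orthonormal_char:
  fixes e :: "nat \<Rightarrow> 'h"
  assumes on: "orthonormal n e"
    and B: "\<And>i. i < n \<Longrightarrow> B i \<in> sets borel"
  shows "j \<le> n \<Longrightarrow> (\<And>i. i < j \<Longrightarrow> inner u (e i) = 0) \<Longrightarrow> (\<integral>\<omega>. iexp (X u \<omega>) * complex_of_real (\<Prod>i<j. indicator (B i) (X (e i) \<omega>)) \<partial>M)
    = complex_of_real (\<Prod>i<j. measure std_normal_distribution (B i)) * (\<integral>\<omega>. iexp (X u \<omega>) \<partial>M)"
proof (induction j arbitrary: u)
  case 0 then show ?case by simp
next
  case (Suc j)
  define W where "W \<omega> = (\<Prod>i<j. indicator (B i) (X (e i) \<omega>) :: real)" for \<omega>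
  define c where "c = (\<Prod>i<j. measure std_normal_distribution (B i))"
  have [measurable]: "W \<in> borel_measurable M"
    unfolding W_def[abs_def] using Suc.prems B by (intro borel_measurable_prod borel_measurable_indicator') auto
  have Wb: "\<bar>W \<omega>\<bar> \<le> 1" for \<omega>
    unfolding W_def abs_prod by (intro prod_le_1) (auto simp: indicator_def)
  have j: "j < n" using Suc.prems by simp
  have Bj[measurable]: "B j \<in> sets borel" using B j by simp
  have ej: "norm (e j) = 1" using orthonormalD[OF on j j] by (simp add: norm_eq_1)
  define \<kappa> where "\<kappa> = complex_of_real c * (\<integral>\<omega>. iexp (X u \<omega>) \<partial>M)"
  \<comment> \<open>Subtracting the value \<open>\<kappa>\<close> predicted by independence makes
    the Fourier transform of \<open>w\<close> against \<open>X (e j)\<close> vanish, so the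
    indicator of \<open>X (e j)\<close> can be introduced by \<open>fourier_unique\<close>.\<close>
  define w where "w \<omega> = iexp (X u \<omega>) * complex_of_real (W \<omega>) - \<kappa>" for \<omega>
  have intw: "integrable M (\<lambda>\<omega>. iexp (s * X h \<omega>) * (iexp (X u \<omega>) * complex_of_real (W \<omega>)))" for s h
    using Wb by (intro integrable_const_bound[of _ 1]) (auto simp: norm_mult)
  have inte: "integrable M (\<lambda>\<omega>. iexp (s * X h \<omega>))" for s h
    by (intro integrable_const_bound[of _ 1]) auto
  have "integrable M w"
    using intw[of 0] unfolding w_def by simp
  moreover have "(\<integral>\<omega>. iexp (s * X (e j) \<omega>) * w \<omega> \<partial>M) = 0" for s
  proof -
    have uj: "inner u (e j) = 0" using Suc.prems by simp
    \<comment> \<open>Pythagoras is where orthogonality of \<open>u\<close> and \<open>e j\<close>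
      is used: it splits the characteristic function of \<open>X (u + s e j)\<close> into a
      product.\<close>
    have nrm: "(norm (u + s *\<^sub>R e j))\<^sup>2 = (norm u)\<^sup>2 + s\<^sup>2"
      unfolding power2_norm_eq_inner using uj orthonormalD[OF on j j]
      by (simp add: inner_add_left inner_add_right inner_commute power2_eq_square)
    have "(\<integral>\<omega>. iexp (s * X (e j) \<omega>) * (iexp (X u \<omega>) * complex_of_real (W \<omega>)) \<partial>M)
      = (\<integral>\<omega>. iexp (X (u + s *\<^sub>R e j) \<omega>) * complex_of_real (W \<omega>) \<partial>M)"
      using X_add_scaled[of u s "e j"]
      by (intro integral_cong_AE) (auto simp: algebra_simps exp_add)
    also have "\<dots> = complex_of_real c * (\<integral>\<omega>. iexp (X (u + s *\<^sub>R e j) \<omega>) \<partial>M)"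
      unfolding W_def c_def
    proof (rule Suc.IH)
      show "j \<le> n" using j by simp
      show "inner (u + s *\<^sub>R e j) (e i) = 0" if "i < j" for i
        using that Suc.prems(2)[of i] orthonormalD[OF on, of j i] j by (simp add: inner_add_left)
    qed
    also have "(\<integral>\<omega>. iexp (X (u + s *\<^sub>R e j) \<omega>) \<partial>M) = complex_of_real (exp (- ((norm u)\<^sup>2) / 2)) * complex_of_real (exp (- (s\<^sup>2) / 2))"
      using X_char[of 1 "u + s *\<^sub>R e j"] nrm by (simp flip: exp_add of_real_mult add: add_divide_distrib)
    also have "\<dots> = (\<integral>\<omega>. iexp (X u \<omega>) \<partial>M) * (\<integral>\<omega>. iexp (s * X (e j) \<omega>) \<partial>M)"
      using X_char[of 1 u] X_char[of s "e j"] ej by simp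
    finally have "(\<integral>\<omega>. iexp (s * X (e j) \<omega>) * (iexp (X u \<omega>) * complex_of_real (W \<omega>)) \<partial>M)
      = \<kappa> * (\<integral>\<omega>. iexp (s * X (e j) \<omega>) \<partial>M)" by (simp add: \<kappa>_def mult.assoc)
    moreover have "(\<integral>\<omega>. iexp (s * X (e j) \<omega>) * w \<omega> \<partial>M)
      = (\<integral>\<omega>. iexp (s * X (e j) \<omega>) * (iexp (X u \<omega>) * complex_of_real (W \<omega>)) - \<kappa> * iexp (s * X (e j) \<omega>) \<partial>M)"
      by (simp add: w_def right_diff_distrib mult.commute)
    ultimately show ?thesis
      by (simp only: Bochner_Integration.integral_diff[OF intw integrable_mult_right[OF inte]] integral_mult_right_zero diff_self)
  qed
  ultimately have 0: "(\<integral>\<omega>. w \<omega> * indicator (B j) (X (e j) \<omega>) \<partial>M) = 0"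
    by (intro fourier_unique[OF _ X_measurable _ Bj])
  have i1: "integrable M (\<lambda>\<omega>. iexp (X u \<omega>) * complex_of_real (\<Prod>i<Suc j. indicator (B i) (X (e i) \<omega>)))"
    unfolding prod.lessThan_Suc W_def[symmetric] using Wb
    by (intro integrable_const_bound[of _ 1]) (auto simp: norm_mult indicator_def)
  have i2: "integrable M (\<lambda>\<omega>. complex_of_real (indicator (B j) (X (e j) \<omega>)))"
    by (intro integrable_const_bound[of _ 1]) (auto simp: norm_mult indicator_def)
  have "w \<omega> * indicator (B j) (X (e j) \<omega>) = iexp (X u \<omega>) * complex_of_real (\<Prod>i<Suc j. indicator (B i) (X (e i) \<omega>))
     - \<kappa> * complex_of_real (indicator (B j) (X (e j) \<omega>))" for \<omega>
    unfolding w_def W_def by (simp add: indicator_def)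
  with 0 have "(\<integral>\<omega>. iexp (X u \<omega>) * complex_of_real (\<Prod>i<Suc j. indicator (B i) (X (e i) \<omega>)) \<partial>M)
     = \<kappa> * (\<integral>\<omega>. complex_of_real (indicator (B j) (X (e j) \<omega>)) \<partial>M)"
    using Bochner_Integration.integral_diff[OF i1 integrable_mult_right[OF i2], of \<kappa>]
    by (simp only: integral_mult_right_zero) simp
  also have "(\<integral>\<omega>. complex_of_real (indicator (B j) (X (e j) \<omega>)) \<partial>M) = complex_of_real (measure std_normal_distribution (B j))"
    unfolding integral_complex_of_real prob_X_unit[OF ej Bj] ..
  finally show ?case by (simp add: \<kappa>_def c_def mult_ac)
qed

text \<open>The case \<open>u = 0\<close>, \<open>j = n\<close> of the preceding lemma gives the
  probability of every rectangle, and rectangles determine the product measure.\<close>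

theorem law_orthonormal:
  fixes e :: "nat \<Rightarrow> 'h"
  assumes on: "orthonormal n e"
  shows "distr M (Pi\<^sub>M {..<n} (\<lambda>_. borel)) (\<lambda>\<omega>. \<lambda>i\<in>{..<n}. X (e i) \<omega>) = Pi\<^sub>M {..<n} (\<lambda>_. std_normal_distribution)"
proof -
  interpret N: real_distribution std_normal_distribution by (rule real_dist_normal_dist)
  interpret PP: product_sigma_finite "\<lambda>_::nat. std_normal_distribution" by standard
  show ?thesis
  proof (rule PP.PiM_eqI)
    show "sets (distr M (Pi\<^sub>M {..<n} (\<lambda>_. borel)) (\<lambda>\<omega>. \<lambda>i\<in>{..<n}. X (e i) \<omega>)) = sets (Pi\<^sub>M {..<n} (\<lambda>_. std_normal_distribution))"
      by (simp cong: sets_PiM_cong)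
    fix B assume "\<And>i. i \<in> {..<n} \<Longrightarrow> B i \<in> sets std_normal_distribution"
    then have B[measurable]: "B i \<in> sets borel" if "i < n" for i using that by auto
    have [measurable]: "(\<lambda>\<omega>. \<lambda>i\<in>{..<n}. X (e i) \<omega>) \<in> measurable M (Pi\<^sub>M {..<n} (\<lambda>_. borel))"
      by measurable
    let ?A = "(\<lambda>\<omega>. \<lambda>i\<in>{..<n}. X (e i) \<omega>) -` (Pi\<^sub>E {..<n} B) \<inter> space M"
    have Ai: "indicator ?A \<omega> = (\<Prod>i<n. indicator (B i) (X (e i) \<omega>) :: real)" if "\<omega> \<in> space M" for \<omega>
    proof (cases "\<forall>i<n. X (e i) \<omega> \<in> B i")
      case True then show ?thesis using that by (auto simp: indicator_def PiE_def extensional_def)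
    next
      case False
      then obtain i where i: "i < n" "X (e i) \<omega> \<notin> B i" by auto
      then have "(\<Prod>i<n. indicator (B i) (X (e i) \<omega>) :: real) = 0" by (intro prod_zero bexI[of _ i]) auto
      moreover have "\<omega> \<notin> ?A" using i by auto
      ultimately show ?thesis by simp
    qed
    have PB: "Pi\<^sub>E {..<n} B \<in> sets (Pi\<^sub>M {..<n} (\<lambda>_. borel))" using B by (intro sets_PiM_I_finite) auto
    have A: "?A \<in> sets M" by (rule measurable_sets[OF _ PB]) simp
    have "complex_of_real (measure M ?A) = complex_of_real (\<integral>\<omega>. indicator ?A \<omega> \<partial>M)" using A by simp
    also have "\<dots> = (\<integral>\<omega>. complex_of_real (indicator ?A \<omega>) \<partial>M)" by (rule integral_complex_of_real[symmetric])
    also have "\<dots> = (\<integral>\<omega>. iexp (X 0 \<omega>) * complex_of_real (\<Prod>i<n. indicator (B i) (X (e i) \<omega>)) \<partial>M)"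
      using X_zero AE_space A B
      by (intro integral_cong_AE) (auto simp: Ai simp del: of_real_prod intro!: borel_measurable_times borel_measurable_of_real borel_measurable_prod borel_measurable_indicator')
    also have "\<dots> = complex_of_real (\<Prod>i<n. measure std_normal_distribution (B i)) * (\<integral>\<omega>. iexp (X 0 \<omega>) \<partial>M)"
      using B by (intro orthonormal_char[OF on]) auto
    also have "(\<integral>\<omega>. iexp (X 0 \<omega>) \<partial>M) = 1" using X_char[of 1 0] by simp
    finally have "measure M ?A = (\<Prod>i<n. measure std_normal_distribution (B i))" by (simp only: mult_1_right of_real_eq_iff)
    then show "emeasure (distr M (Pi\<^sub>M {..<n} (\<lambda>_. borel)) (\<lambda>\<omega>. \<lambda>i\<in>{..<n}. X (e i) \<omega>)) (Pi\<^sub>E {..<n} B)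
       = (\<Prod>i\<in>{..<n}. emeasure std_normal_distribution (B i))"
      using PB by (simp add: emeasure_distr emeasure_eq_measure N.emeasure_eq_measure prod_ennreal)
  qed simp
qed

end

section \<open>Gaussian integration by parts\<close>

lemma power_add_le:
  fixes a b :: real
  assumes "a \<ge> 0" "b \<ge> 0"
  shows "(a + b) ^ N \<le> 2 ^ N * (a ^ N + b ^ N)"
proof -
  have "(a + b) ^ N \<le> (2 * max a b) ^ N" using assms by (intro power_mono) auto
  also have "\<dots> = 2 ^ N * max a b ^ N" by (simp add: power_mult_distrib)
  also have "max a b ^ N \<le> a ^ N + b ^ N" using assms by (auto simp: max_def)
  finally show ?thesis by simp
qed

lemma integrable_std_growth: "integrable std_normal_distribution (\<lambda>x. (1 + \<bar>x\<bar>) ^ N)"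
proof (rule Bochner_Integration.integrable_bound)
  interpret N: real_distribution std_normal_distribution by (rule real_dist_normal_dist)
  show "integrable std_normal_distribution (\<lambda>x. 2 ^ N * (1 + \<bar>x ^ N\<bar>))"
    by (intro integrable_mult_right Bochner_Integration.integrable_add integrable_abs integrable_std_normal_distribution_moment) simp
  show "AE x in std_normal_distribution. norm ((1 + \<bar>x\<bar>) ^ N) \<le> norm (2 ^ N * (1 + \<bar>x ^ N\<bar>))"
    using power_add_le[of 1 "\<bar>x\<bar>" N for x] by (auto simp: power_abs abs_mult)
qed simp

lemma growth_times_density_tendsto:
  fixes f :: "real \<Rightarrow> real"
  assumes "\<And>x. \<bar>f x\<bar> \<le> C * (1 + \<bar>x\<bar>) ^ N" and F: "filterlim (\<lambda>x::real. 1 + \<bar>x\<bar>) at_top F"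
  shows "((\<lambda>x. f x * std_normal_density x) \<longlongrightarrow> 0) F"
proof (rule Lim_null_comparison)
  have "C \<ge> 0" using assms(1)[of 0] by (simp add: order.trans[OF abs_ge_zero])
  show "\<forall>\<^sub>F x in F. norm (f x * std_normal_density x) \<le> C * exp 2 * ((1 + \<bar>x\<bar>) ^ N / exp (1 + \<bar>x\<bar>))"
  proof (intro always_eventually allI)
    fix x :: real
    \<comment> \<open>This square yields \<open>\<bar>x\<bar> - 1/2 \<le> x ^ 2 / 2\<close>, so the
      Gaussian is dominated by a simple exponential; the constant \<open>exp 2\<close> comes from
      writing the result in terms of \<open>1 + \<bar>x\<bar>\<close>.\<close>
    have "0 \<le> (\<bar>x\<bar> - 1)\<^sup>2" by simp
    then have "- x\<^sup>2 / 2 \<le> 2 - (1 + \<bar>x\<bar>)" by (simp add: power2_eq_square algebra_simps)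
    then have e: "exp (- x\<^sup>2 / 2) \<le> exp 2 / exp (1 + \<bar>x\<bar>)" by (simp flip: exp_diff)
    have "std_normal_density x \<le> 1 * exp (- x\<^sup>2 / 2)"
      unfolding std_normal_density_def by (intro mult_right_mono) (use pi_ge_two in \<open>auto intro!: real_le_lsqrt\<close>)
    with e have d: "std_normal_density x \<le> exp 2 / exp (1 + \<bar>x\<bar>)" by simp
    have "norm (f x * std_normal_density x) = \<bar>f x\<bar> * std_normal_density x" by (simp add: abs_mult normal_density_nonneg)
    also have "\<dots> \<le> (C * (1 + \<bar>x\<bar>) ^ N) * (exp 2 / exp (1 + \<bar>x\<bar>))"
      using assms(1) d \<open>C \<ge> 0\<close> by (intro mult_mono) (auto simp: normal_density_nonneg)
    finally show "norm (f x * std_normal_density x) \<le> C * exp 2 * ((1 + \<bar>x\<bar>) ^ N / exp (1 + \<bar>x\<bar>))"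
      by (simp add: field_simps)
  qed
  have "((\<lambda>x. (1 + \<bar>x\<bar>) ^ N / exp (1 + \<bar>x\<bar>)) \<longlongrightarrow> 0) F"
    by (rule filterlim_compose[OF tendsto_power_div_exp_0 F])
  then show "((\<lambda>x. C * exp 2 * ((1 + \<bar>x\<bar>) ^ N / exp (1 + \<bar>x\<bar>))) \<longlongrightarrow> 0) F"
    by (rule tendsto_mult_right_zero)
qed

text \<open>The function \<open>x f - f'\<close> times the density is the derivative of
  \<open>- f\<close> times the density, and the latter tends to zero at both ends by polynomial
  growth. The claim is the fundamental theorem of calculus on the whole line.\<close>

lemma gaussian_ibp_real:
  fixes f f' :: "real \<Rightarrow> real"
  assumes d: "\<And>x. (f has_real_derivative f' x) (at x)" and c: "\<And>x. isCont f' x"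
    and b: "\<And>x. \<bar>f x\<bar> \<le> C * (1 + \<bar>x\<bar>) ^ N" "\<And>x. \<bar>f' x\<bar> \<le> C * (1 + \<bar>x\<bar>) ^ N"
  shows "(\<integral>x. x * f x \<partial>std_normal_distribution) = (\<integral>x. f' x \<partial>std_normal_distribution)"
proof -
  have cf: "continuous_on UNIV f" using d by (meson DERIV_isCont continuous_at_imp_continuous_on)
  have cf': "continuous_on UNIV f'" using c by (simp add: continuous_at_imp_continuous_on)
  have [measurable]: "f \<in> borel_measurable borel" "f' \<in> borel_measurable borel"
    using cf cf' by (auto intro: borel_measurable_continuous_onI)
  have C: "C \<ge> 0" using b(1)[of 0] by (simp add: order.trans[OF abs_ge_zero])
  have i1: "integrable std_normal_distribution f'"
    by (rule Bochner_Integration.integrable_bound[OF integrable_mult_right[OF integrable_std_growth, of C N]]) (use b(2) in \<open>auto intro: order.trans[OF _ abs_ge_self]\<close>)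
  have i2: "integrable std_normal_distribution (\<lambda>x. x * f x)"
  proof (rule Bochner_Integration.integrable_bound[OF integrable_mult_right[OF integrable_std_growth, of C "Suc N"]])
    have "\<bar>x * f x\<bar> \<le> (1 + \<bar>x\<bar>) * (C * (1 + \<bar>x\<bar>) ^ N)" for x
      unfolding abs_mult using b(1) by (intro mult_mono) auto
    then show "AE x in std_normal_distribution. norm (x * f x) \<le> norm (C * (1 + \<bar>x\<bar>) ^ Suc N)"
      using C by (auto simp: abs_mult algebra_simps)
  qed simp
  define G where "G x = - (f x * std_normal_density x)" for x
  define g where "g x = std_normal_density x * (x * f x) - std_normal_density x * f' x" for x
  have il: "integrable lborel (\<lambda>x. std_normal_density x * (x * f x))" "integrable lborel (\<lambda>x. std_normal_density x * f' x)"
    using i1 i2 by (auto simp: integrable_real_density normal_density_nonneg)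
  have sd: "(std_normal_density has_real_derivative - x * std_normal_density x) (at x)" for x
  proof -
    define c where "c = 1 / sqrt (2 * pi)"
    have "std_normal_density = (\<lambda>x. c * exp (- x\<^sup>2 / 2))" by (simp add: fun_eq_iff c_def std_normal_density_def)
    moreover have "((\<lambda>x. c * exp (- x\<^sup>2 / 2)) has_real_derivative - x * (c * exp (- x\<^sup>2 / 2))) (at x)"
      by (rule derivative_eq_intros refl | simp)+
    ultimately show ?thesis by simp
  qed
  have "(LBINT x=-\<infinity>..\<infinity>. g x) = 0 - 0"
  proof (rule interval_integral_FTC_integrable[where F = G])
    fix x :: real
    have "(G has_real_derivative g x) (at x)"
      unfolding G_def g_def by (rule derivative_eq_intros d sd refl | simp)+
    then show "(G has_vector_derivative g x) (at x)" by (simp add: has_real_derivative_iff_has_vector_derivative)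
    show "isCont g x" unfolding g_def using c[of x] DERIV_isCont[OF d] DERIV_isCont[OF sd] by (intro continuous_intros) auto
  next
    show "set_integrable lborel (einterval (-\<infinity>) \<infinity>) g"
      using il unfolding g_def by (simp add: set_integrable_def einterval_iff)
    have t: "filterlim (\<lambda>x::real. 1 + \<bar>x\<bar>) at_top at_top" "filterlim (\<lambda>x::real. 1 + \<bar>x\<bar>) at_top at_bot"
      by (auto intro!: filterlim_tendsto_add_at_top[OF tendsto_const] filterlim_abs_real simp: filterlim_at_bot_mirror)
    show "((G \<circ> real_of_ereal) \<longlongrightarrow> 0) (at_right (-\<infinity>))"
      unfolding ereal_tendsto_simps G_def[abs_def] using tendsto_minus[OF growth_times_density_tendsto[OF b(1) t(2)]] by simp
    show "((G \<circ> real_of_ereal) \<longlongrightarrow> 0) (at_left \<infinity>)"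
      unfolding ereal_tendsto_simps G_def[abs_def] using tendsto_minus[OF growth_times_density_tendsto[OF b(1) t(1)]] by simp
  qed simp
  then have "(\<integral>x. g x \<partial>lborel) = 0"
    by (simp add: interval_lebesgue_integral_def einterval_iff set_lebesgue_integral_def)
  then have "(\<integral>x. std_normal_density x * (x * f x) \<partial>lborel) = (\<integral>x. std_normal_density x * f' x \<partial>lborel)"
    unfolding g_def using il by simp
  then show ?thesis by (simp add: integral_real_density normal_density_nonneg)
qed

text \<open>Gram-Schmidt, one element of \<open>S\<close> at a time; a zero residual leaves the
  system unchanged, so \<open>S\<close> may be linearly dependent.\<close>

lemma finite_orthonormal_basis:
  fixes S :: "'h::real_inner set"
  assumes "finite S"
  shows "\<exists>n (e :: nat \<Rightarrow> 'h). orthonormal n e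
     \<and> (\<forall>h\<in>S. h = (\<Sum>i<n. inner h (e i) *\<^sub>R e i))"
  using assms
proof induction
  case empty then show ?case by (intro exI[of _ 0]) (auto simp: orthonormal_def)
next
  case (insert h S)
  then obtain n and e :: "nat \<Rightarrow> 'h" where on: "orthonormal n e"
    and sp: "\<And>g. g \<in> S \<Longrightarrow> g = (\<Sum>i<n. inner g (e i) *\<^sub>R e i)" by blast
  define r where "r = h - (\<Sum>i<n. inner h (e i) *\<^sub>R e i)"
  have pr: "inner (\<Sum>i<n. c i *\<^sub>R e i) (e j) = c j" if "j < n" for c j
    using that by (simp add: inner_sum_left orthonormalD[OF on] if_distrib[of "(*) _"] cong: if_cong)
  have re: "inner r (e j) = 0" if "j < n" for j
    unfolding r_def inner_diff_left pr[OF that] by simp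
  show ?case
  proof (cases "r = 0")
    case True
    then show ?thesis using on sp by (intro exI[of _ n] exI[of _ e]) (auto simp: r_def)
  next
    case False
    define e' where "e' = e(n := r /\<^sub>R norm r)"
    have rr: "inner (r /\<^sub>R norm r) (r /\<^sub>R norm r) = 1"
      using False by (simp add: power2_norm_eq_inner[symmetric] power2_eq_square)
    have on': "inner (e' i) (e' j) = (if i = j then 1 else 0)" if "i < Suc n" "j < Suc n" for i j
    proof -
      consider "i < n" "j < n" | "i = n" "j < n" | "i < n" "j = n" | "i = n" "j = n"
        using \<open>i < Suc n\<close> \<open>j < Suc n\<close> by linarith
      then show ?thesis using orthonormalD[OF on] re rr unfolding e'_def
        by cases (simp_all add: inner_commute[of "e _" r])
    qed
    have S': "g = (\<Sum>i<Suc n. inner g (e' i) *\<^sub>R e' i)" if "g \<in> S" for g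
    proof -
      have "inner (\<Sum>i<n. inner g (e i) *\<^sub>R e i) r = 0" by (simp add: inner_sum_left inner_commute[of "e _" r] re)
      then have "inner g r = 0" using sp[OF that] by metis
      then have "(\<Sum>i<Suc n. inner g (e' i) *\<^sub>R e' i) = (\<Sum>i<n. inner g (e i) *\<^sub>R e i)"
        by (simp add: e'_def)
      then show ?thesis using sp[OF that] by simp
    qed
    have h': "h = (\<Sum>i<Suc n. inner h (e' i) *\<^sub>R e' i)"
    proof -
      have hr: "h = r + (\<Sum>i<n. inner h (e i) *\<^sub>R e i)" by (simp add: r_def)
      have "inner h r = inner r r"
        by (subst hr) (simp add: inner_add_left inner_sum_left inner_commute[of "e _" r] re)
      then have "(inner h (r /\<^sub>R norm r)) *\<^sub>R (r /\<^sub>R norm r) = r"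
        using False by (simp add: power2_norm_eq_inner[symmetric] power2_eq_square mult.assoc[symmetric])
      then have "(\<Sum>i<Suc n. inner h (e' i) *\<^sub>R e' i) = (\<Sum>i<n. inner h (e i) *\<^sub>R e i) + r"
        by (simp add: e'_def)
      then show ?thesis using hr by (metis add.commute)
    qed
    show ?thesis
    proof (intro exI[of _ "Suc n"] exI[of _ e'] conjI ballI)
      show "orthonormal (Suc n) e'" unfolding orthonormal_def using on' by blast
    next
      fix g assume "g \<in> insert h S"
      then show "g = (\<Sum>i<Suc n. inner g (e' i) *\<^sub>R e' i)" using S' h' by blast
    qed
  qed
qed

text \<open>Functionals of the whole path \<open>x = (X h)\<^sub>h\<close>, differentiated along the Cameron-Martin shifts
  \<open>x + t \<langle>\<cdot>, k\<rangle>\<close>; this needs no enumeration of the coordinates on which \<open>F\<close> depends.\<close>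

definition path_smooth :: "(('h::real_inner \<Rightarrow> real) \<Rightarrow> real) \<Rightarrow> (('h \<Rightarrow> real) \<Rightarrow> 'h) \<Rightarrow> bool" where
  "path_smooth F DF \<longleftrightarrow> continuous_on UNIV F \<and> (\<forall>k. continuous_on UNIV (\<lambda>x. inner (DF x) k)) \<and>
   (\<forall>x k t. ((\<lambda>t. F (\<lambda>h. x h + t * inner h k)) has_real_derivative inner (DF (\<lambda>h. x h + t * inner h k)) k) (at t)) \<and>
   (\<exists>S. finite S \<and> (\<forall>x y. (\<forall>h\<in>S. x h = y h) \<longrightarrow> F x = F y \<and> DF x = DF y) \<and>
     (\<exists>C N. \<forall>x. \<bar>F x\<bar> \<le> C * (1 + (\<Sum>h\<in>S. \<bar>x h\<bar>)) ^ N \<and> norm (DF x) \<le> C * (1 + (\<Sum>h\<in>S. \<bar>x h\<bar>)) ^ N))"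

section \<open>Products, coordinates and measurability of path functionals\<close>

lemma path_smooth_mult:
  assumes "path_smooth F DF" "path_smooth G DG"
  shows "path_smooth (\<lambda>x. F x * G x) (\<lambda>x. F x *\<^sub>R DG x + G x *\<^sub>R DF x)"
proof -
  obtain S C N where S: "finite S" "\<And>x y. (\<forall>h\<in>S. x h = y h) \<Longrightarrow> F x = F y \<and> DF x = DF y"
    and b: "\<And>x. \<bar>F x\<bar> \<le> C * (1 + (\<Sum>h\<in>S. \<bar>x h\<bar>)) ^ N" "\<And>x. norm (DF x) \<le> C * (1 + (\<Sum>h\<in>S. \<bar>x h\<bar>)) ^ N"
    using assms(1) unfolding path_smooth_def by blast
  obtain S' C' N' where S': "finite S'" "\<And>x y. (\<forall>h\<in>S'. x h = y h) \<Longrightarrow> G x = G y \<and> DG x = DG y"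
    and b': "\<And>x. \<bar>G x\<bar> \<le> C' * (1 + (\<Sum>h\<in>S'. \<bar>x h\<bar>)) ^ N'" "\<And>x. norm (DG x) \<le> C' * (1 + (\<Sum>h\<in>S'. \<bar>x h\<bar>)) ^ N'"
    using assms(2) unfolding path_smooth_def by blast
  let ?m = "\<lambda>x. 1 + (\<Sum>h\<in>S \<union> S'. \<bar>x h\<bar>)"
  have C: "C \<ge> 0" using b(1)[of "\<lambda>_. 0"] by (simp add: order.trans[OF abs_ge_zero])
  have C': "C' \<ge> 0" using b'(1)[of "\<lambda>_. 0"] by (simp add: order.trans[OF abs_ge_zero])
  have m: "C * (1 + (\<Sum>h\<in>S. \<bar>x h\<bar>)) ^ N \<le> C * ?m x ^ N" for x
    using S(1) S'(1) C by (intro mult_left_mono power_mono add_left_mono sum_mono2) (auto intro!: add_nonneg_nonneg sum_nonneg)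
  have m': "C' * (1 + (\<Sum>h\<in>S'. \<bar>x h\<bar>)) ^ N' \<le> C' * ?m x ^ N'" for x
    using S(1) S'(1) C' by (intro mult_left_mono power_mono add_left_mono sum_mono2) (auto intro!: add_nonneg_nonneg sum_nonneg)
  have pos: "?m x \<ge> 0" for x :: "_ \<Rightarrow> real" by (intro add_nonneg_nonneg sum_nonneg) auto
  note B = order.trans[OF b(1) m] order.trans[OF b(2) m] and B' = order.trans[OF b'(1) m'] order.trans[OF b'(2) m']
  \<comment> \<open>The factor 2 pays for the two terms of the Leibniz rule, so that one constant
    serves the product and its derivative.\<close>
  have bnd: "\<bar>F x * G x\<bar> \<le> (2 * C * C') * ?m x ^ (N + N')"
    "norm (F x *\<^sub>R DG x + G x *\<^sub>R DF x) \<le> (2 * C * C') * ?m x ^ (N + N')" for x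
  proof -
    have "\<bar>F x * G x\<bar> \<le> (C * ?m x ^ N) * (C' * ?m x ^ N')"
      unfolding abs_mult using C pos by (intro mult_mono B B') auto
    also have "\<dots> \<le> 2 * ((C * ?m x ^ N) * (C' * ?m x ^ N'))"
      using C C' pos[of x] by simp
    finally show "\<bar>F x * G x\<bar> \<le> (2 * C * C') * ?m x ^ (N + N')" by (simp add: power_add mult_ac)
    have "norm (F x *\<^sub>R DG x + G x *\<^sub>R DF x) \<le> \<bar>F x\<bar> * norm (DG x) + \<bar>G x\<bar> * norm (DF x)"
      by (rule order.trans[OF norm_triangle_ineq]) simp
    also have "\<dots> \<le> (C * ?m x ^ N) * (C' * ?m x ^ N') + (C' * ?m x ^ N') * (C * ?m x ^ N)"
      using C C' pos[of x] by (intro add_mono mult_mono B B') auto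
    finally show "norm (F x *\<^sub>R DG x + G x *\<^sub>R DF x) \<le> (2 * C * C') * ?m x ^ (N + N')" by (simp add: power_add mult_ac)
  qed
  show ?thesis
    unfolding path_smooth_def
  proof (intro conjI allI exI[of _ "S \<union> S'"] exI[of _ "2 * C * C'"] exI[of _ "N + N'"] impI)
    show "continuous_on UNIV (\<lambda>x. F x * G x)" using assms unfolding path_smooth_def by (intro continuous_intros) auto
    show "continuous_on UNIV (\<lambda>x. inner (F x *\<^sub>R DG x + G x *\<^sub>R DF x) k)" for k
      using assms unfolding path_smooth_def inner_add_left inner_scaleR_left by (intro continuous_on_add continuous_on_mult) auto
    show "((\<lambda>t. F (\<lambda>h. x h + t * inner h k) * G (\<lambda>h. x h + t * inner h k)) has_real_derivative
      inner (F (\<lambda>h. x h + t * inner h k) *\<^sub>R DG (\<lambda>h. x h + t * inner h k) + G (\<lambda>h. x h + t * inner h k) *\<^sub>R DF (\<lambda>h. x h + t * inner h k)) k) (at t)" for x k t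
    proof -
      have "((\<lambda>t. F (\<lambda>h. x h + t * inner h k)) has_real_derivative inner (DF (\<lambda>h. x h + t * inner h k)) k) (at t)"
        "((\<lambda>t. G (\<lambda>h. x h + t * inner h k)) has_real_derivative inner (DG (\<lambda>h. x h + t * inner h k)) k) (at t)"
        using assms unfolding path_smooth_def by blast+
      from DERIV_mult[OF this] show ?thesis by (simp add: inner_add_left algebra_simps)
    qed
    fix x y :: "_ \<Rightarrow> real" assume e: "\<forall>h\<in>S \<union> S'. x h = y h"
    have "F x = F y \<and> DF x = DF y" by (rule S(2)) (use e in auto)
    moreover have "G x = G y \<and> DG x = DG y" by (rule S'(2)) (use e in auto)
    ultimately show "F x * G x = F y * G y" "F x *\<^sub>R DG x + G x *\<^sub>R DF x = F y *\<^sub>R DG y + G y *\<^sub>R DF y" by simp_all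
  qed (use S(1) S'(1) bnd in \<open>auto\<close>)
qed

lemma path_smooth_coord:
  fixes f f' :: "real \<Rightarrow> real" and u :: "'h::real_inner"
  assumes d: "\<And>x. (f has_real_derivative f' x) (at x)" and c: "continuous_on UNIV f'"
    and b: "\<And>x. \<bar>f x\<bar> \<le> C * (1 + \<bar>x\<bar>) ^ N" "\<And>x. \<bar>f' x\<bar> \<le> C * (1 + \<bar>x\<bar>) ^ N"
  shows "path_smooth (\<lambda>x. f (x u)) (\<lambda>x. f' (x u) *\<^sub>R u)"
proof -
  have cf: "continuous_on UNIV f" using d by (meson DERIV_isCont continuous_at_imp_continuous_on)
  have C: "C \<ge> 0" using b(1)[of 0] by (simp add: order.trans[OF abs_ge_zero])
  have cu: "continuous_on UNIV (\<lambda>x :: 'h \<Rightarrow> real. x u)" by (rule continuous_on_product_coordinates)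
  show ?thesis unfolding path_smooth_def
  proof (intro conjI allI exI[of _ "{u}"] exI[of _ "C * (1 + norm u)"] exI[of _ N] impI)
    show "continuous_on UNIV (\<lambda>x. f (x u))"
      by (rule continuous_on_compose2[OF cf cu]) auto
    show "continuous_on UNIV (\<lambda>x. inner (f' (x u) *\<^sub>R u) k)" for k
      unfolding inner_scaleR_left by (intro continuous_intros continuous_on_compose2[OF c cu]) auto
    show "((\<lambda>t. f (x u + t * inner u k)) has_real_derivative inner (f' (x u + t * inner u k) *\<^sub>R u) k) (at t)" for x k t
    proof -
      have "((\<lambda>t. x u + t * inner u k) has_real_derivative inner u k) (at t)" by (auto intro!: derivative_eq_intros)
      from DERIV_chain2[OF d this] show ?thesis by simp
    qed
    fix x :: "'h \<Rightarrow> real"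
    have "\<bar>f (x u)\<bar> \<le> 1 * (C * (1 + \<bar>x u\<bar>) ^ N)" using b(1) by simp
    also have "\<dots> \<le> (1 + norm u) * (C * (1 + \<bar>x u\<bar>) ^ N)" using C by (intro mult_right_mono) auto
    finally show "\<bar>f (x u)\<bar> \<le> C * (1 + norm u) * (1 + (\<Sum>h\<in>{u}. \<bar>x h\<bar>)) ^ N" by (simp add: mult_ac)
    have "norm (f' (x u) *\<^sub>R u) \<le> (C * (1 + \<bar>x u\<bar>) ^ N) * (1 + norm u)"
      using b(2) C by (auto intro!: mult_mono)
    then show "norm (f' (x u) *\<^sub>R u) \<le> C * (1 + norm u) * (1 + (\<Sum>h\<in>{u}. \<bar>x h\<bar>)) ^ N" by (simp add: mult_ac)
  qed auto
qed

lemma path_smooth_nherm: "path_smooth (\<lambda>x. nherm n (x u)) (\<lambda>x. nherm (n - 1) (x u) *\<^sub>R u)"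
proof -
  obtain C N where 1: "C \<ge> 0" "\<And>x. \<bar>nherm n x\<bar> \<le> C * (1 + \<bar>x\<bar>) ^ N" using nherm_growth by metis
  obtain C' N' where 2: "C' \<ge> 0" "\<And>x. \<bar>nherm (n - 1) x\<bar> \<le> C' * (1 + \<bar>x\<bar>) ^ N'" using nherm_growth by metis
  have up: "c * (1 + \<bar>x\<bar>) ^ k \<le> max C C' * (1 + \<bar>x\<bar>) ^ max N N'" if "0 \<le> c" "c \<le> max C C'" "k \<le> max N N'" for c k and x :: real
    using that by (intro mult_mono power_increasing) auto
  show ?thesis
    using 1(1) 2(1)
    by (intro path_smooth_coord[where C = "max C C'" and N = "max N N'"] nherm_has_derivative continuous_nherm)
       (auto intro!: order.trans[OF 1(2) up] order.trans[OF 2(2) up])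
qed

lemma path_smooth_cos: "path_smooth (\<lambda>x. cos (x u)) (\<lambda>x. (- sin (x u)) *\<^sub>R u)"
  by (rule path_smooth_coord[where f = cos and f' = "\<lambda>x. - sin x" and C = 1 and N = 0]) (auto intro!: continuous_intros derivative_eq_intros)

lemma path_smooth_sin: "path_smooth (\<lambda>x. sin (x u)) (\<lambda>x. cos (x u) *\<^sub>R u)"
  by (rule path_smooth_coord[where f = sin and f' = "\<lambda>x. cos x" and C = 1 and N = 0]) (auto intro!: continuous_intros derivative_eq_intros)

text \<open>The index type of a path may be uncountable, and then coordinatewise measurability does
  not give measurability into the product space. Factoring \<open>F\<close> through a sequence that
  enumerates the finite set \<open>S\<close> brings it down to a countable product.\<close>

lemma measurable_of_continuous_path:
  fixes F :: "('h \<Rightarrow> real) \<Rightarrow> real"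
  assumes c: "continuous_on UNIV F" and S: "finite S" "\<And>x y. (\<forall>h\<in>S. x h = y h) \<Longrightarrow> F x = F y"
    and Y: "\<And>h. Y h \<in> borel_measurable M"
  shows "(\<lambda>\<omega>. F (\<lambda>h. Y h \<omega>)) \<in> borel_measurable M"
proof -
  have S': "countable S" using S(1) by (rule countable_finite)
  have "continuous_on UNIV (\<lambda>z :: nat \<Rightarrow> real. F (\<lambda>h. z (to_nat_on S h)))"
    by (intro continuous_on_compose2[OF c] continuous_on_coordinatewise_then_product continuous_on_product_coordinates) auto
  then have 1: "(\<lambda>z :: nat \<Rightarrow> real. F (\<lambda>h. z (to_nat_on S h))) \<in> borel_measurable borel"
    by (rule borel_measurable_continuous_onI)
  have 2: "(\<lambda>\<omega> n. Y (from_nat_into S n) \<omega>) \<in> borel_measurable M"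
    using Y by (intro measurable_coordinatewise_then_product)
  have "(\<lambda>\<omega>. F (\<lambda>h. Y h \<omega>)) = (\<lambda>\<omega>. F (\<lambda>h. (\<lambda>n. Y (from_nat_into S n) \<omega>) (to_nat_on S h)))"
    using S' by (intro ext S(2)) auto
  then show ?thesis using measurable_compose[OF 2 1] by simp
qed

lemma path_smooth_measurable:
  assumes "path_smooth F DF" "\<And>h. Y h \<in> borel_measurable M"
  shows "(\<lambda>\<omega>. F (\<lambda>h. Y h \<omega>)) \<in> borel_measurable M"
    and "(\<lambda>\<omega>. inner (DF (\<lambda>h. Y h \<omega>)) k) \<in> borel_measurable M"
proof -
  obtain S where S: "finite S" "\<And>x y. (\<forall>h\<in>S. x h = y h) \<Longrightarrow> F x = F y \<and> DF x = DF y"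
    using assms(1) unfolding path_smooth_def by blast
  show "(\<lambda>\<omega>. F (\<lambda>h. Y h \<omega>)) \<in> borel_measurable M"
    using assms S by (intro measurable_of_continuous_path[of F S]) (auto simp: path_smooth_def)
  have *: "inner (DF x) k = inner (DF y) k" if "\<forall>h\<in>S. x h = y h" for x y
    using S(2)[OF that] by simp
  show "(\<lambda>\<omega>. inner (DF (\<lambda>h. Y h \<omega>)) k) \<in> borel_measurable M"
    using assms S(1) * by (intro measurable_of_continuous_path[of "\<lambda>x. inner (DF x) k" S]) (auto simp: path_smooth_def)
qed

lemma path_smooth_eval: "path_smooth (\<lambda>x. x u) (\<lambda>x. u)"
  using path_smooth_coord[where f = "\<lambda>x. x" and f' = "\<lambda>_. 1" and C = 1 and N = 1 and u = u] by simp

lemma path_smooth_one: "path_smooth (\<lambda>x. 1) (\<lambda>x. 0)"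
  using path_smooth_coord[where f = "\<lambda>x. 1" and f' = "\<lambda>_. 0" and C = 1 and N = 0 and u = 0] by simp

section \<open>Integration by parts for path functionals\<close>

context isonormal_process begin

lemma integrable_growth:
  assumes "finite S"
  shows "integrable M (\<lambda>\<omega>. (1 + (\<Sum>h\<in>S. \<bar>X h \<omega>\<bar>)) ^ N)"
  using assms
proof (induction arbitrary: N)
  case empty then show ?case by simp
next
  case (insert h S)
  let ?s = "\<lambda>\<omega>. 1 + (\<Sum>h\<in>S. \<bar>X h \<omega>\<bar>)"
  show ?case
  proof (rule Bochner_Integration.integrable_bound)
    show "integrable M (\<lambda>\<omega>. 2 ^ N * (?s \<omega> ^ N + \<bar>X h \<omega> ^ N\<bar>))"
      by (intro integrable_mult_right Bochner_Integration.integrable_add insert.IH integrable_abs integrable_X_power)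
    have "norm ((1 + (\<Sum>h\<in>insert h S. \<bar>X h \<omega>\<bar>)) ^ N) \<le> norm (2 ^ N * (?s \<omega> ^ N + \<bar>X h \<omega> ^ N\<bar>))" for \<omega>
    proof -
      have s: "?s \<omega> \<ge> 0" by (intro add_nonneg_nonneg sum_nonneg) auto
      have e: "1 + (\<Sum>h\<in>insert h S. \<bar>X h \<omega>\<bar>) = ?s \<omega> + \<bar>X h \<omega>\<bar>" using insert(1,2) by simp
      have "norm ((1 + (\<Sum>h\<in>insert h S. \<bar>X h \<omega>\<bar>)) ^ N) = (?s \<omega> + \<bar>X h \<omega>\<bar>) ^ N"
        unfolding e using s by (simp only: norm_power) simp
      also have "\<dots> \<le> 2 ^ N * (?s \<omega> ^ N + \<bar>X h \<omega>\<bar> ^ N)"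
        using s by (intro power_add_le) auto
      finally show ?thesis using s by (simp add: power_abs)
    qed
    then show "AE \<omega> in M. norm ((1 + (\<Sum>h\<in>insert h S. \<bar>X h \<omega>\<bar>)) ^ N) \<le> norm (2 ^ N * (?s \<omega> ^ N + \<bar>X h \<omega> ^ N\<bar>))" by simp
  qed simp
qed

text \<open>The last part carries a measurability premise because \<open>path_smooth\<close> records
  continuity of \<open>DF\<close> only after pairing with a fixed vector.\<close>

lemma path_smooth_integrable:
  assumes "path_smooth F DF"
  shows "integrable M (\<lambda>\<omega>. F (path \<omega>))" and "integrable M (\<lambda>\<omega>. inner (DF (path \<omega>)) k)"
    and "(\<lambda>\<omega>. norm (DF (path \<omega>))) \<in> borel_measurable M \<Longrightarrow> integrable M (\<lambda>\<omega>. (norm (DF (path \<omega>)))\<^sup>2)"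
proof -
  obtain S C N where S: "finite S" and b: "\<And>x. \<bar>F x\<bar> \<le> C * (1 + (\<Sum>h\<in>S. \<bar>x h\<bar>)) ^ N" "\<And>x. norm (DF x) \<le> C * (1 + (\<Sum>h\<in>S. \<bar>x h\<bar>)) ^ N"
    using assms(1) unfolding path_smooth_def by blast
  have i: "integrable M (\<lambda>\<omega>. K * (1 + (\<Sum>h\<in>S. \<bar>X h \<omega>\<bar>)) ^ N)" for K N
    by (intro integrable_mult_right integrable_growth S)
  show "integrable M (\<lambda>\<omega>. F (path \<omega>))"
    by (rule Bochner_Integration.integrable_bound[OF i[of C N]])
       (use b(1) path_smooth_measurable(1)[OF assms X_measurable] in \<open>auto intro: order.trans[OF _ abs_ge_self]\<close>)
  have "\<bar>inner (DF x) k\<bar> \<le> (C * norm k) * (1 + (\<Sum>h\<in>S. \<bar>x h\<bar>)) ^ N" for x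
  proof -
    have "\<bar>inner (DF x) k\<bar> \<le> norm (DF x) * norm k" by (rule Cauchy_Schwarz_ineq2)
    also have "\<dots> \<le> (C * (1 + (\<Sum>h\<in>S. \<bar>x h\<bar>)) ^ N) * norm k" by (intro mult_right_mono b) auto
    finally show ?thesis by (simp add: mult_ac)
  qed
  then show "integrable M (\<lambda>\<omega>. inner (DF (path \<omega>)) k)"
    by (intro Bochner_Integration.integrable_bound[OF i[of "C * norm k" N]])
       (use path_smooth_measurable(2)[OF assms X_measurable] in \<open>auto intro: order.trans[OF _ abs_ge_self]\<close>)
  have n2: "(norm (DF x))\<^sup>2 \<le> C\<^sup>2 * (1 + (\<Sum>h\<in>S. \<bar>x h\<bar>)) ^ (2 * N)" for x
    using power_mono[OF b(2)[of x], of 2] by (simp add: power_mult_distrib power_mult[symmetric] mult.commute)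
  show "integrable M (\<lambda>\<omega>. (norm (DF (path \<omega>)))\<^sup>2)" if "(\<lambda>\<omega>. norm (DF (path \<omega>))) \<in> borel_measurable M"
    by (rule Bochner_Integration.integrable_bound[OF i[of "C\<^sup>2" "2 * N"]])
       (use n2 that in \<open>auto intro: order.trans[OF _ abs_ge_self]\<close>)
qed

lemma path_smooth_integrable_X: "path_smooth F DF \<Longrightarrow> integrable M (\<lambda>\<omega>. X k \<omega> * F (path \<omega>))"
  using path_smooth_integrable(1)[OF path_smooth_mult[OF path_smooth_eval[of k]]] by simp

text \<open>Moments of the product measure are inherited from \<open>X\<close>, whose coordinates
  along \<open>e\<close> realise it.\<close>

lemma integrable_PiM_growth:
  fixes e :: "nat \<Rightarrow> 'h"
  assumes on: "orthonormal n e"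
  shows "integrable (Pi\<^sub>M {..<n} (\<lambda>_. std_normal_distribution)) (\<lambda>y. (1 + (\<Sum>i<n. \<bar>y i\<bar>)) ^ N)"
proof -
  have [measurable]: "(\<lambda>y. (1 + (\<Sum>i<n. \<bar>y i\<bar>)) ^ N :: real) \<in> borel_measurable (Pi\<^sub>M {..<n} (\<lambda>_. borel))"
    by measurable
  have "integrable M (\<lambda>\<omega>. (1 + (\<Sum>h\<in>e ` {..<n}. \<bar>X h \<omega>\<bar>)) ^ N)" by (rule integrable_growth) simp
  moreover have "inj_on e {..<n}" by (rule orthonormal_inj_on[OF on])
  ultimately have "integrable M (\<lambda>\<omega>. (1 + (\<Sum>i<n. \<bar>X (e i) \<omega>\<bar>)) ^ N)" by (simp add: sum.reindex)
  then have "integrable (distr M (Pi\<^sub>M {..<n} (\<lambda>_. borel)) (\<lambda>\<omega>. \<lambda>i\<in>{..<n}. X (e i) \<omega>)) (\<lambda>y. (1 + (\<Sum>i<n. \<bar>y i\<bar>)) ^ N)"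
    by (subst integrable_distr_eq) auto
  then show ?thesis unfolding law_orthonormal[OF on] .
qed

text \<open>Fubini singles out the coordinate \<open>i\<close>, and the one-dimensional formula
  applies for every fixed value of the others. Integrability of both sides over the product has to
  be known beforehand.\<close>

lemma gaussian_ibp_coord:
  fixes e :: "nat \<Rightarrow> 'h" and f f' :: "(nat \<Rightarrow> real) \<Rightarrow> real"
  assumes on: "orthonormal n e"
    and i: "i < n"
    and meas: "f \<in> borel_measurable (Pi\<^sub>M {..<n} (\<lambda>_. borel))" "f' \<in> borel_measurable (Pi\<^sub>M {..<n} (\<lambda>_. borel))"
    and d: "\<And>y t. ((\<lambda>t. f (y(i := t))) has_real_derivative f' (y(i := t))) (at t)"
    and c: "\<And>y t. isCont (\<lambda>t. f' (y(i := t))) t"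
    and b: "\<And>y. \<bar>f y\<bar> \<le> C * (1 + (\<Sum>j<n. \<bar>y j\<bar>)) ^ N" "\<And>y. \<bar>f' y\<bar> \<le> C * (1 + (\<Sum>j<n. \<bar>y j\<bar>)) ^ N"
  shows "(\<integral>y. y i * f y \<partial>Pi\<^sub>M {..<n} (\<lambda>_. std_normal_distribution)) = (\<integral>y. f' y \<partial>Pi\<^sub>M {..<n} (\<lambda>_. std_normal_distribution))"
    and "integrable (Pi\<^sub>M {..<n} (\<lambda>_. std_normal_distribution)) (\<lambda>y. y i * f y)"
    and "integrable (Pi\<^sub>M {..<n} (\<lambda>_. std_normal_distribution)) f'"
proof -
  let ?P = "Pi\<^sub>M {..<n} (\<lambda>_. std_normal_distribution)"
  interpret N: real_distribution std_normal_distribution by (rule real_dist_normal_dist)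
  interpret PP: product_sigma_finite "\<lambda>_::nat. std_normal_distribution" by standard
  have sets_eq: "sets ?P = sets (Pi\<^sub>M {..<n} (\<lambda>_. borel))" by (simp cong: sets_PiM_cong)
  have [measurable]: "f \<in> borel_measurable ?P" "f' \<in> borel_measurable ?P"
    using meas by (simp_all cong: measurable_cong_sets add: measurable_cong_sets[OF sets_eq refl])
  have [measurable]: "(\<lambda>y. y i) \<in> borel_measurable ?P"
    using measurable_component_singleton[of i "{..<n}" "\<lambda>_. std_normal_distribution"] i by simp
  have C: "C \<ge> 0" using b(1)[of "\<lambda>_. 0"] by (simp add: order.trans[OF abs_ge_zero])
  let ?s = "\<lambda>y :: nat \<Rightarrow> real. 1 + (\<Sum>j<n. \<bar>y j\<bar>)"
  have s: "?s y \<ge> 0" for y by (intro add_nonneg_nonneg sum_nonneg) auto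
  have yi: "\<bar>y i\<bar> \<le> ?s y" for y
    using member_le_sum[of i "{..<n}" "\<lambda>j. \<bar>y j\<bar>"] i by simp
  have "\<bar>y i * f y\<bar> \<le> C * ?s y ^ Suc N" for y
  proof -
    have "\<bar>y i * f y\<bar> \<le> ?s y * (C * ?s y ^ N)" unfolding abs_mult using s b(1) yi by (intro mult_mono) auto
    then show ?thesis by (simp add: mult_ac)
  qed
  then show i1: "integrable ?P (\<lambda>y. y i * f y)"
    by (intro Bochner_Integration.integrable_bound[OF integrable_mult_right[OF integrable_PiM_growth[OF on], of C "Suc N"]])
       (auto intro: order.trans[OF _ abs_ge_self])
  show i2: "integrable ?P f'"
    by (intro Bochner_Integration.integrable_bound[OF integrable_mult_right[OF integrable_PiM_growth[OF on], of C N]])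
       (use b(2) in \<open>auto intro: order.trans[OF _ abs_ge_self]\<close>)
  let ?J = "{..<n} - {i}"
  have I: "{..<n} = insert i ?J" using i by auto
  have ins: "(\<integral>y. g y \<partial>?P) = (\<integral>x. (\<integral>t. g (x(i := t)) \<partial>std_normal_distribution) \<partial>Pi\<^sub>M ?J (\<lambda>_. std_normal_distribution))"
    if "integrable ?P g" for g :: "_ \<Rightarrow> real"
    using PP.product_integral_insert[of ?J i g] that unfolding I[symmetric] by simp
  have "(\<integral>y. y i * f y \<partial>?P) = (\<integral>x. (\<integral>t. (x(i := t)) i * f (x(i := t)) \<partial>std_normal_distribution) \<partial>Pi\<^sub>M ?J (\<lambda>_. std_normal_distribution))"
    by (rule ins[OF i1])
  also have "\<dots> = (\<integral>x. (\<integral>t. f' (x(i := t)) \<partial>std_normal_distribution) \<partial>Pi\<^sub>M ?J (\<lambda>_. std_normal_distribution))"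
  proof (rule Bochner_Integration.integral_cong[OF refl])
    fix x :: "nat \<Rightarrow> real"
    let ?K = "C * (?s x) ^ N"
    have g: "C * ?s (x(i := t)) ^ N \<le> ?K * (1 + \<bar>t\<bar>) ^ N" for t
    proof -
      have "?s (x(i := t)) \<le> ?s x * (1 + \<bar>t\<bar>)"
      proof -
        have "(\<Sum>j<n. \<bar>(x(i := t)) j\<bar>) = \<bar>t\<bar> + (\<Sum>j\<in>?J. \<bar>x j\<bar>)"
          by (subst I, subst sum.insert) auto
        moreover have "(\<Sum>j\<in>?J. \<bar>x j\<bar>) \<le> (\<Sum>j<n. \<bar>x j\<bar>)" by (intro sum_mono2) auto
        ultimately show ?thesis
          by (simp add: algebra_simps) (intro add_increasing2 mult_nonneg_nonneg sum_nonneg, auto)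
      qed
      then have "C * ?s (x(i := t)) ^ N \<le> C * (?s x * (1 + \<bar>t\<bar>)) ^ N"
        using C s by (intro mult_left_mono power_mono) auto
      then show ?thesis by (simp add: power_mult_distrib mult_ac)
    qed
    have "(\<integral>t. t * f (x(i := t)) \<partial>std_normal_distribution) = (\<integral>t. f' (x(i := t)) \<partial>std_normal_distribution)"
      by (rule gaussian_ibp_real[where C = ?K and N = N]) (rule d c order.trans[OF b(1) g] order.trans[OF b(2) g])+
    then show "(\<integral>t. (x(i := t)) i * f (x(i := t)) \<partial>std_normal_distribution) = (\<integral>t. f' (x(i := t)) \<partial>std_normal_distribution)"
      by simp
  qed
  also have "\<dots> = (\<integral>y. f' y \<partial>?P)"
    by (rule ins[OF i2, symmetric])
  finally show "(\<integral>y. y i * f y \<partial>?P) = (\<integral>y. f' y \<partial>?P)" .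
qed

text \<open>Along an orthonormal basis of the span of \<open>S\<close> and \<open>k\<close> the path
  functional becomes a function of independent standard Gaussians. The vector \<open>k\<close> is
  expanded in this basis, and each coefficient multiplies one coordinate formula.\<close>

theorem gaussian_ibp:
  assumes "path_smooth F DF"
  shows "(\<integral>\<omega>. X k \<omega> * F (path \<omega>) \<partial>M) = (\<integral>\<omega>. inner (DF (path \<omega>)) k \<partial>M)"
proof -
  obtain S C N where S: "finite S" "\<And>x y. (\<forall>h\<in>S. x h = y h) \<Longrightarrow> F x = F y \<and> DF x = DF y"
    and b: "\<And>x. \<bar>F x\<bar> \<le> C * (1 + (\<Sum>h\<in>S. \<bar>x h\<bar>)) ^ N" "\<And>x. norm (DF x) \<le> C * (1 + (\<Sum>h\<in>S. \<bar>x h\<bar>)) ^ N"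
    using assms(1) unfolding path_smooth_def by blast
  have C: "C \<ge> 0" using b(1)[of "\<lambda>_. 0"] by (simp add: order.trans[OF abs_ge_zero])
  have "finite (insert k S)" using S(1) by simp
  from finite_orthonormal_basis[OF this] obtain n and e :: "nat \<Rightarrow> 'h" where on: "orthonormal n e"
    and sp': "\<forall>h\<in>insert k S. h = (\<Sum>i<n. inner h (e i) *\<^sub>R e i)" by blast
  have sp: "h = (\<Sum>i<n. inner h (e i) *\<^sub>R e i)" if "h \<in> insert k S" for h
    using sp' that by blast
  let ?P = "Pi\<^sub>M {..<n} (\<lambda>_. std_normal_distribution)"
  \<comment> \<open>\<open>x y\<close> rebuilds a full path from its basis coordinates
    \<open>y\<close>; it agrees with the true path almost surely on the finitely many vectors that
    matter.\<close>
  define x where "x y h = (\<Sum>i<n. inner h (e i) * y i)" for y :: "nat \<Rightarrow> real" and h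
  define Y where "Y \<omega> = (\<lambda>i\<in>{..<n}. X (e i) \<omega>)" for \<omega>
  have Y[measurable]: "Y \<in> measurable M (Pi\<^sub>M {..<n} (\<lambda>_. borel))" unfolding Y_def by measurable
  have xm: "(\<lambda>y. x y h) \<in> borel_measurable (Pi\<^sub>M {..<n} (\<lambda>_. borel))" for h
    unfolding x_def by measurable
  have AE1: "AE \<omega> in M. \<forall>h\<in>insert k S. X h \<omega> = x (Y \<omega>) h"
  proof (rule AE_finite_allI)
    show "finite (insert k S)" using S(1) by simp
    fix h assume h: "h \<in> insert k S"
    have "AE \<omega> in M. X (\<Sum>i<n. inner h (e i) *\<^sub>R e i) \<omega> = (\<Sum>i<n. inner h (e i) * X (e i) \<omega>)"
      by (rule X_linear) simp
    then show "AE \<omega> in M. X h \<omega> = x (Y \<omega>) h" unfolding sp[OF h, symmetric] by (simp add: x_def Y_def)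
  qed
  then have AE2: "AE \<omega> in M. X k \<omega> = x (Y \<omega>) k \<and> F (path \<omega>) = F (x (Y \<omega>)) \<and> DF (path \<omega>) = DF (x (Y \<omega>))"
  proof eventually_elim
    case (elim \<omega>)
    then have "F (path \<omega>) = F (x (Y \<omega>)) \<and> DF (path \<omega>) = DF (x (Y \<omega>))" by (intro S(2)) auto
    then show ?case using elim by simp
  qed
  define f where "f y = F (x y)" for y
  define f' where "f' i y = inner (DF (x y)) (e i)" for i y
  have fm: "f \<in> borel_measurable (Pi\<^sub>M {..<n} (\<lambda>_. borel))" "f' i \<in> borel_measurable (Pi\<^sub>M {..<n} (\<lambda>_. borel))" for i
    using path_smooth_measurable[OF assms, of "\<lambda>h y. x y h"] xm unfolding f_def[abs_def] f'_def[abs_def] by auto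
  \<comment> \<open>Changing the coordinate \<open>i\<close> shifts the rebuilt path in the
    Cameron-Martin direction \<open>e i\<close>, so the derivative supplied by
    \<open>path_smooth\<close> is the partial derivative.\<close>
  have upd: "\<exists>z. \<forall>t. x (y(i := t)) = (\<lambda>h. z h + t * inner h (e i))" if "i < n" for y i
  proof (intro exI[of _ "x (y(i := 0))"] allI ext)
    fix t h
    have J: "{..<n} = insert i ({..<n} - {i})" using that by auto
    have *: "x (y(i := t)) h = inner h (e i) * t + (\<Sum>j\<in>{..<n} - {i}. inner h (e j) * y j)" for t
      unfolding x_def by (subst J, subst sum.insert) auto
    show "x (y(i := t)) h = x (y(i := 0)) h + t * inner h (e i)" unfolding * by simp
  qed
  have d: "((\<lambda>t. f (y(i := t))) has_real_derivative f' i (y(i := t))) (at t)" if i: "i < n" for y i t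
  proof -
    obtain z where z: "\<And>t. x (y(i := t)) = (\<lambda>h. z h + t * inner h (e i))" using upd[OF i, of y] by blast
    show ?thesis unfolding f_def f'_def z using assms unfolding path_smooth_def by blast
  qed
  have cont: "isCont (\<lambda>t. f' i (y(i := t))) t" if i: "i < n" for y i t
  proof -
    obtain z where z: "\<And>t. x (y(i := t)) = (\<lambda>h. z h + t * inner h (e i))" using upd[OF i, of y] by blast
    have "continuous_on UNIV (\<lambda>x. inner (DF x) (e i))" using assms unfolding path_smooth_def by blast
    then have "continuous_on UNIV (\<lambda>t. inner (DF (\<lambda>h. z h + t * inner h (e i))) (e i))"
      by (rule continuous_on_compose2) (intro continuous_on_coordinatewise_then_product continuous_intros, auto)
    then show ?thesis unfolding f'_def z by (simp add: continuous_on_eq_continuous_at)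
  qed
  define L where "L = 1 + (\<Sum>h\<in>S. norm h)"
  have L: "L \<ge> 1" unfolding L_def by (simp add: sum_nonneg)
  let ?s = "\<lambda>y :: nat \<Rightarrow> real. 1 + (\<Sum>j<n. \<bar>y j\<bar>)"
  have gr: "C * (1 + (\<Sum>h\<in>S. \<bar>x y h\<bar>)) ^ N \<le> (C * L ^ N) * ?s y ^ N" for y
  proof -
    have "\<bar>x y h\<bar> \<le> norm h * (\<Sum>j<n. \<bar>y j\<bar>)" for h
    proof -
      have "\<bar>x y h\<bar> \<le> (\<Sum>i<n. \<bar>inner h (e i) * y i\<bar>)" unfolding x_def by (rule sum_abs)
      also have "\<dots> \<le> (\<Sum>i<n. norm h * \<bar>y i\<bar>)"
      proof (intro sum_mono)
        fix i assume "i \<in> {..<n}"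
        then have "norm (e i) = 1" using orthonormalD[OF on, of i i] by (simp add: norm_eq_1)
        then have "\<bar>inner h (e i)\<bar> \<le> norm h" using Cauchy_Schwarz_ineq2[of h "e i"] by simp
        then show "\<bar>inner h (e i) * y i\<bar> \<le> norm h * \<bar>y i\<bar>" by (simp add: abs_mult mult_right_mono)
      qed
      finally show ?thesis by (simp add: sum_distrib_left)
    qed
    then have "(\<Sum>h\<in>S. \<bar>x y h\<bar>) \<le> (\<Sum>h\<in>S. norm h * (\<Sum>j<n. \<bar>y j\<bar>))" by (intro sum_mono)
    then have "1 + (\<Sum>h\<in>S. \<bar>x y h\<bar>) \<le> 1 + (\<Sum>h\<in>S. norm h) * (\<Sum>j<n. \<bar>y j\<bar>)" by (simp add: sum_distrib_right)
    also have "\<dots> \<le> L * ?s y"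
      unfolding L_def by (simp add: algebra_simps sum_nonneg)
    finally have "(1 + (\<Sum>h\<in>S. \<bar>x y h\<bar>)) ^ N \<le> (L * ?s y) ^ N" by (intro power_mono) (auto intro!: add_nonneg_nonneg sum_nonneg)
    then show ?thesis using C by (simp add: power_mult_distrib mult_left_mono mult.assoc)
  qed
  have bf: "\<bar>f y\<bar> \<le> (C * L ^ N) * ?s y ^ N" for y unfolding f_def by (rule order.trans[OF b(1) gr])
  have bf': "\<bar>f' i y\<bar> \<le> (C * L ^ N) * ?s y ^ N" if "i < n" for i y
  proof -
    have "norm (e i) = 1" using orthonormalD[OF on that that] by (simp add: norm_eq_1)
    then have "\<bar>f' i y\<bar> \<le> norm (DF (x y))" unfolding f'_def using Cauchy_Schwarz_ineq2[of "DF (x y)" "e i"] by simp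
    also have "\<dots> \<le> (C * L ^ N) * ?s y ^ N" by (rule order.trans[OF b(2) gr])
    finally show ?thesis .
  qed
  have ibp: "(\<integral>y. y i * f y \<partial>?P) = (\<integral>y. f' i y \<partial>?P)" "integrable ?P (\<lambda>y. y i * f y)" "integrable ?P (f' i)"
    if "i < n" for i
    by (rule gaussian_ibp_coord[OF on that fm(1) fm(2)[of i] d[OF that] cont[OF that] bf bf'[OF that]])+
  have tr: "(\<integral>\<omega>. g (Y \<omega>) \<partial>M) = (\<integral>y. g y \<partial>?P)" if "g \<in> borel_measurable (Pi\<^sub>M {..<n} (\<lambda>_. borel))" for g :: "_ \<Rightarrow> real"
    unfolding law_orthonormal[OF on, symmetric] using that Y unfolding Y_def[abs_def] by (subst integral_distr) auto
  have "(\<integral>\<omega>. X k \<omega> * F (path \<omega>) \<partial>M) = (\<integral>\<omega>. x (Y \<omega>) k * f (Y \<omega>) \<partial>M)"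
    using AE2 path_smooth_measurable(1)[OF assms X_measurable] measurable_compose[OF Y xm] measurable_compose[OF Y fm(1)]
    by (intro integral_cong_AE borel_measurable_times) (auto simp: f_def)
  also have "\<dots> = (\<integral>y. x y k * f y \<partial>?P)" by (rule tr) (intro borel_measurable_times xm fm)
  also have "\<dots> = (\<integral>y. (\<Sum>i<n. inner k (e i) * (y i * f y)) \<partial>?P)"
    unfolding x_def by (simp add: sum_distrib_right mult.assoc)
  also have "\<dots> = (\<Sum>i<n. inner k (e i) * (\<integral>y. f' i y \<partial>?P))"
    by (subst Bochner_Integration.integral_sum) (auto simp: ibp)
  also have "\<dots> = (\<integral>y. (\<Sum>i<n. inner k (e i) * f' i y) \<partial>?P)"
    by (subst Bochner_Integration.integral_sum) (auto simp: ibp)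
  also have "\<dots> = (\<integral>y. inner (DF (x y)) k \<partial>?P)"
    by (subst (2) sp[of k]) (auto simp: f'_def inner_sum_right)
  also have "\<dots> = (\<integral>\<omega>. inner (DF (x (Y \<omega>))) k \<partial>M)"
    using path_smooth_measurable(2)[OF assms, of "\<lambda>h y. x y h"] xm by (intro tr[symmetric]) auto
  also have "\<dots> = (\<integral>\<omega>. inner (DF (path \<omega>)) k \<partial>M)"
    using AE2 path_smooth_measurable(2)[OF assms X_measurable] measurable_compose[OF Y path_smooth_measurable(2)[OF assms, of "\<lambda>h y. x y h"]] xm
    by (intro integral_cong_AE) auto
  finally show ?thesis .
qed

section \<open>Products of Hermite polynomials\<close>

text \<open>The recurrence produces \<open>X h\<close> times \<open>nherm (a - 1)\<close>, and
  integration by parts differentiates either factor. Since \<open>h\<close> is a unit vector, the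
  derivative of the Hermite factor cancels the term with \<open>nherm (a - 2)\<close>; only the
  derivative of \<open>R\<close> survives, that is, an edge leaving the vertex
  \<open>h\<close>.\<close>

lemma nherm_slot:
  assumes h: "norm h = 1" and R: "path_smooth R DR"
  shows "of_int a * (\<integral>\<omega>. nherm a (X h \<omega>) * R (path \<omega>) \<partial>M)
    = (\<integral>\<omega>. nherm (a - 1) (X h \<omega>) * inner (DR (path \<omega>)) h \<partial>M)"
proof -
  have hh: "inner h h = 1" using h by (simp add: norm_eq_1)
  note cm1 = path_smooth_mult[OF path_smooth_nherm[of "a - 1" h] R] and cm2 = path_smooth_mult[OF path_smooth_nherm[of "a - 2" h] R]
  have D: "inner (nherm (a - 1) (X h \<omega>) *\<^sub>R DR (path \<omega>) + R (path \<omega>) *\<^sub>R nherm (a - 1 - 1) (X h \<omega>) *\<^sub>R h) h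
     = nherm (a - 1) (X h \<omega>) * inner (DR (path \<omega>)) h + nherm (a - 2) (X h \<omega>) * R (path \<omega>)" for \<omega>
    using hh by (simp add: inner_add_left)
  have i2: "integrable M (\<lambda>\<omega>. nherm (a - 2) (X h \<omega>) * R (path \<omega>))" by (rule path_smooth_integrable(1)[OF cm2])
  have i3: "integrable M (\<lambda>\<omega>. nherm (a - 1) (X h \<omega>) * inner (DR (path \<omega>)) h + nherm (a - 2) (X h \<omega>) * R (path \<omega>))"
    using path_smooth_integrable(2)[OF cm1, of h] unfolding D .
  have i4: "integrable M (\<lambda>\<omega>. nherm (a - 1) (X h \<omega>) * inner (DR (path \<omega>)) h)"
    using Bochner_Integration.integrable_diff[OF i3 i2] by simp
  have "of_int a * (\<integral>\<omega>. nherm a (X h \<omega>) * R (path \<omega>) \<partial>M)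
    = (\<integral>\<omega>. (of_int a * nherm a (X h \<omega>)) * R (path \<omega>) \<partial>M)"
    by (simp add: mult.assoc)
  also have "\<dots> = (\<integral>\<omega>. X h \<omega> * (nherm (a - 1) (X h \<omega>) * R (path \<omega>)) - nherm (a - 2) (X h \<omega>) * R (path \<omega>) \<partial>M)"
    unfolding nherm_step by (simp add: algebra_simps)
  also have "\<dots> = (\<integral>\<omega>. X h \<omega> * (nherm (a - 1) (X h \<omega>) * R (path \<omega>)) \<partial>M) - (\<integral>\<omega>. nherm (a - 2) (X h \<omega>) * R (path \<omega>) \<partial>M)"
    by (rule Bochner_Integration.integral_diff[OF path_smooth_integrable_X[OF cm1] i2])
  also have "(\<integral>\<omega>. X h \<omega> * (nherm (a - 1) (X h \<omega>) * R (path \<omega>)) \<partial>M)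
    = (\<integral>\<omega>. nherm (a - 1) (X h \<omega>) * inner (DR (path \<omega>)) h + nherm (a - 2) (X h \<omega>) * R (path \<omega>) \<partial>M)"
    using gaussian_ibp[OF cm1, of h] unfolding D .
  also have "\<dots> = (\<integral>\<omega>. nherm (a - 1) (X h \<omega>) * inner (DR (path \<omega>)) h \<partial>M) + (\<integral>\<omega>. nherm (a - 2) (X h \<omega>) * R (path \<omega>) \<partial>M)"
    by (rule Bochner_Integration.integral_add[OF i4 i2])
  finally show ?thesis by simp
qed

text \<open>Each application of the slot rule lowers both orders by one and releases
  \<open>inner h g\<close>. If one order runs out before the other, the mean of a Hermite polynomial
  of positive order remains, which is zero.\<close>

lemma expectation_nherm2:
  assumes "norm h = 1" "norm g = 1"
  shows "(\<integral>\<omega>. nherm (int p) (X h \<omega>) * nherm (int q) (X g \<omega>) \<partial>M) = (if p = q then dpow (int p) (inner h g) else 0)"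
proof (induction p arbitrary: q)
  case 0
  have "real q * (\<integral>\<omega>. nherm (int q) (X g \<omega>) \<partial>M) = 0"
    using nherm_slot[OF assms(2) path_smooth_one, of "int q"] by simp
  then show ?case by (cases "q = 0") (auto simp: prob_space)
next
  case (Suc p)
  have s: "of_int (int (Suc p)) * (\<integral>\<omega>. nherm (int (Suc p)) (X h \<omega>) * nherm (int q) (X g \<omega>) \<partial>M)
    = inner h g * (\<integral>\<omega>. nherm (int p) (X h \<omega>) * nherm (int q - 1) (X g \<omega>) \<partial>M)"
    using nherm_slot[OF assms(1) path_smooth_nherm[of "int q" g], of "int (Suc p)"]
    by (simp add: inner_commute[of g h] mult.assoc mult.left_commute[of _ "inner h g"] mult.commute[of _ "inner h g"])
  show ?case
  proof (cases q)
    case 0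
    then show ?thesis using s by simp
  next
    case (Suc q')
    then have "int q - 1 = int q'" by simp
    then have "of_int (int (Suc p)) * (\<integral>\<omega>. nherm (int (Suc p)) (X h \<omega>) * nherm (int q) (X g \<omega>) \<partial>M)
       = (if p = q' then inner h g * dpow (int p) (inner h g) else 0)" using s Suc.IH[of q'] by simp
    also have "inner h g * dpow (int p) (inner h g) = of_int (int (Suc p)) * dpow (int (Suc p)) (inner h g)"
      using dpow_step[of "int (Suc p)" "inner h g"] by simp
    finally show ?thesis using Suc by (auto simp del: of_nat_Suc split: if_splits)
  qed
qed

section \<open>Diagram formula for four Hermite factors\<close>

definition hermite4 :: "'h \<Rightarrow> 'h \<Rightarrow> 'h \<Rightarrow> 'h \<Rightarrow> int \<Rightarrow> int \<Rightarrow> int \<Rightarrow> int \<Rightarrow> real" where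
  "hermite4 h1 h2 h3 h4 a b c d = (\<integral>\<omega>. nherm a (X h1 \<omega>) * (nherm b (X h2 \<omega>) * (nherm c (X h3 \<omega>) * nherm d (X h4 \<omega>))) \<partial>M)"

lemma integrable_nherm4:
  "integrable M (\<lambda>\<omega>. nherm a (X h1 \<omega>) * (nherm b (X h2 \<omega>) * (nherm c (X h3 \<omega>) * nherm d (X h4 \<omega>))))"
  by (rule path_smooth_integrable(1)[OF path_smooth_mult[OF path_smooth_nherm path_smooth_mult[OF path_smooth_nherm path_smooth_mult[OF path_smooth_nherm path_smooth_nherm]]]])

lemma hermite4_step1:
  assumes "norm h1 = 1"
  shows "of_int a * hermite4 h1 h2 h3 h4 a b c d = inner h1 h2 * hermite4 h1 h2 h3 h4 (a - 1) (b - 1) c d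
     + inner h1 h3 * hermite4 h1 h2 h3 h4 (a - 1) b (c - 1) d + inner h1 h4 * hermite4 h1 h2 h3 h4 (a - 1) b c (d - 1)"
proof -
  have "of_int a * hermite4 h1 h2 h3 h4 a b c d = (\<integral>\<omega>.
      inner h1 h2 * (nherm (a - 1) (X h1 \<omega>) * (nherm (b - 1) (X h2 \<omega>) * (nherm c (X h3 \<omega>) * nherm d (X h4 \<omega>))))
    + inner h1 h3 * (nherm (a - 1) (X h1 \<omega>) * (nherm b (X h2 \<omega>) * (nherm (c - 1) (X h3 \<omega>) * nherm d (X h4 \<omega>))))
    + inner h1 h4 * (nherm (a - 1) (X h1 \<omega>) * (nherm b (X h2 \<omega>) * (nherm c (X h3 \<omega>) * nherm (d - 1) (X h4 \<omega>)))) \<partial>M)"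
    unfolding hermite4_def nherm_slot[OF assms path_smooth_mult[OF path_smooth_nherm path_smooth_mult[OF path_smooth_nherm path_smooth_nherm]]]
    by (intro Bochner_Integration.integral_cong refl) (simp add: inner_add_left inner_commute[of _ h1] algebra_simps)
  also have "\<dots> = inner h1 h2 * hermite4 h1 h2 h3 h4 (a - 1) (b - 1) c d
     + inner h1 h3 * hermite4 h1 h2 h3 h4 (a - 1) b (c - 1) d + inner h1 h4 * hermite4 h1 h2 h3 h4 (a - 1) b c (d - 1)"
    unfolding hermite4_def by (simp add: integrable_nherm4)
  finally show ?thesis .
qed

lemma hermite4_perm:
  "hermite4 h1 h2 h3 h4 a b c d = hermite4 h2 h1 h3 h4 b a c d"
  "hermite4 h1 h2 h3 h4 a b c d = hermite4 h3 h1 h2 h4 c a b d"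
  "hermite4 h1 h2 h3 h4 a b c d = hermite4 h4 h1 h2 h3 d a b c"
  unfolding hermite4_def by (simp_all add: mult_ac)

text \<open>Adding the slot rule over the four vertices counts every edge at both of its ends, hence
  the factor 2 in \<open>2 * m\<close>. The recurrence so obtained treats all six edges alike, as
  the recurrence of the diagram sum does.\<close>

lemma hermite4_total:
  assumes "norm h1 = 1" "norm h2 = 1" "norm h3 = 1" "norm h4 = 1" "a + b + c + d = 2 * m"
  shows "of_int m * hermite4 h1 h2 h3 h4 a b c d = inner h1 h2 * hermite4 h1 h2 h3 h4 (a - 1) (b - 1) c d
     + inner h1 h3 * hermite4 h1 h2 h3 h4 (a - 1) b (c - 1) d + inner h1 h4 * hermite4 h1 h2 h3 h4 (a - 1) b c (d - 1)
     + inner h2 h3 * hermite4 h1 h2 h3 h4 a (b - 1) (c - 1) d + inner h2 h4 * hermite4 h1 h2 h3 h4 a (b - 1) c (d - 1)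
     + inner h3 h4 * hermite4 h1 h2 h3 h4 a b (c - 1) (d - 1)"
proof -
  let ?U = "hermite4 h1 h2 h3 h4"
  have 1: "of_int a * ?U a b c d = inner h1 h2 * ?U (a - 1) (b - 1) c d
     + inner h1 h3 * ?U (a - 1) b (c - 1) d + inner h1 h4 * ?U (a - 1) b c (d - 1)"
    by (rule hermite4_step1[OF assms(1)])
  have 2: "of_int b * ?U a b c d = inner h1 h2 * ?U (a - 1) (b - 1) c d
     + inner h2 h3 * ?U a (b - 1) (c - 1) d + inner h2 h4 * ?U a (b - 1) c (d - 1)"
    using hermite4_step1[OF assms(2), of b h1 h3 h4 a c d] by (simp only: hermite4_perm(1)[of h2 h1] inner_commute[of h2 h1])
  have 3: "of_int c * ?U a b c d = inner h1 h3 * ?U (a - 1) b (c - 1) d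
     + inner h2 h3 * ?U a (b - 1) (c - 1) d + inner h3 h4 * ?U a b (c - 1) (d - 1)"
    using hermite4_step1[OF assms(3), of c h1 h2 h4 a b d] by (simp only: hermite4_perm(2)[of h1 h2 h3 h4] inner_commute[of h3 h1] inner_commute[of h3 h2])
  have 4: "of_int d * ?U a b c d = inner h1 h4 * ?U (a - 1) b c (d - 1)
     + inner h2 h4 * ?U a (b - 1) c (d - 1) + inner h3 h4 * ?U a b (c - 1) (d - 1)"
    using hermite4_step1[OF assms(4), of d h1 h2 h3 a b c] by (simp only: hermite4_perm(3)[of h1 h2 h3 h4] inner_commute[of h4 h1] inner_commute[of h4 h2] inner_commute[of h4 h3])
  have "2 * (of_int m * ?U a b c d) = of_int (a + b + c + d) * ?U a b c d" unfolding assms(5) by simp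
  also have "\<dots> = of_int a * ?U a b c d + of_int b * ?U a b c d + of_int c * ?U a b c d + of_int d * ?U a b c d"
    by (simp add: algebra_simps)
  finally show ?thesis unfolding 1 2 3 4 by simp
qed

end

text \<open>Here \<open>i\<close> and \<open>j\<close> are the numbers of edges between vertices 1, 2 and between 1, 3; the other four edge
  multiplicities are then determined by the degrees \<open>a, b, c, d\<close>, whose sum is \<open>2 m\<close>.\<close>

definition diagram4 :: "nat \<Rightarrow> real \<Rightarrow> real \<Rightarrow> real \<Rightarrow> real \<Rightarrow> real \<Rightarrow> real \<Rightarrow> int \<Rightarrow> int \<Rightarrow> int \<Rightarrow> int \<Rightarrow> int \<Rightarrow> real" where
  "diagram4 K r12 r13 r14 r23 r24 r34 a b c d m = (\<Sum>i=0..K. \<Sum>j=0..K.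
     dpow (int i) r12 * dpow (int j) r13 * dpow (a - int i - int j) r14 *
     dpow (m - d - int i - int j) r23 * dpow (int j + b + d - m) r24 * dpow (int i + c + d - m) r34)"

lemma sum_shift_int:
  fixes f :: "int \<Rightarrow> real"
  assumes "f 0 = 0" "f (int (Suc K)) = 0"
  shows "(\<Sum>i=0..K. f (int i)) = (\<Sum>i=0..K. f (int i + 1))"
proof -
  have "(\<Sum>i=0..K. f (int i)) = (\<Sum>i=0..Suc K. f (int i))" using assms(2) by simp
  also have "\<dots> = f (int 0) + (\<Sum>i=0..K. f (int (Suc i)))" by (simp only: sum.atLeast0_atMost_Suc_shift comp_def of_nat_0)
  finally show ?thesis using assms(1) by (simp add: algebra_simps)
qed

text \<open>The six multiplicities add up to \<open>m\<close>, and \<open>dpow_step\<close> lowers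
  each of them. Lowering the edges 12 and 13 shifts a summation index; the boundary term at
  \<open>K + 1\<close> vanishes because \<open>a \<le> int K\<close> makes the multiplicity of the
  edge 14 negative. For the other four edges the change of degrees and of \<open>m\<close> is
  enough.\<close>

lemma diagram4_total:
  assumes m: "a + b + c + d = 2 * m" and K: "a \<le> int K"
  shows "of_int m * diagram4 K r12 r13 r14 r23 r24 r34 a b c d m =
       r12 * diagram4 K r12 r13 r14 r23 r24 r34 (a - 1) (b - 1) c d (m - 1)
     + r13 * diagram4 K r12 r13 r14 r23 r24 r34 (a - 1) b (c - 1) d (m - 1)
     + r14 * diagram4 K r12 r13 r14 r23 r24 r34 (a - 1) b c (d - 1) (m - 1)
     + r23 * diagram4 K r12 r13 r14 r23 r24 r34 a (b - 1) (c - 1) d (m - 1)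
     + r24 * diagram4 K r12 r13 r14 r23 r24 r34 a (b - 1) c (d - 1) (m - 1)
     + r34 * diagram4 K r12 r13 r14 r23 r24 r34 a b (c - 1) (d - 1) (m - 1)"
proof -
  define t where "t e1 e2 e3 e4 e5 e6 i j =
     dpow (i - e1) r12 * dpow (j - e2) r13 * dpow (a - i - j - e3) r14 *
     dpow (m - d - i - j - e4) r23 * dpow (j + b + d - m - e5) r24 * dpow (i + c + d - m - e6) r34"
    for e1 e2 e3 e4 e5 e6 i j :: int
  let ?S = "\<lambda>f. \<Sum>i=0..K. \<Sum>j=0..K. (f (int i) (int j) :: real)"
  have trm: "of_int m * t 0 0 0 0 0 0 i j = r12 * t 1 0 0 0 0 0 i j + r13 * t 0 1 0 0 0 0 i j + r14 * t 0 0 1 0 0 0 i j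
     + r23 * t 0 0 0 1 0 0 i j + r24 * t 0 0 0 0 1 0 i j + r34 * t 0 0 0 0 0 1 i j" for i j
  proof -
    have mm: "m = i + j + (a - i - j) + (m - d - i - j) + (j + b + d - m) + (i + c + d - m)" using m by simp
    have gen: "of_int (e1 + e2 + e3 + e4 + e5 + e6) * (dpow e1 r12 * dpow e2 r13 * dpow e3 r14 * dpow e4 r23 * dpow e5 r24 * dpow e6 r34)
      = r12 * (dpow (e1 - 1) r12 * dpow e2 r13 * dpow e3 r14 * dpow e4 r23 * dpow e5 r24 * dpow e6 r34)
      + r13 * (dpow e1 r12 * dpow (e2 - 1) r13 * dpow e3 r14 * dpow e4 r23 * dpow e5 r24 * dpow e6 r34)
      + r14 * (dpow e1 r12 * dpow e2 r13 * dpow (e3 - 1) r14 * dpow e4 r23 * dpow e5 r24 * dpow e6 r34)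
      + r23 * (dpow e1 r12 * dpow e2 r13 * dpow e3 r14 * dpow (e4 - 1) r23 * dpow e5 r24 * dpow e6 r34)
      + r24 * (dpow e1 r12 * dpow e2 r13 * dpow e3 r14 * dpow e4 r23 * dpow (e5 - 1) r24 * dpow e6 r34)
      + r34 * (dpow e1 r12 * dpow e2 r13 * dpow e3 r14 * dpow e4 r23 * dpow e5 r24 * dpow (e6 - 1) r34)" for e1 e2 e3 e4 e5 e6
    proof -
      define x1 x2 x3 x4 x5 x6 where x: "x1 = dpow e1 r12" "x2 = dpow e2 r13" "x3 = dpow e3 r14" "x4 = dpow e4 r23" "x5 = dpow e5 r24" "x6 = dpow e6 r34"
      define y1 y2 y3 y4 y5 y6 where y: "y1 = dpow (e1 - 1) r12" "y2 = dpow (e2 - 1) r13" "y3 = dpow (e3 - 1) r14" "y4 = dpow (e4 - 1) r23" "y5 = dpow (e5 - 1) r24" "y6 = dpow (e6 - 1) r34"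
      have s: "of_int e1 * x1 = r12 * y1" "of_int e2 * x2 = r13 * y2" "of_int e3 * x3 = r14 * y3"
        "of_int e4 * x4 = r23 * y4" "of_int e5 * x5 = r24 * y5" "of_int e6 * x6 = r34 * y6"
        unfolding x y by (rule dpow_step)+
      have "of_int (e1 + e2 + e3 + e4 + e5 + e6) * (x1 * x2 * x3 * x4 * x5 * x6)
        = (of_int e1 * x1) * x2 * x3 * x4 * x5 * x6 + x1 * (of_int e2 * x2) * x3 * x4 * x5 * x6
        + x1 * x2 * (of_int e3 * x3) * x4 * x5 * x6 + x1 * x2 * x3 * (of_int e4 * x4) * x5 * x6
        + x1 * x2 * x3 * x4 * (of_int e5 * x5) * x6 + x1 * x2 * x3 * x4 * x5 * (of_int e6 * x6)"
        by (simp add: algebra_simps)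
      then show ?thesis unfolding s unfolding x y by (simp only: mult_ac)
    qed
    show ?thesis
      using gen[of i j "a - i - j" "m - d - i - j" "j + b + d - m" "i + c + d - m", folded mm] unfolding t_def by simp
  qed
  have "of_int m * diagram4 K r12 r13 r14 r23 r24 r34 a b c d m = ?S (\<lambda>i j. of_int m * t 0 0 0 0 0 0 i j)"
    unfolding diagram4_def t_def sum_distrib_left by simp
  also have "\<dots> = r12 * ?S (t 1 0 0 0 0 0) + r13 * ?S (t 0 1 0 0 0 0) + r14 * ?S (t 0 0 1 0 0 0)
     + r23 * ?S (t 0 0 0 1 0 0) + r24 * ?S (t 0 0 0 0 1 0) + r34 * ?S (t 0 0 0 0 0 1)"
    unfolding trm sum.distrib by (simp only: sum_distrib_left)
  also have "?S (t 1 0 0 0 0 0) = diagram4 K r12 r13 r14 r23 r24 r34 (a - 1) (b - 1) c d (m - 1)"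
  proof -
    have "?S (t 1 0 0 0 0 0) = (\<Sum>i=0..K. \<Sum>j=0..K. t 1 0 0 0 0 0 (int i + 1) (int j))"
      by (rule sum_shift_int[of "\<lambda>i. \<Sum>j=0..K. t 1 0 0 0 0 0 i (int j)"])
         (use K in \<open>auto intro!: sum.neutral simp: t_def\<close>)
    then show ?thesis unfolding diagram4_def t_def by (simp add: algebra_simps)
  qed
  also have "?S (t 0 1 0 0 0 0) = diagram4 K r12 r13 r14 r23 r24 r34 (a - 1) b (c - 1) d (m - 1)"
  proof -
    have "?S (t 0 1 0 0 0 0) = (\<Sum>i=0..K. \<Sum>j=0..K. t 0 1 0 0 0 0 (int i) (int j + 1))"
      by (intro sum.cong refl sum_shift_int) (use K in \<open>auto simp: t_def\<close>)
    then show ?thesis unfolding diagram4_def t_def by (simp add: algebra_simps)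
  qed
  also have "?S (t 0 0 1 0 0 0) = diagram4 K r12 r13 r14 r23 r24 r34 (a - 1) b c (d - 1) (m - 1)"
    unfolding diagram4_def t_def by (simp add: algebra_simps)
  also have "?S (t 0 0 0 1 0 0) = diagram4 K r12 r13 r14 r23 r24 r34 a (b - 1) (c - 1) d (m - 1)"
    unfolding diagram4_def t_def by (simp add: algebra_simps)
  also have "?S (t 0 0 0 0 1 0) = diagram4 K r12 r13 r14 r23 r24 r34 a (b - 1) c (d - 1) (m - 1)"
    unfolding diagram4_def t_def by (simp add: algebra_simps)
  also have "?S (t 0 0 0 0 0 1) = diagram4 K r12 r13 r14 r23 r24 r34 a b (c - 1) (d - 1) (m - 1)"
    unfolding diagram4_def t_def by (simp add: algebra_simps)
  finally show ?thesis .
qed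

text \<open>Both sides obey the same recurrence in the number \<open>m\<close> of edges, and
  \<open>m + 1\<close> can be cancelled. The degrees may become negative during the induction, where
  both sides are zero.\<close>

lemma (in isonormal_process) hermite4_eq_diagram4:
  assumes n: "norm h1 = 1" "norm h2 = 1" "norm h3 = 1" "norm h4 = 1"
  shows "a + b + c + d = 2 * int m \<Longrightarrow> a \<le> int K \<Longrightarrow> hermite4 h1 h2 h3 h4 a b c d
    = diagram4 K (inner h1 h2) (inner h1 h3) (inner h1 h4) (inner h2 h3) (inner h2 h4) (inner h3 h4) a b c d (int m)"
proof (induction m arbitrary: a b c d)
  case 0
  show ?case
  proof (cases "a < 0 \<or> b < 0 \<or> c < 0 \<or> d < 0")
    case True
    then have "hermite4 h1 h2 h3 h4 a b c d = 0" unfolding hermite4_def by auto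
    moreover have "diagram4 K (inner h1 h2) (inner h1 h3) (inner h1 h4) (inner h2 h3) (inner h2 h4) (inner h3 h4) a b c d (int 0) = 0"
      unfolding diagram4_def
    proof (intro sum.neutral ballI)
      fix i j :: nat
      \<comment> \<open>The six multiplicities add up to \<open>m = 0\<close>, so if none were
        negative all would vanish, and with them all four degrees.\<close>
      have "a - int i - int j < 0 \<or> int 0 - d - int i - int j < 0 \<or> int j + b + d - int 0 < 0 \<or> int i + c + d - int 0 < 0"
        using True 0 by linarith
      then show "dpow (int i) (inner h1 h2) * dpow (int j) (inner h1 h3) * dpow (a - int i - int j) (inner h1 h4) *
           dpow (int 0 - d - int i - int j) (inner h2 h3) * dpow (int j + b + d - int 0) (inner h2 h4) *
           dpow (int i + c + d - int 0) (inner h3 h4) = 0" by (elim disjE) simp_all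
    qed
    ultimately show ?thesis by simp
  next
    case False
    then have z: "a = 0" "b = 0" "c = 0" "d = 0" using 0 by linarith+
    have "diagram4 K (inner h1 h2) (inner h1 h3) (inner h1 h4) (inner h2 h3) (inner h2 h4) (inner h3 h4) a b c d (int 0)
      = (\<Sum>i\<in>{0..K}. if i = 0 then (\<Sum>j\<in>{0..K}. if j = 0 then 1 else 0) else 0)"
      unfolding diagram4_def z
    proof (intro sum.cong refl)
      fix i
      show "(\<Sum>j=0..K. dpow (int i) (inner h1 h2) * dpow (int j) (inner h1 h3) * dpow (0 - int i - int j) (inner h1 h4) *
           dpow (int 0 - 0 - int i - int j) (inner h2 h3) * dpow (int j + 0 + 0 - int 0) (inner h2 h4) *
           dpow (int i + 0 + 0 - int 0) (inner h3 h4)) = (if i = 0 then (\<Sum>j\<in>{0..K}. if j = 0 then 1 else 0) else 0)"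
      proof (cases "i = 0")
        case True
        show ?thesis unfolding True by (subst if_P[OF refl], intro sum.cong refl) auto
      qed (auto intro!: sum.neutral)
    qed
    also have "\<dots> = 1" by simp
    finally show ?thesis unfolding hermite4_def z by (simp add: prob_space)
  qed
next
  case (Suc m)
  have "of_int (int (Suc m)) * hermite4 h1 h2 h3 h4 a b c d =
     of_int (int (Suc m)) * diagram4 K (inner h1 h2) (inner h1 h3) (inner h1 h4) (inner h2 h3) (inner h2 h4) (inner h3 h4) a b c d (int (Suc m))"
  proof -
    have m: "int (Suc m) - 1 = int m" by simp
    note IH = Suc.IH[of "a - 1" "b - 1" c d] Suc.IH[of "a - 1" b "c - 1" d] Suc.IH[of "a - 1" b c "d - 1"]
      Suc.IH[of a "b - 1" "c - 1" d] Suc.IH[of a "b - 1" c "d - 1"] Suc.IH[of a b "c - 1" "d - 1"]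
    show ?thesis
      unfolding hermite4_total[OF n Suc.prems(1)] diagram4_total[OF Suc.prems] m
      using Suc.prems by (simp add: IH)
  qed
  then show ?case by (simp del: of_nat_Suc)
qed

section \<open>Finite chaos combinations\<close>

lemma ex_parseval:
  assumes "finite S"
  shows "\<exists>B. parseval B S"
proof -
  obtain n and e :: "nat \<Rightarrow> 'a" where on: "orthonormal n e" and sp: "\<forall>h\<in>S. h = (\<Sum>i<n. inner h (e i) *\<^sub>R e i)"
    using finite_orthonormal_basis[OF assms] by blast
  have inj: "inj_on e {..<n}" by (rule orthonormal_inj_on[OF on])
  have "parseval (e ` {..<n}) S"
  proof
    fix h g assume "h \<in> S" "g \<in> S"
    have "inner h g = inner (\<Sum>i<n. inner h (e i) *\<^sub>R e i) g" using sp \<open>h \<in> S\<close> by metis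
    also have "\<dots> = (\<Sum>i<n. inner h (e i) * inner g (e i))"
      by (simp add: inner_sum_left inner_commute[of "e _" g])
    finally show "inner h g = (\<Sum>i\<in>e ` {..<n}. inner h i * inner g i)" using inj by (simp add: sum.reindex)
  qed (use assms in auto)
  then show ?thesis by blast
qed

context isonormal_process begin

definition chaos_sum :: "'h set \<Rightarrow> ('h \<Rightarrow> real) \<Rightarrow> nat \<Rightarrow> 'a \<Rightarrow> real" where
  "chaos_sum S a p \<omega> = (\<Sum>h\<in>S. a h * nherm (int p) (X h \<omega>))"

definition chaos_sum_deriv :: "'h set \<Rightarrow> ('h \<Rightarrow> real) \<Rightarrow> nat \<Rightarrow> 'a \<Rightarrow> 'h" where
  "chaos_sum_deriv S a p \<omega> = (\<Sum>h\<in>S. (a h * nherm (int p - 1) (X h \<omega>)) *\<^sub>R h)"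

lemma nherm_X_measurable [measurable]: "(\<lambda>\<omega>. nherm n (X h \<omega>)) \<in> borel_measurable M"
  by (rule measurable_compose[OF X_measurable borel_measurable_continuous_onI[OF continuous_nherm]])

lemma chaos_sum_measurable [measurable]: "chaos_sum S a p \<in> borel_measurable M"
  unfolding chaos_sum_def[abs_def] by measurable

lemma chaos_sum_deriv_measurable [measurable]: "chaos_sum_deriv S a p \<in> borel_measurable M"
  unfolding chaos_sum_deriv_def[abs_def] by measurable

lemma chaos_sum_mult: "chaos_sum S a p \<omega> * chaos_sum S b q \<omega> =
    (\<Sum>x\<in>S \<times> S. a (fst x) * b (snd x) * (nherm (int p) (X (fst x) \<omega>) * nherm (int q) (X (snd x) \<omega>)))"
  unfolding chaos_sum_def sum_product sum.cartesian_product by (intro sum.cong refl) auto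

lemma inner_chaos_sum_deriv: "inner (chaos_sum_deriv S a p \<omega>) (chaos_sum_deriv S b q \<omega>) =
    (\<Sum>x\<in>S \<times> S. a (fst x) * b (snd x) * inner (fst x) (snd x) * (nherm (int p - 1) (X (fst x) \<omega>) * nherm (int q - 1) (X (snd x) \<omega>)))"
proof -
  have "inner (chaos_sum_deriv S a p \<omega>) (chaos_sum_deriv S b q \<omega>) = (\<Sum>h\<in>S. \<Sum>g\<in>S. (a h * nherm (int p - 1) (X h \<omega>)) * ((b g * nherm (int q - 1) (X g \<omega>)) * inner h g))"
    unfolding chaos_sum_deriv_def by (simp add: inner_sum_left inner_sum_right sum_distrib_left) (subst sum.swap, simp add: mult_ac)
  then show ?thesis unfolding sum.cartesian_product by (simp add: case_prod_unfold mult_ac)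
qed

lemma integrable_nherm2: "integrable M (\<lambda>\<omega>. nherm a (X h \<omega>) * nherm b (X g \<omega>))"
  by (rule path_smooth_integrable(1)[OF path_smooth_mult[OF path_smooth_nherm path_smooth_nherm]])

lemma square_sum: "(\<Sum>x\<in>A. w x * f x)\<^sup>2 = (\<Sum>x\<in>A. \<Sum>y\<in>A. w x * w y * (f x * f y :: real))"
  unfolding power2_eq_square sum_product by (intro sum.cong refl) (simp add: mult_ac)

text \<open>The vertices are listed as \<open>fst x\<close>, \<open>snd x\<close>,
  \<open>snd y\<close>, \<open>fst y\<close>, so that in \<open>diagram4\<close> the edge 12 lies
  within one copy of the product and the edge 13 joins the first factor to the second factor of the
  other copy.\<close>

lemma integrable_sum_nherm4:
  "integrable M (\<lambda>\<omega>. (\<Sum>x\<in>A. w x * (nherm a (X (fst x) \<omega>) * nherm b (X (snd x) \<omega>)))\<^sup>2)"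
  "(\<integral>\<omega>. (\<Sum>x\<in>A. w x * (nherm a (X (fst x) \<omega>) * nherm b (X (snd x) \<omega>)))\<^sup>2 \<partial>M)
     = (\<Sum>x\<in>A. \<Sum>y\<in>A. w x * w y * hermite4 (fst x) (snd x) (snd y) (fst y) a b b a)"
proof -
  have e: "(\<Sum>x\<in>A. w x * (nherm a (X (fst x) \<omega>) * nherm b (X (snd x) \<omega>)))\<^sup>2
    = (\<Sum>x\<in>A. \<Sum>y\<in>A. w x * w y * (nherm a (X (fst x) \<omega>) * (nherm b (X (snd x) \<omega>) * (nherm b (X (snd y) \<omega>) * nherm a (X (fst y) \<omega>)))))" for \<omega>
    unfolding square_sum by (intro sum.cong refl) (simp add: mult_ac)
  show "integrable M (\<lambda>\<omega>. (\<Sum>x\<in>A. w x * (nherm a (X (fst x) \<omega>) * nherm b (X (snd x) \<omega>)))\<^sup>2)"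
    unfolding e by (intro Bochner_Integration.integrable_sum integrable_mult_right integrable_nherm4)
  show "(\<integral>\<omega>. (\<Sum>x\<in>A. w x * (nherm a (X (fst x) \<omega>) * nherm b (X (snd x) \<omega>)))\<^sup>2 \<partial>M)
     = (\<Sum>x\<in>A. \<Sum>y\<in>A. w x * w y * hermite4 (fst x) (snd x) (snd y) (fst y) a b b a)"
    unfolding e hermite4_def
    by (subst Bochner_Integration.integral_sum, intro Bochner_Integration.integrable_sum integrable_mult_right integrable_nherm4,
        intro sum.cong refl, subst Bochner_Integration.integral_sum, intro integrable_mult_right integrable_nherm4, simp)
qed

lemma integrable_chaos_sum_mult: "integrable M (\<lambda>\<omega>. chaos_sum S a p \<omega> * chaos_sum S b q \<omega>)"
  unfolding chaos_sum_mult by (intro Bochner_Integration.integrable_sum integrable_mult_right integrable_nherm2)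

lemma expectation_chaos_sum_mult:
  assumes "\<forall>h\<in>S. norm h = 1"
  shows "(\<integral>\<omega>. chaos_sum S a p \<omega> * chaos_sum S b q \<omega> \<partial>M) = (if p = q then Gsum S a b p else 0)"
proof -
  have "(\<integral>\<omega>. chaos_sum S a p \<omega> * chaos_sum S b q \<omega> \<partial>M) = (\<Sum>x\<in>S \<times> S. a (fst x) * b (snd x) * (if p = q then dpow (int p) (inner (fst x) (snd x)) else 0))"
    unfolding chaos_sum_mult
    by (subst Bochner_Integration.integral_sum, intro integrable_mult_right integrable_nherm2)
       (use assms in \<open>auto intro!: sum.cong simp: expectation_nherm2\<close>)
  then show ?thesis by (auto simp: Gsum_def sum.cartesian_product case_prod_unfold)
qed

lemma integrable_inner_chaos_sum_deriv: "integrable M (\<lambda>\<omega>. inner (chaos_sum_deriv S a p \<omega>) (chaos_sum_deriv S b q \<omega>))"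
  unfolding inner_chaos_sum_deriv by (intro Bochner_Integration.integrable_sum integrable_mult_right integrable_nherm2)

lemma expectation_inner_chaos_sum_deriv:
  assumes "\<forall>h\<in>S. norm h = 1" "p \<ge> 1" "q \<ge> 1"
  shows "(\<integral>\<omega>. inner (chaos_sum_deriv S a p \<omega>) (chaos_sum_deriv S b q \<omega>) \<partial>M) = (if p = q then real p * Gsum S a b p else 0)"
proof -
  have pq: "int p - 1 = int (p - 1)" "int q - 1 = int (q - 1)" "p - Suc 0 = q - Suc 0 \<longleftrightarrow> p = q" using assms by auto
  have "(\<integral>\<omega>. inner (chaos_sum_deriv S a p \<omega>) (chaos_sum_deriv S b q \<omega>) \<partial>M) = (\<Sum>x\<in>S \<times> S. a (fst x) * b (snd x) * inner (fst x) (snd x) * (if p = q then dpow (int p - 1) (inner (fst x) (snd x)) else 0))"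
    unfolding inner_chaos_sum_deriv
    by (subst Bochner_Integration.integral_sum, intro integrable_mult_right integrable_nherm2)
       (use assms(1) in \<open>auto intro!: sum.cong simp: expectation_nherm2 pq\<close>)
  also have "\<dots> = (if p = q then real p * Gsum S a b p else 0)"
  proof -
    have "a h * b g * inner h g * dpow (int p - 1) (inner h g) = real p * (a h * b g * dpow (int p) (inner h g))" for h g
      using dpow_step[of "int p" "inner h g"] by (simp add: mult_ac)
    then have "(\<Sum>x\<in>S \<times> S. a (fst x) * b (snd x) * inner (fst x) (snd x) * dpow (int p - 1) (inner (fst x) (snd x)))
      = (\<Sum>x\<in>S \<times> S. real p * (a (fst x) * b (snd x) * dpow (int p) (inner (fst x) (snd x))))"
      by (intro sum.cong refl)
    then show ?thesis by (auto simp: Gsum_def sum.cartesian_product case_prod_unfold sum_distrib_left)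
  qed
  finally show ?thesis .
qed

lemma integrable_chaos_sum4: "integrable M (\<lambda>\<omega>. (chaos_sum S a p \<omega> * chaos_sum S b q \<omega>)\<^sup>2)"
  unfolding chaos_sum_mult by (rule integrable_sum_nherm4)

text \<open>For degrees \<open>p, q, q, p\<close> there are \<open>m = p + q\<close> edges, and the
  multiplicities collapse to the symmetric pattern of \<open>Tsum\<close>: \<open>r\<close> twice,
  \<open>s\<close> twice, \<open>p - r - s\<close> and \<open>q - r - s\<close>.\<close>

lemma hermite4_Tsum:
  assumes "norm h = 1" "norm g = 1" "norm h' = 1" "norm g' = 1" "p \<le> K"
  shows "hermite4 h g g' h' (int p) (int q) (int q) (int p) = (\<Sum>r=0..K. \<Sum>s=0..K.
     dpow (int r) (inner h g) * dpow (int s) (inner h g') * dpow (int p - int r - int s) (inner h h') *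
     dpow (int q - int r - int s) (inner g g') * dpow (int s) (inner g h') * dpow (int r) (inner h' g'))"
  using hermite4_eq_diagram4[of h g g' h' "int p" "int q" "int q" "int p" "p + q" K] assms
  by (simp add: diagram4_def inner_commute[of g' h'])

lemma expectation_chaos_sum4:
  assumes n: "\<forall>h\<in>S. norm h = 1" and K: "p \<le> K"
  shows "(\<integral>\<omega>. (chaos_sum S a p \<omega> * chaos_sum S b q \<omega>)\<^sup>2 \<partial>M) = (\<Sum>r=0..K. Ssum S a b p q K r)"
proof -
  have "(\<integral>\<omega>. (chaos_sum S a p \<omega> * chaos_sum S b q \<omega>)\<^sup>2 \<partial>M) = (\<Sum>x\<in>S \<times> S. \<Sum>y\<in>S \<times> S. \<Sum>r=0..K. \<Sum>s=0..K. a (fst x) * b (snd x) * (a (fst y) * b (snd y)) *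
     (dpow (int r) (inner (fst x) (snd x)) * dpow (int s) (inner (fst x) (snd y)) *
      dpow (int p - int r - int s) (inner (fst x) (fst y)) * dpow (int q - int r - int s) (inner (snd x) (snd y)) *
      dpow (int s) (inner (snd x) (fst y)) * dpow (int r) (inner (fst y) (snd y))))"
    unfolding chaos_sum_mult integrable_sum_nherm4(2)
    by (intro sum.cong refl, subst hermite4_Tsum[OF _ _ _ _ K]) (use n in \<open>auto simp: sum_distrib_left\<close>)
  also have "\<dots> = (\<Sum>r=0..K. Ssum S a b p q K r)"
    unfolding Ssum_def Tsum_def by (subst sum_swap3[symmetric], intro sum.cong refl, subst sum_swap3[symmetric]) (rule refl)
  finally show ?thesis .
qed

lemma integrable_inner_chaos_sum_deriv_sq: "integrable M (\<lambda>\<omega>. (inner (chaos_sum_deriv S a p \<omega>) (chaos_sum_deriv S b q \<omega>))\<^sup>2)"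
  unfolding inner_chaos_sum_deriv by (rule integrable_sum_nherm4)

text \<open>The inner product of the derivatives contributes a factor \<open>inner h g\<close> in
  each copy, which is one more edge between \<open>F\<close> and \<open>G\<close>. By
  \<open>dpow_step\<close> it turns \<open>dpow r\<close> into \<open>(r + 1)\<close> times
  \<open>dpow (r + 1)\<close>, and the two copies together give the square.\<close>

lemma expectation_inner_chaos_sum_deriv_sq:
  assumes n: "\<forall>h\<in>S. norm h = 1" and K: "p \<le> K" and pq: "p \<ge> 1" "q \<ge> 1"
  shows "(\<integral>\<omega>. (inner (chaos_sum_deriv S a p \<omega>) (chaos_sum_deriv S b q \<omega>))\<^sup>2 \<partial>M) = (\<Sum>r=0..K. (real r)\<^sup>2 * Ssum S a b p q K r)"
proof -
  define f where "f x y s r = (of_int r)\<^sup>2 * (a (fst x) * b (snd x) * (a (fst y) * b (snd y)) *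
     (dpow r (inner (fst x) (snd x)) * dpow (int s) (inner (fst x) (snd y)) *
      dpow (int p - r - int s) (inner (fst x) (fst y)) * dpow (int q - r - int s) (inner (snd x) (snd y)) *
      dpow (int s) (inner (snd x) (fst y)) * dpow r (inner (fst y) (snd y))))" for x y :: "'h \<times> 'h" and s :: nat and r
  have pq': "int p - 1 = int (p - 1)" "int q - 1 = int (q - 1)" using pq by auto
  have "(\<integral>\<omega>. (inner (chaos_sum_deriv S a p \<omega>) (chaos_sum_deriv S b q \<omega>))\<^sup>2 \<partial>M) = (\<Sum>x\<in>S \<times> S. \<Sum>y\<in>S \<times> S. \<Sum>r=0..K. \<Sum>s=0..K. f x y s (int r + 1))"
    unfolding inner_chaos_sum_deriv integrable_sum_nherm4(2)
  proof (intro sum.cong refl)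
    fix x y assume xy: "x \<in> S \<times> S" "y \<in> S \<times> S"
    let ?i = "inner (fst x) (snd x)" and ?j = "inner (fst y) (snd y)"
    have "hermite4 (fst x) (snd x) (snd y) (fst y) (int p - 1) (int q - 1) (int q - 1) (int p - 1)
      = (\<Sum>r=0..K. \<Sum>s=0..K.
     dpow (int r) ?i * dpow (int s) (inner (fst x) (snd y)) * dpow (int p - 1 - int r - int s) (inner (fst x) (fst y)) *
     dpow (int q - 1 - int r - int s) (inner (snd x) (snd y)) * dpow (int s) (inner (snd x) (fst y)) * dpow (int r) ?j)"
      unfolding pq' by (rule hermite4_Tsum) (use n xy K in auto)
    then have "a (fst x) * b (snd x) * ?i * (a (fst y) * b (snd y) * ?j) *
      hermite4 (fst x) (snd x) (snd y) (fst y) (int p - 1) (int q - 1) (int q - 1) (int p - 1)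
      = (\<Sum>r=0..K. \<Sum>s=0..K. a (fst x) * b (snd x) * (a (fst y) * b (snd y)) * ((?i * dpow (int r) ?i) *
      dpow (int s) (inner (fst x) (snd y)) * dpow (int p - 1 - int r - int s) (inner (fst x) (fst y)) *
     dpow (int q - 1 - int r - int s) (inner (snd x) (snd y)) * dpow (int s) (inner (snd x) (fst y)) * (?j * dpow (int r) ?j)))"
      by (simp add: sum_distrib_left mult_ac)
    also have "\<dots> = (\<Sum>r=0..K. \<Sum>s=0..K. f x y s (int r + 1))"
    proof (intro sum.cong refl)
      fix r s
      have i: "t * dpow (int r) t = of_int (int r + 1) * dpow (int r + 1) t" for t
        using dpow_step[of "int r + 1" t] by simp
      show "a (fst x) * b (snd x) * (a (fst y) * b (snd y)) * ((?i * dpow (int r) ?i) *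
      dpow (int s) (inner (fst x) (snd y)) * dpow (int p - 1 - int r - int s) (inner (fst x) (fst y)) *
     dpow (int q - 1 - int r - int s) (inner (snd x) (snd y)) * dpow (int s) (inner (snd x) (fst y)) * (?j * dpow (int r) ?j)) = f x y s (int r + 1)"
        unfolding i f_def by (simp add: power2_eq_square algebra_simps del: of_int_add)
    qed
    finally show "a (fst x) * b (snd x) * ?i * (a (fst y) * b (snd y) * ?j) *
      hermite4 (fst x) (snd x) (snd y) (fst y) (int p - 1) (int q - 1) (int q - 1) (int p - 1) = (\<Sum>r=0..K. \<Sum>s=0..K. f x y s (int r + 1))" .
  qed
  \<comment> \<open>The index returns from \<open>r + 1\<close> to \<open>r\<close>: the new term at
    \<open>0\<close> carries the weight 0, and the lost one at \<open>K + 1\<close> vanishes since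
    \<open>p \<le> K\<close>.\<close>
  also have "\<dots> = (\<Sum>x\<in>S \<times> S. \<Sum>y\<in>S \<times> S. \<Sum>r=0..K. \<Sum>s=0..K. f x y s (int r))"
    by (intro sum.cong refl sum_shift_int[of "\<lambda>r. \<Sum>s=0..K. f _ _ s r", symmetric])
       (use K in \<open>auto intro!: sum.neutral simp: f_def\<close>)
  also have "\<dots> = (\<Sum>r=0..K. \<Sum>s=0..K. \<Sum>x\<in>S \<times> S. \<Sum>y\<in>S \<times> S. f x y s (int r))"
    by (subst sum_swap3[symmetric], intro sum.cong refl, subst sum_swap3[symmetric]) (rule refl)
  also have "\<dots> = (\<Sum>r=0..K. (real r)\<^sup>2 * Ssum S a b p q K r)"
    unfolding Ssum_def Tsum_def sum_distrib_left f_def by simp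
  finally show ?thesis .
qed

text \<open>A relation between \<open>F\<close> and \<open>D\<close>, because the representation by
  \<open>S\<close> and \<open>a\<close> is not unique: powers of linearly dependent unit vectors can
  satisfy relations. That \<open>D\<close> is determined almost surely by \<open>F\<close> follows
  only from uniqueness of the Malliavin derivative.\<close>

definition finite_chaos :: "nat \<Rightarrow> ('a \<Rightarrow> real) \<Rightarrow> ('a \<Rightarrow> 'h) \<Rightarrow> bool" where
  "finite_chaos p F D \<longleftrightarrow> (\<exists>S a. finite S \<and> (\<forall>h\<in>S. norm h = 1) \<and> F = chaos_sum S a p \<and> D = chaos_sum_deriv S a p)"

lemma chaos_sum_extend:
  assumes "finite T" "S \<subseteq> T"
  shows "chaos_sum S a p = chaos_sum T (\<lambda>h. if h \<in> S then a h else 0) p"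
    and "chaos_sum_deriv S a p = chaos_sum_deriv T (\<lambda>h. if h \<in> S then a h else 0) p"
  using assms unfolding chaos_sum_def[abs_def] chaos_sum_deriv_def[abs_def]
  by (auto intro!: ext sum.mono_neutral_cong_left)

lemma finite_chaos2E:
  assumes "finite_chaos p F D" "finite_chaos q G E"
  obtains S a b where "finite S" "\<forall>h\<in>S. norm h = 1"
    "F = chaos_sum S a p" "D = chaos_sum_deriv S a p" "G = chaos_sum S b q" "E = chaos_sum_deriv S b q"
proof -
  obtain S a where S: "finite S" "\<forall>h\<in>S. norm h = 1" "F = chaos_sum S a p" "D = chaos_sum_deriv S a p"
    using assms(1) unfolding finite_chaos_def by blast
  obtain T b where T: "finite T" "\<forall>h\<in>T. norm h = 1" "G = chaos_sum T b q" "E = chaos_sum_deriv T b q"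
    using assms(2) unfolding finite_chaos_def by blast
  show ?thesis
    by (rule that[of "S \<union> T" "\<lambda>h. if h \<in> S then a h else 0" "\<lambda>h. if h \<in> T then b h else 0"])
       (use S T chaos_sum_extend[of "S \<union> T" S a p] chaos_sum_extend[of "S \<union> T" T b q] in auto)
qed

lemma finite_chaos_diff:
  assumes "finite_chaos p F D" "finite_chaos p G E"
  shows "finite_chaos p (\<lambda>\<omega>. F \<omega> - G \<omega>) (\<lambda>\<omega>. D \<omega> - E \<omega>)"
proof -
  obtain S a b where S: "finite S" "\<forall>h\<in>S. norm h = 1"
    "F = chaos_sum S a p" "D = chaos_sum_deriv S a p" "G = chaos_sum S b p" "E = chaos_sum_deriv S b p"
    using finite_chaos2E[OF assms] by blast
  have "(\<lambda>\<omega>. F \<omega> - G \<omega>) = chaos_sum S (\<lambda>h. a h - b h) p" "(\<lambda>\<omega>. D \<omega> - E \<omega>) = chaos_sum_deriv S (\<lambda>h. a h - b h) p"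
    unfolding S chaos_sum_def[abs_def] chaos_sum_deriv_def[abs_def] by (auto simp: sum_subtractf algebra_simps)
  then show ?thesis unfolding finite_chaos_def using S by blast
qed

section \<open>Moment bounds for finite combinations\<close>

lemma finite_chaos_measurable:
  assumes "finite_chaos p F D"
  shows "F \<in> borel_measurable M" "D \<in> borel_measurable M"
  using assms unfolding finite_chaos_def by auto

lemma finite_chaos_integrable:
  assumes "finite_chaos p F D" "finite_chaos q G E"
  shows "integrable M (\<lambda>\<omega>. F \<omega> * G \<omega>)" "integrable M (\<lambda>\<omega>. (F \<omega> * G \<omega>)\<^sup>2)"
    "integrable M (\<lambda>\<omega>. inner (D \<omega>) (E \<omega>))" "integrable M (\<lambda>\<omega>. (inner (D \<omega>) (E \<omega>))\<^sup>2)"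
  by (rule finite_chaos2E[OF assms], simp add: integrable_chaos_sum_mult integrable_chaos_sum4 integrable_inner_chaos_sum_deriv integrable_inner_chaos_sum_deriv_sq)+

lemma finite_chaos_orthogonal:
  assumes "finite_chaos p F D" "finite_chaos q G E" "p \<noteq> q"
  shows "(\<integral>\<omega>. F \<omega> * G \<omega> \<partial>M) = 0"
  by (rule finite_chaos2E[OF assms(1,2)]) (use assms(3) in \<open>simp add: expectation_chaos_sum_mult\<close>)

lemma finite_chaos_norm_deriv:
  assumes "finite_chaos p F D" "p \<ge> 1"
  shows "(\<integral>\<omega>. (norm (D \<omega>))\<^sup>2 \<partial>M) = real p * (\<integral>\<omega>. (F \<omega>)\<^sup>2 \<partial>M)"
proof -
  obtain S a where S: "finite S" "\<forall>h\<in>S. norm h = 1" "F = chaos_sum S a p" "D = chaos_sum_deriv S a p"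
    using assms(1) unfolding finite_chaos_def by blast
  show ?thesis using expectation_inner_chaos_sum_deriv[of S p p a a] expectation_chaos_sum_mult[of S a p a p] S assms(2)
    by (simp add: power2_norm_eq_inner) (simp add: power2_eq_square)
qed

lemma finite_chaos_fourth:
  assumes "finite_chaos p F D"
  shows "(\<integral>\<omega>. (F \<omega>)^4 \<partial>M) \<le> hyper_const p * (\<integral>\<omega>. (F \<omega>)\<^sup>2 \<partial>M)\<^sup>2"
proof -
  obtain S a where S: "finite S" "\<forall>h\<in>S. norm h = 1" "F = chaos_sum S a p" "D = chaos_sum_deriv S a p"
    using assms(1) unfolding finite_chaos_def by blast
  obtain B where "parseval B S" using ex_parseval[OF S(1)] by blast
  then interpret parseval B S .
  have "(\<integral>\<omega>. (F \<omega>)^4 \<partial>M) = Qsum S a p p"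
    using expectation_chaos_sum4[OF S(2), of p p a a p] by (simp add: S Qsum_def power2_eq_square power4_eq_xxxx mult.assoc)
  moreover have "(\<integral>\<omega>. (F \<omega>)\<^sup>2 \<partial>M) = Gsum S a a p"
    using expectation_chaos_sum_mult[OF S(2), of a p a p] by (simp add: S power2_eq_square)
  ultimately show ?thesis using Qsum_le[of p p a] by simp
qed

definition kappa4 :: "('a \<Rightarrow> real) \<Rightarrow> real" where
  "kappa4 F = (\<integral>\<omega>. (F \<omega>)^4 \<partial>M) - 3 * (\<integral>\<omega>. (F \<omega>)\<^sup>2 \<partial>M)\<^sup>2"

lemma kappa4_chaos_sum:
  assumes "\<forall>h\<in>S. norm h = 1" "p \<le> K"
  shows "kappa4 (chaos_sum S a p) = kappa_sum S a p K"
  using expectation_chaos_sum4[OF assms, of a a p] expectation_chaos_sum_mult[OF assms(1), of a p a p]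
  by (simp add: kappa4_def kappa_sum_def Qsum_def power2_eq_square power4_eq_xxxx mult.assoc)

lemma finite_chaos_kappa4_nonneg:
  assumes "finite_chaos p F D" "p \<ge> 1"
  shows "kappa4 F \<ge> 0"
proof -
  obtain S a where S: "finite S" "\<forall>h\<in>S. norm h = 1" "F = chaos_sum S a p" "D = chaos_sum_deriv S a p"
    using assms(1) unfolding finite_chaos_def by blast
  obtain B where "parseval B S" using ex_parseval[OF S(1)] by blast
  then interpret parseval B S .
  show ?thesis unfolding S kappa4_chaos_sum[OF S(2) order.refl] using assms by (intro kappa_sum_nonneg) auto
qed

text \<open>The mean of \<open>\<langle>DF, DG\<rangle> / p\<close> is the covariance, so the
  left-hand side is a variance. Its component of order zero, \<open>r = p\<close>, cancels, and for
  the others the weight \<open>r\<^sup>2 / p\<^sup>2\<close> is at most 1.\<close>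

lemma finite_chaos_same_order:
  assumes "finite_chaos p F D" "finite_chaos p G E" "p \<ge> 1"
  shows "(\<integral>\<omega>. ((\<integral>\<omega>. F \<omega> * G \<omega> \<partial>M) - inner (D \<omega>) (E \<omega>) / real p)\<^sup>2 \<partial>M)
    \<le> (\<Sum>r=1..p-1. real ((2 * r) choose r)) * sqrt (kappa4 F * kappa4 G)"
proof -
  obtain S a b where S: "finite S" "\<forall>h\<in>S. norm h = 1"
    "F = chaos_sum S a p" "D = chaos_sum_deriv S a p" "G = chaos_sum S b p" "E = chaos_sum_deriv S b p"
    using finite_chaos2E[OF assms(1,2)] by blast
  obtain B where "parseval B S" using ex_parseval[OF S(1)] by blast
  then interpret parseval B S .
  define C where "C = Gsum S a b p"
  define k where "k = sqrt (kappa_sum S a p p * kappa_sum S b p p)"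
  have k: "k \<ge> 0" unfolding k_def using assms(3) by (intro real_sqrt_ge_zero mult_nonneg_nonneg kappa_sum_nonneg) auto
  have C: "(\<integral>\<omega>. F \<omega> * G \<omega> \<partial>M) = C" using expectation_chaos_sum_mult[OF S(2), of a p b p] by (simp add: S C_def)
  have p: "real p > 0" using assms(3) by simp
  let ?I = "\<lambda>\<omega>. inner (D \<omega>) (E \<omega>)"
  have EI: "(\<integral>\<omega>. ?I \<omega> \<partial>M) = real p * C" using expectation_inner_chaos_sum_deriv[OF S(2) assms(3,3), of a b] by (simp add: S C_def)
  have EI2: "(\<integral>\<omega>. (?I \<omega>)\<^sup>2 \<partial>M) = (\<Sum>r=1..p-1. (real r)\<^sup>2 * Ssum S a b p p p r) + (real p)\<^sup>2 * C\<^sup>2"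
  proof -
    have "(\<integral>\<omega>. (?I \<omega>)\<^sup>2 \<partial>M) = (\<Sum>r=0..p. (real r)\<^sup>2 * Ssum S a b p p p r)"
      using expectation_inner_chaos_sum_deriv_sq[OF S(2) order.refl assms(3,3), of a b] by (simp add: S)
    also have "\<dots> = (real 0)\<^sup>2 * Ssum S a b p p p 0 + (\<Sum>r=1..p-1. (real r)\<^sup>2 * Ssum S a b p p p r) + (real p)\<^sup>2 * Ssum S a b p p p p"
      using assms(3) by (intro sum_split_ends) (auto simp: Ssum_eq_0)
    finally show ?thesis by (simp add: Ssum_p_p C_def)
  qed
  note int = finite_chaos_integrable[OF assms(1,2)]
  have "(\<integral>\<omega>. (C - ?I \<omega> / real p)\<^sup>2 \<partial>M) = (\<integral>\<omega>. (C\<^sup>2 - (2 * C / real p) * ?I \<omega>) + (1 / (real p)\<^sup>2) * (?I \<omega>)\<^sup>2 \<partial>M)"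
    by (intro Bochner_Integration.integral_cong refl) (simp add: power2_diff power_divide)
  also have "\<dots> = C\<^sup>2 - (2 * C / real p) * (real p * C) + (1 / (real p)\<^sup>2) * (\<integral>\<omega>. (?I \<omega>)\<^sup>2 \<partial>M)"
    using int by (simp add: EI prob_space)
  also have "\<dots> = (\<Sum>r=1..p-1. (real r)\<^sup>2 * Ssum S a b p p p r) / (real p)\<^sup>2"
    unfolding EI2 using p by (simp add: field_simps power2_eq_square)
  also have "\<dots> \<le> (\<Sum>r=1..p-1. (real p)\<^sup>2 * (real ((p + p - 2 * r) choose (p - r)) * k)) / (real p)\<^sup>2"
  proof (intro divide_right_mono sum_mono)
    fix r assume r: "r \<in> {1..p - 1}"
    show "(real r)\<^sup>2 * Ssum S a b p p p r \<le> (real p)\<^sup>2 * (real ((p + p - 2 * r) choose (p - r)) * k)"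
      unfolding k_def using r by (intro mult_mono power_mono Ssum_le_kappa_sum Ssum_nonneg) auto
  qed simp
  also have "\<dots> = (\<Sum>r=1..p-1. real ((p + p - 2 * r) choose (p - r))) * k"
    using p by (simp add: sum_distrib_left[symmetric] sum_distrib_right[symmetric])
  \<comment> \<open>Reflecting \<open>r\<close> to \<open>p - r\<close> produces the central
    binomial coefficients that occur in \<open>psi\<close>.\<close>
  also have "(\<Sum>r=1..p-1. real ((p + p - 2 * r) choose (p - r))) = (\<Sum>r=1..p-1. real ((2 * r) choose r))"
    by (rule sum.reindex_bij_witness[where i = "\<lambda>r. p - r" and j = "\<lambda>r. p - r"]) (auto simp: diff_mult_distrib2 mult_2)
  finally have "(\<integral>\<omega>. (C - inner (D \<omega>) (E \<omega>) / real p)\<^sup>2 \<partial>M) \<le> (\<Sum>r=1..p-1. real ((2 * r) choose r)) * k" .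
  moreover have "kappa4 F = kappa_sum S a p p" "kappa4 G = kappa_sum S b p p"
    unfolding S using kappa4_chaos_sum[OF S(2) order.refl] by auto
  ultimately show ?thesis by (simp only: C k_def)
qed

text \<open>No constant component exists, so nothing cancels and \<open>r\<close> runs up to the
  smaller order. The top value \<open>r = p\<close> is treated apart because there only the cumulant
  of \<open>G\<close> is available.\<close>

lemma finite_chaos_distinct_order:
  assumes "finite_chaos p F D" "finite_chaos q G E" "p \<ge> 1" "p < q"
  shows "(\<integral>\<omega>. (inner (D \<omega>) (E \<omega>))\<^sup>2 \<partial>M) \<le> (real p)\<^sup>2 * ((\<integral>\<omega>. (F \<omega>)\<^sup>2 \<partial>M) * sqrt (kappa4 G)
    + (\<Sum>r=1..p-1. real ((p + q - 2 * r) choose (p - r))) * sqrt (kappa4 F * kappa4 G))"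
proof -
  obtain S a b where S: "finite S" "\<forall>h\<in>S. norm h = 1"
    "F = chaos_sum S a p" "D = chaos_sum_deriv S a p" "G = chaos_sum S b q" "E = chaos_sum_deriv S b q"
    using finite_chaos2E[OF assms(1,2)] by blast
  obtain B where "parseval B S" using ex_parseval[OF S(1)] by blast
  then interpret parseval B S .
  define k where "k = sqrt (kappa_sum S a p q * kappa_sum S b q q)"
  have q: "q \<ge> 1" "p \<le> q" using assms by auto
  have k: "k \<ge> 0" unfolding k_def using assms(3) q by (intro real_sqrt_ge_zero mult_nonneg_nonneg kappa_sum_nonneg) auto
  have y: "(\<integral>\<omega>. (F \<omega>)\<^sup>2 \<partial>M) = Gsum S a a p" using expectation_chaos_sum_mult[OF S(2), of a p a p] by (simp add: S power2_eq_square)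
  have "(\<integral>\<omega>. (inner (D \<omega>) (E \<omega>))\<^sup>2 \<partial>M) = (\<Sum>r=0..q. (real r)\<^sup>2 * Ssum S a b p q q r)"
    using expectation_inner_chaos_sum_deriv_sq[OF S(2) q(2) assms(3) q(1), of a b] by (simp add: S)
  also have "\<dots> = (real 0)\<^sup>2 * Ssum S a b p q q 0 + (\<Sum>r=1..p-1. (real r)\<^sup>2 * Ssum S a b p q q r) + (real p)\<^sup>2 * Ssum S a b p q q p"
    using assms by (intro sum_split_ends) (auto simp: Ssum_eq_0)
  also have "\<dots> = (\<Sum>r=1..p-1. (real r)\<^sup>2 * Ssum S a b p q q r) + (real p)\<^sup>2 * Ssum S a b p q q p" by simp
  also have "\<dots> \<le> (\<Sum>r=1..p-1. (real p)\<^sup>2 * (real ((p + q - 2 * r) choose (p - r)) * k)) + (real p)\<^sup>2 * (Gsum S a a p * sqrt (kappa_sum S b q q))"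
  proof (intro add_mono sum_mono mult_left_mono Ssum_top_le_kappa_sum)
    fix r assume r: "r \<in> {1..p - 1}"
    show "(real r)\<^sup>2 * Ssum S a b p q q r \<le> (real p)\<^sup>2 * (real ((p + q - 2 * r) choose (p - r)) * k)"
      unfolding k_def using r assms by (intro mult_mono power_mono Ssum_le_kappa_sum Ssum_nonneg) auto
  qed (use assms in auto)
  also have "\<dots> = (real p)\<^sup>2 * (Gsum S a a p * sqrt (kappa_sum S b q q) + (\<Sum>r=1..p-1. real ((p + q - 2 * r) choose (p - r))) * k)"
    by (simp add: sum_distrib_left[symmetric] sum_distrib_right[symmetric] distrib_left)
  finally have "(\<integral>\<omega>. (inner (D \<omega>) (E \<omega>))\<^sup>2 \<partial>M) \<le> (real p)\<^sup>2 * (Gsum S a a p * sqrt (kappa_sum S b q q) + (\<Sum>r=1..p-1. real ((p + q - 2 * r) choose (p - r))) * k)" .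
  moreover have "kappa4 F = kappa_sum S a p q" "kappa4 G = kappa_sum S b q q"
    unfolding S using kappa4_chaos_sum[OF S(2) q(2)] kappa4_chaos_sum[OF S(2) order.refl] by auto
  ultimately show ?thesis by (simp only: y k_def)
qed

end

section \<open>Smooth cylindrical functionals\<close>

lemma smooth_pgD:
  assumes "smooth_pg n g"
  shows "(\<And>i. i < n \<Longrightarrow> x i = y i) \<Longrightarrow> g x = g y"
    and "set is \<subseteq> {..<n} \<Longrightarrow> i < n \<Longrightarrow> (\<lambda>t. foldr pd is g (x(i := t))) differentiable (at (x i))"
    and "set is \<subseteq> {..<n} \<Longrightarrow> \<exists>c N. \<forall>x. \<bar>foldr pd is g x\<bar> \<le> c * (1 + (\<Sum>i<n. \<bar>x i\<bar>)) ^ N"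
proof -
  note a = assms[unfolded smooth_pg_def, THEN conjunct1] assms[unfolded smooth_pg_def, THEN conjunct2, THEN conjunct1]
    assms[unfolded smooth_pg_def, THEN conjunct2, THEN conjunct2]
  show "g x = g y" if "\<And>i. i < n \<Longrightarrow> x i = y i" by (rule a(1)[rule_format]) (rule that)
  show "(\<lambda>t. foldr pd is g (x(i := t))) differentiable (at (x i))" if "set is \<subseteq> {..<n}" "i < n"
    by (rule a(2)[rule_format]) (intro conjI that)
  show "\<exists>c N. \<forall>x. \<bar>foldr pd is g x\<bar> \<le> c * (1 + (\<Sum>i<n. \<bar>x i\<bar>)) ^ N" if "set is \<subseteq> {..<n}"
    by (rule a(3)[rule_format]) (rule that)
qed

lemma smooth_pg_pd:
  assumes g: "smooth_pg n g" and i: "i < n"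
  shows "smooth_pg n (pd i g)"
  unfolding smooth_pg_def
proof (intro conjI allI impI)
  fix x y :: "nat \<Rightarrow> real" assume xy: "\<forall>i<n. x i = y i"
  have "g (x(i := t)) = g (y(i := t))" for t
    by (rule smooth_pgD(1)[OF g]) (use xy in simp)
  moreover have "x i = y i" using xy i by simp
  ultimately show "pd i g x = pd i g y" unfolding pd_def by simp
next
  fix "is" j and x :: "nat \<Rightarrow> real" assume a: "set is \<subseteq> {..<n} \<and> j < n"
  have "(\<lambda>t. foldr pd (is @ [i]) g (x(j := t))) differentiable (at (x j))"
    by (rule smooth_pgD(2)[OF g]) (use a i in auto)
  then show "(\<lambda>t. foldr pd is (pd i g) (x(j := t))) differentiable (at (x j))" by simp
next
  fix "is" assume a: "set is \<subseteq> {..<n}"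
  have "\<exists>c N. \<forall>x. \<bar>foldr pd (is @ [i]) g x\<bar> \<le> c * (1 + (\<Sum>i<n. \<bar>x i\<bar>)) ^ N"
    by (rule smooth_pgD(3)[OF g]) (use a i in auto)
  then show "\<exists>c N. \<forall>x. \<bar>foldr pd is (pd i g) x\<bar> \<le> c * (1 + (\<Sum>i<n. \<bar>x i\<bar>)) ^ N" by simp
qed

lemma smooth_pg_deriv:
  assumes g: "smooth_pg n g" and i: "i < n"
  shows "((\<lambda>t. g (x(i := t))) has_real_derivative pd i g (x(i := s))) (at s)"
proof -
  have "(\<lambda>t. g (x(i := t))) differentiable (at s)"
    using smooth_pgD(2)[OF g, of "[]" i "x(i := s)"] i by simp
  then have "((\<lambda>t. g (x(i := t))) has_real_derivative deriv (\<lambda>t. g (x(i := t))) s) (at s)"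
    by (simp add: DERIV_deriv_iff_real_differentiable)
  then show ?thesis by (simp add: pd_def)
qed

lemma smooth_pg_growth:
  assumes "smooth_pg n g"
  shows "\<exists>c N. \<forall>x. \<bar>g x\<bar> \<le> c * (1 + (\<Sum>i<n. \<bar>x i\<bar>)) ^ N"
  using smooth_pgD(3)[OF assms, of "[]"] by simp

lemma real_mvt:
  fixes f f' :: "real \<Rightarrow> real"
  assumes "\<And>t. (f has_real_derivative f' t) (at t)"
  shows "\<exists>c. \<bar>c - a\<bar> \<le> \<bar>b - a\<bar> \<and> f b - f a = (b - a) * f' c"
proof -
  consider "a < b" | "a = b" | "b < a" by linarith
  then show ?thesis
  proof cases
    case 1
    from MVT2[OF this, of f f'] assms obtain z where "a < z" "z < b" "f b - f a = (b - a) * f' z" by blast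
    then show ?thesis by (intro exI[of _ z]) auto
  next
    case 2 then show ?thesis by auto
  next
    case 3
    from MVT2[OF this, of f f'] assms obtain z where "b < z" "z < a" "f a - f b = (a - b) * f' z" by blast
    then show ?thesis by (intro exI[of _ z]) (auto simp: algebra_simps)
  qed
qed

text \<open>\<open>smooth_pg\<close> grants differentiability only in each variable separately, so
  the increment is taken one coordinate at a time. The points \<open>\<xi> j\<close> lie
  coordinatewise no farther from \<open>x\<close> than \<open>y\<close> does, which is all that
  limits need.\<close>

lemma smooth_pg_mvt:
  assumes g: "smooth_pg n g"
  shows "\<exists>\<xi>. g y - g x = (\<Sum>j<n. (y j - x j) * pd j g (\<xi> j)) \<and> (\<forall>j i. \<bar>\<xi> j i - x i\<bar> \<le> \<bar>y i - x i\<bar>)"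
proof -
  define z where "z m = (\<lambda>i. if i < m then y i else x i)" for m
  have "m \<le> n \<Longrightarrow> \<exists>\<xi>. g (z m) - g x = (\<Sum>j<m. (y j - x j) * pd j g (\<xi> j)) \<and> (\<forall>j i. \<bar>\<xi> j i - x i\<bar> \<le> \<bar>y i - x i\<bar>)" for m
  proof (induction m)
    case 0
    have "z 0 = x" by (simp add: z_def)
    then show ?case by (intro exI[of _ "\<lambda>_. x"]) simp
  next
    case (Suc m)
    then obtain \<xi> where \<xi>: "g (z m) - g x = (\<Sum>j<m. (y j - x j) * pd j g (\<xi> j))" "\<forall>j i. \<bar>\<xi> j i - x i\<bar> \<le> \<bar>y i - x i\<bar>" by auto
    have m: "m < n" using Suc.prems by simp
    obtain c where c: "\<bar>c - x m\<bar> \<le> \<bar>y m - x m\<bar>" "g ((z m)(m := y m)) - g ((z m)(m := x m)) = (y m - x m) * pd m g ((z m)(m := c))"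
      using real_mvt[OF smooth_pg_deriv[OF g m, of "z m"], of "x m" "y m"] by blast
    have z1: "(z m)(m := y m) = z (Suc m)" "(z m)(m := x m) = z m"
      by (auto simp: z_def less_Suc_eq)
    define \<xi>' where "\<xi>' = \<xi>(m := (z m)(m := c))"
    have "g (z (Suc m)) - g x = (\<Sum>j<Suc m. (y j - x j) * pd j g (\<xi>' j))"
      using \<xi>(1) c(2) unfolding z1 by (simp add: \<xi>'_def)
    moreover have "\<forall>j i. \<bar>\<xi>' j i - x i\<bar> \<le> \<bar>y i - x i\<bar>"
      using \<xi>(2) c(1) by (auto simp: \<xi>'_def z_def)
    ultimately show ?case by blast
  qed
  from this[of n] obtain \<xi> where "g (z n) - g x = (\<Sum>j<n. (y j - x j) * pd j g (\<xi> j))" "\<forall>j i. \<bar>\<xi> j i - x i\<bar> \<le> \<bar>y i - x i\<bar>" by auto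
  moreover have "g (z n) = g y" by (rule smooth_pgD(1)[OF g]) (simp add: z_def)
  ultimately show ?thesis by auto
qed

lemma tendsto_funI:
  fixes f :: "'s \<Rightarrow> 'i \<Rightarrow> real"
  assumes "\<And>i. ((\<lambda>s. f s i) \<longlongrightarrow> l i) F"
  shows "(f \<longlongrightarrow> l) F"
proof -
  have "limitin (product_topology (\<lambda>_::'i. euclidean :: real topology) UNIV) f l F"
    using assms by (simp only: limitin_componentwise limitin_canonical_iff) simp
  then show ?thesis by (simp only: euclidean_product_topology limitin_canonical_iff)
qed

text \<open>Separate differentiability alone would not give joint continuity. The polynomial bounds
  on the partial derivatives do, through the mean value formula; applied to partial derivatives in
  turn, this makes all of them continuous.\<close>

lemma smooth_pg_continuous:
  assumes g: "smooth_pg n g"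
  shows "continuous_on UNIV g"
proof (rule continuous_on_sequentiallyI)
  fix u :: "nat \<Rightarrow> nat \<Rightarrow> real" and a assume ua: "u \<longlonglongrightarrow> a"
  have ui: "(\<lambda>k. u k i) \<longlonglongrightarrow> a i" for i
  proof -
    have "continuous_on UNIV (\<lambda>x :: nat \<Rightarrow> real. x i)" by (rule continuous_on_product_coordinates)
    from continuous_on_tendsto_compose[OF this ua UNIV_I] show ?thesis by simp
  qed
  have "\<exists>c N. \<forall>x. \<bar>pd j g x\<bar> \<le> c * (1 + (\<Sum>i<n. \<bar>x i\<bar>)) ^ N" if "j < n" for j
    by (rule smooth_pg_growth[OF smooth_pg_pd[OF g that]])
  then have "\<forall>j. \<exists>c N. j < n \<longrightarrow> (\<forall>x. \<bar>pd j g x\<bar> \<le> c * (1 + (\<Sum>i<n. \<bar>x i\<bar>)) ^ N)"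
    by (intro allI) (metis (no_types))
  then obtain c N where "\<forall>j. j < n \<longrightarrow> (\<forall>x. \<bar>pd j g x\<bar> \<le> c j * (1 + (\<Sum>i<n. \<bar>x i\<bar>)) ^ N j)"
    unfolding choice_iff by blast
  then have cN: "\<bar>pd j g x\<bar> \<le> c j * (1 + (\<Sum>i<n. \<bar>x i\<bar>)) ^ N j" if "j < n" for j x
    using that by simp
  have cpos: "c j \<ge> 0" if "j < n" for j
    using cN[OF that, of "\<lambda>_. 0"] by (simp add: order.trans[OF abs_ge_zero])
  define R where "R k = (\<Sum>j<n. \<bar>u k j - a j\<bar> * (c j * (1 + (\<Sum>i<n. \<bar>a i\<bar> + \<bar>u k i - a i\<bar>)) ^ N j))" for k
  have d0: "(\<lambda>k. \<bar>u k i - a i\<bar>) \<longlonglongrightarrow> 0" for i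
    using ui[of i] by (simp add: LIM_zero tendsto_rabs_zero)
  have "R \<longlonglongrightarrow> (\<Sum>j<n. 0 * (c j * (1 + (\<Sum>i<n. \<bar>a i\<bar> + 0)) ^ N j))"
    unfolding R_def[abs_def] by (intro tendsto_intros d0)
  then have R: "R \<longlonglongrightarrow> 0" by simp
  have "(\<lambda>k. g (u k) - g a) \<longlonglongrightarrow> 0"
  proof (rule Lim_null_comparison[OF _ R], intro always_eventually allI)
    fix k
    obtain \<xi> where \<xi>: "g (u k) - g a = (\<Sum>j<n. (u k j - a j) * pd j g (\<xi> j))" "\<And>j i. \<bar>\<xi> j i - a i\<bar> \<le> \<bar>u k i - a i\<bar>"
      using smooth_pg_mvt[OF g, of "u k" a] by blast
    have "\<bar>g (u k) - g a\<bar> \<le> (\<Sum>j<n. \<bar>(u k j - a j) * pd j g (\<xi> j)\<bar>)" unfolding \<xi>(1) by (rule sum_abs)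
    also have "\<dots> \<le> R k"
      unfolding R_def
    proof (rule sum_mono)
      fix j assume j: "j \<in> {..<n}"
      have "\<bar>pd j g (\<xi> j)\<bar> \<le> c j * (1 + (\<Sum>i<n. \<bar>\<xi> j i\<bar>)) ^ N j" by (rule cN) (use j in simp)
      also have "\<dots> \<le> c j * (1 + (\<Sum>i<n. \<bar>a i\<bar> + \<bar>u k i - a i\<bar>)) ^ N j"
      proof (intro mult_left_mono power_mono add_left_mono sum_mono)
        fix i
        show "\<bar>\<xi> j i\<bar> \<le> \<bar>a i\<bar> + \<bar>u k i - a i\<bar>" using \<xi>(2)[of j i] by linarith
      qed (use cpos j in \<open>auto intro!: add_nonneg_nonneg sum_nonneg\<close>)
      finally show "\<bar>(u k j - a j) * pd j g (\<xi> j)\<bar> \<le> \<bar>u k j - a j\<bar> * (c j * (1 + (\<Sum>i<n. \<bar>a i\<bar> + \<bar>u k i - a i\<bar>)) ^ N j)"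
        unfolding abs_mult by (intro mult_left_mono) auto
    qed
    finally show "norm (g (u k) - g a) \<le> R k" by simp
  qed
  then show "(\<lambda>k. g (u k)) \<longlonglongrightarrow> g a" by (rule LIM_zero_cancel)
qed

text \<open>The mean value points tend to the base point as the step shrinks, and the partial
  derivatives are continuous there; this is the chain rule that the Cameron-Martin shifts
  require.\<close>

lemma smooth_pg_directional:
  assumes g: "smooth_pg n g"
  shows "((\<lambda>t. g (\<lambda>i. a i + t * b i)) has_real_derivative (\<Sum>j<n. b j * pd j g (\<lambda>i. a i + t * b i))) (at t)"
proof -
  define x where "x = (\<lambda>i. a i + t * b i)"
  define y where "y s = (\<lambda>i. a i + (t + s) * b i)" for s
  have "\<forall>s. \<exists>\<xi>. g (y s) - g x = (\<Sum>j<n. (y s j - x j) * pd j g (\<xi> j)) \<and> (\<forall>j i. \<bar>\<xi> j i - x i\<bar> \<le> \<bar>y s i - x i\<bar>)"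
    using smooth_pg_mvt[OF g] by blast
  then obtain \<xi> where \<xi>: "\<And>s. g (y s) - g x = (\<Sum>j<n. (y s j - x j) * pd j g (\<xi> s j))" "\<And>s j i. \<bar>\<xi> s j i - x i\<bar> \<le> \<bar>y s i - x i\<bar>"
    by metis
  have yx: "y s i - x i = s * b i" for s i by (simp add: y_def x_def algebra_simps)
  have lim: "((\<lambda>s. \<xi> s j) \<longlongrightarrow> x) (at 0)" for j
  proof (rule tendsto_funI)
    fix i
    have "((\<lambda>s. \<xi> s j i - x i) \<longlongrightarrow> 0) (at 0)"
    proof (rule Lim_null_comparison)
      show "\<forall>\<^sub>F s in at 0. norm (\<xi> s j i - x i) \<le> \<bar>s * b i\<bar>" using \<xi>(2)[of _ j i] unfolding yx by simp
      show "((\<lambda>s. \<bar>s * b i\<bar>) \<longlongrightarrow> 0) (at 0)" by (auto intro!: tendsto_eq_intros)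
    qed
    then show "((\<lambda>s. \<xi> s j i) \<longlongrightarrow> x i) (at 0)" by (rule LIM_zero_cancel)
  qed
  have "((\<lambda>s. \<Sum>j<n. b j * pd j g (\<xi> s j)) \<longlongrightarrow> (\<Sum>j<n. b j * pd j g x)) (at 0)"
  proof (intro tendsto_sum tendsto_mult tendsto_const)
    fix j assume "j \<in> {..<n}"
    then have "continuous_on UNIV (pd j g)" using smooth_pg_continuous[OF smooth_pg_pd[OF g]] by simp
    from continuous_on_tendsto_compose[OF this lim] show "((\<lambda>s. pd j g (\<xi> s j)) \<longlongrightarrow> pd j g x) (at 0)" by simp
  qed
  moreover have "\<forall>\<^sub>F s in at 0. (g (y s) - g x) / s = (\<Sum>j<n. b j * pd j g (\<xi> s j))"
    unfolding eventually_at_filter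
    by (intro always_eventually allI impI) (simp add: \<xi>(1) yx sum_divide_distrib)
  ultimately have "((\<lambda>s. (g (y s) - g x) / s) \<longlongrightarrow> (\<Sum>j<n. b j * pd j g x)) (at 0)"
    by (simp add: filterlim_cong)
  then show ?thesis unfolding DERIV_def y_def x_def by simp
qed

lemma path_smooth_smooth_cyl:
  fixes \<phi> :: "nat \<Rightarrow> 'h::real_inner"
  assumes g: "smooth_pg n g"
  shows "path_smooth (\<lambda>x. g (\<lambda>i. x (\<phi> i))) (\<lambda>x. \<Sum>i<n. pd i g (\<lambda>i. x (\<phi> i)) *\<^sub>R \<phi> i)"
proof -
  note dep = smooth_pgD(1)[OF g] smooth_pgD(1)[OF smooth_pg_pd[OF g]]
  let ?S = "\<phi> ` {..<n}"
  have coord: "continuous_on UNIV (\<lambda>(x :: 'h \<Rightarrow> real) i. x (\<phi> i))"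
    by (intro continuous_on_coordinatewise_then_product continuous_on_product_coordinates)
  \<comment> \<open>The vectors \<open>\<phi> i\<close> may repeat while the growth bound sums over
    the set of them; the factor \<open>1 + real n\<close> accounts for the multiplicity.\<close>
  have sm: "1 + (\<Sum>i<n. \<bar>x (\<phi> i)\<bar>) \<le> (1 + real n) * (1 + (\<Sum>h\<in>?S. \<bar>x h\<bar>))" for x :: "'h \<Rightarrow> real"
  proof -
    have "(\<Sum>i<n. \<bar>x (\<phi> i)\<bar>) \<le> (\<Sum>i<n. (\<Sum>h\<in>?S. \<bar>x h\<bar>))"
      by (intro sum_mono member_le_sum) auto
    then show ?thesis by (simp add: algebra_simps sum_nonneg add_increasing)
  qed
  have up: "\<exists>c N. c \<ge> 0 \<and> (\<forall>x. \<bar>f (\<lambda>i. x (\<phi> i))\<bar> \<le> c * (1 + (\<Sum>h\<in>?S. \<bar>x h\<bar>)) ^ N)" if "smooth_pg n f" for f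
  proof -
    obtain c N where c: "\<And>x. \<bar>f x\<bar> \<le> c * (1 + (\<Sum>i<n. \<bar>x i\<bar>)) ^ N" using smooth_pg_growth[OF \<open>smooth_pg n f\<close>] by blast
    have c0: "c \<ge> 0" using c[of "\<lambda>_. 0"] by (simp add: order.trans[OF abs_ge_zero])
    have "\<bar>f (\<lambda>i. x (\<phi> i))\<bar> \<le> (c * (1 + real n) ^ N) * (1 + (\<Sum>h\<in>?S. \<bar>x h\<bar>)) ^ N" for x
    proof -
      have "\<bar>f (\<lambda>i. x (\<phi> i))\<bar> \<le> c * (1 + (\<Sum>i<n. \<bar>x (\<phi> i)\<bar>)) ^ N" by (rule c)
      also have "\<dots> \<le> c * ((1 + real n) * (1 + (\<Sum>h\<in>?S. \<bar>x h\<bar>))) ^ N"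
        using c0 sm by (intro mult_left_mono power_mono) (auto intro!: add_nonneg_nonneg sum_nonneg)
      finally show ?thesis by (simp add: power_mult_distrib mult.assoc)
    qed
    moreover have "c * (1 + real n) ^ N \<ge> 0" using c0 by simp
    ultimately show ?thesis by blast
  qed
  obtain c0 N0 where b0: "c0 \<ge> 0" "\<And>x. \<bar>g (\<lambda>i. x (\<phi> i))\<bar> \<le> c0 * (1 + (\<Sum>h\<in>?S. \<bar>x h\<bar>)) ^ N0"
    using up[OF g] by blast
  have "\<forall>j\<in>{..<n}. \<exists>cN. fst cN \<ge> 0 \<and> (\<forall>x. \<bar>pd j g (\<lambda>i. x (\<phi> i))\<bar> \<le> fst cN * (1 + (\<Sum>h\<in>?S. \<bar>x h\<bar>)) ^ snd cN)"
    using up[OF smooth_pg_pd[OF g]] by simp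
  from bchoice[OF this] obtain cN where cN: "\<And>j. j < n \<Longrightarrow> fst (cN j) \<ge> 0"
    "\<And>j x. j < n \<Longrightarrow> \<bar>pd j g (\<lambda>i. x (\<phi> i))\<bar> \<le> fst (cN j) * (1 + (\<Sum>h\<in>?S. \<bar>x h\<bar>)) ^ snd (cN j)"
    by auto
  define C where "C = c0 + (\<Sum>j<n. fst (cN j) * norm (\<phi> j))"
  define N where "N = N0 + (\<Sum>j<n. snd (cN j))"
  have Cp: "0 \<le> (\<Sum>j<n. fst (cN j) * norm (\<phi> j))" using cN(1) by (intro sum_nonneg) auto
  let ?m = "\<lambda>x. 1 + (\<Sum>h\<in>?S. \<bar>x h\<bar>)"
  have m1: "?m x \<ge> 1" for x :: "'h \<Rightarrow> real" by (simp add: sum_nonneg)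
  show ?thesis
    unfolding path_smooth_def
  proof (intro conjI allI exI[of _ ?S] exI[of _ C] exI[of _ N] impI)
    show "continuous_on UNIV (\<lambda>x. g (\<lambda>i. x (\<phi> i)))"
      by (rule continuous_on_compose2[OF smooth_pg_continuous[OF g] coord]) auto
    show "continuous_on UNIV (\<lambda>x. inner (\<Sum>i<n. pd i g (\<lambda>i. x (\<phi> i)) *\<^sub>R \<phi> i) k)" for k
      unfolding inner_sum_left inner_scaleR_left
      by (intro continuous_on_sum continuous_on_mult continuous_on_const
          continuous_on_compose2[OF smooth_pg_continuous[OF smooth_pg_pd[OF g]] coord]) auto
    show "((\<lambda>t. g (\<lambda>i. x (\<phi> i) + t * inner (\<phi> i) k)) has_real_derivative
       inner (\<Sum>i<n. pd i g (\<lambda>i. x (\<phi> i) + t * inner (\<phi> i) k) *\<^sub>R \<phi> i) k) (at t)" for x k t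
      using smooth_pg_directional[OF g, of "\<lambda>i. x (\<phi> i)" "\<lambda>i. inner (\<phi> i) k" t]
      by (simp add: inner_sum_left mult.commute)
    show "finite ?S" by simp
    fix x y :: "'h \<Rightarrow> real" assume "\<forall>h\<in>?S. x h = y h"
    then have e: "x (\<phi> i) = y (\<phi> i)" if "i < n" for i using that by auto
    show "g (\<lambda>i. x (\<phi> i)) = g (\<lambda>i. y (\<phi> i))" by (rule dep(1)) (rule e)
    show "(\<Sum>i<n. pd i g (\<lambda>i. x (\<phi> i)) *\<^sub>R \<phi> i) = (\<Sum>i<n. pd i g (\<lambda>i. y (\<phi> i)) *\<^sub>R \<phi> i)"
    proof (intro sum.cong refl)
      fix i assume "i \<in> {..<n}"
      then have "pd i g (\<lambda>i. x (\<phi> i)) = pd i g (\<lambda>i. y (\<phi> i))" by (intro dep(2) e) auto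
      then show "pd i g (\<lambda>i. x (\<phi> i)) *\<^sub>R \<phi> i = pd i g (\<lambda>i. y (\<phi> i)) *\<^sub>R \<phi> i" by simp
    qed
  next
    fix x :: "'h \<Rightarrow> real"
    have "\<bar>g (\<lambda>i. x (\<phi> i))\<bar> \<le> c0 * ?m x ^ N0" by (rule b0(2))
    also have "\<dots> \<le> C * ?m x ^ N"
      using b0(1) Cp m1[of x] unfolding C_def N_def by (intro mult_mono power_increasing) auto
    finally show "\<bar>g (\<lambda>i. x (\<phi> i))\<bar> \<le> C * ?m x ^ N" .
    have "norm (\<Sum>i<n. pd i g (\<lambda>i. x (\<phi> i)) *\<^sub>R \<phi> i) \<le> (\<Sum>i<n. norm (pd i g (\<lambda>i. x (\<phi> i)) *\<^sub>R \<phi> i))" by (rule norm_sum)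
    also have "\<dots> \<le> (\<Sum>i<n. fst (cN i) * norm (\<phi> i) * ?m x ^ N)"
    proof (intro sum_mono)
      fix i assume i: "i \<in> {..<n}"
      have "snd (cN i) \<le> N" unfolding N_def using member_le_sum[of i "{..<n}" "\<lambda>j. snd (cN j)"] i by simp
      then have "?m x ^ snd (cN i) \<le> ?m x ^ N" using m1[of x] by (intro power_increasing) auto
      then have "fst (cN i) * ?m x ^ snd (cN i) \<le> fst (cN i) * ?m x ^ N" using cN(1)[of i] i by (intro mult_left_mono) auto
      then have "\<bar>pd i g (\<lambda>i. x (\<phi> i))\<bar> \<le> fst (cN i) * ?m x ^ N" using cN(2)[of i x] i by simp
      then show "norm (pd i g (\<lambda>i. x (\<phi> i)) *\<^sub>R \<phi> i) \<le> fst (cN i) * norm (\<phi> i) * ?m x ^ N"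
        using mult_right_mono[of "\<bar>pd i g (\<lambda>i. x (\<phi> i))\<bar>" "fst (cN i) * ?m x ^ N" "norm (\<phi> i)"] by (simp add: mult_ac)
    qed
    also have "\<dots> = (\<Sum>i<n. fst (cN i) * norm (\<phi> i)) * ?m x ^ N" by (simp add: sum_distrib_right)
    also have "\<dots> \<le> C * ?m x ^ N" using b0(1) m1[of x] unfolding C_def by (intro mult_right_mono) auto
    finally show "norm (\<Sum>i<n. pd i g (\<lambda>i. x (\<phi> i)) *\<^sub>R \<phi> i) \<le> C * ?m x ^ N" .
  qed
qed

text \<open>The derivative is written as a sum over all coordinates with coefficients that are
  mostly zero, so that iterated partial derivatives stay in the same class. Orders may fall below
  zero, where \<open>nherm\<close> vanishes.\<close>

lemma pd_sum_nherm:
  assumes "i < n"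
  shows "pd i (\<lambda>x. \<Sum>k<n. c k * nherm (m k) (x k)) = (\<lambda>x. \<Sum>k<n. (if k = i then c i else 0) * nherm (m k - 1) (x k))"
proof
  fix x :: "nat \<Rightarrow> real"
  have I: "{..<n} = insert i ({..<n} - {i})" using assms by auto
  have "(\<lambda>t. \<Sum>k<n. c k * nherm (m k) ((x(i := t)) k)) = (\<lambda>t. c i * nherm (m i) t + (\<Sum>k\<in>{..<n} - {i}. c k * nherm (m k) (x k)))"
    by (rule ext, subst I, subst sum.insert) auto
  moreover have "((\<lambda>t. c i * nherm (m i) t + (\<Sum>k\<in>{..<n} - {i}. c k * nherm (m k) (x k))) has_real_derivative c i * nherm (m i - 1) (x i)) (at (x i))"
    by (auto intro!: derivative_eq_intros nherm_has_derivative)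
  ultimately have "pd i (\<lambda>x. \<Sum>k<n. c k * nherm (m k) (x k)) x = c i * nherm (m i - 1) (x i)"
    unfolding pd_def by (simp add: DERIV_imp_deriv)
  also have "\<dots> = (\<Sum>k<n. (if k = i then c i * nherm (m k - 1) (x k) else 0))" using assms by simp
  finally show "pd i (\<lambda>x. \<Sum>k<n. c k * nherm (m k) (x k)) x = (\<Sum>k<n. (if k = i then c i else 0) * nherm (m k - 1) (x k))"
    by (simp add: if_distrib[of "\<lambda>a. a * _"] cong: if_cong)
qed

lemma smooth_pg_sum_nherm: "smooth_pg n (\<lambda>x. \<Sum>k<n. c k * nherm (m k) (x k))"
proof -
  have it: "set is \<subseteq> {..<n} \<Longrightarrow> \<exists>c' m'. foldr pd is (\<lambda>x. \<Sum>k<n. c k * nherm (m k) (x k)) = (\<lambda>x. \<Sum>k<n. c' k * nherm (m' k) (x k))" for "is"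
  proof (induction "is")
    case Nil then show ?case by auto
  next
    case (Cons i "is")
    then obtain c' m' where e: "foldr pd is (\<lambda>x. \<Sum>k<n. c k * nherm (m k) (x k)) = (\<lambda>x. \<Sum>k<n. c' k * nherm (m' k) (x k))" by auto
    have "i < n" using Cons.prems by simp
    then show ?case using pd_sum_nherm[of i n c' m'] by (auto simp: e)
  qed
  show ?thesis
    unfolding smooth_pg_def
  proof (intro conjI allI impI)
    fix x y :: "nat \<Rightarrow> real" assume "\<forall>i<n. x i = y i"
    then show "(\<Sum>k<n. c k * nherm (m k) (x k)) = (\<Sum>k<n. c k * nherm (m k) (y k))" by simp
  next
    fix "is" i and x :: "nat \<Rightarrow> real" assume a: "set is \<subseteq> {..<n} \<and> i < n"
    then obtain c' m' where e: "foldr pd is (\<lambda>x. \<Sum>k<n. c k * nherm (m k) (x k)) = (\<lambda>x. \<Sum>k<n. c' k * nherm (m' k) (x k))" using it by blast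
    have I: "{..<n} = insert i ({..<n} - {i})" using a by auto
    have "(\<lambda>t. \<Sum>k<n. c' k * nherm (m' k) ((x(i := t)) k)) = (\<lambda>t. c' i * nherm (m' i) t + (\<Sum>k\<in>{..<n} - {i}. c' k * nherm (m' k) (x k)))"
      by (rule ext, subst I, subst sum.insert) auto
    moreover have "((\<lambda>t. c' i * nherm (m' i) t + (\<Sum>k\<in>{..<n} - {i}. c' k * nherm (m' k) (x k))) has_real_derivative c' i * nherm (m' i - 1) (x i)) (at (x i))"
      by (auto intro!: derivative_eq_intros nherm_has_derivative)
    ultimately show "(\<lambda>t. foldr pd is (\<lambda>x. \<Sum>k<n. c k * nherm (m k) (x k)) (x(i := t))) differentiable (at (x i))"
      unfolding e by (metis real_differentiable_def)
  next
    fix "is" assume "set is \<subseteq> {..<n}"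
    then obtain c' m' where e: "foldr pd is (\<lambda>x. \<Sum>k<n. c k * nherm (m k) (x k)) = (\<lambda>x. \<Sum>k<n. c' k * nherm (m' k) (x k))" using it by blast
    have "\<forall>k. \<exists>CN. fst CN \<ge> 0 \<and> (\<forall>x. \<bar>nherm (m' k) x\<bar> \<le> fst CN * (1 + \<bar>x\<bar>) ^ snd CN)"
      using nherm_growth by (metis fst_conv snd_conv)
    then obtain CN where CN: "\<And>k. fst (CN k) \<ge> 0" "\<And>k x. \<bar>nherm (m' k) x\<bar> \<le> fst (CN k) * (1 + \<bar>x\<bar>) ^ snd (CN k)" by metis
    define N where "N = (\<Sum>k<n. snd (CN k))"
    have "\<bar>\<Sum>k<n. c' k * nherm (m' k) (x k)\<bar> \<le> (\<Sum>k<n. \<bar>c' k\<bar> * fst (CN k)) * (1 + (\<Sum>i<n. \<bar>x i\<bar>)) ^ N" for x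
    proof -
      let ?s = "1 + (\<Sum>i<n. \<bar>x i\<bar>)"
      have "\<bar>\<Sum>k<n. c' k * nherm (m' k) (x k)\<bar> \<le> (\<Sum>k<n. \<bar>c' k * nherm (m' k) (x k)\<bar>)" by (rule sum_abs)
      also have "\<dots> \<le> (\<Sum>k<n. \<bar>c' k\<bar> * fst (CN k) * ?s ^ N)"
      proof (rule sum_mono)
        fix k assume k: "k \<in> {..<n}"
        have "snd (CN k) \<le> N" unfolding N_def using member_le_sum[of k "{..<n}" "\<lambda>j. snd (CN j)"] k by simp
        have xk: "1 + \<bar>x k\<bar> \<le> ?s" using member_le_sum[of k "{..<n}" "\<lambda>j. \<bar>x j\<bar>"] k by simp
        have "(1 + \<bar>x k\<bar>) ^ snd (CN k) \<le> ?s ^ snd (CN k)" using xk by (intro power_mono) auto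
        also have "\<dots> \<le> ?s ^ N" using \<open>snd (CN k) \<le> N\<close> by (intro power_increasing) (auto simp: sum_nonneg)
        finally have "fst (CN k) * (1 + \<bar>x k\<bar>) ^ snd (CN k) \<le> fst (CN k) * ?s ^ N" using CN(1) by (intro mult_left_mono)
        then have "\<bar>nherm (m' k) (x k)\<bar> \<le> fst (CN k) * ?s ^ N" using CN(2)[of k "x k"] by linarith
        then show "\<bar>c' k * nherm (m' k) (x k)\<bar> \<le> \<bar>c' k\<bar> * fst (CN k) * ?s ^ N"
          by (simp add: abs_mult mult.assoc mult_left_mono)
      qed
      finally show ?thesis by (simp add: sum_distrib_right)
    qed
    then show "\<exists>C N. \<forall>x. \<bar>foldr pd is (\<lambda>x. \<Sum>k<n. c k * nherm (m k) (x k)) x\<bar> \<le> C * (1 + (\<Sum>i<n. \<bar>x i\<bar>)) ^ N"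
      unfolding e by blast
  qed
qed

context isonormal_process begin

lemma smooth_cyl_path_smooth:
  assumes "smooth_cyl M X F DF"
  obtains G DG where "path_smooth G DG" "\<And>\<omega>. \<omega> \<in> space M \<Longrightarrow> F \<omega> = G (path \<omega>)" "\<And>\<omega>. \<omega> \<in> space M \<Longrightarrow> DF \<omega> = DG (path \<omega>)"
proof -
  obtain n g and \<phi> :: "nat \<Rightarrow> 'h" where g: "smooth_pg n g"
    and e: "\<forall>\<omega>\<in>space M. F \<omega> = g (\<lambda>i. X (\<phi> i) \<omega>) \<and> DF \<omega> = (\<Sum>i<n. pd i g (\<lambda>i. X (\<phi> i) \<omega>) *\<^sub>R \<phi> i)"
    using assms unfolding smooth_cyl_def by blast
  show ?thesis
    by (rule that[OF path_smooth_smooth_cyl[OF g, of \<phi>]]) (use e in auto)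
qed

lemma finite_chaos_smooth_cyl:
  assumes "finite_chaos p F D"
  shows "smooth_cyl M X F D"
proof -
  obtain S a where S: "finite S" "\<forall>h\<in>S. norm h = 1" "F = chaos_sum S a p" "D = chaos_sum_deriv S a p"
    using assms(1) unfolding finite_chaos_def by blast
  obtain \<phi> where \<phi>: "bij_betw \<phi> {..<card S} S"
    using ex_bij_betw_nat_finite[OF S(1)] by (auto simp: atLeast0LessThan)
  define g where "g = (\<lambda>x. \<Sum>k<card S. a (\<phi> k) * nherm (int p) (x k))"
  have pdg: "pd i g x = a (\<phi> i) * nherm (int p - 1) (x i)" if "i < card S" for i x
    unfolding g_def using pd_sum_nherm[OF that, of "\<lambda>k. a (\<phi> k)" "\<lambda>_. int p"] that
    by (simp add: if_distrib[of "\<lambda>a. a * _"] cong: if_cong)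
  have "F \<omega> = g (\<lambda>i. X (\<phi> i) \<omega>)" "D \<omega> = (\<Sum>i<card S. pd i g (\<lambda>i. X (\<phi> i) \<omega>) *\<^sub>R \<phi> i)" for \<omega>
    unfolding S chaos_sum_def chaos_sum_deriv_def g_def[symmetric]
    using sum.reindex_bij_betw[OF \<phi>, of "\<lambda>h. a h * nherm (int p) (X h \<omega>)"]
      sum.reindex_bij_betw[OF \<phi>, of "\<lambda>h. (a h * nherm (int p - 1) (X h \<omega>)) *\<^sub>R h"]
    by (simp_all add: pdg) (simp add: g_def)
  moreover have "smooth_pg (card S) g" unfolding g_def by (rule smooth_pg_sum_nherm)
  ultimately show ?thesis unfolding smooth_cyl_def by blast
qed

lemma chaos_approx:
  assumes "F \<in> wiener_chaos M X p" "e > 0"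
  shows "\<exists>G D. finite_chaos p G D \<and> (\<integral>\<^sup>+\<omega>. ennreal ((F \<omega> - G \<omega>)\<^sup>2) \<partial>M) < ennreal e"
proof -
  obtain hs :: "'h list" and cs :: "real list" where hs: "\<forall>h\<in>set hs. norm h = 1" "length cs = length hs"
    and b: "(\<integral>\<^sup>+\<omega>. ennreal ((F \<omega> - (\<Sum>k<length hs. cs ! k * hermite p (X (hs ! k) \<omega>)))\<^sup>2) \<partial>M) < ennreal e"
    using assms unfolding wiener_chaos_def by blast
  \<comment> \<open>A list may contain a vector several times, so its coefficients are collected;
    \<open>fact p\<close> converts \<open>hermite\<close> to \<open>nherm\<close>.\<close>
  define a where "a h = (\<Sum>k\<in>{k\<in>{..<length hs}. hs ! k = h}. cs ! k * fact p)" for h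
  have "(\<Sum>k<length hs. cs ! k * hermite p (X (hs ! k) \<omega>)) = chaos_sum (set hs) a p \<omega>" for \<omega>
  proof -
    have "chaos_sum (set hs) a p \<omega> = (\<Sum>h\<in>set hs. \<Sum>k\<in>{k\<in>{..<length hs}. hs ! k = h}. cs ! k * hermite p (X (hs ! k) \<omega>))"
      unfolding chaos_sum_def a_def sum_distrib_right
      by (intro sum.cong refl) (auto simp: hermite_eq_nherm)
    also have "\<dots> = (\<Sum>k<length hs. cs ! k * hermite p (X (hs ! k) \<omega>))"
      by (rule sum.group) auto
    finally show ?thesis by simp
  qed
  then show ?thesis using hs b
    by (intro exI[of _ "chaos_sum (set hs) a p"] exI[of _ "chaos_sum_deriv (set hs) a p"]) (auto simp: finite_chaos_def)
qed

end

section \<open>Closability of the Malliavin derivative\<close>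

text \<open>The bounds are allowed to vary with \<open>n\<close> and only their limit survives,
  which is how cumulants of approximants are replaced by the cumulant of the limit.\<close>

lemma fatou_bound:
  fixes f :: "nat \<Rightarrow> 'a \<Rightarrow> real"
  assumes m: "\<And>n. f n \<in> borel_measurable M" and lim: "AE \<omega> in M. (\<lambda>n. f n \<omega>) \<longlonglongrightarrow> g \<omega>"
    and b: "\<And>n. (\<integral>\<^sup>+\<omega>. ennreal (f n \<omega>) \<partial>M) \<le> ennreal (K n)" and K: "K \<longlonglongrightarrow> k"
  shows "(\<integral>\<^sup>+\<omega>. ennreal (g \<omega>) \<partial>M) \<le> ennreal k"
proof -
  have "(\<integral>\<^sup>+\<omega>. ennreal (g \<omega>) \<partial>M) = (\<integral>\<^sup>+\<omega>. liminf (\<lambda>n. ennreal (f n \<omega>)) \<partial>M)"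
  proof (rule nn_integral_cong_AE)
    show "AE \<omega> in M. ennreal (g \<omega>) = liminf (\<lambda>n. ennreal (f n \<omega>))"
      using lim
    proof eventually_elim
      case (elim \<omega>)
      then have "(\<lambda>n. ennreal (f n \<omega>)) \<longlonglongrightarrow> ennreal (g \<omega>)" by (rule tendsto_ennrealI)
      then show ?case by (simp add: lim_imp_Liminf)
    qed
  qed
  also have "\<dots> \<le> liminf (\<lambda>n. \<integral>\<^sup>+\<omega>. ennreal (f n \<omega>) \<partial>M)"
    using m by (intro nn_integral_liminf) auto
  also have "\<dots> \<le> liminf (\<lambda>n. ennreal (K n))" by (intro Liminf_mono always_eventually allI b)
  also have "\<dots> = ennreal k" using tendsto_ennrealI[OF K] by (simp add: lim_imp_Liminf)
  finally show ?thesis .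
qed

lemma integral_le_of_nn_integral:
  fixes f :: "'a \<Rightarrow> real"
  assumes "\<And>\<omega>. f \<omega> \<ge> 0" "f \<in> borel_measurable M" "(\<integral>\<^sup>+\<omega>. ennreal (f \<omega>) \<partial>M) \<le> ennreal k" "k \<ge> 0"
  shows "integrable M f" "(\<integral>\<omega>. f \<omega> \<partial>M) \<le> k"
proof -
  have "(\<integral>\<^sup>+\<omega>. ennreal (f \<omega>) \<partial>M) < \<infinity>" using assms(3) by (rule order.strict_trans1) simp
  then show "integrable M f" using assms by (intro integrableI_nonneg) auto
  have "(\<integral>\<omega>. f \<omega> \<partial>M) = enn2real (\<integral>\<^sup>+\<omega>. ennreal (f \<omega>) \<partial>M)"
    using assms by (intro integral_eq_nn_integral) auto
  also have "\<dots> \<le> k" using assms by (intro enn2real_leI) auto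
  finally show "(\<integral>\<omega>. f \<omega> \<partial>M) \<le> k" .
qed

section \<open>Square-integrable functions and their limits\<close>

definition sq_int :: "'a measure \<Rightarrow> ('a \<Rightarrow> real) \<Rightarrow> bool" where
  "sq_int M f \<longleftrightarrow> f \<in> borel_measurable M \<and> integrable M (\<lambda>\<omega>. (f \<omega>)\<^sup>2)"

lemma sq_intD: "sq_int M f \<Longrightarrow> f \<in> borel_measurable M" "sq_int M f \<Longrightarrow> integrable M (\<lambda>\<omega>. (f \<omega>)\<^sup>2)"
  by (simp_all add: sq_int_def)

lemma abs_mult_le_squares: "\<bar>x * y\<bar> \<le> x\<^sup>2 + (y\<^sup>2 :: real)"
  using sum_squares_bound[of x y] sum_squares_bound[of x "-y"] by (simp add: abs_le_iff)

lemma sq_int_mult: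
  assumes "sq_int M f" "sq_int M g"
  shows "integrable M (\<lambda>\<omega>. f \<omega> * g \<omega>)"
proof (rule Bochner_Integration.integrable_bound)
  show "integrable M (\<lambda>\<omega>. (f \<omega>)\<^sup>2 + (g \<omega>)\<^sup>2)" using assms by (simp add: sq_int_def)
  show "AE \<omega> in M. norm (f \<omega> * g \<omega>) \<le> norm ((f \<omega>)\<^sup>2 + (g \<omega>)\<^sup>2)"
    by (intro AE_I2) (simp add: abs_mult_le_squares)
qed (use assms in \<open>auto simp: sq_int_def\<close>)

lemma sq_int_diff:
  assumes "sq_int M f" "sq_int M g"
  shows "sq_int M (\<lambda>\<omega>. f \<omega> - g \<omega>)" "sq_int M (\<lambda>\<omega>. f \<omega> + g \<omega>)"
proof -
  note m = sq_intD[OF assms(1)] sq_intD[OF assms(2)]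
  have "(f \<omega> - g \<omega>)\<^sup>2 = (f \<omega>)\<^sup>2 + (g \<omega>)\<^sup>2 - 2 * (f \<omega> * g \<omega>)" "(f \<omega> + g \<omega>)\<^sup>2 = (f \<omega>)\<^sup>2 + (g \<omega>)\<^sup>2 + 2 * (f \<omega> * g \<omega>)" for \<omega>
    by (simp_all add: power2_diff power2_sum)
  moreover have "integrable M (\<lambda>\<omega>. (f \<omega>)\<^sup>2 + (g \<omega>)\<^sup>2 - 2 * (f \<omega> * g \<omega>))" "integrable M (\<lambda>\<omega>. (f \<omega>)\<^sup>2 + (g \<omega>)\<^sup>2 + 2 * (f \<omega> * g \<omega>))"
    by (intro Bochner_Integration.integrable_add Bochner_Integration.integrable_diff integrable_mult_right m sq_int_mult[OF assms])+
  ultimately show "sq_int M (\<lambda>\<omega>. f \<omega> - g \<omega>)" "sq_int M (\<lambda>\<omega>. f \<omega> + g \<omega>)"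
    using m(1,3) unfolding sq_int_def by (simp_all only: borel_measurable_diff borel_measurable_add simp_thms)
qed

lemma sq_int_Cauchy_Schwarz:
  assumes f: "sq_int M f" and g: "sq_int M g"
  shows "(\<integral>\<omega>. f \<omega> * g \<omega> \<partial>M)\<^sup>2 \<le> (\<integral>\<omega>. (f \<omega>)\<^sup>2 \<partial>M) * (\<integral>\<omega>. (g \<omega>)\<^sup>2 \<partial>M)"
proof -
  define a b c where "a = (\<integral>\<omega>. (f \<omega>)\<^sup>2 \<partial>M)" and "b = (\<integral>\<omega>. f \<omega> * g \<omega> \<partial>M)" and "c = (\<integral>\<omega>. (g \<omega>)\<^sup>2 \<partial>M)"
  have q: "a - 2 * t * b + t\<^sup>2 * c \<ge> 0" for t
  proof -
    have "0 \<le> (\<integral>\<omega>. (f \<omega> - t * g \<omega>)\<^sup>2 \<partial>M)" by (intro integral_nonneg_AE) auto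
    also have "\<dots> = (\<integral>\<omega>. (f \<omega>)\<^sup>2 - (2 * t) * (f \<omega> * g \<omega>) + t\<^sup>2 * (g \<omega>)\<^sup>2 \<partial>M)"
      by (intro Bochner_Integration.integral_cong refl) (simp add: power2_diff power_mult_distrib)
    also have "\<dots> = a - (2 * t) * b + t\<^sup>2 * c"
      using sq_intD(2)[OF f] sq_intD(2)[OF g] sq_int_mult[OF f g] by (simp add: a_def b_def c_def)
    finally show ?thesis by simp
  qed
  have "c \<ge> 0" unfolding c_def by (intro integral_nonneg_AE) auto
  have "b\<^sup>2 \<le> a * c"
  proof (cases "c = 0")
    case True
    have "b = 0"
    proof (rule ccontr)
      assume "b \<noteq> 0"
      \<comment> \<open>With \<open>c = 0\<close> the quadratic is affine in \<open>t\<close>, and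
        this value of \<open>t\<close> makes it equal to \<open>- 1\<close>.\<close>
      then show False using q[of "(a + 1) / (2 * b)"] True by simp
    qed
    then show ?thesis using True by simp
  next
    case False
    then have "c > 0" using \<open>c \<ge> 0\<close> by simp
    have "0 \<le> (a - 2 * (b / c) * b + (b / c)\<^sup>2 * c) * c" using q[of "b / c"] \<open>c > 0\<close> by simp
    also have "\<dots> = a * c - b\<^sup>2" using \<open>c > 0\<close> by (simp add: power2_eq_square field_simps)
    finally show ?thesis by simp
  qed
  then show ?thesis by (simp add: a_def b_def c_def)
qed

text \<open>Phrased with the nonnegative integral, like the definitions of the chaos and of the
  derivative, so that square integrability of the limit is a consequence.\<close>

definition L2lim :: "'a measure \<Rightarrow> (nat \<Rightarrow> 'a \<Rightarrow> real) \<Rightarrow> ('a \<Rightarrow> real) \<Rightarrow> bool" where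
  "L2lim M f g \<longleftrightarrow> (\<forall>n. sq_int M (f n)) \<and> g \<in> borel_measurable M \<and> (\<lambda>n. \<integral>\<^sup>+\<omega>. ennreal ((g \<omega> - f n \<omega>)\<^sup>2) \<partial>M) \<longlonglongrightarrow> 0"

lemma L2lim_sq_int:
  assumes "L2lim M f g"
  shows "sq_int M g"
proof -
  have l: "(\<lambda>n. \<integral>\<^sup>+\<omega>. ennreal ((g \<omega> - f n \<omega>)\<^sup>2) \<partial>M) \<longlonglongrightarrow> 0" and f: "\<And>n. sq_int M (f n)" and gm: "g \<in> borel_measurable M"
    using assms by (auto simp: L2lim_def)
  have "\<forall>\<^sub>F n in sequentially. (\<integral>\<^sup>+\<omega>. ennreal ((g \<omega> - f n \<omega>)\<^sup>2) \<partial>M) < 1"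
    by (rule order_tendstoD(2)[OF l]) simp
  then obtain n where n: "(\<integral>\<^sup>+\<omega>. ennreal ((g \<omega> - f n \<omega>)\<^sup>2) \<partial>M) < 1"
    using eventually_happens'[OF sequentially_bot] by blast
  have "sq_int M (\<lambda>\<omega>. g \<omega> - f n \<omega>)"
    unfolding sq_int_def
  proof
    show "(\<lambda>\<omega>. g \<omega> - f n \<omega>) \<in> borel_measurable M" using gm f[of n] by (auto simp: sq_int_def)
    then show "integrable M (\<lambda>\<omega>. (g \<omega> - f n \<omega>)\<^sup>2)"
      using order.strict_trans[OF n, of \<infinity>] by (intro integrableI_nonneg) simp_all
  qed
  from sq_int_diff(2)[OF this f[of n]] show ?thesis by simp
qed

lemma L2lim_iff:
  assumes f: "\<And>n. sq_int M (f n)" and g: "sq_int M g"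
  shows "L2lim M f g \<longleftrightarrow> (\<lambda>n. \<integral>\<omega>. (g \<omega> - f n \<omega>)\<^sup>2 \<partial>M) \<longlonglongrightarrow> 0"
proof -
  have "(\<integral>\<^sup>+\<omega>. ennreal ((g \<omega> - f n \<omega>)\<^sup>2) \<partial>M) = ennreal (\<integral>\<omega>. (g \<omega> - f n \<omega>)\<^sup>2 \<partial>M)" for n
    using sq_intD(2)[OF sq_int_diff(1)[OF g f[of n]]] by (intro nn_integral_eq_integral) auto
  moreover have "(\<lambda>n. ennreal (\<integral>\<omega>. (g \<omega> - f n \<omega>)\<^sup>2 \<partial>M)) \<longlonglongrightarrow> ennreal 0 \<longleftrightarrow> (\<lambda>n. \<integral>\<omega>. (g \<omega> - f n \<omega>)\<^sup>2 \<partial>M) \<longlonglongrightarrow> 0"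
    by (rule tendsto_ennreal_iff) simp_all
  ultimately show ?thesis using f sq_intD(1)[OF g] by (simp add: L2lim_def)
qed

lemma tendsto_0_of_square_le:
  fixes u v :: "nat \<Rightarrow> real"
  assumes "\<And>n. (u n)\<^sup>2 \<le> v n" "v \<longlonglongrightarrow> 0"
  shows "u \<longlonglongrightarrow> 0"
proof (rule Lim_null_comparison)
  show "\<forall>\<^sub>F n in sequentially. norm (u n) \<le> sqrt (v n)"
    using assms(1) by (auto intro!: always_eventually real_le_rsqrt)
  show "(\<lambda>n. sqrt (v n)) \<longlonglongrightarrow> 0" using tendsto_real_sqrt[OF assms(2)] by simp
qed

lemma L2lim_mult_const:
  assumes f: "L2lim M f g" and W: "sq_int M W"
  shows "(\<lambda>n. \<integral>\<omega>. f n \<omega> * W \<omega> \<partial>M) \<longlonglongrightarrow> (\<integral>\<omega>. g \<omega> * W \<omega> \<partial>M)"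
proof -
  have fn: "sq_int M (f n)" for n using f by (simp add: L2lim_def)
  note g = L2lim_sq_int[OF f]
  have l: "(\<lambda>n. \<integral>\<omega>. (g \<omega> - f n \<omega>)\<^sup>2 \<partial>M) \<longlonglongrightarrow> 0" using f L2lim_iff[OF fn g] by simp
  have "(\<lambda>n. \<integral>\<omega>. (g \<omega> - f n \<omega>) * W \<omega> \<partial>M) \<longlonglongrightarrow> 0"
  proof (rule tendsto_0_of_square_le)
    show "(\<integral>\<omega>. (g \<omega> - f n \<omega>) * W \<omega> \<partial>M)\<^sup>2 \<le> (\<integral>\<omega>. (g \<omega> - f n \<omega>)\<^sup>2 \<partial>M) * (\<integral>\<omega>. (W \<omega>)\<^sup>2 \<partial>M)" for n
      by (intro sq_int_Cauchy_Schwarz sq_int_diff fn g W)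
    show "(\<lambda>n. (\<integral>\<omega>. (g \<omega> - f n \<omega>)\<^sup>2 \<partial>M) * (\<integral>\<omega>. (W \<omega>)\<^sup>2 \<partial>M)) \<longlonglongrightarrow> 0"
      using tendsto_mult_left_zero[OF l] .
  qed
  moreover have "(\<integral>\<omega>. (g \<omega> - f n \<omega>) * W \<omega> \<partial>M) = (\<integral>\<omega>. g \<omega> * W \<omega> \<partial>M) - (\<integral>\<omega>. f n \<omega> * W \<omega> \<partial>M)" for n
    unfolding left_diff_distrib by (intro Bochner_Integration.integral_diff sq_int_mult fn g W)
  ultimately have "(\<lambda>n. (\<integral>\<omega>. g \<omega> * W \<omega> \<partial>M) - ((\<integral>\<omega>. g \<omega> * W \<omega> \<partial>M) - (\<integral>\<omega>. f n \<omega> * W \<omega> \<partial>M))) \<longlonglongrightarrow> (\<integral>\<omega>. g \<omega> * W \<omega> \<partial>M) - 0"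
    by (intro tendsto_diff tendsto_const) simp
  then show ?thesis by simp
qed

lemma L2lim_mult:
  assumes f: "L2lim M f g" and u: "L2lim M u v"
  shows "(\<lambda>n. \<integral>\<omega>. f n \<omega> * u n \<omega> \<partial>M) \<longlonglongrightarrow> (\<integral>\<omega>. g \<omega> * v \<omega> \<partial>M)"
proof -
  have fn: "sq_int M (f n)" and un: "sq_int M (u n)" for n using f u by (simp_all add: L2lim_def)
  note g = L2lim_sq_int[OF f] and v = L2lim_sq_int[OF u]
  have l: "(\<lambda>n. \<integral>\<omega>. (g \<omega> - f n \<omega>)\<^sup>2 \<partial>M) \<longlonglongrightarrow> 0" "(\<lambda>n. \<integral>\<omega>. (v \<omega> - u n \<omega>)\<^sup>2 \<partial>M) \<longlonglongrightarrow> 0"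
    using f u L2lim_iff[OF fn g] L2lim_iff[OF un v] by simp_all
  have 1: "(\<lambda>n. \<integral>\<omega>. (g \<omega> - f n \<omega>) * (v \<omega> - u n \<omega>) \<partial>M) \<longlonglongrightarrow> 0"
  proof (rule tendsto_0_of_square_le)
    show "(\<integral>\<omega>. (g \<omega> - f n \<omega>) * (v \<omega> - u n \<omega>) \<partial>M)\<^sup>2 \<le> (\<integral>\<omega>. (g \<omega> - f n \<omega>)\<^sup>2 \<partial>M) * (\<integral>\<omega>. (v \<omega> - u n \<omega>)\<^sup>2 \<partial>M)" for n
      by (intro sq_int_Cauchy_Schwarz sq_int_diff fn un g v)
    show "(\<lambda>n. (\<integral>\<omega>. (g \<omega> - f n \<omega>)\<^sup>2 \<partial>M) * (\<integral>\<omega>. (v \<omega> - u n \<omega>)\<^sup>2 \<partial>M)) \<longlonglongrightarrow> 0"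
      using tendsto_mult_zero[OF l] .
  qed
  have 2: "(\<lambda>n. \<integral>\<omega>. f n \<omega> * v \<omega> \<partial>M) \<longlonglongrightarrow> (\<integral>\<omega>. g \<omega> * v \<omega> \<partial>M)" by (rule L2lim_mult_const[OF f v])
  have 3: "(\<lambda>n. \<integral>\<omega>. u n \<omega> * g \<omega> \<partial>M) \<longlonglongrightarrow> (\<integral>\<omega>. v \<omega> * g \<omega> \<partial>M)" by (rule L2lim_mult_const[OF u g])
  have e: "(\<integral>\<omega>. f n \<omega> * u n \<omega> \<partial>M) = (\<integral>\<omega>. (g \<omega> - f n \<omega>) * (v \<omega> - u n \<omega>) \<partial>M) + (\<integral>\<omega>. f n \<omega> * v \<omega> \<partial>M)
      + (\<integral>\<omega>. u n \<omega> * g \<omega> \<partial>M) - (\<integral>\<omega>. g \<omega> * v \<omega> \<partial>M)" for n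
  proof -
    have i: "integrable M (\<lambda>\<omega>. (g \<omega> - f n \<omega>) * (v \<omega> - u n \<omega>))" "integrable M (\<lambda>\<omega>. f n \<omega> * v \<omega>)"
      "integrable M (\<lambda>\<omega>. u n \<omega> * g \<omega>)" "integrable M (\<lambda>\<omega>. g \<omega> * v \<omega>)"
      by (intro sq_int_mult sq_int_diff fn un g v)+
    \<comment> \<open>The product of the two errors tends to zero by Cauchy-Schwarz, and the mixed
      terms keep one factor fixed; no bound on the approximants is involved.\<close>
    have "f n \<omega> * u n \<omega> = (g \<omega> - f n \<omega>) * (v \<omega> - u n \<omega>) + f n \<omega> * v \<omega> + u n \<omega> * g \<omega> - g \<omega> * v \<omega>" for \<omega>
      by (simp add: algebra_simps)
    then have "(\<integral>\<omega>. f n \<omega> * u n \<omega> \<partial>M) = (\<integral>\<omega>. (g \<omega> - f n \<omega>) * (v \<omega> - u n \<omega>) + f n \<omega> * v \<omega> + u n \<omega> * g \<omega> - g \<omega> * v \<omega> \<partial>M)"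
      by (simp only:)
    then show ?thesis using i
      by (simp only: Bochner_Integration.integral_diff Bochner_Integration.integral_add Bochner_Integration.integrable_add)
  qed
  have "(\<lambda>n. \<integral>\<omega>. f n \<omega> * u n \<omega> \<partial>M) \<longlonglongrightarrow> 0 + (\<integral>\<omega>. g \<omega> * v \<omega> \<partial>M) + (\<integral>\<omega>. v \<omega> * g \<omega> \<partial>M) - (\<integral>\<omega>. g \<omega> * v \<omega> \<partial>M)"
    unfolding e by (intro tendsto_intros 1 2 3)
  then show ?thesis by (simp add: mult.commute)
qed

context isonormal_process begin

lemma smooth_cyl_measurable:
  assumes "smooth_cyl M X F DF"
  shows "F \<in> borel_measurable M" "DF \<in> borel_measurable M"
proof -
  obtain n g and \<phi> :: "nat \<Rightarrow> 'h" where g: "smooth_pg n g"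
    and e: "\<forall>\<omega>\<in>space M. F \<omega> = g (\<lambda>i. X (\<phi> i) \<omega>) \<and> DF \<omega> = (\<Sum>i<n. pd i g (\<lambda>i. X (\<phi> i) \<omega>) *\<^sub>R \<phi> i)"
    using assms unfolding smooth_cyl_def by blast
  have c: "(\<lambda>\<omega> i. X (\<phi> i) \<omega>) \<in> borel_measurable M"
    by (intro measurable_coordinatewise_then_product X_measurable)
  have f: "(\<lambda>\<omega>. f (\<lambda>i. X (\<phi> i) \<omega>)) \<in> borel_measurable M" if "smooth_pg n f" for f
    by (rule measurable_compose[OF c borel_measurable_continuous_onI[OF smooth_pg_continuous[OF that]]])
  have "(\<lambda>\<omega>. g (\<lambda>i. X (\<phi> i) \<omega>)) \<in> borel_measurable M" by (rule f[OF g])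
  then show "F \<in> borel_measurable M" using e by (subst measurable_cong) auto
  have "(\<lambda>\<omega>. \<Sum>i<n. pd i g (\<lambda>i. X (\<phi> i) \<omega>) *\<^sub>R \<phi> i) \<in> borel_measurable M"
    by (intro borel_measurable_sum borel_measurable_scaleR f smooth_pg_pd[OF g]) auto
  then show "DF \<in> borel_measurable M" using e by (subst measurable_cong) auto
qed

lemma smooth_cyl_sq_int:
  assumes "smooth_cyl M X F DF"
  shows "sq_int M F" "sq_int M (\<lambda>\<omega>. inner (DF \<omega>) k)"
proof -
  note m = smooth_cyl_measurable[OF assms]
  obtain G DG where G: "path_smooth G DG" "\<And>\<omega>. \<omega> \<in> space M \<Longrightarrow> F \<omega> = G (path \<omega>)" "\<And>\<omega>. \<omega> \<in> space M \<Longrightarrow> DF \<omega> = DG (path \<omega>)"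
    using smooth_cyl_path_smooth[OF assms] by blast
  have "integrable M (\<lambda>\<omega>. (F \<omega>)\<^sup>2) \<longleftrightarrow> integrable M (\<lambda>\<omega>. G (path \<omega>) * G (path \<omega>))"
    using G(2) by (intro Bochner_Integration.integrable_cong refl) (simp add: power2_eq_square)
  also have \<dots> by (rule path_smooth_integrable(1)[OF path_smooth_mult[OF G(1) G(1)]])
  finally show "sq_int M F" using m by (simp add: sq_int_def)
  have nm: "(\<lambda>\<omega>. norm (DF \<omega>)) \<in> borel_measurable M" using m(2) by measurable
  then have "(\<lambda>\<omega>. norm (DG (path \<omega>))) \<in> borel_measurable M"
    using G(3) by (subst measurable_cong[of M _ "\<lambda>\<omega>. norm (DF \<omega>)"]) auto
  then have "integrable M (\<lambda>\<omega>. (norm (DG (path \<omega>)))\<^sup>2)" by (rule path_smooth_integrable(3)[OF G(1)])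
  then have i: "integrable M (\<lambda>\<omega>. (norm k)\<^sup>2 * (norm (DF \<omega>))\<^sup>2)"
    using G(3) by (subst Bochner_Integration.integrable_cong[OF refl, of _ _ "\<lambda>\<omega>. (norm k)\<^sup>2 * (norm (DG (path \<omega>)))\<^sup>2"]) auto
  have "integrable M (\<lambda>\<omega>. (inner (DF \<omega>) k)\<^sup>2)"
  proof (rule Bochner_Integration.integrable_bound[OF i])
    show "(\<lambda>\<omega>. (inner (DF \<omega>) k)\<^sup>2) \<in> borel_measurable M" using m(2) by measurable
    have "(inner v k)\<^sup>2 \<le> (norm k)\<^sup>2 * (norm v)\<^sup>2" for v
      using Cauchy_Schwarz_ineq[of v k] by (simp add: power2_norm_eq_inner mult.commute)
    then show "AE \<omega> in M. norm ((inner (DF \<omega>) k)\<^sup>2) \<le> norm ((norm k)\<^sup>2 * (norm (DF \<omega>))\<^sup>2)" by auto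
  qed
  then show "sq_int M (\<lambda>\<omega>. inner (DF \<omega>) k)" using m(2) by (auto simp: sq_int_def)
qed

lemma sq_int_bounded:
  assumes "f \<in> borel_measurable M" "\<And>\<omega>. \<bar>f \<omega>\<bar> \<le> B"
  shows "sq_int M f"
  unfolding sq_int_def
proof
  have b: "(f \<omega>)\<^sup>2 \<le> B\<^sup>2" for \<omega>
    using power_mono[OF assms(2)[of \<omega>] abs_ge_zero, of 2] by simp
  show "integrable M (\<lambda>\<omega>. (f \<omega>)\<^sup>2)"
  proof (rule integrable_const_bound[of _ "B\<^sup>2"])
    show "AE \<omega> in M. norm ((f \<omega>)\<^sup>2) \<le> B\<^sup>2" using b by (intro AE_I2) simp
  qed (use assms(1) in measurable)
qed fact

text \<open>Integration by parts survives the closure because the test functional is bounded.\<close>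

lemma malliavin_ibp:
  assumes d: "malliavin_deriv M X F G" and Z: "path_smooth Z DZ" and b: "\<And>x. \<bar>Z x\<bar> \<le> 1"
  shows "(\<integral>\<omega>. inner (G \<omega>) k * Z (path \<omega>) \<partial>M)
     = (\<integral>\<omega>. F \<omega> * (X k \<omega> * Z (path \<omega>) - inner (DZ (path \<omega>)) k) \<partial>M)"
    and "sq_int M (\<lambda>\<omega>. inner (G \<omega>) k)"
proof -
  note dd = d[unfolded malliavin_deriv_def]
  note m[measurable] = dd[THEN conjunct1] dd[THEN conjunct2, THEN conjunct1]
  from dd[THEN conjunct2, THEN conjunct2] obtain Fs DFs where sl: "(\<forall>n. smooth_cyl M X (Fs n) (DFs n))
        \<and> (\<lambda>n. \<integral>\<^sup>+\<omega>. ennreal ((F \<omega> - Fs n \<omega>)\<^sup>2) \<partial>M) \<longlonglongrightarrow> 0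
        \<and> (\<lambda>n. \<integral>\<^sup>+\<omega>. ennreal ((norm (DFs n \<omega> - G \<omega>))\<^sup>2) \<partial>M) \<longlonglongrightarrow> 0"
    by (elim exE)
  have s: "smooth_cyl M X (Fs n) (DFs n)" for n using sl by simp
  have l: "(\<lambda>n. \<integral>\<^sup>+\<omega>. ennreal ((F \<omega> - Fs n \<omega>)\<^sup>2) \<partial>M) \<longlonglongrightarrow> 0"
      "(\<lambda>n. \<integral>\<^sup>+\<omega>. ennreal ((norm (DFs n \<omega> - G \<omega>))\<^sup>2) \<partial>M) \<longlonglongrightarrow> 0"
    by (rule sl[THEN conjunct2, THEN conjunct1], rule sl[THEN conjunct2, THEN conjunct2])
  note [measurable] = smooth_cyl_measurable[OF s]
  have Zm[measurable]: "(\<lambda>\<omega>. Z (path \<omega>)) \<in> borel_measurable M" by (rule path_smooth_measurable(1)[OF Z X_measurable])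
  have DZm[measurable]: "(\<lambda>\<omega>. inner (DZ (path \<omega>)) k) \<in> borel_measurable M" by (rule path_smooth_measurable(2)[OF Z X_measurable])
  let ?Z = "\<lambda>\<omega>. Z (path \<omega>)"
  \<comment> \<open>\<open>?W\<close> is the divergence of \<open>Z k\<close>, the adjoint of the
    derivative in the direction \<open>k\<close> applied to \<open>Z\<close>.\<close>
  let ?W = "\<lambda>\<omega>. X k \<omega> * Z (path \<omega>) - inner (DZ (path \<omega>)) k"
  have L1: "L2lim M Fs F" using smooth_cyl_sq_int(1)[OF s] l(1) m by (simp add: L2lim_def)
  have L2: "L2lim M (\<lambda>n \<omega>. inner (DFs n \<omega>) k) (\<lambda>\<omega>. inner (G \<omega>) k)"
    unfolding L2lim_def
  proof (intro conjI allI)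
    show "sq_int M (\<lambda>\<omega>. inner (DFs n \<omega>) k)" for n by (rule smooth_cyl_sq_int(2)[OF s])
    show "(\<lambda>\<omega>. inner (G \<omega>) k) \<in> borel_measurable M" by measurable
    have b2: "(\<integral>\<^sup>+\<omega>. ennreal ((inner (G \<omega>) k - inner (DFs n \<omega>) k)\<^sup>2) \<partial>M)
        \<le> ennreal ((norm k)\<^sup>2) * (\<integral>\<^sup>+\<omega>. ennreal ((norm (DFs n \<omega> - G \<omega>))\<^sup>2) \<partial>M)" for n
    proof -
      have vw: "(inner v k - inner w k)\<^sup>2 \<le> (norm k)\<^sup>2 * (norm (w - v))\<^sup>2" for v w
      proof -
        have "(inner v k - inner w k)\<^sup>2 = (inner (w - v) k)\<^sup>2"
          by (simp add: inner_diff_left power2_commute)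
        also have "\<dots> \<le> inner (w - v) (w - v) * inner k k" by (rule Cauchy_Schwarz_ineq)
        finally show ?thesis by (simp add: power2_norm_eq_inner mult.commute)
      qed
      have "(\<integral>\<^sup>+\<omega>. ennreal ((inner (G \<omega>) k - inner (DFs n \<omega>) k)\<^sup>2) \<partial>M)
        \<le> (\<integral>\<^sup>+\<omega>. ennreal ((norm k)\<^sup>2) * ennreal ((norm (DFs n \<omega> - G \<omega>))\<^sup>2) \<partial>M)"
      proof (intro nn_integral_mono)
        fix \<omega>
        show "ennreal ((inner (G \<omega>) k - inner (DFs n \<omega>) k)\<^sup>2) \<le> ennreal ((norm k)\<^sup>2) * ennreal ((norm (DFs n \<omega> - G \<omega>))\<^sup>2)"
          using vw[of "G \<omega>" "DFs n \<omega>"] by (subst ennreal_mult[symmetric]) (simp_all add: ennreal_leI)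
      qed
      also have "\<dots> = ennreal ((norm k)\<^sup>2) * (\<integral>\<^sup>+\<omega>. ennreal ((norm (DFs n \<omega> - G \<omega>))\<^sup>2) \<partial>M)"
        by (rule nn_integral_cmult) measurable
      finally show ?thesis .
    qed
    show "(\<lambda>n. \<integral>\<^sup>+\<omega>. ennreal ((inner (G \<omega>) k - inner (DFs n \<omega>) k)\<^sup>2) \<partial>M) \<longlonglongrightarrow> 0"
    proof (rule tendsto_sandwich)
      show "\<forall>\<^sub>F n in sequentially. 0 \<le> (\<integral>\<^sup>+\<omega>. ennreal ((inner (G \<omega>) k - inner (DFs n \<omega>) k)\<^sup>2) \<partial>M)" by simp
      show "\<forall>\<^sub>F n in sequentially. (\<integral>\<^sup>+\<omega>. ennreal ((inner (G \<omega>) k - inner (DFs n \<omega>) k)\<^sup>2) \<partial>M)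
        \<le> ennreal ((norm k)\<^sup>2) * (\<integral>\<^sup>+\<omega>. ennreal ((norm (DFs n \<omega> - G \<omega>))\<^sup>2) \<partial>M)"
        by (intro always_eventually allI b2)
      have "(\<lambda>n. ennreal ((norm k)\<^sup>2) * (\<integral>\<^sup>+\<omega>. ennreal ((norm (DFs n \<omega> - G \<omega>))\<^sup>2) \<partial>M)) \<longlonglongrightarrow> ennreal ((norm k)\<^sup>2) * 0"
        by (rule ennreal_tendsto_cmult[OF _ l(2)]) simp
      then show "(\<lambda>n. ennreal ((norm k)\<^sup>2) * (\<integral>\<^sup>+\<omega>. ennreal ((norm (DFs n \<omega> - G \<omega>))\<^sup>2) \<partial>M)) \<longlonglongrightarrow> 0"
        by (simp only: mult_zero_right)
    qed (rule tendsto_const)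
  qed
  show "sq_int M (\<lambda>\<omega>. inner (G \<omega>) k)" by (rule L2lim_sq_int[OF L2])
  have Zs: "sq_int M ?Z" by (rule sq_int_bounded[OF Zm b])
  have XZs: "sq_int M (\<lambda>\<omega>. X k \<omega> * ?Z \<omega>)"
    unfolding sq_int_def using path_smooth_integrable(1)[OF path_smooth_mult[OF path_smooth_mult[OF path_smooth_eval[of k] Z] path_smooth_mult[OF path_smooth_eval[of k] Z]]]
    by (auto simp: power2_eq_square)
  have DZs: "sq_int M (\<lambda>\<omega>. inner (DZ (path \<omega>)) k)"
  proof -
    obtain S C N where S: "finite S" and bb: "\<And>x. \<bar>Z x\<bar> \<le> C * (1 + (\<Sum>h\<in>S. \<bar>x h\<bar>)) ^ N \<and> norm (DZ x) \<le> C * (1 + (\<Sum>h\<in>S. \<bar>x h\<bar>)) ^ N"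
      using Z unfolding path_smooth_def by blast
    have "(inner (DZ x) k)\<^sup>2 \<le> (C\<^sup>2 * (norm k)\<^sup>2) * (1 + (\<Sum>h\<in>S. \<bar>x h\<bar>)) ^ (2 * N)" for x
    proof -
      have "(inner (DZ x) k)\<^sup>2 \<le> (norm (DZ x))\<^sup>2 * (norm k)\<^sup>2"
        using Cauchy_Schwarz_ineq[of "DZ x" k] by (simp add: power2_norm_eq_inner)
      also have "\<dots> \<le> (C * (1 + (\<Sum>h\<in>S. \<bar>x h\<bar>)) ^ N)\<^sup>2 * (norm k)\<^sup>2"
        using bb by (intro mult_right_mono power_mono) auto
      finally show ?thesis by (simp add: power_mult_distrib power_mult[symmetric] mult_ac)
    qed
    then have "integrable M (\<lambda>\<omega>. (inner (DZ (path \<omega>)) k)\<^sup>2)"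
      by (intro Bochner_Integration.integrable_bound[OF integrable_mult_right[OF integrable_growth[OF S], of "C\<^sup>2 * (norm k)\<^sup>2" "2 * N"]])
         (auto intro: order.trans[OF _ abs_ge_self])
    then show ?thesis by (simp add: sq_int_def)
  qed
  have Ws: "sq_int M ?W" by (rule sq_int_diff(1)[OF XZs DZs])
  \<comment> \<open>For a smooth approximant, the Gaussian formula is applied to the product with
    \<open>Z\<close>; the Leibniz rule separates the two derivatives.\<close>
  have eq: "(\<integral>\<omega>. inner (DFs n \<omega>) k * ?Z \<omega> \<partial>M) = (\<integral>\<omega>. Fs n \<omega> * ?W \<omega> \<partial>M)" for n
  proof -
    obtain H DH where H: "path_smooth H DH" "\<And>\<omega>. \<omega> \<in> space M \<Longrightarrow> Fs n \<omega> = H (path \<omega>)" "\<And>\<omega>. \<omega> \<in> space M \<Longrightarrow> DFs n \<omega> = DH (path \<omega>)"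
      using smooth_cyl_path_smooth[OF s[of n]] by blast
    have fs: "sq_int M (Fs n)" "sq_int M (\<lambda>\<omega>. inner (DFs n \<omega>) k)" by (rule smooth_cyl_sq_int[OF s])+
    have "(\<integral>\<omega>. Fs n \<omega> * (X k \<omega> * ?Z \<omega>) \<partial>M) = (\<integral>\<omega>. X k \<omega> * (H (path \<omega>) * ?Z \<omega>) \<partial>M)"
      using H(2) by (intro Bochner_Integration.integral_cong refl) (simp add: mult_ac)
    also have "\<dots> = (\<integral>\<omega>. inner (H (path \<omega>) *\<^sub>R DZ (path \<omega>) + ?Z \<omega> *\<^sub>R DH (path \<omega>)) k \<partial>M)"
      by (rule gaussian_ibp[OF path_smooth_mult[OF H(1) Z]])
    also have "\<dots> = (\<integral>\<omega>. Fs n \<omega> * inner (DZ (path \<omega>)) k + inner (DFs n \<omega>) k * ?Z \<omega> \<partial>M)"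
      using H(2,3) by (intro Bochner_Integration.integral_cong refl) (simp add: inner_add_left mult_ac)
    also have "\<dots> = (\<integral>\<omega>. Fs n \<omega> * inner (DZ (path \<omega>)) k \<partial>M) + (\<integral>\<omega>. inner (DFs n \<omega>) k * ?Z \<omega> \<partial>M)"
      by (intro Bochner_Integration.integral_add sq_int_mult fs DZs Zs)
    finally show ?thesis
      unfolding right_diff_distrib by (subst Bochner_Integration.integral_diff) (auto intro!: sq_int_mult fs XZs DZs)
  qed
  have "(\<lambda>n. \<integral>\<omega>. inner (DFs n \<omega>) k * ?Z \<omega> \<partial>M) \<longlonglongrightarrow> (\<integral>\<omega>. inner (G \<omega>) k * ?Z \<omega> \<partial>M)"
    by (rule L2lim_mult_const[OF L2 Zs])
  moreover have "(\<lambda>n. \<integral>\<omega>. inner (DFs n \<omega>) k * ?Z \<omega> \<partial>M) \<longlonglongrightarrow> (\<integral>\<omega>. F \<omega> * ?W \<omega> \<partial>M)"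
    unfolding eq by (rule L2lim_mult_const[OF L1 Ws])
  ultimately show "(\<integral>\<omega>. inner (G \<omega>) k * ?Z \<omega> \<partial>M) = (\<integral>\<omega>. F \<omega> * ?W \<omega> \<partial>M)"
    by (rule LIMSEQ_unique)
qed

text \<open>The right-hand side of \<open>malliavin_ibp\<close> involves \<open>F\<close> but not
  the chosen derivative, so two derivatives have the same pairing with every bounded test
  functional. Cosine and sine of \<open>X u\<close> combine to the exponentials, which are
  total.\<close>

theorem malliavin_unique:
  assumes G: "malliavin_deriv M X F G" and G': "malliavin_deriv M X F G'"
  shows "AE \<omega> in M. G \<omega> = G' \<omega>"
proof -
  have scalar: "AE \<omega> in M. inner (G \<omega>) k - inner (G' \<omega>) k = 0" for k
  proof (rule exponentials_total)
    have sq: "sq_int M (\<lambda>\<omega>. inner (G \<omega>) k)" "sq_int M (\<lambda>\<omega>. inner (G' \<omega>) k)"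
      using malliavin_ibp(2)[OF G path_smooth_one] malliavin_ibp(2)[OF G' path_smooth_one] by auto
    have one: "sq_int M (\<lambda>\<omega>. 1)" by (rule sq_int_bounded[of _ 1]) auto
    show int: "integrable M (\<lambda>\<omega>. inner (G \<omega>) k - inner (G' \<omega>) k)"
      using sq_int_mult[OF sq_int_diff(1)[OF sq] one] by simp
    fix u
    have z: "(\<integral>\<omega>. (inner (G \<omega>) k - inner (G' \<omega>) k) * Z (path \<omega>) \<partial>M) = 0" if Z: "path_smooth Z DZ" "\<And>x. \<bar>Z x\<bar> \<le> 1" for Z DZ
    proof -
      have Zs: "sq_int M (\<lambda>\<omega>. Z (path \<omega>))"
        by (rule sq_int_bounded[OF path_smooth_measurable(1)[OF Z(1) X_measurable] Z(2)])
      show ?thesis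
        unfolding left_diff_distrib
        by (subst Bochner_Integration.integral_diff) (auto intro!: sq_int_mult sq Zs simp: malliavin_ibp(1)[OF G Z] malliavin_ibp(1)[OF G' Z])
    qed
    let ?d = "\<lambda>\<omega>. inner (G \<omega>) k - inner (G' \<omega>) k"
    have c: "(\<integral>\<omega>. ?d \<omega> * cos (X u \<omega>) \<partial>M) = 0" by (rule z[OF path_smooth_cos]) simp
    have s: "(\<integral>\<omega>. ?d \<omega> * sin (X u \<omega>) \<partial>M) = 0" by (rule z[OF path_smooth_sin]) simp
    have dm: "?d \<in> borel_measurable M" using int by auto
    have ic: "integrable M (\<lambda>\<omega>. ?d \<omega> * cos (X u \<omega>))" "integrable M (\<lambda>\<omega>. ?d \<omega> * sin (X u \<omega>))"
      using dm by (auto intro!: Bochner_Integration.integrable_bound[OF int] simp: abs_mult mult_right_le_one_le)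
    have "iexp (X u \<omega>) * complex_of_real (?d \<omega>) = complex_of_real (?d \<omega> * cos (X u \<omega>)) + \<i> * complex_of_real (?d \<omega> * sin (X u \<omega>))" for \<omega>
      unfolding cis_conv_exp[symmetric] by (simp add: complex_eq_iff)
    then have "(\<integral>\<omega>. iexp (X u \<omega>) * complex_of_real (?d \<omega>) \<partial>M)
      = (\<integral>\<omega>. complex_of_real (?d \<omega> * cos (X u \<omega>)) + \<i> * complex_of_real (?d \<omega> * sin (X u \<omega>)) \<partial>M)"
      by (simp only:)
    also have "\<dots> = complex_of_real (\<integral>\<omega>. ?d \<omega> * cos (X u \<omega>) \<partial>M) + \<i> * complex_of_real (\<integral>\<omega>. ?d \<omega> * sin (X u \<omega>) \<partial>M)"
      using ic by (subst Bochner_Integration.integral_add) (auto simp del: of_real_mult of_real_diff intro!: integrable_mult_right integrable_of_real)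
    finally show "(\<integral>\<omega>. iexp (X u \<omega>) * complex_of_real (?d \<omega>) \<partial>M) = 0" by (simp only: c s) simp
  qed
  \<comment> \<open>The scalar statement has a null set for each direction; a countable dense set of
    directions makes one null set suffice. If the difference were nonzero, the open half space
    around it would contain a direction from \<open>D\<close>.\<close>
  obtain D :: "'h set" where D: "countable D" "\<And>U. open U \<Longrightarrow> U \<noteq> {} \<Longrightarrow> \<exists>d\<in>D. d \<in> U"
    using countable_dense_setE by blast
  have "AE \<omega> in M. \<forall>k\<in>D. inner (G \<omega>) k - inner (G' \<omega>) k = 0"
    using scalar by (intro AE_ball_countable'[OF _ D(1)])
  then show ?thesis
  proof eventually_elim
    case (elim \<omega>)
    show ?case
    proof (rule ccontr)
      assume "G \<omega> \<noteq> G' \<omega>"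
      let ?v = "G \<omega> - G' \<omega>"
      have "open {x. 0 < inner ?v x}" by (intro open_Collect_less continuous_intros)
      moreover have "?v \<in> {x. 0 < inner ?v x}" using \<open>G \<omega> \<noteq> G' \<omega>\<close> by simp
      ultimately obtain d where "d \<in> D" "0 < inner ?v d" using D(2) by blast
      then show False using elim by (auto simp: inner_diff_left)
    qed
  qed
qed

end

section \<open>Passage to the limit\<close>

lemma Cauchy_of_summable_norm_diff:
  fixes x :: "nat \<Rightarrow> 'b::real_normed_vector"
  assumes "summable (\<lambda>n. norm (x (Suc n) - x n))"
  shows "Cauchy x"
proof -
  define s where "s n = (\<Sum>k<n. norm (x (Suc k) - x k))" for n
  have "Cauchy s"
    using assms unfolding s_def[abs_def] by (intro convergent_Cauchy) (simp add: summable_iff_convergent)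
  have tri: "norm (x (m + k) - x m) \<le> s (m + k) - s m" for m k
  proof (induction k)
    case (Suc k)
    have "norm (x (m + Suc k) - x m) \<le> norm (x (Suc (m + k)) - x (m + k)) + norm (x (m + k) - x m)"
      using norm_triangle_ineq[of "x (Suc (m + k)) - x (m + k)" "x (m + k) - x m"] by simp
    also have "\<dots> \<le> s (m + Suc k) - s m" using Suc by (simp add: s_def)
    finally show ?case .
  qed simp
  show ?thesis
    unfolding Cauchy_altdef
  proof (intro allI impI)
    fix e :: real assume "e > 0"
    then obtain N where N: "\<And>m n. m \<ge> N \<Longrightarrow> n > m \<Longrightarrow> dist (s m) (s n) < e"
      using \<open>Cauchy s\<close> unfolding Cauchy_altdef by meson
    have "dist (x m) (x n) < e" if "m \<ge> N" "n > m" for m n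
    proof -
      obtain k where k: "n = m + k" using \<open>n > m\<close> less_imp_add_positive by blast
      have "dist (x m) (x n) \<le> s n - s m" using tri[of m k] by (simp add: k dist_norm norm_minus_commute)
      also have "\<dots> \<le> dist (s m) (s n)" by (simp add: dist_real_def)
      finally show ?thesis using N[OF that] by linarith
    qed
    then show "\<exists>N. \<forall>m\<ge>N. \<forall>n>m. dist (x m) (x n) < e" by blast
  qed
qed

lemma AE_summable_of_nn_integral:
  fixes f :: "nat \<Rightarrow> 'a \<Rightarrow> real"
  assumes m: "\<And>n. f n \<in> borel_measurable M" and nn: "\<And>n \<omega>. f n \<omega> \<ge> 0"
    and b: "\<And>n. (\<integral>\<^sup>+\<omega>. ennreal (f n \<omega>) \<partial>M) \<le> ennreal (K n)" and K: "summable K" "\<And>n. K n \<ge> 0"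
  shows "AE \<omega> in M. summable (\<lambda>n. f n \<omega>)"
proof -
  have "(\<integral>\<^sup>+\<omega>. (\<Sum>n. ennreal (f n \<omega>)) \<partial>M) = (\<Sum>n. \<integral>\<^sup>+\<omega>. ennreal (f n \<omega>) \<partial>M)"
    using m by (intro nn_integral_suminf) auto
  also have "\<dots> \<le> (\<Sum>n. ennreal (K n))" by (intro suminf_le b summableI)
  also have "\<dots> = ennreal (\<Sum>n. K n)" by (rule suminf_ennreal2[OF K(2,1)])
  finally have "(\<integral>\<^sup>+\<omega>. (\<Sum>n. ennreal (f n \<omega>)) \<partial>M) \<noteq> \<infinity>"
    by (metis ennreal_less_top infinity_ennreal_def not_le top.not_eq_extremum)
  then have "AE \<omega> in M. (\<Sum>n. ennreal (f n \<omega>)) \<noteq> \<infinity>"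
    using m by (intro nn_integral_PInf_AE) auto
  then show ?thesis
  proof eventually_elim
    case (elim \<omega>)
    then show ?case using nn by (intro summable_suminf_not_top) auto
  qed
qed

lemma quarter_tendsto: "(\<lambda>n. (1/4 :: real) ^ n) \<longlonglongrightarrow> 0"
  by (rule LIMSEQ_realpow_zero) auto

lemma nn_tendsto_0:
  assumes "\<And>n. a n \<le> ennreal (b n)" "b \<longlonglongrightarrow> 0"
  shows "a \<longlonglongrightarrow> 0"
proof (rule tendsto_sandwich)
  show "\<forall>\<^sub>F n in sequentially. 0 \<le> a n" by simp
  show "\<forall>\<^sub>F n in sequentially. a n \<le> ennreal (b n)" using assms(1) by simp
  show "(\<lambda>n. ennreal (b n)) \<longlonglongrightarrow> 0" using tendsto_ennrealI[OF assms(2)] by simp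
qed (rule tendsto_const)

lemma square_diff_le: "(a - b)\<^sup>2 \<le> 2 * ((c - a)\<^sup>2 + (c - b)\<^sup>2 :: real)"
proof -
  have "0 \<le> ((c - a) + (c - b))\<^sup>2" by simp
  then show ?thesis by (simp add: power2_eq_square algebra_simps)
qed

context isonormal_process begin

lemma finite_chaos_add:
  assumes "finite_chaos p F D" "finite_chaos p G E"
  shows "finite_chaos p (\<lambda>\<omega>. F \<omega> + G \<omega>) (\<lambda>\<omega>. D \<omega> + E \<omega>)"
proof -
  obtain S a b where S: "finite S" "\<forall>h\<in>S. norm h = 1"
    "F = chaos_sum S a p" "D = chaos_sum_deriv S a p" "G = chaos_sum S b p" "E = chaos_sum_deriv S b p"
    using finite_chaos2E[OF assms] by blast
  have "(\<lambda>\<omega>. F \<omega> + G \<omega>) = chaos_sum S (\<lambda>h. a h + b h) p" "(\<lambda>\<omega>. D \<omega> + E \<omega>) = chaos_sum_deriv S (\<lambda>h. a h + b h) p"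
    unfolding S chaos_sum_def[abs_def] chaos_sum_deriv_def[abs_def] by (auto simp: sum.distrib algebra_simps)
  then show ?thesis unfolding finite_chaos_def using S by blast
qed

lemma finite_chaos_sq_int:
  assumes "finite_chaos p F D"
  shows "sq_int M F" "sq_int M (\<lambda>\<omega>. (F \<omega>)\<^sup>2)" "integrable M (\<lambda>\<omega>. (norm (D \<omega>))\<^sup>2)"
  using finite_chaos_integrable[OF assms assms] finite_chaos_measurable[OF assms]
  by (auto simp: sq_int_def power2_eq_square[of "F _"] power2_norm_eq_inner)

lemma hyper_const_nonneg: "hyper_const p \<ge> 0"
  unfolding hyper_const_def by (intro sum_nonneg) auto

text \<open>Cauchy-Schwarz reduces to fourth moments, which hypercontractivity bounds by second
  moments. The lemma serves differences of squares, factored into difference times sum.\<close>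

lemma finite_chaos_product:
  assumes P: "finite_chaos p F D" and Q: "finite_chaos p G E"
  shows "(\<integral>\<omega>. (F \<omega> * G \<omega>)\<^sup>2 \<partial>M) \<le> hyper_const p * ((\<integral>\<omega>. (F \<omega>)\<^sup>2 \<partial>M) * (\<integral>\<omega>. (G \<omega>)\<^sup>2 \<partial>M))"
proof (rule power2_le_imp_le)
  let ?a = "\<integral>\<omega>. (F \<omega>)\<^sup>2 \<partial>M" and ?b = "\<integral>\<omega>. (G \<omega>)\<^sup>2 \<partial>M"
  have f: "(\<integral>\<omega>. ((H \<omega>)\<^sup>2)\<^sup>2 \<partial>M) \<le> hyper_const p * (\<integral>\<omega>. (H \<omega>)\<^sup>2 \<partial>M)\<^sup>2" if "finite_chaos p H E'" for H E'
    using finite_chaos_fourth[OF that] by simp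
  have "(\<integral>\<omega>. (F \<omega> * G \<omega>)\<^sup>2 \<partial>M)\<^sup>2 = (\<integral>\<omega>. (F \<omega>)\<^sup>2 * (G \<omega>)\<^sup>2 \<partial>M)\<^sup>2" by (simp add: power_mult_distrib)
  also have "\<dots> \<le> (\<integral>\<omega>. ((F \<omega>)\<^sup>2)\<^sup>2 \<partial>M) * (\<integral>\<omega>. ((G \<omega>)\<^sup>2)\<^sup>2 \<partial>M)"
    by (intro sq_int_Cauchy_Schwarz finite_chaos_sq_int(2)[OF P] finite_chaos_sq_int(2)[OF Q])
  also have "\<dots> \<le> (hyper_const p * ?a\<^sup>2) * (hyper_const p * ?b\<^sup>2)"
    using hyper_const_nonneg by (intro mult_mono f[OF P] f[OF Q]) (auto intro!: mult_nonneg_nonneg integral_nonneg_AE)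
  also have "\<dots> = (hyper_const p * (?a * ?b))\<^sup>2" by (simp add: power2_eq_square mult_ac)
  finally show "(\<integral>\<omega>. (F \<omega> * G \<omega>)\<^sup>2 \<partial>M)\<^sup>2 \<le> (hyper_const p * (?a * ?b))\<^sup>2" .
  show "0 \<le> hyper_const p * (?a * ?b)" using hyper_const_nonneg by (intro mult_nonneg_nonneg integral_nonneg_AE) auto
qed

text \<open>The geometric rate gives almost sure convergence without passing to subsequences.\<close>

definition fast_approx :: "nat \<Rightarrow> ('a \<Rightarrow> real) \<Rightarrow> (nat \<Rightarrow> 'a \<Rightarrow> real) \<Rightarrow> (nat \<Rightarrow> 'a \<Rightarrow> 'h) \<Rightarrow> bool" where
  "fast_approx p F Fn Dn \<longleftrightarrow> F \<in> borel_measurable M \<and> (\<forall>n. finite_chaos p (Fn n) (Dn n)) \<and>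
     (\<forall>n. (\<integral>\<^sup>+\<omega>. ennreal ((F \<omega> - Fn n \<omega>)\<^sup>2) \<partial>M) \<le> ennreal ((1/4) ^ n))"

lemma fast_approx_exists:
  assumes "F \<in> wiener_chaos M X p"
  shows "\<exists>Fn Dn. fast_approx p F Fn Dn"
proof -
  have "\<forall>n. \<exists>GD. finite_chaos p (fst GD) (snd GD) \<and> (\<integral>\<^sup>+\<omega>. ennreal ((F \<omega> - fst GD \<omega>)\<^sup>2) \<partial>M) < ennreal ((1/4) ^ n)"
  proof
    fix n
    have "(0::real) < (1/4) ^ n" by simp
    from chaos_approx[OF assms this] obtain G D where
      "finite_chaos p G D \<and> (\<integral>\<^sup>+\<omega>. ennreal ((F \<omega> - G \<omega>)\<^sup>2) \<partial>M) < ennreal ((1/4) ^ n)" by (elim exE)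
    then show "\<exists>GD. finite_chaos p (fst GD) (snd GD) \<and> (\<integral>\<^sup>+\<omega>. ennreal ((F \<omega> - fst GD \<omega>)\<^sup>2) \<partial>M) < ennreal ((1/4) ^ n)"
      by (intro exI[of _ "(G, D)"]) simp
  qed
  from choice[OF this] obtain GD where GD: "\<forall>n. finite_chaos p (fst (GD n)) (snd (GD n)) \<and>
    (\<integral>\<^sup>+\<omega>. ennreal ((F \<omega> - fst (GD n) \<omega>)\<^sup>2) \<partial>M) < ennreal ((1/4) ^ n)" by (elim exE)
  have "F \<in> borel_measurable M" using assms by (simp add: wiener_chaos_def)
  then show ?thesis
    unfolding fast_approx_def
  proof (intro exI[of _ "\<lambda>n. fst (GD n)"] exI[of _ "\<lambda>n. snd (GD n)"] conjI allI)
    fix n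
    show "finite_chaos p (fst (GD n)) (snd (GD n))" using GD by simp
    show "(\<integral>\<^sup>+\<omega>. ennreal ((F \<omega> - fst (GD n) \<omega>)\<^sup>2) \<partial>M) \<le> ennreal ((1/4) ^ n)"
      using GD[rule_format, of n] by (rule less_imp_le[OF conjunct2])
  qed
qed

context
  fixes p F Fn Dn
  assumes fast_approx: "fast_approx p F Fn Dn"
begin

lemma fast_approx_finite_chaos: "finite_chaos p (Fn n) (Dn n)"
  using fast_approx by (simp add: fast_approx_def)

lemma fast_approx_measurable [measurable]: "F \<in> borel_measurable M" "Fn n \<in> borel_measurable M" "Dn n \<in> borel_measurable M"
  using fast_approx finite_chaos_measurable[OF fast_approx_finite_chaos] by (simp_all add: fast_approx_def)

lemma fast_approx_nn: "(\<integral>\<^sup>+\<omega>. ennreal ((F \<omega> - Fn n \<omega>)\<^sup>2) \<partial>M) \<le> ennreal ((1/4) ^ n)"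
  using fast_approx by (simp add: fast_approx_def)

lemma fast_approx_L2lim: "L2lim M Fn F"
  unfolding L2lim_def
  by (intro conjI allI finite_chaos_sq_int(1)[OF fast_approx_finite_chaos] fast_approx_measurable nn_tendsto_0[OF fast_approx_nn quarter_tendsto])

lemma fast_approx_dist: "(\<integral>\<omega>. (F \<omega> - Fn n \<omega>)\<^sup>2 \<partial>M) \<le> (1/4) ^ n" "integrable M (\<lambda>\<omega>. (F \<omega> - Fn n \<omega>)\<^sup>2)"
  using integral_le_of_nn_integral[OF _ _ fast_approx_nn[of n]] by simp_all

lemma fast_approx_Cauchy: "(\<integral>\<omega>. (Fn n \<omega> - Fn m \<omega>)\<^sup>2 \<partial>M) \<le> 2 * ((1/4) ^ n + (1/4) ^ m)"
proof -
  have "(\<integral>\<omega>. (Fn n \<omega> - Fn m \<omega>)\<^sup>2 \<partial>M) \<le> (\<integral>\<omega>. 2 * ((F \<omega> - Fn n \<omega>)\<^sup>2 + (F \<omega> - Fn m \<omega>)\<^sup>2) \<partial>M)"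
    using sq_intD(2)[OF finite_chaos_sq_int(1)[OF finite_chaos_diff[OF fast_approx_finite_chaos fast_approx_finite_chaos]]] fast_approx_dist(2)
    by (intro integral_mono) (auto simp: square_diff_le simp del: distrib_left_numeral)
  also have "\<dots> = 2 * ((\<integral>\<omega>. (F \<omega> - Fn n \<omega>)\<^sup>2 \<partial>M) + (\<integral>\<omega>. (F \<omega> - Fn m \<omega>)\<^sup>2 \<partial>M))"
    using fast_approx_dist(2) by simp
  also have "\<dots> \<le> 2 * ((1/4) ^ n + (1/4) ^ m)"
    using fast_approx_dist(1) by (intro mult_left_mono add_mono) auto
  finally show ?thesis .
qed

lemma fast_approx_AE: "AE \<omega> in M. (\<lambda>n. Fn n \<omega>) \<longlonglongrightarrow> F \<omega>"
proof -
  have "AE \<omega> in M. summable (\<lambda>n. (F \<omega> - Fn n \<omega>)\<^sup>2)"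
    by (rule AE_summable_of_nn_integral[OF _ _ fast_approx_nn]) (auto intro!: summable_geometric)
  then show ?thesis
  proof eventually_elim
    case (elim \<omega>)
    then have "(\<lambda>n. (F \<omega> - Fn n \<omega>)\<^sup>2) \<longlonglongrightarrow> 0" by (rule summable_LIMSEQ_zero)
    then have "(\<lambda>n. F \<omega> - Fn n \<omega>) \<longlonglongrightarrow> 0" by (rule tendsto_0_of_square_le[OF order.refl])
    then have "(\<lambda>n. F \<omega> - (F \<omega> - Fn n \<omega>)) \<longlonglongrightarrow> F \<omega> - 0" by (intro tendsto_diff tendsto_const)
    then show ?case by simp
  qed
qed

lemma fast_approx_Cauchy_deriv:
  assumes "p \<ge> 1"
  shows "(\<integral>\<omega>. (norm (Dn n \<omega> - Dn m \<omega>))\<^sup>2 \<partial>M) \<le> real p * (2 * ((1/4) ^ n + (1/4) ^ m))"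
  unfolding finite_chaos_norm_deriv[OF finite_chaos_diff[OF fast_approx_finite_chaos fast_approx_finite_chaos] assms]
  by (intro mult_left_mono fast_approx_Cauchy) simp

lemma fast_approx_AE_Cauchy:
  assumes p: "p \<ge> 1"
  shows "AE \<omega> in M. Cauchy (\<lambda>n. Dn n \<omega>)"
proof -
  let ?K = "\<lambda>n. (2 * real p + 1) * (1/2) ^ n"
  have "AE \<omega> in M. summable (\<lambda>n. norm (Dn (Suc n) \<omega> - Dn n \<omega>))"
  proof (rule AE_summable_of_nn_integral[where K = ?K])
    fix n
    have i: "integrable M (\<lambda>\<omega>. (norm (Dn (Suc n) \<omega> - Dn n \<omega>))\<^sup>2)"
      by (rule finite_chaos_sq_int(3)[OF finite_chaos_diff[OF fast_approx_finite_chaos fast_approx_finite_chaos]])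
    \<comment> \<open>Weighting by \<open>2 ^ n\<close> balances the squared distance, of order
      \<open>(1/4) ^ n\<close>, against \<open>(1/2) ^ n\<close>, so that first moments of the
      increments become summable.\<close>
    have le: "t \<le> (2 ^ n * t\<^sup>2 + (1/2) ^ n) / 2" for t :: real
    proof -
      have "0 \<le> (1/2) ^ n * (2 ^ n * t - 1)\<^sup>2" by simp
      also have "\<dots> = 2 ^ n * t\<^sup>2 - 2 * t + (1/2) ^ n"
        by (simp add: power2_eq_square algebra_simps power_divide)
      finally show ?thesis by simp
    qed
    have "(\<integral>\<^sup>+\<omega>. ennreal (norm (Dn (Suc n) \<omega> - Dn n \<omega>)) \<partial>M)
      \<le> (\<integral>\<^sup>+\<omega>. ennreal ((2 ^ n * (norm (Dn (Suc n) \<omega> - Dn n \<omega>))\<^sup>2 + (1/2) ^ n) / 2) \<partial>M)"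
      by (intro nn_integral_mono ennreal_leI le)
    also have "\<dots> = ennreal (\<integral>\<omega>. (2 ^ n * (norm (Dn (Suc n) \<omega> - Dn n \<omega>))\<^sup>2 + (1/2) ^ n) / 2 \<partial>M)"
      using i by (intro nn_integral_eq_integral) auto
    also have "(\<integral>\<omega>. (2 ^ n * (norm (Dn (Suc n) \<omega> - Dn n \<omega>))\<^sup>2 + (1/2) ^ n) / 2 \<partial>M)
      = (2 ^ n * (\<integral>\<omega>. (norm (Dn (Suc n) \<omega> - Dn n \<omega>))\<^sup>2 \<partial>M) + (1/2) ^ n) / 2"
      using i by (simp add: prob_space)
    also have "ennreal \<dots> \<le> ennreal (?K n)"
    proof (rule ennreal_leI)
      have "2 ^ n * (\<integral>\<omega>. (norm (Dn (Suc n) \<omega> - Dn n \<omega>))\<^sup>2 \<partial>M) \<le> 2 ^ n * (real p * (2 * ((1/4) ^ Suc n + (1/4) ^ n)))"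
        by (intro mult_left_mono fast_approx_Cauchy_deriv p) simp
      also have "\<dots> \<le> 2 ^ n * (real p * (4 * (1/4) ^ n))"
        by (intro mult_left_mono) auto
      also have "\<dots> = 4 * real p * ((2 * (1/4)) ^ n)" by (simp only: power_mult_distrib) simp
      also have "\<dots> = 4 * real p * (1/2) ^ n" by simp
      finally have "2 ^ n * (\<integral>\<omega>. (norm (Dn (Suc n) \<omega> - Dn n \<omega>))\<^sup>2 \<partial>M) \<le> 4 * real p * (1/2) ^ n" .
      moreover have "0 \<le> (1/2 :: real) ^ n" by simp
      ultimately show "(2 ^ n * (\<integral>\<omega>. (norm (Dn (Suc n) \<omega> - Dn n \<omega>))\<^sup>2 \<partial>M) + (1/2) ^ n) / 2 \<le> ?K n"
        by (simp add: distrib_right mult.assoc add_increasing)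
    qed
    finally show "(\<integral>\<^sup>+\<omega>. ennreal (norm (Dn (Suc n) \<omega> - Dn n \<omega>)) \<partial>M) \<le> ennreal (?K n)" .
  qed (auto intro!: summable_mult summable_geometric)
  then show ?thesis by eventually_elim (rule Cauchy_of_summable_norm_diff)
qed

text \<open>The isometry up to the factor \<open>p\<close> between \<open>F\<close> and its
  derivative makes \<open>Dn\<close> Cauchy in mean square, and the geometric rate makes it converge
  almost surely. Fatou in the second index then shows that the pointwise limit is also the mean
  square limit.\<close>

lemma fast_approx_derivative:
  assumes p: "p \<ge> 1"
  shows "\<exists>G. malliavin_deriv M X F G \<and> (AE \<omega> in M. (\<lambda>n. Dn n \<omega>) \<longlonglongrightarrow> G \<omega>)"
proof -
  \<comment> \<open>Replacing the sequence by zero off the set where it is Cauchy gives convergence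
    everywhere, hence a measurable limit.\<close>
  define u where "u n \<omega> = (if Cauchy (\<lambda>n. Dn n \<omega>) then Dn n \<omega> else 0)" for n \<omega>
  define G where "G \<omega> = lim (\<lambda>n. u n \<omega>)" for \<omega>
  have "Cauchy (\<lambda>n. u n \<omega>)" for \<omega>
    unfolding u_def by (cases "Cauchy (\<lambda>n. Dn n \<omega>)") (simp_all add: convergent_Cauchy convergent_const)
  then have uG: "(\<lambda>n. u n \<omega>) \<longlonglongrightarrow> G \<omega>" for \<omega>
    unfolding G_def by (simp add: convergent_LIMSEQ_iff[symmetric] Cauchy_convergent_iff[symmetric])
  have um: "u n \<in> borel_measurable M" for n
    unfolding u_def[abs_def] by measurable
  have Gm[measurable]: "G \<in> borel_measurable M"
    by (rule borel_measurable_LIMSEQ_metric[OF um uG])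
  have lim: "AE \<omega> in M. (\<lambda>n. Dn n \<omega>) \<longlonglongrightarrow> G \<omega>"
    using fast_approx_AE_Cauchy[OF p]
  proof eventually_elim
    case (elim \<omega>)
    then have "(\<lambda>n. u n \<omega>) = (\<lambda>n. Dn n \<omega>)" by (simp add: u_def)
    then show ?case using uG[of \<omega>] by simp
  qed
  have "(\<integral>\<^sup>+\<omega>. ennreal ((norm (Dn n \<omega> - G \<omega>))\<^sup>2) \<partial>M) \<le> ennreal (real p * (2 * ((1/4) ^ n + 0)))" for n
  proof (rule fatou_bound)
    show "(\<lambda>\<omega>. (norm (Dn n \<omega> - Dn m \<omega>))\<^sup>2) \<in> borel_measurable M" for m by measurable
    show "AE \<omega> in M. (\<lambda>m. (norm (Dn n \<omega> - Dn m \<omega>))\<^sup>2) \<longlonglongrightarrow> (norm (Dn n \<omega> - G \<omega>))\<^sup>2"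
      using lim by eventually_elim (intro tendsto_intros)
    show "(\<integral>\<^sup>+\<omega>. ennreal ((norm (Dn n \<omega> - Dn m \<omega>))\<^sup>2) \<partial>M) \<le> ennreal (real p * (2 * ((1/4) ^ n + (1/4) ^ m)))" for m
    proof -
      have "(\<integral>\<^sup>+\<omega>. ennreal ((norm (Dn n \<omega> - Dn m \<omega>))\<^sup>2) \<partial>M) = ennreal (\<integral>\<omega>. (norm (Dn n \<omega> - Dn m \<omega>))\<^sup>2 \<partial>M)"
        by (intro nn_integral_eq_integral finite_chaos_sq_int(3)[OF finite_chaos_diff[OF fast_approx_finite_chaos fast_approx_finite_chaos]]) simp
      then show ?thesis using ennreal_leI[OF fast_approx_Cauchy_deriv[OF p]] by simp
    qed
    show "(\<lambda>m. real p * (2 * ((1/4) ^ n + (1/4) ^ m))) \<longlonglongrightarrow> real p * (2 * ((1/4) ^ n + 0))"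
      by (intro tendsto_intros quarter_tendsto)
  qed
  moreover have "(\<lambda>n. real p * (2 * ((1/4) ^ n + 0))) \<longlonglongrightarrow> 0"
    using tendsto_mult[OF tendsto_const[of "real p * 2"] quarter_tendsto] by (simp add: mult.assoc)
  ultimately have l2: "(\<lambda>n. \<integral>\<^sup>+\<omega>. ennreal ((norm (Dn n \<omega> - G \<omega>))\<^sup>2) \<partial>M) \<longlonglongrightarrow> 0" by (rule nn_tendsto_0)
  have "malliavin_deriv M X F G"
    unfolding malliavin_deriv_def
  proof (intro conjI exI[of _ Fn] exI[of _ Dn] allI)
    show "smooth_cyl M X (Fn k) (Dn k)" for k by (rule finite_chaos_smooth_cyl[OF fast_approx_finite_chaos])
    show "(\<lambda>k. \<integral>\<^sup>+\<omega>. ennreal ((F \<omega> - Fn k \<omega>)\<^sup>2) \<partial>M) \<longlonglongrightarrow> 0" by (rule nn_tendsto_0[OF fast_approx_nn quarter_tendsto])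
  qed (use l2 in auto)
  then show ?thesis using lim by blast
qed

text \<open>Uniqueness transfers the convergence to an arbitrary derivative, as the final inequality
  is asserted for all of them.\<close>

lemma fast_approx_AE_derivative:
  assumes "p \<ge> 1" "malliavin_deriv M X F G"
  shows "AE \<omega> in M. (\<lambda>n. Dn n \<omega>) \<longlonglongrightarrow> G \<omega>"
proof -
  obtain G' where G': "malliavin_deriv M X F G'" "AE \<omega> in M. (\<lambda>n. Dn n \<omega>) \<longlonglongrightarrow> G' \<omega>"
    using fast_approx_derivative[OF assms(1)] by blast
  show ?thesis using G'(2) malliavin_unique[OF assms(2) G'(1)] by eventually_elim simp
qed

text \<open>A difference of squares is a product of two elements of the same chaos, so
  \<open>finite_chaos_product\<close> controls it by second moments. Fatou lets the first index tend
  to infinity, and with squares converging in mean square the fourth moments converge.\<close>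

lemma fast_approx_L2lim_square: "L2lim M (\<lambda>n \<omega>. (Fn n \<omega>)\<^sup>2) (\<lambda>\<omega>. (F \<omega>)\<^sup>2)"
proof -
  \<comment> \<open>Twice the second moment of \<open>F\<close> plus one bounds all approximants,
    since their squared distances to \<open>F\<close> are at most 1.\<close>
  define B where "B = 2 * ((\<integral>\<omega>. (F \<omega>)\<^sup>2 \<partial>M) + 1)"
  have F2: "integrable M (\<lambda>\<omega>. (F \<omega>)\<^sup>2)" using L2lim_sq_int[OF fast_approx_L2lim] by (simp add: sq_int_def)
  have Fn2: "integrable M (\<lambda>\<omega>. (Fn n \<omega>)\<^sup>2)" for n using finite_chaos_sq_int(1)[OF fast_approx_finite_chaos] by (simp add: sq_int_def)
  have B: "(\<integral>\<omega>. (Fn n \<omega>)\<^sup>2 \<partial>M) \<le> B" for n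
  proof -
    have "(\<integral>\<omega>. (Fn n \<omega>)\<^sup>2 \<partial>M) \<le> (\<integral>\<omega>. 2 * ((F \<omega>)\<^sup>2 + (F \<omega> - Fn n \<omega>)\<^sup>2) \<partial>M)"
    proof (rule integral_mono)
      fix \<omega> show "(Fn n \<omega>)\<^sup>2 \<le> 2 * ((F \<omega>)\<^sup>2 + (F \<omega> - Fn n \<omega>)\<^sup>2)"
        using square_diff_le[of 0 "Fn n \<omega>" "F \<omega>"] by simp
    qed (use Fn2 F2 fast_approx_dist(2) in auto)
    also have "\<dots> = 2 * ((\<integral>\<omega>. (F \<omega>)\<^sup>2 \<partial>M) + (\<integral>\<omega>. (F \<omega> - Fn n \<omega>)\<^sup>2 \<partial>M))"
      using F2 fast_approx_dist(2) by simp
    also have "\<dots> \<le> B"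
      unfolding B_def using order.trans[OF fast_approx_dist(1)[of n] power_le_one[of "1/4 :: real" n]] by simp
    finally show ?thesis .
  qed
  have B0: "B \<ge> 0" using order.trans[OF _ B[of 0]] by simp
  let ?c = "hyper_const p"
  have bd: "(\<integral>\<omega>. ((Fn m \<omega>)\<^sup>2 - (Fn n \<omega>)\<^sup>2)\<^sup>2 \<partial>M) \<le> ?c * ((2 * ((1/4) ^ m + (1/4) ^ n)) * (4 * B))" for m n
  proof -
    have "(\<integral>\<omega>. ((Fn m \<omega>)\<^sup>2 - (Fn n \<omega>)\<^sup>2)\<^sup>2 \<partial>M) = (\<integral>\<omega>. ((Fn m \<omega> - Fn n \<omega>) * (Fn m \<omega> + Fn n \<omega>))\<^sup>2 \<partial>M)"
      by (simp add: power2_eq_square algebra_simps)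
    also have "\<dots> \<le> ?c * ((\<integral>\<omega>. (Fn m \<omega> - Fn n \<omega>)\<^sup>2 \<partial>M) * (\<integral>\<omega>. (Fn m \<omega> + Fn n \<omega>)\<^sup>2 \<partial>M))"
      by (rule finite_chaos_product[OF finite_chaos_diff[OF fast_approx_finite_chaos fast_approx_finite_chaos] finite_chaos_add[OF fast_approx_finite_chaos fast_approx_finite_chaos]])
    also have "\<dots> \<le> ?c * ((2 * ((1/4) ^ m + (1/4) ^ n)) * (4 * B))"
    proof (intro mult_left_mono mult_mono fast_approx_Cauchy hyper_const_nonneg)
      have "(\<integral>\<omega>. (Fn m \<omega> + Fn n \<omega>)\<^sup>2 \<partial>M) \<le> (\<integral>\<omega>. 2 * ((Fn m \<omega>)\<^sup>2 + (Fn n \<omega>)\<^sup>2) \<partial>M)"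
      proof (rule integral_mono)
        fix \<omega> show "(Fn m \<omega> + Fn n \<omega>)\<^sup>2 \<le> 2 * ((Fn m \<omega>)\<^sup>2 + (Fn n \<omega>)\<^sup>2)"
          using square_diff_le[of "Fn m \<omega>" "- Fn n \<omega>" 0] by simp
        show "integrable M (\<lambda>\<omega>. (Fn m \<omega> + Fn n \<omega>)\<^sup>2)"
          using finite_chaos_sq_int(1)[OF finite_chaos_add[OF fast_approx_finite_chaos fast_approx_finite_chaos]] by (simp add: sq_int_def)
      qed (use Fn2 in auto)
      also have "\<dots> = 2 * ((\<integral>\<omega>. (Fn m \<omega>)\<^sup>2 \<partial>M) + (\<integral>\<omega>. (Fn n \<omega>)\<^sup>2 \<partial>M))" using Fn2 by simp
      also have "\<dots> \<le> 4 * B" using B[of m] B[of n] by simp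
      finally show "(\<integral>\<omega>. (Fn m \<omega> + Fn n \<omega>)\<^sup>2 \<partial>M) \<le> 4 * B" .
    qed (auto intro!: integral_nonneg_AE)
    finally show ?thesis .
  qed
  have "(\<integral>\<^sup>+\<omega>. ennreal (((F \<omega>)\<^sup>2 - (Fn n \<omega>)\<^sup>2)\<^sup>2) \<partial>M) \<le> ennreal (?c * ((2 * (0 + (1/4) ^ n)) * (4 * B)))" for n
  proof (rule fatou_bound)
    show "(\<lambda>\<omega>. ((Fn m \<omega>)\<^sup>2 - (Fn n \<omega>)\<^sup>2)\<^sup>2) \<in> borel_measurable M" for m by measurable
    show "AE \<omega> in M. (\<lambda>m. ((Fn m \<omega>)\<^sup>2 - (Fn n \<omega>)\<^sup>2)\<^sup>2) \<longlonglongrightarrow> ((F \<omega>)\<^sup>2 - (Fn n \<omega>)\<^sup>2)\<^sup>2"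
      using fast_approx_AE by eventually_elim (intro tendsto_intros)
    show "(\<integral>\<^sup>+\<omega>. ennreal (((Fn m \<omega>)\<^sup>2 - (Fn n \<omega>)\<^sup>2)\<^sup>2) \<partial>M) \<le> ennreal (?c * ((2 * ((1/4) ^ m + (1/4) ^ n)) * (4 * B)))" for m
    proof -
      have "integrable M (\<lambda>\<omega>. ((Fn m \<omega>)\<^sup>2 - (Fn n \<omega>)\<^sup>2)\<^sup>2)"
        by (intro sq_intD(2) sq_int_diff(1) finite_chaos_sq_int(2)[OF fast_approx_finite_chaos])
      then have "(\<integral>\<^sup>+\<omega>. ennreal (((Fn m \<omega>)\<^sup>2 - (Fn n \<omega>)\<^sup>2)\<^sup>2) \<partial>M) = ennreal (\<integral>\<omega>. ((Fn m \<omega>)\<^sup>2 - (Fn n \<omega>)\<^sup>2)\<^sup>2 \<partial>M)"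
        by (intro nn_integral_eq_integral) simp_all
      then show ?thesis using ennreal_leI[OF bd] by simp
    qed
    show "(\<lambda>m. ?c * ((2 * ((1/4) ^ m + (1/4) ^ n)) * (4 * B))) \<longlonglongrightarrow> ?c * ((2 * (0 + (1/4) ^ n)) * (4 * B))"
      by (intro tendsto_intros quarter_tendsto)
  qed
  moreover have "(\<lambda>n. ?c * ((2 * (0 + (1/4) ^ n)) * (4 * B))) \<longlonglongrightarrow> ?c * ((2 * (0 + 0)) * (4 * B))"
    by (intro tendsto_intros quarter_tendsto)
  then have "(\<lambda>n. ?c * ((2 * (0 + (1/4) ^ n)) * (4 * B))) \<longlonglongrightarrow> 0" by simp
  ultimately have "(\<lambda>n. \<integral>\<^sup>+\<omega>. ennreal (((F \<omega>)\<^sup>2 - (Fn n \<omega>)\<^sup>2)\<^sup>2) \<partial>M) \<longlonglongrightarrow> 0" by (rule nn_tendsto_0)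
  then show ?thesis unfolding L2lim_def using finite_chaos_sq_int(2)[OF fast_approx_finite_chaos] by simp
qed

lemma fast_approx_second_moment: "(\<lambda>n. \<integral>\<omega>. (Fn n \<omega>)\<^sup>2 \<partial>M) \<longlonglongrightarrow> (\<integral>\<omega>. (F \<omega>)\<^sup>2 \<partial>M)"
  using L2lim_mult[OF fast_approx_L2lim fast_approx_L2lim] by (simp add: power2_eq_square)

lemma fast_approx_kappa4: "(\<lambda>n. kappa4 (Fn n)) \<longlonglongrightarrow> kappa4 F"
proof -
  have "(\<lambda>n. \<integral>\<omega>. (Fn n \<omega>)^4 \<partial>M) \<longlonglongrightarrow> (\<integral>\<omega>. (F \<omega>)^4 \<partial>M)"
    using L2lim_mult[OF fast_approx_L2lim_square fast_approx_L2lim_square] by (simp flip: power_add)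
  then show ?thesis unfolding kappa4_def by (intro tendsto_intros fast_approx_second_moment)
qed

end

section \<open>Inequalities in a general chaos\<close>

lemma chaos_kappa4_nonneg:
  assumes "F \<in> wiener_chaos M X p" "p \<ge> 1"
  shows "kappa4 F \<ge> 0"
proof -
  obtain Fn Dn where f: "fast_approx p F Fn Dn" using fast_approx_exists[OF assms(1)] by blast
  show ?thesis
    by (rule LIMSEQ_le_const[OF fast_approx_kappa4[OF f]]) (use finite_chaos_kappa4_nonneg[OF fast_approx_finite_chaos[OF f] assms(2)] in blast)
qed

lemma chaos_orthogonal:
  assumes "F \<in> wiener_chaos M X p" "H \<in> wiener_chaos M X q" "p \<noteq> q"
  shows "(\<integral>\<omega>. F \<omega> * H \<omega> \<partial>M) = 0"
proof -
  obtain Fn Dn where f: "fast_approx p F Fn Dn" using fast_approx_exists[OF assms(1)] by blast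
  obtain Hn En where h: "fast_approx q H Hn En" using fast_approx_exists[OF assms(2)] by blast
  have "(\<lambda>n. \<integral>\<omega>. Fn n \<omega> * Hn n \<omega> \<partial>M) \<longlonglongrightarrow> (\<integral>\<omega>. F \<omega> * H \<omega> \<partial>M)"
    by (rule L2lim_mult[OF fast_approx_L2lim[OF f] fast_approx_L2lim[OF h]])
  then show ?thesis
    unfolding finite_chaos_orthogonal[OF fast_approx_finite_chaos[OF f] fast_approx_finite_chaos[OF h] assms(3)] by (simp add: LIMSEQ_const_iff)
qed

text \<open>Only an inequality has to survive, so almost sure convergence of the integrand is enough
  on the left, while covariance and cumulants converge.\<close>

lemma chaos_same_order:
  assumes F: "F \<in> wiener_chaos M X p" "malliavin_deriv M X F G"
    and H: "H \<in> wiener_chaos M X p" "malliavin_deriv M X H E" and p: "p \<ge> 1"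
  shows "(\<integral>\<omega>. ((\<integral>\<omega>. F \<omega> * H \<omega> \<partial>M) - inner (G \<omega>) (E \<omega>) / real p)\<^sup>2 \<partial>M)
    \<le> (\<Sum>r=1..p-1. real ((2 * r) choose r)) * sqrt (kappa4 F * kappa4 H)"
proof (rule integral_le_of_nn_integral(2))
  obtain Fn Dn where f: "fast_approx p F Fn Dn" using fast_approx_exists[OF F(1)] by blast
  obtain Hn En where h: "fast_approx p H Hn En" using fast_approx_exists[OF H(1)] by blast
  have [measurable]: "G \<in> borel_measurable M" "E \<in> borel_measurable M"
    using F(2) H(2) by (auto simp: malliavin_deriv_def)
  note [measurable] = fast_approx_measurable[OF f] fast_approx_measurable[OF h]
  show "(\<lambda>\<omega>. ((\<integral>\<omega>. F \<omega> * H \<omega> \<partial>M) - inner (G \<omega>) (E \<omega>) / real p)\<^sup>2) \<in> borel_measurable M" by measurable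
  let ?c = "\<lambda>n. \<integral>\<omega>. Fn n \<omega> * Hn n \<omega> \<partial>M"
  let ?B = "\<Sum>r=1..p-1. real ((2 * r) choose r)"
  have c: "?c \<longlonglongrightarrow> (\<integral>\<omega>. F \<omega> * H \<omega> \<partial>M)"
    by (rule L2lim_mult[OF fast_approx_L2lim[OF f] fast_approx_L2lim[OF h]])
  show "(\<integral>\<^sup>+\<omega>. ennreal (((\<integral>\<omega>. F \<omega> * H \<omega> \<partial>M) - inner (G \<omega>) (E \<omega>) / real p)\<^sup>2) \<partial>M) \<le> ennreal (?B * sqrt (kappa4 F * kappa4 H))"
  proof (rule fatou_bound)
    show "(\<lambda>\<omega>. (?c n - inner (Dn n \<omega>) (En n \<omega>) / real p)\<^sup>2) \<in> borel_measurable M" for n by measurable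
    show "AE \<omega> in M. (\<lambda>n. (?c n - inner (Dn n \<omega>) (En n \<omega>) / real p)\<^sup>2) \<longlonglongrightarrow> ((\<integral>\<omega>. F \<omega> * H \<omega> \<partial>M) - inner (G \<omega>) (E \<omega>) / real p)\<^sup>2"
      using fast_approx_AE_derivative[OF f p F(2)] fast_approx_AE_derivative[OF h p H(2)]
      by eventually_elim (intro tendsto_intros c, use p in auto)
    show "(\<lambda>n. ?B * sqrt (kappa4 (Fn n) * kappa4 (Hn n))) \<longlonglongrightarrow> ?B * sqrt (kappa4 F * kappa4 H)"
      by (intro tendsto_intros fast_approx_kappa4[OF f] fast_approx_kappa4[OF h])
    fix n
    note i = finite_chaos_integrable[OF fast_approx_finite_chaos[OF f, of n] fast_approx_finite_chaos[OF h, of n]]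
    have "integrable M (\<lambda>\<omega>. (?c n)\<^sup>2 - (2 * ?c n / real p) * inner (Dn n \<omega>) (En n \<omega>) + (1 / (real p)\<^sup>2) * (inner (Dn n \<omega>) (En n \<omega>))\<^sup>2)"
      using i by (intro Bochner_Integration.integrable_add Bochner_Integration.integrable_diff integrable_mult_right) auto
    moreover have "(?c n - inner (Dn n \<omega>) (En n \<omega>) / real p)\<^sup>2 = (?c n)\<^sup>2 - (2 * ?c n / real p) * inner (Dn n \<omega>) (En n \<omega>) + (1 / (real p)\<^sup>2) * (inner (Dn n \<omega>) (En n \<omega>))\<^sup>2" for \<omega>
      by (simp add: power2_diff power_divide)
    ultimately have "integrable M (\<lambda>\<omega>. (?c n - inner (Dn n \<omega>) (En n \<omega>) / real p)\<^sup>2)" by (simp only:)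
    then have "(\<integral>\<^sup>+\<omega>. ennreal ((?c n - inner (Dn n \<omega>) (En n \<omega>) / real p)\<^sup>2) \<partial>M) = ennreal (\<integral>\<omega>. (?c n - inner (Dn n \<omega>) (En n \<omega>) / real p)\<^sup>2 \<partial>M)"
      by (intro nn_integral_eq_integral) simp_all
    then show "(\<integral>\<^sup>+\<omega>. ennreal ((?c n - inner (Dn n \<omega>) (En n \<omega>) / real p)\<^sup>2) \<partial>M) \<le> ennreal (?B * sqrt (kappa4 (Fn n) * kappa4 (Hn n)))"
      using ennreal_leI[OF finite_chaos_same_order[OF fast_approx_finite_chaos[OF f, of n] fast_approx_finite_chaos[OF h, of n] p]] by simp
  qed
  show "0 \<le> ?B * sqrt (kappa4 F * kappa4 H)"
    using chaos_kappa4_nonneg[OF F(1) p] chaos_kappa4_nonneg[OF H(1) p]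
    by (intro mult_nonneg_nonneg sum_nonneg real_sqrt_ge_zero) auto
qed simp

lemma chaos_distinct_order:
  assumes F: "F \<in> wiener_chaos M X p" "malliavin_deriv M X F G"
    and H: "H \<in> wiener_chaos M X q" "malliavin_deriv M X H E" and p: "p \<ge> 1" "p < q"
  shows "(\<integral>\<omega>. (inner (G \<omega>) (E \<omega>))\<^sup>2 \<partial>M) \<le> (real p)\<^sup>2 * ((\<integral>\<omega>. (F \<omega>)\<^sup>2 \<partial>M) * sqrt (kappa4 H)
    + (\<Sum>r=1..p-1. real ((p + q - 2 * r) choose (p - r))) * sqrt (kappa4 F * kappa4 H))"
proof (rule integral_le_of_nn_integral(2))
  obtain Fn Dn where f: "fast_approx p F Fn Dn" using fast_approx_exists[OF F(1)] by blast
  obtain Hn En where h: "fast_approx q H Hn En" using fast_approx_exists[OF H(1)] by blast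
  have q: "q \<ge> 1" using p by simp
  have [measurable]: "G \<in> borel_measurable M" "E \<in> borel_measurable M"
    using F(2) H(2) by (auto simp: malliavin_deriv_def)
  note [measurable] = fast_approx_measurable[OF f] fast_approx_measurable[OF h]
  show "(\<lambda>\<omega>. (inner (G \<omega>) (E \<omega>))\<^sup>2) \<in> borel_measurable M" by measurable
  let ?B = "\<Sum>r=1..p-1. real ((p + q - 2 * r) choose (p - r))"
  show "(\<integral>\<^sup>+\<omega>. ennreal ((inner (G \<omega>) (E \<omega>))\<^sup>2) \<partial>M) \<le> ennreal ((real p)\<^sup>2 * ((\<integral>\<omega>. (F \<omega>)\<^sup>2 \<partial>M) * sqrt (kappa4 H) + ?B * sqrt (kappa4 F * kappa4 H)))"
  proof (rule fatou_bound)
    show "(\<lambda>\<omega>. (inner (Dn n \<omega>) (En n \<omega>))\<^sup>2) \<in> borel_measurable M" for n by measurable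
    show "AE \<omega> in M. (\<lambda>n. (inner (Dn n \<omega>) (En n \<omega>))\<^sup>2) \<longlonglongrightarrow> (inner (G \<omega>) (E \<omega>))\<^sup>2"
      using fast_approx_AE_derivative[OF f p(1) F(2)] fast_approx_AE_derivative[OF h q H(2)]
      by eventually_elim (intro tendsto_intros)
    show "(\<lambda>n. (real p)\<^sup>2 * ((\<integral>\<omega>. (Fn n \<omega>)\<^sup>2 \<partial>M) * sqrt (kappa4 (Hn n)) + ?B * sqrt (kappa4 (Fn n) * kappa4 (Hn n))))
       \<longlonglongrightarrow> (real p)\<^sup>2 * ((\<integral>\<omega>. (F \<omega>)\<^sup>2 \<partial>M) * sqrt (kappa4 H) + ?B * sqrt (kappa4 F * kappa4 H))"
      by (intro tendsto_intros fast_approx_kappa4[OF f] fast_approx_kappa4[OF h] fast_approx_second_moment[OF f])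
    fix n
    have "(\<integral>\<^sup>+\<omega>. ennreal ((inner (Dn n \<omega>) (En n \<omega>))\<^sup>2) \<partial>M) = ennreal (\<integral>\<omega>. (inner (Dn n \<omega>) (En n \<omega>))\<^sup>2 \<partial>M)"
      using finite_chaos_integrable(4)[OF fast_approx_finite_chaos[OF f, of n] fast_approx_finite_chaos[OF h, of n]] by (intro nn_integral_eq_integral) simp_all
    then show "(\<integral>\<^sup>+\<omega>. ennreal ((inner (Dn n \<omega>) (En n \<omega>))\<^sup>2) \<partial>M) \<le> ennreal ((real p)\<^sup>2 * ((\<integral>\<omega>. (Fn n \<omega>)\<^sup>2 \<partial>M) * sqrt (kappa4 (Hn n)) + ?B * sqrt (kappa4 (Fn n) * kappa4 (Hn n))))"
      using ennreal_leI[OF finite_chaos_distinct_order[OF fast_approx_finite_chaos[OF f, of n] fast_approx_finite_chaos[OF h, of n] p]] by simp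
  qed
  show "0 \<le> (real p)\<^sup>2 * ((\<integral>\<omega>. (F \<omega>)\<^sup>2 \<partial>M) * sqrt (kappa4 H) + ?B * sqrt (kappa4 F * kappa4 H))"
    using chaos_kappa4_nonneg[OF F(1) p(1)] chaos_kappa4_nonneg[OF H(1) q]
    by (intro mult_nonneg_nonneg add_nonneg_nonneg sum_nonneg real_sqrt_ge_zero integral_nonneg_AE) auto
qed simp

end

section \<open>The main inequality\<close>

lemma sqrt_sum_le:
  fixes f :: "'a \<Rightarrow> real"
  assumes "finite A" "\<And>x. x \<in> A \<Longrightarrow> f x \<ge> 0"
  shows "sqrt (\<Sum>x\<in>A. f x) \<le> (\<Sum>x\<in>A. sqrt (f x))"
  using assms
proof (induction A)
  case (insert x A)
  have "sqrt (f x + (\<Sum>x\<in>A. f x)) \<le> sqrt (f x) + sqrt (\<Sum>x\<in>A. f x)"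
    using insert by (intro sqrt_add_le_add_sqrt sum_nonneg) auto
  then show ?case using insert by simp
qed simp

lemma sqrt_sqrt_mult_le:
  assumes "x \<ge> 0" "y \<ge> 0"
  shows "sqrt (sqrt (x * y)) \<le> (sqrt x + sqrt y) / 2"
  using arith_geo_mean_sqrt[of "sqrt x" "sqrt y"] assms by (simp add: real_sqrt_mult)

text \<open>A crude bound, adequate because \<open>psi\<close> has a factorial where the estimate
  for distinct orders produces a binomial coefficient.\<close>

lemma binomial_le_fact: "real (n choose k) \<le> fact n"
proof (cases "k \<le> n")
  case True
  have "real (n choose k) * 1 \<le> real (n choose k) * (fact k * fact (n - k))"
    by (intro mult_left_mono) (auto simp: fact_ge_1 mult_ge1_I)
  also have "\<dots> = fact n" using True by (simp add: binomial_fact)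
  finally show ?thesis by simp
qed (simp add: binomial_eq_0)

text \<open>For \<open>q i < q j\<close> the two terms \<open>(i, j)\<close> and \<open>(j, i)\<close> must be combined before taking square roots: bounding
  them separately would cost a factor larger than the constant \<open>\<surd>2\<close> in \<open>psi\<close>.\<close>

lemma sum_pairs_split:
  fixes f :: "nat \<Rightarrow> nat \<Rightarrow> real" and q :: "nat \<Rightarrow> nat"
  shows "(\<Sum>i<d. \<Sum>j<d. f i j) = (\<Sum>i<d. \<Sum>j<d. if q i = q j then f i j else if q i < q j then f i j + f j i else 0)"
proof -
  have "(\<Sum>i<d. \<Sum>j<d. f i j) = (\<Sum>i<d. \<Sum>j<d. (if q i \<le> q j then f i j else 0)) + (\<Sum>i<d. \<Sum>j<d. (if q j < q i then f i j else 0))"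
    unfolding sum.distrib[symmetric] by (intro sum.cong refl) auto
  also have "(\<Sum>i<d. \<Sum>j<d. (if q j < q i then f i j else 0)) = (\<Sum>i<d. \<Sum>j<d. (if q i < q j then f j i else 0))"
    by (rule sum.swap)
  also have "(\<Sum>i<d. \<Sum>j<d. (if q i \<le> q j then f i j else 0)) + \<dots>
    = (\<Sum>i<d. \<Sum>j<d. if q i = q j then f i j else if q i < q j then f i j + f j i else 0)"
    unfolding sum.distrib[symmetric] by (intro sum.cong refl) auto
  finally show ?thesis .
qed

text \<open>The estimate is symmetric in the two cumulants, whereas each term of \<open>psi\<close>
  contains one of them. The inequality of the means splits it into the average of the terms
  \<open>(i, j)\<close> and \<open>(j, i)\<close>.\<close>

lemma sqrt_same_order_le:
  assumes "x \<ge> 0" "y \<ge> 0" "B \<ge> 0" "e \<le> B * sqrt (x * y)"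
  shows "sqrt e \<le> (sqrt (2 * B) * \<bar>x\<bar> powr (1/2) + sqrt (2 * B) * \<bar>y\<bar> powr (1/2)) / 2"
proof -
  have "sqrt e \<le> sqrt B * sqrt (sqrt (x * y))" using assms(4) by (simp flip: real_sqrt_mult)
  also have "\<dots> \<le> sqrt (2 * B) * ((sqrt x + sqrt y) / 2)"
    using assms(1-3) by (intro mult_mono sqrt_sqrt_mult_le) auto
  finally show ?thesis using assms(1,2) by (simp add: powr_half_sqrt algebra_simps add_divide_distrib)
qed

lemma powr_quarter: "x \<ge> 0 \<Longrightarrow> x powr (1/4) = sqrt (sqrt x)"
  using powr_powr[of x "1/2" "1/2"] by (simp add: powr_half_sqrt)

text \<open>The two entries have the same numerator \<open>T\<close> and the denominators
  \<open>q\<^sup>2\<close> and \<open>p\<^sup>2\<close>. Their sum is at most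
  \<open>2 T / p\<^sup>2\<close>, whence the factor \<open>sqrt 2\<close>, and
  \<open>p\<^sup>2\<close> cancels against the weight in \<open>T\<close>. The term with
  \<open>z\<close> is nonnegative and completes the right-hand side to a pair of terms of
  \<open>psi\<close>.\<close>

lemma sqrt_distinct_order_le:
  fixes K L :: real and p q :: nat
  assumes KL: "K \<ge> 0" "L \<ge> 0" "y \<ge> 0" "z \<ge> 0" and pq: "p \<ge> 1" "p < q"
    and T: "T \<ge> 0" "T \<le> (real p)\<^sup>2 * (y * sqrt L + (\<Sum>r=1..p-1. real ((p + q - 2 * r) choose (p - r))) * sqrt (K * L))"
  shows "sqrt (T / (real q)\<^sup>2 + T / (real p)\<^sup>2)
    \<le> (sqrt 2 * sqrt z * \<bar>K\<bar> powr (1/4) + (\<Sum>r=1..min p q - 1. sqrt (2 * fact (p + q - 2*r)) * real (q choose r) * \<bar>K\<bar> powr (1/2)))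
    + (sqrt 2 * sqrt y * \<bar>L\<bar> powr (1/4) + (\<Sum>r=1..min q p - 1. sqrt (2 * fact (q + p - 2*r)) * real (p choose r) * \<bar>L\<bar> powr (1/2)))"
proof -
  define c where "c r = real ((p + q - 2 * r) choose (p - r))" for r
  define R where "R = y * sqrt L + (\<Sum>r=1..p-1. c r) * sqrt (K * L)"
  have p: "real p > 0" "real p \<le> real q" using pq by auto
  have TR: "T / (real p)\<^sup>2 \<le> R" using T(2) p unfolding R_def c_def by (simp add: field_simps)
  have "T / (real q)\<^sup>2 \<le> T / (real p)\<^sup>2" using T(1) p by (intro divide_left_mono power_mono mult_pos_pos) auto
  then have "T / (real q)\<^sup>2 + T / (real p)\<^sup>2 \<le> 2 * R" using TR by simp
  then have "sqrt (T / (real q)\<^sup>2 + T / (real p)\<^sup>2) \<le> sqrt 2 * sqrt R" by (simp flip: real_sqrt_mult)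
  also have "sqrt R \<le> sqrt (y * sqrt L) + sqrt (\<Sum>r=1..p-1. c r * sqrt (K * L))"
    unfolding R_def sum_distrib_right using KL by (intro sqrt_add_le_add_sqrt sum_nonneg) (auto simp: c_def)
  also have "sqrt (\<Sum>r=1..p-1. c r * sqrt (K * L)) \<le> (\<Sum>r=1..p-1. sqrt (c r * sqrt (K * L)))"
    using KL by (intro sqrt_sum_le) (auto simp: c_def)
  finally have "sqrt (T / (real q)\<^sup>2 + T / (real p)\<^sup>2)
     \<le> sqrt 2 * (sqrt (y * sqrt L) + (\<Sum>r=1..p-1. sqrt (c r * sqrt (K * L))))" by simp
  also have "\<dots> = sqrt 2 * sqrt y * \<bar>L\<bar> powr (1/4) + (\<Sum>r=1..p-1. sqrt (2 * c r) * sqrt (sqrt (K * L)))"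
    using KL by (simp add: distrib_left sum_distrib_left real_sqrt_mult powr_quarter mult.assoc)
  also have "(\<Sum>r=1..p-1. sqrt (2 * c r) * sqrt (sqrt (K * L)))
    \<le> (\<Sum>r=1..p-1. sqrt (2 * fact (p + q - 2*r)) * real (q choose r) * \<bar>K\<bar> powr (1/2) + sqrt (2 * fact (q + p - 2*r)) * real (p choose r) * \<bar>L\<bar> powr (1/2))"
  proof (rule sum_mono)
    fix r assume r: "r \<in> {1..p - 1}"
    let ?f = "sqrt (2 * fact (p + q - 2*r))"
    have f: "sqrt (2 * c r) \<le> ?f" using binomial_le_fact by (simp add: c_def)
    \<comment> \<open>The estimate yields no such binomials; being at least 1 for
      \<open>r < p < q\<close>, they may be inserted to match \<open>psi\<close>.\<close>
    have b: "real (q choose r) \<ge> 1" "real (p choose r) \<ge> 1" using r pq by (auto simp: Suc_le_eq zero_less_binomial)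
    have up: "sqrt t \<le> real n * sqrt t" if "real n \<ge> 1" "t \<ge> 0" for n t
      using mult_right_mono[OF that(1), of "sqrt t"] that(2) by simp
    have "sqrt (2 * c r) * sqrt (sqrt (K * L)) \<le> ?f * ((sqrt K + sqrt L) / 2)"
      using KL f by (intro mult_mono sqrt_sqrt_mult_le) auto
    also have "\<dots> \<le> ?f * (sqrt K + sqrt L)"
      using KL by (intro mult_left_mono) auto
    also have "\<dots> \<le> ?f * (real (q choose r) * sqrt K + real (p choose r) * sqrt L)"
      using KL b by (intro mult_left_mono add_mono up) auto
    finally show "sqrt (2 * c r) * sqrt (sqrt (K * L)) \<le> ?f * real (q choose r) * \<bar>K\<bar> powr (1/2) + sqrt (2 * fact (q + p - 2*r)) * real (p choose r) * \<bar>L\<bar> powr (1/2)"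
      using KL by (simp add: powr_half_sqrt distrib_left mult.assoc add.commute[of q p])
  qed
  finally have "sqrt (T / (real q)\<^sup>2 + T / (real p)\<^sup>2) \<le> sqrt 2 * sqrt y * \<bar>L\<bar> powr (1/4)
     + (\<Sum>r=1..p-1. sqrt (2 * fact (p + q - 2*r)) * real (q choose r) * \<bar>K\<bar> powr (1/2) + sqrt (2 * fact (q + p - 2*r)) * real (p choose r) * \<bar>L\<bar> powr (1/2))"
    by simp
  moreover have "0 \<le> sqrt 2 * sqrt z * \<bar>K\<bar> powr (1/4)" using KL by simp
  moreover have "min p q = p" "min q p = p" using pq by auto
  ultimately show ?thesis by (simp only: sum.distrib)
qed

text \<open>Existence of the derivatives is included so that the inequality cannot hold vacuously.
  It is claimed for every choice of \<open>G\<close> because a derivative is determined only up to a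
  null set.\<close>

theorem theorem1p5:
  fixes M :: "'a measure"
    and X :: "'h::{real_inner, complete_space, second_countable_topology} \<Rightarrow> 'a \<Rightarrow> real"
    and d :: nat and q :: "nat \<Rightarrow> nat" and F :: "nat \<Rightarrow> 'a \<Rightarrow> real"
  assumes iso: "isonormal M X"
    and d: "d \<ge> 1"
    and q: "\<And>i. i < d \<Longrightarrow> q i \<ge> 1"
    and F: "\<And>i. i < d \<Longrightarrow> F i \<in> wiener_chaos M X (q i)"
  shows "(\<forall>i<d. \<exists>G. malliavin_deriv M X (F i) G)
    \<and> (\<forall>G :: nat \<Rightarrow> 'a \<Rightarrow> 'h. (\<forall>i<d. malliavin_deriv M X (F i) (G i)) \<longrightarrow>
        (let C = (\<lambda>i j. prob_space.expectation M (\<lambda>\<omega>. F i \<omega> * F j \<omega>)) in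
         sqrt (\<Sum>i<d. \<Sum>j<d. prob_space.expectation M
                 (\<lambda>\<omega>. (C i j - (1 / real (q j)) * inner (G i \<omega>) (G j \<omega>))\<^sup>2))
         \<le> psi d q
             (\<lambda>i. prob_space.expectation M (\<lambda>\<omega>. (F i \<omega>) ^ 4)
                  - 3 * (prob_space.expectation M (\<lambda>\<omega>. (F i \<omega>)\<^sup>2))\<^sup>2)
             (\<lambda>i. prob_space.expectation M (\<lambda>\<omega>. (F i \<omega>)\<^sup>2))))"
proof -
  interpret prob_space M using iso by (simp add: isonormal_def)
  interpret isonormal_process M X by unfold_locales (rule iso)
  have ex: "\<forall>i<d. \<exists>G. malliavin_deriv M X (F i) G"
  proof (intro allI impI)
    fix i assume "i < d"
    then obtain Fn Dn where "fast_approx (q i) (F i) Fn Dn" using fast_approx_exists[OF F] by blast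
    from fast_approx_derivative[OF this q[OF \<open>i < d\<close>]] show "\<exists>G. malliavin_deriv M X (F i) G" by blast
  qed
  have bound: "sqrt (\<Sum>i<d. \<Sum>j<d. expectation (\<lambda>\<omega>. (expectation (\<lambda>\<omega>. F i \<omega> * F j \<omega>) - (1 / real (q j)) * inner (G i \<omega>) (G j \<omega>))\<^sup>2))
     \<le> psi d q (\<lambda>i. kappa4 (F i)) (\<lambda>i. expectation (\<lambda>\<omega>. (F i \<omega>)\<^sup>2))"
    if G: "\<forall>i<d. malliavin_deriv M X (F i) (G i)" for G
  proof -
    define E where "E i j = expectation (\<lambda>\<omega>. (expectation (\<lambda>\<omega>. F i \<omega> * F j \<omega>) - (1 / real (q j)) * inner (G i \<omega>) (G j \<omega>))\<^sup>2)" for i j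
    define K where "K i = kappa4 (F i)" for i
    define y where "y i = expectation (\<lambda>\<omega>. (F i \<omega>)\<^sup>2)" for i
    define t where "t i j = (if q i = q j then
         sqrt (2 * (\<Sum>r=1..q i - 1. real ((2*r) choose r))) * \<bar>K i\<bar> powr (1/2)
       else
         sqrt 2 * sqrt (y j) * \<bar>K i\<bar> powr (1/4)
         + (\<Sum>r=1..min (q i) (q j) - 1.
              sqrt (2 * fact (q i + q j - 2*r)) * real (q j choose r) * \<bar>K i\<bar> powr (1/2)))" for i j
    have K: "K i \<ge> 0" if "i < d" for i unfolding K_def using chaos_kappa4_nonneg[OF F q] that by blast
    have y: "y i \<ge> 0" for i unfolding y_def by (intro integral_nonneg_AE) auto
    have E0: "E i j \<ge> 0" for i j unfolding E_def by (intro integral_nonneg_AE) auto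
    let ?s = "\<lambda>f i j. if q i = q j then f i j else if q i < q j then f i j + f j i else (0::real)"
    \<comment> \<open>Averaging over \<open>(i, j)\<close> and \<open>(j, i)\<close> leaves the
      double sum unchanged; an equal-order entry then receives the mean of its two terms, and a pair
      of distinct orders receives their sum.\<close>
    let ?t = "\<lambda>i j. (t i j + t j i) / 2"
    have pair: "sqrt (?s E i j) \<le> ?s ?t i j" if ij: "i < d" "j < d" for i j
    proof -
      consider "q i = q j" | "q i < q j" | "q j < q i" by linarith
      then show ?thesis
      proof cases
        case 1
        have Fj: "F j \<in> wiener_chaos M X (q i)" using F[OF ij(2)] 1 by simp
        have "E i j \<le> (\<Sum>r=1..q i - 1. real ((2 * r) choose r)) * sqrt (K i * K j)"
          using chaos_same_order[OF F[OF ij(1)] _ Fj _ q[OF ij(1)], of "G i" "G j"] G ij 1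
          by (simp add: E_def K_def)
        from sqrt_same_order_le[OF K[OF ij(1)] K[OF ij(2)] _ this] show ?thesis
          using 1 by (simp add: t_def sum_nonneg)
      next
        case 2
        define T where "T = expectation (\<lambda>\<omega>. (inner (G i \<omega>) (G j \<omega>))\<^sup>2)"
        have T0: "T \<ge> 0" unfolding T_def by (intro integral_nonneg_AE) auto
        have Tle: "T \<le> (real (q i))\<^sup>2 * (y i * sqrt (K j) + (\<Sum>r=1..q i - 1. real ((q i + q j - 2 * r) choose (q i - r))) * sqrt (K i * K j))"
          unfolding T_def y_def K_def
          by (rule chaos_distinct_order[OF F[OF ij(1)] _ F[OF ij(2)] _ q[OF ij(1)] 2]) (use G ij in auto)
        have c: "expectation (\<lambda>\<omega>. F i \<omega> * F j \<omega>) = 0" "expectation (\<lambda>\<omega>. F j \<omega> * F i \<omega>) = 0"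
          using chaos_orthogonal[OF F[OF ij(1)] F[OF ij(2)]] chaos_orthogonal[OF F[OF ij(2)] F[OF ij(1)]] 2 by auto
        \<comment> \<open>Different chaoses are orthogonal, so both covariances vanish and the two
          entries differ only in the order by which they are divided.\<close>
        have "E i j = T / (real (q j))\<^sup>2" "E j i = T / (real (q i))\<^sup>2"
          unfolding E_def c T_def inner_commute[of "G j _" "G i _"] by (simp_all add: power_divide)
        then have "sqrt (?s E i j) \<le> t i j + t j i"
          using sqrt_distinct_order_le[OF K[OF ij(1)] K[OF ij(2)] y[of i] y[of j] q[OF ij(1)] 2 T0 Tle] 2
          by (simp add: t_def)
        also have "\<dots> = ?s ?t i j" using 2 by (simp add: field_simps)
        finally show ?thesis .
      next
        case 3 then show ?thesis by simp
      qed
    qed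
    have "sqrt (\<Sum>i<d. \<Sum>j<d. E i j) = sqrt (\<Sum>x\<in>{..<d} \<times> {..<d}. ?s E (fst x) (snd x))"
      by (subst sum_pairs_split[of E d q]) (simp add: sum.cartesian_product case_prod_unfold)
    also have "\<dots> \<le> (\<Sum>x\<in>{..<d} \<times> {..<d}. sqrt (?s E (fst x) (snd x)))"
      using E0 by (intro sqrt_sum_le) (auto intro: add_nonneg_nonneg)
    also have "\<dots> \<le> (\<Sum>x\<in>{..<d} \<times> {..<d}. ?s ?t (fst x) (snd x))"
      by (intro sum_mono pair) auto
    also have "\<dots> = (\<Sum>i<d. \<Sum>j<d. ?t i j)"
      by (subst sum_pairs_split[of ?t d q]) (simp add: sum.cartesian_product case_prod_unfold)
    also have "\<dots> = (\<Sum>i<d. \<Sum>j<d. t i j)"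
    proof -
      have "(\<Sum>i<d. \<Sum>j<d. t j i) = (\<Sum>i<d. \<Sum>j<d. t i j)" by (rule sum.swap)
      then show ?thesis by (simp add: add_divide_distrib sum.distrib sum_divide_distrib[symmetric])
    qed
    also have "\<dots> = psi d q K y" unfolding psi_def t_def ..
    finally show ?thesis unfolding E_def K_def[abs_def] y_def[abs_def] .
  qed
  show ?thesis
    using ex bound unfolding Let_def kappa4_def by blast
qed

end
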